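(* For every $\varepsilon>0$ and every $\Delta\in\mathbb{N}$ there exist $\alpha_0>0$ and $d_0$ such that the following holds for all $0<\alpha<\alpha_0$ and all $d\geq d_0$. If $H$ is an $\alpha$-separable bipartite graph with at most $(1-\varepsilon)d$ vertices and maximum degree $\Delta(H)\leq\Delta$, and $G$ is a graph with average degree at least $d$, then $G$ contains a subdivision of $H$.
   Context: All graphs are finite and simple. The average degree of $G$ is $d(G)=2e(G)/|G|$. A graph $H$ is $\alpha$-separable if there exists a set $S\subseteq V(H)$ of at most $\alpha|H|$ vertices such that every connected component of $H-S$ has at most $\alpha|H|$ vertices. A subdivision of $H$ is a graph obtained from $H$ by replacing its edges with pairwise internally vertex-disjoint paths (of length at least one) between the corresponding endpoints. *)

theory Defs
  imports Complex_Main "Graph_Theory.Graph_Theory"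
begin

text \<open>
  A finite simple graph is a \<^locale>\<open>pair_graph\<close>: a finite vertex set with a symmetric irreflexive
  set of arcs. An undirected edge \<open>uv\<close> is thus present as the two arcs \<open>(u, v)\<close> and \<open>(v, u)\<close>, so
  the degree of a vertex is its out-degree.
\<close>

definition edges :: "'a pair_pre_digraph \<Rightarrow> 'a set set" where
  "edges G = (\<lambda>(u, v). {u, v}) ` parcs G"

definition average_degree :: "'a pair_pre_digraph \<Rightarrow> real" where
  "average_degree G = 2 * real (card (edges G)) / real (card (pverts G))"

text \<open>The maximum degree of the graph without vertices is \<open>0\<close>.\<close>

definition max_degree :: "'a pair_pre_digraph \<Rightarrow> nat" where
  "max_degree G = Max (insert 0 (out_degree (with_proj G) ` pverts G))"

definition bipartite :: "'a pair_pre_digraph \<Rightarrow> bool" where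
  "bipartite G \<longleftrightarrow> (\<exists>A B. pverts G = A \<union> B \<and> A \<inter> B = {} \<and> parcs G \<subseteq> A \<times> B \<union> B \<times> A)"

text \<open>
  Since the arc set is symmetric, the strongly connected components are the connected components
  of the undirected graph.
\<close>

definition separable :: "real \<Rightarrow> 'a pair_pre_digraph \<Rightarrow> bool" where
  "separable \<alpha> H \<longleftrightarrow>
    (\<exists>S \<subseteq> pverts H.
       real (card S) \<le> \<alpha> * real (card (pverts H)) \<and>
       (\<forall>C \<in> pre_digraph.sccs (with_proj H \<restriction> (pverts H - S)).
          real (card (verts C)) \<le> \<alpha> * real (card (pverts H))))"

text \<open>
  \<open>K\<close> is a subdivision of \<open>H\<close>: the map \<open>f\<close> sends the vertices of \<open>H\<close> to the branch vertices, and
  \<open>P (u, v)\<close> is the path of \<open>K\<close> that replaces the edge \<open>uv\<close>, traversed from \<open>f u\<close> to \<open>f v\<close>; the arc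
  \<open>(v, u)\<close> gets the same path backwards. Each path has length at least one because \<open>f u \<noteq> f v\<close>.
  The last two conditions say that \<open>K\<close> has no other vertices and edges. The vertex types may differ,
  which the constant \<^const>\<open>subdivision\<close> (iterated subdivision of single edges) does not allow.
\<close>

definition is_subdivision_of :: "'b pair_pre_digraph \<Rightarrow> 'a pair_pre_digraph \<Rightarrow> bool" where
  "is_subdivision_of K H \<longleftrightarrow>
    pair_graph K \<and>
    (\<exists>(f :: 'a \<Rightarrow> 'b) (P :: 'a \<times> 'a \<Rightarrow> ('b \<times> 'b) awalk).
       inj_on f (pverts H) \<and>
       (\<forall>(u, v) \<in> parcs H.
          pre_digraph.apath (with_proj K) (f u) (P (u, v)) (f v) \<and>
          P (v, u) = rev_path (P (u, v)) \<and>
          set (pre_digraph.inner_verts (with_proj K) (P (u, v))) \<inter> f ` pverts H = {}) \<and>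
       (\<forall>(u, v) \<in> parcs H. \<forall>(x, y) \<in> parcs H. {u, v} \<noteq> {x, y} \<longrightarrow>
          set (pre_digraph.inner_verts (with_proj K) (P (u, v))) \<inter>
          set (pre_digraph.inner_verts (with_proj K) (P (x, y))) = {}) \<and>
       pverts K = f ` pverts H \<union>
         (\<Union>e \<in> parcs H. set (pre_digraph.inner_verts (with_proj K) (P e))) \<and>
       parcs K = (\<Union>e \<in> parcs H. set (P e)))"

definition contains_subdivision :: "'b pair_pre_digraph \<Rightarrow> 'a pair_pre_digraph \<Rightarrow> bool" where
  "contains_subdivision G H \<longleftrightarrow>
    (\<exists>K. subgraph (with_proj K) (with_proj G) \<and> is_subdivision_of K H)"

end

theory Submission
  imports Defs "HOL-Library.Disjoint_Sets"
begin

text \<open>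
  Pass to a subgraph of \<open>G\<close> that is almost as dense and has no separation whose order is a small
  multiple of \<open>d\<close> (Mader). Suppose first that some subgraph whose average degree is proportional to
  \<open>d\<close> contains no dense pair of vertex sets of size proportional to \<open>d\<close>. Contracting small stars
  then gives a much denser minor; its highly connected part is linked by the theorem of Thomas and
  Wollan, and every graph of bounded degree on \<open>d\<close> vertices is a topological minor.

  Otherwise dense pairs occur everywhere, and by density increment each contains a tile: a pair
  \<open>(A, B)\<close> in which any two large subsets are joined by many edges. Disjoint tiles can be made to
  cover almost \<open>d\<close> vertices, because counting degrees gives many edges between a smaller family of
  tiles and the uncovered vertices, so that some tile can be split and extended by uncovered vertices.
  The components of \<open>H - S\<close> are embedded one at a time into the tiles, keeping the two sides of each
  tile balanced by exchanging the colour classes; \<open>S\<close> goes into a single tile. The few edges at \<open>S\<close>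
  become paths that Menger's theorem provides between reserved vertices of the tiles. Taking these
  paths with as few vertices as possible makes them occupy little of each tile, since a path that
  visits a tile often could be rerouted through the reserve.
\<close>

section \<open>Simple graphs and connected vertex sets\<close>

definition simple_graph :: "'a set \<Rightarrow> 'a rel \<Rightarrow> bool" where
  "simple_graph V E \<longleftrightarrow> finite V \<and> sym E \<and> irrefl E \<and> E \<subseteq> V \<times> V"

lemma simple_graphD:
  assumes "simple_graph V E"
  shows "finite V" "finite E" "sym E" "irrefl E" "E \<subseteq> V \<times> V"
  using assms by (auto simp: simple_graph_def intro: finite_subset)

lemma sym_Restr: "sym E \<Longrightarrow> sym (Restr E C)"
  by (auto simp: sym_def)

lemma simple_graph_Restr: "simple_graph V E \<Longrightarrow> S \<subseteq> V \<Longrightarrow> simple_graph S (Restr E S)"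
  unfolding simple_graph_def by (auto simp: sym_def irrefl_def intro: finite_subset)

definition connected_in :: "'a rel \<Rightarrow> 'a set \<Rightarrow> bool" where
  "connected_in E C \<longleftrightarrow> C \<noteq> {} \<and> (\<forall>x\<in>C. \<forall>y\<in>C. (x, y) \<in> (Restr E C)\<^sup>*)"

lemma connected_in_singleton: "connected_in E {x}"
  by (simp add: connected_in_def)

lemma connected_in_mono:
  assumes "connected_in E C" "Restr E C \<subseteq> E'"
  shows "connected_in E' C"
proof -
  have "(Restr E C)\<^sup>* \<subseteq> (Restr E' C)\<^sup>*" using assms(2) by (intro rtrancl_mono) auto
  thus ?thesis using assms(1) unfolding connected_in_def by blast
qed

lemma connected_in_rootI:
  assumes "sym E" "r \<in> C" "\<And>x. x \<in> C \<Longrightarrow> (r, x) \<in> (Restr E C)\<^sup>*"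
  shows "connected_in E C"
  unfolding connected_in_def
proof (intro conjI ballI)
  show "C \<noteq> {}" using assms(2) by auto
  fix x y assume "x \<in> C" "y \<in> C"
  have "(x, r) \<in> (Restr E C)\<^sup>*"
    using assms(3)[OF \<open>x \<in> C\<close>] sym_rtrancl[OF sym_Restr[OF assms(1)]] by (meson symD)
  thus "(x, y) \<in> (Restr E C)\<^sup>*" using assms(3)[OF \<open>y \<in> C\<close>] by simp
qed

lemma connected_in_UN:
  assumes "sym E" "connected_in M C" "\<And>l. l \<in> C \<Longrightarrow> connected_in E (W l)"
    and adj: "\<And>l l'. l \<in> C \<Longrightarrow> l' \<in> C \<Longrightarrow> (l, l') \<in> M \<Longrightarrow> \<exists>u\<in>W l. \<exists>v\<in>W l'. (u, v) \<in> E"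
  shows "connected_in E (\<Union>l\<in>C. W l)"
proof -
  let ?U = "\<Union>l\<in>C. W l"
  obtain l0 where l0: "l0 \<in> C" using assms(2) by (auto simp: connected_in_def)
  obtain r where r: "r \<in> W l0" using assms(3)[OF l0] by (auto simp: connected_in_def)
  have within: "(x, y) \<in> (Restr E ?U)\<^sup>*" if "l \<in> C" "x \<in> W l" "y \<in> W l" for l x y
  proof -
    have "(x, y) \<in> (Restr E (W l))\<^sup>*" using assms(3)[OF that(1)] that by (auto simp: connected_in_def)
    moreover have "Restr E (W l) \<subseteq> Restr E ?U" using that by auto
    ultimately show ?thesis using rtrancl_mono by blast
  qed
  have reach: "\<forall>x\<in>W l. (r, x) \<in> (Restr E ?U)\<^sup>*" if "(l0, l) \<in> (Restr M C)\<^sup>*" for l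
    using that
  proof (induction rule: rtrancl_induct)
    case base
    thus ?case using within[OF l0 r] by auto
  next
    case (step l l')
    then obtain u v where uv: "u \<in> W l" "v \<in> W l'" "(u, v) \<in> E" using adj by blast
    have "(u, v) \<in> Restr E ?U" using uv step by auto
    moreover have "(r, u) \<in> (Restr E ?U)\<^sup>*" using step uv by auto
    ultimately have "(r, v) \<in> (Restr E ?U)\<^sup>*" by (rule rtrancl.rtrancl_into_rtrancl[rotated])
    thus ?case using within[of l' v] step uv by (auto intro: rtrancl_trans)
  qed
  show ?thesis
  proof (rule connected_in_rootI[OF assms(1), of r])
    show "r \<in> ?U" using l0 r by auto
    fix x assume "x \<in> ?U"
    then obtain l where "l \<in> C" "x \<in> W l" by auto
    thus "(r, x) \<in> (Restr E ?U)\<^sup>*" using reach[of l] assms(2) l0 by (auto simp: connected_in_def)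
  qed
qed

lemma connected_in_Un_Int:
  assumes "sym E" "connected_in E C" "connected_in E D" "C \<inter> D \<noteq> {}"
  shows "connected_in E (C \<union> D)"
proof -
  obtain r where r: "r \<in> C" "r \<in> D" using assms(4) by auto
  have mono: "(Restr E C)\<^sup>* \<subseteq> (Restr E (C \<union> D))\<^sup>*" "(Restr E D)\<^sup>* \<subseteq> (Restr E (C \<union> D))\<^sup>*"
    by (rule rtrancl_mono; auto)+
  have "(r, z) \<in> (Restr E (C \<union> D))\<^sup>*" if "z \<in> C \<union> D" for z
    using r mono assms that unfolding connected_in_def by blast
  thus ?thesis using connected_in_rootI[OF assms(1), of r] r by blast
qed

lemma connected_in_edge:
  assumes "sym E" "(x, y) \<in> E"
  shows "connected_in E {x, y}"
proof (rule connected_in_rootI[OF assms(1)])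
  show "(x, z) \<in> (Restr E {x, y})\<^sup>*" if "z \<in> {x, y}" for z using that assms(2) by auto
qed simp

lemma connected_in_Un_edge:
  assumes "sym E" "connected_in E C" "connected_in E D" "x \<in> C" "y \<in> D" "(x, y) \<in> E"
  shows "connected_in E (C \<union> D)"
proof -
  have "connected_in E (C \<union> {x, y})"
    using assms connected_in_edge[OF assms(1,6)] by (intro connected_in_Un_Int) auto
  hence "connected_in E ((C \<union> {x, y}) \<union> D)" by (rule connected_in_Un_Int[OF assms(1) _ assms(3)]) (use assms(5) in auto)
  moreover have "(C \<union> {x, y}) \<union> D = C \<union> D" using assms(4,5) by auto
  ultimately show ?thesis by simp
qed

lemma connected_in_Un_leaves:
  assumes "sym E" "connected_in E C" "\<And>v. v \<in> F \<Longrightarrow> \<exists>u\<in>C. (u, v) \<in> E"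
  shows "connected_in E (C \<union> F)"
proof -
  obtain r where r: "r \<in> C" using assms(2) by (auto simp: connected_in_def)
  have mono: "(Restr E C)\<^sup>* \<subseteq> (Restr E (C \<union> F))\<^sup>*" by (rule rtrancl_mono) auto
  have core: "(r, u) \<in> (Restr E (C \<union> F))\<^sup>*" if "u \<in> C" for u
    using assms(2) r that mono unfolding connected_in_def by blast
  have "(r, v) \<in> (Restr E (C \<union> F))\<^sup>*" if "v \<in> C \<union> F" for v
  proof (cases "v \<in> C")
    case False
    hence "v \<in> F" using that by blast
    from assms(3)[OF this] obtain u where u: "u \<in> C" "(u, v) \<in> E" by blast
    hence "(u, v) \<in> Restr E (C \<union> F)" using that by auto
    thus ?thesis using core[OF u(1)] by (rule rtrancl.rtrancl_into_rtrancl[rotated])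
  qed (rule core)
  thus ?thesis using connected_in_rootI[OF assms(1), of r] r by blast
qed

lemma connected_in_insert:
  assumes "sym E" "connected_in E C" "x \<in> C" "(x, y) \<in> E"
  shows "connected_in E (insert y C)"
  using connected_in_Un_leaves[OF assms(1,2), of "{y}"] assms(3,4) by auto

lemma connected_in_leaving_edge:
  assumes "connected_in E C" "D \<subseteq> C" "D \<noteq> {}" "D \<noteq> C"
  shows "\<exists>x\<in>D. \<exists>y\<in>C - D. (x, y) \<in> E"
proof (rule ccontr)
  assume no: "\<not> ?thesis"
  obtain x where x: "x \<in> D" using assms by auto
  obtain y where y: "y \<in> C" "y \<notin> D" using assms by auto
  have "z \<in> D" if "(x, z) \<in> (Restr E C)\<^sup>*" for z
    using that by (induction rule: rtrancl_induct) (use x no in auto)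
  moreover have "(x, y) \<in> (Restr E C)\<^sup>*" using assms x y by (auto simp: connected_in_def)
  ultimately show False using y by auto
qed

definition component_in :: "'a rel \<Rightarrow> 'a set \<Rightarrow> 'a \<Rightarrow> 'a set" where
  "component_in E S x = {y. (x, y) \<in> (Restr E S)\<^sup>*}"

lemma component_in_self: "x \<in> component_in E S x"
  by (simp add: component_in_def)

lemma component_in_subset:
  assumes "x \<in> S"
  shows "component_in E S x \<subseteq> S"
proof
  fix y assume "y \<in> component_in E S x"
  hence "(x, y) \<in> (Restr E S)\<^sup>*" by (simp add: component_in_def)
  thus "y \<in> S" by (induction rule: rtrancl_induct) (use assms in auto)
qed

lemma component_in_closed:
  assumes "y \<in> component_in E S x" "x \<in> S" "(y, z) \<in> E" "z \<in> S"
  shows "z \<in> component_in E S x"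
proof -
  have "y \<in> S" using component_in_subset[OF assms(2)] assms(1) by blast
  thus ?thesis
    using assms unfolding component_in_def by (auto intro: rtrancl.rtrancl_into_rtrancl)
qed

lemma component_in_sym:
  assumes "sym E" "y \<in> component_in E S x"
  shows "x \<in> component_in E S y"
  using assms(2) sym_rtrancl[OF sym_Restr[OF assms(1)]] unfolding component_in_def by (auto dest: symD)

lemma component_in_disjoint:
  assumes "sym E" "y \<notin> component_in E S x"
  shows "component_in E S x \<inter> component_in E S y = {}"
proof (rule ccontr)
  assume "\<not> ?thesis"
  then obtain w where "w \<in> component_in E S x" "y \<in> component_in E S w"
    using component_in_sym[OF assms(1)] by blast
  hence "y \<in> component_in E S x" unfolding component_in_def by (auto intro: rtrancl_trans)
  thus False using assms(2) by simp
qed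

lemma connected_in_component_in:
  assumes "sym E" "x \<in> S"
  shows "connected_in E (component_in E S x)"
proof (rule connected_in_rootI[OF assms(1) component_in_self])
  fix y assume "y \<in> component_in E S x"
  hence "(x, y) \<in> (Restr E S)\<^sup>*" by (simp add: component_in_def)
  thus "(x, y) \<in> (Restr E (component_in E S x))\<^sup>*"
  proof (induction rule: rtrancl_induct)
    case (step y z)
    have y: "y \<in> component_in E S x" using step(1) by (simp add: component_in_def)
    hence "z \<in> component_in E S x" using step(2) component_in_closed[OF y assms(2), of z] by auto
    thus ?case using step y by (meson IntD1 IntI SigmaI rtrancl.rtrancl_into_rtrancl)
  qed simp
qed

lemma connected_in_noncut_vertex:
  assumes "sym E" "finite C" "connected_in E C" "r \<in> C" "C \<noteq> {r}"
  shows "\<exists>v\<in>C - {r}. connected_in E (C - {v})"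
proof -
  let ?P = "\<lambda>D. D \<subseteq> C \<and> D \<noteq> C \<and> r \<in> D \<and> connected_in E D"
  have root: "?P {r}" using assms connected_in_singleton[of E r] by blast
  have "\<forall>D. ?P D \<longrightarrow> card D < Suc (card C)"
    using assms(2) by (auto intro: card_mono simp: less_Suc_eq_le)
  from ex_has_greatest_nat[of ?P, OF root this] obtain D
    where D: "?P D" and max: "\<forall>D'. ?P D' \<longrightarrow> card D' \<le> card D" by (elim exE conjE) (rule that, auto)
  then obtain x v where v: "x \<in> D" "v \<in> C - D" "(x, v) \<in> E"
    using connected_in_leaving_edge[OF assms(3), of D] by auto
  have con: "connected_in E (insert v D)" using connected_in_insert[OF assms(1) _ v(1,3)] D by auto
  have "insert v D = C"
  proof (rule ccontr)
    assume "insert v D \<noteq> C"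
    hence "card (insert v D) \<le> card D" using con D v max by auto
    thus False using v D assms(2) finite_subset[of D C] by auto
  qed
  hence "C - {v} = D" using v by auto
  thus ?thesis using v D by auto
qed

lemma connected_in_trim:
  assumes "sym E" "finite C" "connected_in E C" "C \<inter> A \<noteq> {}" "C \<inter> B \<noteq> {}"
  shows "\<exists>D a b. D \<subseteq> C \<and> connected_in E D \<and> D \<inter> A = {a} \<and> D \<inter> B = {b}"
  using assms(2-)
proof (induction "card C" arbitrary: C rule: less_induct)
  case less
  show ?case
  proof (cases "\<exists>v\<in>C. connected_in E (C - {v}) \<and> (C - {v}) \<inter> A \<noteq> {} \<and> (C - {v}) \<inter> B \<noteq> {}")
    case True
    then obtain v where v: "v \<in> C" "connected_in E (C - {v})" "(C - {v}) \<inter> A \<noteq> {}" "(C - {v}) \<inter> B \<noteq> {}"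
      by auto
    have "card (C - {v}) < card C" using v less by (meson card_Diff1_less)
    from less(1)[OF this _ v(2,3,4)] less(2) show ?thesis by (meson Diff_subset finite_Diff order_trans)
  next
    case False
    have one: "C \<inter> A = {v} \<or> C \<inter> B = {v}" if "v \<in> C" "connected_in E (C - {v})" for v
      using False that less by blast
    obtain r where r: "r \<in> C" using less by (auto simp: connected_in_def)
    show ?thesis
    proof (cases "C = {r}")
      case True
      thus ?thesis using less by blast
    next
      case False
      obtain v where v: "v \<in> C - {r}" "connected_in E (C - {v})"
        using connected_in_noncut_vertex[OF assms(1) less(2,3) r False] by auto
      hence "C \<noteq> {v}" using r by auto
      then obtain w where w: "w \<in> C - {v}" "connected_in E (C - {w})"
        using connected_in_noncut_vertex[OF assms(1) less(2,3), of v] v by auto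
      have "C \<inter> A = {v} \<or> C \<inter> B = {v}" "C \<inter> A = {w} \<or> C \<inter> B = {w}" "v \<noteq> w" using one v w by auto
      thus ?thesis using less(3) by auto
    qed
  qed
qed

definition connector :: "'a rel \<Rightarrow> 'a \<Rightarrow> 'a \<Rightarrow> 'a set \<Rightarrow> bool" where
  "connector E x y C \<longleftrightarrow> connected_in E C \<and> (\<exists>u\<in>C. (x, u) \<in> E) \<and> (\<exists>v\<in>C. (y, v) \<in> E)"

lemma connectorE:
  assumes "connector E x y C"
  obtains u v where "connected_in E C" "u \<in> C" "(x, u) \<in> E" "v \<in> C" "(y, v) \<in> E"
  using assms by (auto simp: connector_def)

lemma connector_sym: "connector E x y C \<Longrightarrow> connector E y x C"
  by (auto simp: connector_def)

lemma connected_in_Un_connector: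
  assumes "sym E" "connector E x y K" "connected_in E C" "connected_in E D" "x \<in> C" "y \<in> D"
  shows "connected_in E (C \<union> K \<union> D)"
proof -
  obtain u v where uv: "connected_in E K" "u \<in> K" "(x, u) \<in> E" "v \<in> K" "(y, v) \<in> E"
    using assms(2) by (rule connectorE)
  have "connected_in E (C \<union> K)" by (rule connected_in_Un_edge[OF assms(1,3) uv(1) assms(5) uv(2,3)])
  thus ?thesis
    using connected_in_Un_edge[OF assms(1) _ assms(4) _ assms(6)] uv symD[OF assms(1)] by blast
qed

section \<open>Counting edges\<close>

definition edge_count :: "('a \<times> 'b) set \<Rightarrow> 'a set \<Rightarrow> 'b set \<Rightarrow> nat" where
  "edge_count E X Y = card (E \<inter> X \<times> Y)"

lemma edge_count_eq_sum:
  assumes "finite X" "finite Y"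
  shows "edge_count E X Y = (\<Sum>x\<in>X. card (E `` {x} \<inter> Y))"
proof -
  have "E \<inter> X \<times> Y = Sigma X (\<lambda>x. E `` {x} \<inter> Y)" by auto
  thus ?thesis unfolding edge_count_def using assms by (simp add: card_SigmaI)
qed

lemma edge_count_converse: "edge_count (E\<inverse>) Y X = edge_count E X Y"
proof -
  have "E\<inverse> \<inter> Y \<times> X = (E \<inter> X \<times> Y)\<inverse>" by auto
  thus ?thesis by (simp add: edge_count_def)
qed

lemma edge_count_commute: "sym E \<Longrightarrow> edge_count E X Y = edge_count E Y X"
  using edge_count_converse[of E Y X] by (simp add: sym_conv_converse_eq)

lemma edge_count_le:
  assumes "finite X" "finite Y"
  shows "edge_count E X Y \<le> card X * card Y"
  using card_mono[of "X \<times> Y" "E \<inter> X \<times> Y"] assms by (simp add: edge_count_def card_cartesian_product)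

lemma edge_count_mono:
  assumes "E \<subseteq> E'" "X \<subseteq> X'" "Y \<subseteq> Y'" "finite X'" "finite Y'"
  shows "edge_count E X Y \<le> edge_count E' X' Y'"
  unfolding edge_count_def using assms by (intro card_mono) auto

lemma edge_count_Un_left:
  assumes "finite X" "finite X'" "finite Y" "X \<inter> X' = {}"
  shows "edge_count E (X \<union> X') Y = edge_count E X Y + edge_count E X' Y"
  using assms by (simp add: edge_count_eq_sum sum.union_disjoint)

lemma edge_count_Un_right:
  assumes "finite X" "finite Y" "finite Y'" "Y \<inter> Y' = {}"
  shows "edge_count E X (Y \<union> Y') = edge_count E X Y + edge_count E X Y'"
  using edge_count_Un_left[OF assms(2,3,1,4), of "E\<inverse>"] by (simp add: edge_count_converse)

lemma edge_count_UN_left_le: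
  assumes "finite I"
  shows "edge_count E (\<Union>i\<in>I. X i) Y \<le> (\<Sum>i\<in>I. edge_count E (X i) Y)"
proof -
  have eq: "E \<inter> (\<Union>i\<in>I. X i) \<times> Y = (\<Union>i\<in>I. E \<inter> X i \<times> Y)" by auto
  show ?thesis unfolding edge_count_def eq by (rule card_UN_le[OF assms])
qed

lemma edge_count_Un_left_le: "edge_count E (X \<union> X') Y \<le> edge_count E X Y + edge_count E X' Y"
  using card_Un_le[of "E \<inter> X \<times> Y" "E \<inter> X' \<times> Y"]
  by (simp add: edge_count_def Sigma_Un_distrib1 Int_Un_distrib)

lemma edge_count_remove_vertex:
  assumes "sym E" "finite W"
  shows "edge_count E W W \<le> edge_count E (W - {v}) (W - {v}) + 2 * card (E `` {v} \<inter> W)"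
proof -
  let ?W = "W - {v}" and ?N = "E `` {v} \<inter> W"
  have "Restr E W \<subseteq> Restr E ?W \<union> ({v} \<times> ?N \<union> ?N \<times> {v})" by (auto dest: symD[OF assms(1)])
  hence "card (Restr E W) \<le> card (Restr E ?W \<union> ({v} \<times> ?N \<union> ?N \<times> {v}))"
    using assms(2) by (intro card_mono) auto
  also have "\<dots> \<le> card (Restr E ?W) + card ({v} \<times> ?N \<union> ?N \<times> {v})" by (rule card_Un_le)
  also have "card ({v} \<times> ?N \<union> ?N \<times> {v}) \<le> card ({v} \<times> ?N) + card (?N \<times> {v})" by (rule card_Un_le)
  finally show ?thesis by (simp add: edge_count_def card_cartesian_product)
qed

lemma simple_graph_card_edges:
  assumes "simple_graph V E"
  shows "edge_count E V V = card E" "card E = (\<Sum>v\<in>V. card (E `` {v}))"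
proof -
  note V = simple_graphD[OF assms]
  have "E \<inter> V \<times> V = E" "\<And>v. E `` {v} \<inter> V = E `` {v}" using V(5) by auto
  thus "edge_count E V V = card E" "card E = (\<Sum>v\<in>V. card (E `` {v}))"
    using edge_count_eq_sum[OF V(1,1), of E] by (simp_all add: edge_count_def)
qed

lemma subset_sum_ge_average:
  fixes g :: "'a \<Rightarrow> real"
  assumes "finite X" "a \<le> card X"
  shows "\<exists>X0\<subseteq>X. card X0 = a \<and> real a * sum g X \<le> real (card X) * sum g X0"
  using assms
proof (induction "card X" arbitrary: X)
  case 0
  thus ?case by (intro exI[of _ X]) auto
next
  case (Suc n)
  show ?case
  proof (cases "a = Suc n")
    case True
    thus ?thesis using Suc by (intro exI[of _ X]) auto
  next
    case False
    have "\<exists>x\<in>X. real (Suc n) * g x \<le> sum g X"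
    proof (rule ccontr)
      assume "\<not> ?thesis"
      hence "(\<Sum>x\<in>X. sum g X) < (\<Sum>x\<in>X. real (Suc n) * g x)"
        using Suc.hyps(2) by (intro sum_strict_mono) (auto simp: Suc.prems)
      thus False using Suc.hyps(2) by (simp add: sum_distrib_left[symmetric])
    qed
    then obtain x where x: "x \<in> X" "real (Suc n) * g x \<le> sum g X" by auto
    let ?X = "X - {x}"
    have "card ?X = n" using x Suc by (simp add: card_Diff_singleton)
    then obtain X0 where X0: "X0 \<subseteq> ?X" "card X0 = a" "real a * sum g ?X \<le> real n * sum g X0"
      using Suc.hyps(1)[of ?X] Suc.prems False Suc.hyps(2) by (metis finite_Diff le_SucE)
    have "sum g X = g x + sum g ?X" using x Suc by (simp add: sum.remove)
    hence "real n * sum g X \<le> real (Suc n) * sum g ?X" using x(2) by (simp add: algebra_simps)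
    hence "real a * (real n * sum g X) \<le> real a * (real (Suc n) * sum g ?X)"
      by (rule mult_left_mono) simp
    also have "\<dots> \<le> real (Suc n) * (real n * sum g X0)"
      using mult_left_mono[OF X0(3), of "real (Suc n)"] by (simp add: mult.left_commute)
    finally have "real n * (real a * sum g X) \<le> real n * (real (Suc n) * sum g X0)"
      by (simp only: mult.left_commute)
    moreover have "n > 0 \<or> a = 0" using False Suc.prems(2) Suc.hyps(2) by auto
    moreover have "X0 = {}" if "a = 0" using X0 that Suc.prems(1) by (meson card_0_eq finite_Diff finite_subset)
    ultimately have "real a * sum g X \<le> real (Suc n) * sum g X0" by auto
    thus ?thesis using X0 Suc.hyps(2) by (metis Diff_subset order_trans)
  qed
qed

lemma rectangle_sum_ge_average:
  fixes w :: "'a \<Rightarrow> 'b \<Rightarrow> real"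
  assumes "finite X" "finite Y" "a \<le> card X" "b \<le> card Y"
  shows "\<exists>X0\<subseteq>X. \<exists>Y0\<subseteq>Y. card X0 = a \<and> card Y0 = b \<and>
    real a * real b * (\<Sum>x\<in>X. \<Sum>y\<in>Y. w x y) \<le> real (card X) * real (card Y) * (\<Sum>x\<in>X0. \<Sum>y\<in>Y0. w x y)"
proof -
  obtain X0 where X0: "X0 \<subseteq> X" "card X0 = a"
    "real a * (\<Sum>x\<in>X. \<Sum>y\<in>Y. w x y) \<le> real (card X) * (\<Sum>x\<in>X0. \<Sum>y\<in>Y. w x y)"
    using subset_sum_ge_average[OF assms(1,3), of "\<lambda>x. \<Sum>y\<in>Y. w x y"] by blast
  obtain Y0 where Y0: "Y0 \<subseteq> Y" "card Y0 = b"
    "real b * (\<Sum>y\<in>Y. \<Sum>x\<in>X0. w x y) \<le> real (card Y) * (\<Sum>y\<in>Y0. \<Sum>x\<in>X0. w x y)"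
    using subset_sum_ge_average[OF assms(2,4), of "\<lambda>y. \<Sum>x\<in>X0. w x y"] by blast
  have "real b * (real a * (\<Sum>x\<in>X. \<Sum>y\<in>Y. w x y)) \<le> real b * (real (card X) * (\<Sum>x\<in>X0. \<Sum>y\<in>Y. w x y))"
    using X0(3) by (rule mult_left_mono) simp
  also have "\<dots> = real (card X) * (real b * (\<Sum>y\<in>Y. \<Sum>x\<in>X0. w x y))"
    by (subst sum.swap) (rule mult.left_commute)
  also have "\<dots> \<le> real (card X) * (real (card Y) * (\<Sum>y\<in>Y0. \<Sum>x\<in>X0. w x y))"
    using Y0(3) by (rule mult_left_mono) simp
  also have "(\<Sum>y\<in>Y0. \<Sum>x\<in>X0. w x y) = (\<Sum>x\<in>X0. \<Sum>y\<in>Y0. w x y)" by (rule sum.swap)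
  finally have "real a * real b * (\<Sum>x\<in>X. \<Sum>y\<in>Y. w x y) \<le> real (card X) * real (card Y) * (\<Sum>x\<in>X0. \<Sum>y\<in>Y0. w x y)"
    by (simp only: mult.assoc mult.left_commute)
  thus ?thesis using X0 Y0 by blast
qed

lemma edge_count_eq_double_sum:
  assumes "finite X" "finite Y"
  shows "real (edge_count E X Y) = (\<Sum>x\<in>X. \<Sum>y\<in>Y. of_bool ((x, y) \<in> E))"
proof -
  have "real (card (E `` {x} \<inter> Y)) = (\<Sum>y\<in>Y. of_bool ((x, y) \<in> E))" for x
    using assms(2) by (simp add: Int_commute Collect_conj_eq Image_singleton of_bool_def sum.If_cases)
  thus ?thesis using edge_count_eq_sum[OF assms, of E] by simp
qed

lemma dense_subrectangle:
  assumes "finite X" "finite Y" "a \<le> card X" "b \<le> card Y" "0 < a" "0 < b"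
    and "\<theta> * real (card X) * real (card Y) \<le> real (edge_count E X Y)"
  shows "\<exists>X0\<subseteq>X. \<exists>Y0\<subseteq>Y. card X0 = a \<and> card Y0 = b \<and> \<theta> * real a * real b \<le> real (edge_count E X0 Y0)"
proof -
  obtain X0 Y0 where XY: "X0 \<subseteq> X" "Y0 \<subseteq> Y" "card X0 = a" "card Y0 = b"
    "real a * real b * (\<Sum>x\<in>X. \<Sum>y\<in>Y. of_bool ((x, y) \<in> E))
      \<le> real (card X) * real (card Y) * (\<Sum>x\<in>X0. \<Sum>y\<in>Y0. of_bool ((x, y) \<in> E))"
    using rectangle_sum_ge_average[OF assms(1-4), of "\<lambda>x y. of_bool ((x, y) \<in> E)"] by blast
  have f: "finite X0" "finite Y0" using XY assms finite_subset by auto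
  have avg: "real a * real b * real (edge_count E X Y) \<le> real (card X) * real (card Y) * real (edge_count E X0 Y0)"
    using XY(5) by (simp add: edge_count_eq_double_sum assms(1,2) f)
  have pos: "0 < real (card X) * real (card Y)" using assms(3-6) by simp
  have "real (card X) * real (card Y) * (\<theta> * real a * real b) = real a * real b * (\<theta> * real (card X) * real (card Y))"
    by (simp add: algebra_simps)
  also have "\<dots> \<le> real a * real b * real (edge_count E X Y)" using assms(7) by (intro mult_left_mono) auto
  also note avg
  finally have "\<theta> * real a * real b \<le> real (edge_count E X0 Y0)"
    using pos by (simp only: mult_le_cancel_left_pos)
  thus ?thesis using XY by blast
qed

lemma sparse_subrectangle:
  assumes "finite X" "finite Y" "a \<le> card X" "b \<le> card Y" "0 < a" "0 < b"
    and "real (edge_count E X Y) < \<theta> * real (card X) * real (card Y)"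
  shows "\<exists>X0\<subseteq>X. \<exists>Y0\<subseteq>Y. card X0 = a \<and> card Y0 = b \<and> real (edge_count E X0 Y0) < \<theta> * real a * real b"
proof -
  obtain X0 Y0 where XY: "X0 \<subseteq> X" "Y0 \<subseteq> Y" "card X0 = a" "card Y0 = b"
    "real a * real b * (\<Sum>x\<in>X. \<Sum>y\<in>Y. - of_bool ((x, y) \<in> E))
      \<le> real (card X) * real (card Y) * (\<Sum>x\<in>X0. \<Sum>y\<in>Y0. - of_bool ((x, y) \<in> E))"
    using rectangle_sum_ge_average[OF assms(1-4), of "\<lambda>x y. - of_bool ((x, y) \<in> E)"] by blast
  have f: "finite X0" "finite Y0" using XY assms finite_subset by auto
  have avg: "real (card X) * real (card Y) * real (edge_count E X0 Y0) \<le> real a * real b * real (edge_count E X Y)"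
    using XY(5) by (simp add: edge_count_eq_double_sum assms(1,2) f sum_negf)
  have pos: "0 < real (card X) * real (card Y)" using assms(3-6) by simp
  note avg
  also have "real a * real b * real (edge_count E X Y) < real a * real b * (\<theta> * real (card X) * real (card Y))"
    using assms(5-7) by simp
  also have "\<dots> = real (card X) * real (card Y) * (\<theta> * real a * real b)" by (simp add: algebra_simps)
  finally have "real (edge_count E X0 Y0) < \<theta> * real a * real b"
    using pos by (simp only: mult_less_cancel_left_pos)
  thus ?thesis using XY by blast
qed

section \<open>Lower-regular pairs\<close>

definition lower_regular :: "('a \<times> 'b) set \<Rightarrow> nat \<Rightarrow> real \<Rightarrow> 'a set \<Rightarrow> 'b set \<Rightarrow> bool" where
  "lower_regular E m \<rho> A B \<longleftrightarrow> (\<forall>A'\<subseteq>A. \<forall>B'\<subseteq>B. m \<le> card A' \<longrightarrow> m \<le> card B' \<longrightarrow>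
     \<rho> * real (card A') * real (card B') \<le> real (edge_count E A' B'))"

lemma lower_regular_subset: "lower_regular E m \<rho> A B \<Longrightarrow> A' \<subseteq> A \<Longrightarrow> B' \<subseteq> B \<Longrightarrow> lower_regular E m \<rho> A' B'"
  unfolding lower_regular_def by blast

lemma lower_regular_commute:
  assumes "sym E" "lower_regular E m \<rho> A B"
  shows "lower_regular E m \<rho> B A"
  unfolding lower_regular_def
proof (intro allI impI)
  fix B' A' assume "B' \<subseteq> B" "A' \<subseteq> A" "m \<le> card B'" "m \<le> card A'"
  hence "\<rho> * real (card A') * real (card B') \<le> real (edge_count E A' B')"
    using assms(2) unfolding lower_regular_def by blast
  thus "\<rho> * real (card B') * real (card A') \<le> real (edge_count E B' A')"
    using edge_count_commute[OF assms(1), of A' B'] by (simp add: mult_ac)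
qed

lemma lower_regular_edge:
  assumes "lower_regular E m \<rho> A B" "0 < \<rho>" "0 < m" "A' \<subseteq> A" "B' \<subseteq> B" "m \<le> card A'" "m \<le> card B'"
  shows "\<exists>a\<in>A'. \<exists>b\<in>B'. (a, b) \<in> E"
proof (rule ccontr)
  assume "\<not> ?thesis"
  hence "E \<inter> A' \<times> B' = {}" by auto
  hence "edge_count E A' B' = 0" by (simp add: edge_count_def)
  moreover have "0 < \<rho> * real (card A') * real (card B')" using assms by auto
  ultimately show False using assms unfolding lower_regular_def by (metis not_le of_nat_0)
qed

lemma lower_regular_few_low_degree:
  assumes "lower_regular E m \<rho> A B" "finite A" "finite B" "0 < m" "B' \<subseteq> B" "m \<le> card B'"
  shows "card {a \<in> A. real (card (E `` {a} \<inter> B')) < \<rho> * real (card B')} < m"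
proof (rule ccontr)
  let ?A = "{a \<in> A. real (card (E `` {a} \<inter> B')) < \<rho> * real (card B')}"
  assume many: "\<not> card ?A < m"
  have fin: "finite ?A" "finite B'" using assms finite_subset by auto
  have "\<rho> * real (card ?A) * real (card B') \<le> real (edge_count E ?A B')"
    using assms(1,5,6) many unfolding lower_regular_def by auto
  also have "\<dots> = (\<Sum>a\<in>?A. real (card (E `` {a} \<inter> B')))" using edge_count_eq_sum[OF fin, of E] by simp
  also have "\<dots> < (\<Sum>a\<in>?A. \<rho> * real (card B'))"
  proof (rule sum_strict_mono[OF fin(1)])
    show "?A \<noteq> {}" using many assms(4) by (metis card.empty)
  qed auto
  finally show False by (simp add: algebra_simps)
qed

lemma not_lower_regularE:
  assumes "\<not> lower_regular E m \<rho> X Y" "finite X" "finite Y" "0 < m"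
  obtains A B where "A \<subseteq> X" "B \<subseteq> Y" "card A = m" "card B = m"
    "real (edge_count E A B) < \<rho> * real m * real m"
proof -
  obtain A B where AB: "A \<subseteq> X" "B \<subseteq> Y" "m \<le> card A" "m \<le> card B"
    "real (edge_count E A B) < \<rho> * real (card A) * real (card B)"
    using assms(1) unfolding lower_regular_def by (meson not_le)
  have "finite A" "finite B" using AB assms(2,3) finite_subset by auto
  from sparse_subrectangle[OF this AB(3,4) assms(4,4) AB(5)] obtain A0 B0
    where "A0 \<subseteq> A" "B0 \<subseteq> B" "card A0 = m" "card B0 = m" "real (edge_count E A0 B0) < \<rho> * real m * real m" by blast
  thus thesis using AB(1,2) by (intro that[of A0 B0]) auto
qed

lemma dense_outside_sparse_corner:
  fixes \<theta> :: real and q m :: nat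
  defines "\<theta>' \<equiv> \<theta> * (1 + 1 / (2 * real q ^ 2))"
  assumes q: "2 \<le> q" "0 \<le> \<theta>" and fin: "finite X" "finite Y" and card: "card X = q * m" "card Y = q * m"
    and AB: "A \<subseteq> X" "B \<subseteq> Y" "card A = m" "card B = m"
    and dense: "\<theta> * real (card X) * real (card Y) \<le> real (edge_count E X Y)"
    and sparse: "real (edge_count E A B) < \<theta> / 2 * real m * real m"
  shows "\<theta>' * real (card (X - A)) * real (card Y) \<le> real (edge_count E (X - A) Y) \<or>
    \<theta>' * real (card A) * real (card (Y - B)) \<le> real (edge_count E A (Y - B))"
proof (rule ccontr)
  assume neg: "\<not> ?thesis"
  have finAB: "finite A" "finite B" using AB fin finite_subset by auto
  have rest: "real (card (X - A)) = (real q - 1) * real m" "real (card (Y - B)) = (real q - 1) * real m"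
    using AB finAB card q(1) by (simp_all add: card_Diff_subset of_nat_diff algebra_simps)
  have "edge_count E X Y = edge_count E (X - A) Y + edge_count E A Y"
    using edge_count_Un_left[of "X - A" A Y E] AB(1) fin finAB by (simp add: Int_commute Un_absorb2)
  also have "edge_count E A Y = edge_count E A (Y - B) + edge_count E A B"
    using edge_count_Un_right[of A "Y - B" B E] AB(2) fin finAB by (simp add: Int_commute Un_absorb2)
  finally have "real (edge_count E X Y) < \<theta>' * real (card (X - A)) * real (card Y)
      + \<theta>' * real (card A) * real (card (Y - B)) + \<theta> / 2 * (real m * real m)"
    using sparse neg by (simp add: mult.assoc)
  also have "\<dots> = (real m * real m) * \<theta> * ((1 + 1 / (2 * real q ^ 2)) * (real q ^ 2 - 1) + 1 / 2)"
  proof -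
    have "\<theta> * z * ((real q - 1) * real m) * (real q * real m) + \<theta> * z * real m * ((real q - 1) * real m)
        + \<theta> / 2 * (real m * real m) = (real m * real m) * \<theta> * (z * (real q ^ 2 - 1) + 1 / 2)" for z
      by (simp add: power2_eq_square algebra_simps)
    thus ?thesis by (simp only: \<theta>'_def rest card(2) AB(3) of_nat_mult)
  qed
  also have "(1 + 1 / (2 * real q ^ 2)) * (real q ^ 2 - 1) + 1 / 2 = real q ^ 2 - 1 / (2 * real q ^ 2)"
    using q(1) by (simp add: field_simps)
  also have "(real m * real m) * \<theta> * (real q ^ 2 - 1 / (2 * real q ^ 2)) \<le> (real m * real m) * \<theta> * real q ^ 2"
    using q(2) by (intro mult_left_mono) auto
  also have "\<dots> = \<theta> * real (card X) * real (card Y)" unfolding card by (simp add: power2_eq_square)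
  finally show False using dense by simp
qed

lemma density_increment:
  fixes \<theta> \<theta>0 :: real and q m :: nat
  assumes q: "2 \<le> q" "0 < m" and \<theta>: "0 < \<theta>0" "\<theta>0 \<le> \<theta>" and fin: "finite X" "finite Y"
    and card: "card X = q * m" "card Y = q * m"
    and dense: "\<theta> * real (card X) * real (card Y) \<le> real (edge_count E X Y)"
    and irregular: "\<not> lower_regular E m (\<theta>0 / 2) X Y"
  shows "\<exists>X0\<subseteq>X. \<exists>Y0\<subseteq>Y. card X0 = m \<and> card Y0 = m \<and>
    \<theta> * (1 + 1 / (2 * real q ^ 2)) * real m * real m \<le> real (edge_count E X0 Y0)"
proof -
  obtain A B where AB: "A \<subseteq> X" "B \<subseteq> Y" "card A = m" "card B = m"
    "real (edge_count E A B) < \<theta>0 / 2 * real m * real m"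
    by (rule not_lower_regularE[OF irregular fin q(2)])
  have "\<theta>0 / 2 * real m * real m \<le> \<theta> / 2 * real m * real m" using \<theta>(2) by (intro mult_right_mono) auto
  hence sparse: "real (edge_count E A B) < \<theta> / 2 * real m * real m" using AB(5) by linarith
  have finAB: "finite A" "finite B" using AB fin finite_subset by auto
  have "m \<le> (q - 1) * m" "m \<le> q * m" using q(1) by auto
  hence large: "m \<le> card (X - A)" "m \<le> card (Y - B)" "m \<le> card Y"
    using AB finAB card by (auto simp: card_Diff_subset diff_mult_distrib)
  have \<theta>0: "0 \<le> \<theta>" using \<theta> by simp
  from dense_outside_sparse_corner[OF q(1) \<theta>0 fin card AB(1-4) dense sparse] show ?thesis
  proof
    assume "\<theta> * (1 + 1 / (2 * real q ^ 2)) * real (card (X - A)) * real (card Y) \<le> real (edge_count E (X - A) Y)"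
    from dense_subrectangle[OF _ fin(2) large(1,3) q(2,2) this] fin(1) show ?thesis by blast
  next
    assume "\<theta> * (1 + 1 / (2 * real q ^ 2)) * real (card A) * real (card (Y - B)) \<le> real (edge_count E A (Y - B))"
    from dense_subrectangle[OF finAB(1) _ _ large(2) q(2,2) this] fin(2) AB show ?thesis by blast
  qed
qed

lemma lower_regular_subpair_of_power:
  fixes \<theta> \<theta>0 :: real and q r :: nat
  assumes q: "2 \<le> q" "0 < r" and \<theta>0: "0 < \<theta>0"
    and "\<theta>0 \<le> \<theta>" "finite X" "finite Y" "card X = r * q ^ t" "card Y = r * q ^ t"
      "\<theta> * real (card X) * real (card Y) \<le> real (edge_count E X Y)"
      "1 < \<theta> * (1 + 1 / (2 * real q ^ 2)) ^ t"
  shows "\<exists>X'\<subseteq>X. \<exists>Y'\<subseteq>Y. \<exists>m\<ge>r. card X' = q * m \<and> card Y' = q * m \<and> q * m \<le> r * q ^ t \<and>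
    lower_regular E m (\<theta>0 / 2) X' Y'"
  using assms(4-)
proof (induction t arbitrary: \<theta> X Y)
  case 0
  have "real (edge_count E X Y) \<le> real r * real r" using edge_count_le[OF 0(2,3), of E] 0(4,5)
    by (metis mult.right_neutral of_nat_le_iff of_nat_mult power_0)
  moreover have "\<theta> * (real r * real r) > 1 * (real r * real r)" using 0(7) q(2)
    by (intro mult_strict_right_mono) auto
  ultimately show ?case using 0 by simp
next
  case (Suc t)
  define m where "m = r * q ^ t"
  define \<theta>' where "\<theta>' = \<theta> * (1 + 1 / (2 * real q ^ 2))"
  have m: "r \<le> m" "0 < m" unfolding m_def using q by auto
  have card: "card X = q * m" "card Y = q * m" using Suc by (auto simp: m_def)
  show ?case
  proof (cases "lower_regular E m (\<theta>0 / 2) X Y")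
    case True
    thus ?thesis using card m
      by (intro exI[of _ X] exI[of _ Y] exI[of _ m] conjI) (auto simp: m_def)
  next
    case False
    obtain X0 Y0 where XY0: "X0 \<subseteq> X" "Y0 \<subseteq> Y" "card X0 = m" "card Y0 = m"
      "\<theta>' * real m * real m \<le> real (edge_count E X0 Y0)"
      using density_increment[OF q(1) m(2) \<theta>0 Suc.prems(1-3) card Suc.prems(6) False] by (auto simp: \<theta>'_def)
    have "\<theta> * 1 \<le> \<theta>'" unfolding \<theta>'_def using Suc.prems(1) \<theta>0 by (intro mult_left_mono) auto
    hence "\<theta>0 \<le> \<theta>'" using Suc.prems(1) by linarith
    from Suc.IH[OF this]
    have "\<exists>X'\<subseteq>X0. \<exists>Y'\<subseteq>Y0. \<exists>m\<ge>r. card X' = q * m \<and> card Y' = q * m \<and> q * m \<le> r * q ^ t \<and>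
        lower_regular E m (\<theta>0 / 2) X' Y'"
      using XY0 Suc.prems(2,3,7) finite_subset[OF XY0(1)] finite_subset[OF XY0(2)]
      by (auto simp: m_def \<theta>'_def mult.assoc)
    moreover have "r * q ^ t \<le> r * q ^ Suc t" using q(1) by simp
    ultimately show ?thesis using XY0 by (meson order_trans)
  qed
qed

definition increment_steps :: "nat \<Rightarrow> real \<Rightarrow> nat" where
  "increment_steps q \<theta> = (LEAST t. 1 < \<theta> * (1 + 1 / (2 * real q ^ 2)) ^ t)"

lemma increment_steps:
  assumes "2 \<le> q" "0 < \<theta>"
  shows "1 < \<theta> * (1 + 1 / (2 * real q ^ 2)) ^ increment_steps q \<theta>"
proof -
  have "1 + 1 / (2 * real q ^ 2) > 1" using assms(1) by simp
  then obtain t where "1 / \<theta> < (1 + 1 / (2 * real q ^ 2)) ^ t" using real_arch_pow by blast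
  hence "1 < \<theta> * (1 + 1 / (2 * real q ^ 2)) ^ t" using assms(2) by (simp add: field_simps)
  thus ?thesis unfolding increment_steps_def by (rule LeastI)
qed

lemma dense_pair_contains_lower_regular:
  fixes \<theta> :: real and q r :: nat
  defines "M \<equiv> r * q ^ increment_steps q \<theta>"
  assumes "2 \<le> q" "0 < \<theta>" "0 < r" and fin: "finite X" "finite Y" and large: "M \<le> card X" "M \<le> card Y"
    and dense: "\<theta> * real (card X) * real (card Y) \<le> real (edge_count E X Y)"
  obtains X' Y' m where "X' \<subseteq> X" "Y' \<subseteq> Y" "r \<le> m" "card X' = q * m" "card Y' = q * m" "q * m \<le> M"
    "lower_regular E m (\<theta> / 2) X' Y'"
proof -
  have pos: "0 < M" using assms(2,4) by (simp add: M_def)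
  obtain X0 Y0 where XY: "X0 \<subseteq> X" "Y0 \<subseteq> Y" "card X0 = M" "card Y0 = M"
    "\<theta> * real M * real M \<le> real (edge_count E X0 Y0)"
    using dense_subrectangle[OF fin large pos pos dense] by auto
  have "\<exists>X'\<subseteq>X0. \<exists>Y'\<subseteq>Y0. \<exists>m\<ge>r. card X' = q * m \<and> card Y' = q * m \<and> q * m \<le> M \<and>
      lower_regular E m (\<theta> / 2) X' Y'"
    unfolding M_def
    by (rule lower_regular_subpair_of_power[OF assms(2,4,3) order.refl])
       (use XY fin finite_subset[OF XY(1)] finite_subset[OF XY(2)] increment_steps[OF assms(2,3)] in \<open>auto simp: M_def\<close>)
  thus thesis using XY(1,2) that by (meson order_trans)
qed

section \<open>Embedding bounded-degree graphs into lower-regular pairs\<close>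

definition candidates ::
  "'a rel \<Rightarrow> 'w rel \<Rightarrow> ('w \<Rightarrow> 'a set) \<Rightarrow> ('w \<Rightarrow> 'a) \<Rightarrow> 'w set \<Rightarrow> 'w \<Rightarrow> 'a set" where
  "candidates E F side \<phi> Z y = {a \<in> side y. \<forall>z\<in>Z \<inter> F `` {y}. (\<phi> z, a) \<in> E}"

definition partial_embedding ::
  "'a rel \<Rightarrow> 'w rel \<Rightarrow> ('w \<Rightarrow> 'a set) \<Rightarrow> real \<Rightarrow> 'w set \<Rightarrow> ('w \<Rightarrow> 'a) \<Rightarrow> 'w set \<Rightarrow> bool" where
  "partial_embedding E F side \<rho> W \<phi> Z \<longleftrightarrow> inj_on \<phi> Z \<and> (\<forall>z\<in>Z. \<phi> z \<in> side z) \<and>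
     (\<forall>u\<in>Z. \<forall>v\<in>Z. (u, v) \<in> F \<longrightarrow> (\<phi> u, \<phi> v) \<in> E) \<and>
     (\<forall>y\<in>W - Z. \<rho> ^ card (Z \<inter> F `` {y}) * real (card (side y)) \<le> real (card (candidates E F side \<phi> Z y)))"

context
  fixes E :: "'a rel" and F :: "'w rel" and side :: "'w \<Rightarrow> 'a set"
    and \<rho> :: real and m \<Delta> :: nat and W :: "'w set"
  assumes E: "sym E" and \<rho>: "0 < \<rho>" "\<rho> \<le> 1" and F: "simple_graph W F" and W: "card W \<le> m"
    and deg: "\<And>w. card (F `` {w}) \<le> \<Delta>" and fin: "\<And>w. finite (side w)"
    and large: "\<And>w. w \<in> W \<Longrightarrow> real ((\<Delta> + 2) * m) \<le> \<rho> ^ \<Delta> * real (card (side w))"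
    and regular: "\<And>x y. (x, y) \<in> F \<Longrightarrow> lower_regular E m \<rho> (side x) (side y)"
begin

lemma candidates_large:
  assumes "partial_embedding E F side \<rho> W \<phi> Z" "y \<in> W - Z"
  shows "(\<Delta> + 2) * m \<le> card (candidates E F side \<phi> Z y)"
proof -
  have "card (Z \<inter> F `` {y}) \<le> card (F `` {y})"
    using simple_graphD(2)[OF F] by (intro card_mono) (auto intro: finite_Image)
  hence "card (Z \<inter> F `` {y}) \<le> \<Delta>" using deg[of y] by linarith
  hence "\<rho> ^ \<Delta> \<le> \<rho> ^ card (Z \<inter> F `` {y})" using \<rho> by (intro power_decreasing) auto
  hence "\<rho> ^ \<Delta> * real (card (side y)) \<le> \<rho> ^ card (Z \<inter> F `` {y}) * real (card (side y))"
    by (intro mult_right_mono) auto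
  hence "real ((\<Delta> + 2) * m) \<le> real (card (candidates E F side \<phi> Z y))"
    using large[of y] assms unfolding partial_embedding_def by force
  thus ?thesis by (simp only: of_nat_le_iff)
qed

lemma good_candidate:
  assumes emb: "partial_embedding E F side \<rho> W \<phi> Z" and x: "x \<in> W - Z" and Z: "Z \<subseteq> W"
  obtains a where "a \<in> candidates E F side \<phi> Z x" "a \<notin> \<phi> ` Z"
    "\<And>y. y \<in> F `` {x} - Z \<Longrightarrow>
      \<rho> * real (card (candidates E F side \<phi> Z y)) \<le> real (card (E `` {a} \<inter> candidates E F side \<phi> Z y))"
proof -
  let ?cand = "candidates E F side \<phi> Z" and ?N = "F `` {x} - Z"
  define bad where "bad y = {a \<in> side x. real (card (E `` {a} \<inter> ?cand y)) < \<rho> * real (card (?cand y))}" for y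
  note F = simple_graphD[OF F]
  have fN: "finite ?N" "finite (F `` {x})" using F(2) by (auto intro: finite_Image)
  have fZ: "finite Z" using Z F(1) by (rule finite_subset)
  have m0: "0 < m" using W x F(1) by (metis DiffD1 card_gt_0_iff empty_iff le_zero_eq neq0_conv)
  have few_bad: "card (bad y) \<le> m" if "y \<in> ?N" for y
  proof -
    have "m \<le> card (?cand y)" using candidates_large[OF emb, of y] F(5) that by auto
    moreover have "?cand y \<subseteq> side y" by (auto simp: candidates_def)
    ultimately show ?thesis unfolding bad_def
      using lower_regular_few_low_degree[OF regular fin fin m0, of x y "?cand y"] that by simp
  qed
  have "card (\<Union>y\<in>?N. bad y) \<le> (\<Sum>y\<in>?N. card (bad y))" using fN(1) by (rule card_UN_le)
  also have "\<dots> \<le> (\<Sum>y\<in>?N. m)" by (intro sum_mono few_bad)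
  also have "\<dots> \<le> \<Delta> * m" using card_mono[OF fN(2), of ?N] deg[of x] by auto
  finally have "card (\<phi> ` Z \<union> (\<Union>y\<in>?N. bad y)) \<le> m + \<Delta> * m"
    using card_Un_le[of "\<phi> ` Z" "\<Union>y\<in>?N. bad y"] card_image_le[OF fZ, of \<phi>] card_mono[OF F(1) Z] W by linarith
  also have "\<dots> < card (?cand x)" using candidates_large[OF emb x] m0 by (auto simp: algebra_simps)
  finally have "card (\<phi> ` Z \<union> (\<Union>y\<in>?N. bad y)) < card (?cand x)" .
  moreover have "finite (\<phi> ` Z \<union> (\<Union>y\<in>?N. bad y))" using fZ fN(1) fin by (auto simp: bad_def)
  ultimately have "\<not> ?cand x \<subseteq> \<phi> ` Z \<union> (\<Union>y\<in>?N. bad y)" by (meson card_mono not_le)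
  then obtain a where a: "a \<in> ?cand x" "a \<notin> \<phi> ` Z" "\<And>y. y \<in> ?N \<Longrightarrow> a \<notin> bad y" by auto
  hence "a \<in> side x" by (simp add: candidates_def)
  hence "\<rho> * real (card (?cand y)) \<le> real (card (E `` {a} \<inter> ?cand y))" if "y \<in> ?N" for y
    using a(3)[OF that] by (simp add: bad_def not_less)
  with a(1,2) show thesis by (rule that)
qed

lemma partial_embedding_extend:
  assumes emb: "partial_embedding E F side \<rho> W \<phi> Z" and x: "x \<in> W - Z" and Z: "Z \<subseteq> W"
  shows "\<exists>\<phi>'. partial_embedding E F side \<rho> W \<phi>' (insert x Z)"
proof -
  obtain a where a: "a \<in> candidates E F side \<phi> Z x" "a \<notin> \<phi> ` Z"
    and dense: "\<And>y. y \<in> F `` {x} - Z \<Longrightarrow>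
      \<rho> * real (card (candidates E F side \<phi> Z y)) \<le> real (card (E `` {a} \<inter> candidates E F side \<phi> Z y))"
    by (rule good_candidate[OF assms]) blast
  let ?\<phi> = "\<phi>(x := a)"
  have \<phi>: "inj_on \<phi> Z" "\<forall>z\<in>Z. \<phi> z \<in> side z" "\<forall>u\<in>Z. \<forall>v\<in>Z. (u, v) \<in> F \<longrightarrow> (\<phi> u, \<phi> v) \<in> E"
    "\<And>y. y \<in> W - Z \<Longrightarrow> \<rho> ^ card (Z \<inter> F `` {y}) * real (card (side y)) \<le> real (card (candidates E F side \<phi> Z y))"
    using emb by (auto simp: partial_embedding_def)
  have F': "sym F" "(x, x) \<notin> F" and fZ: "finite Z"
    using simple_graphD[OF F] Z finite_subset by (auto simp: irrefl_def)
  have adj: "(\<phi> z, a) \<in> E" if "z \<in> Z" "(x, z) \<in> F" for z using a(1) that by (auto simp: candidates_def)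
  have edges: "\<forall>u\<in>insert x Z. \<forall>v\<in>insert x Z. (u, v) \<in> F \<longrightarrow> (?\<phi> u, ?\<phi> v) \<in> E"
  proof (intro ballI impI)
    fix u v assume uv: "u \<in> insert x Z" "v \<in> insert x Z" "(u, v) \<in> F"
    consider "u = x" "v \<in> Z" "v \<noteq> x" | "v = x" "u \<in> Z" "u \<noteq> x" | "u \<in> Z" "v \<in> Z" "u \<noteq> x" "v \<noteq> x"
      using uv F'(2) x by auto
    thus "(?\<phi> u, ?\<phi> v) \<in> E"
    proof cases
      case 1
      thus ?thesis using adj[of v] uv(3) symD[OF E] by simp
    next
      case 2
      thus ?thesis using adj[of u] symD[OF F'(1) uv(3)] by simp
    next
      case 3
      thus ?thesis using \<phi>(3) uv(3) by simp
    qed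
  qed
  have sizes: "\<rho> ^ card (insert x Z \<inter> F `` {y}) * real (card (side y)) \<le> real (card (candidates E F side ?\<phi> (insert x Z) y))"
    if y: "y \<in> W - insert x Z" for y
  proof (cases "(x, y) \<in> F")
    case False
    hence "(y, x) \<notin> F" using F'(1) by (auto simp: sym_def)
    hence "insert x Z \<inter> F `` {y} = Z \<inter> F `` {y}" by auto
    moreover from this have "candidates E F side ?\<phi> (insert x Z) y = candidates E F side \<phi> Z y"
      using x by (auto simp: candidates_def)
    ultimately show ?thesis using \<phi>(4) y by auto
  next
    case True
    hence yx: "(y, x) \<in> F" using F'(1) by (auto simp: sym_def)
    hence "insert x Z \<inter> F `` {y} = insert x (Z \<inter> F `` {y})" by auto
    hence Suc: "card (insert x Z \<inter> F `` {y}) = Suc (card (Z \<inter> F `` {y}))" using x fZ by simp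
    have "candidates E F side ?\<phi> (insert x Z) y = E `` {a} \<inter> candidates E F side \<phi> Z y"
      using x yx by (auto simp: candidates_def)
    moreover have "\<rho> * (\<rho> ^ card (Z \<inter> F `` {y}) * real (card (side y))) \<le> \<rho> * real (card (candidates E F side \<phi> Z y))"
      using \<phi>(4) y \<rho>(1) by (intro mult_left_mono) auto
    ultimately show ?thesis unfolding Suc using dense[of y] True y by (simp add: mult.assoc)
  qed
  have "inj_on ?\<phi> (insert x Z)" using \<phi>(1) a(2) x by (auto simp: inj_on_def)
  moreover have "\<forall>z\<in>insert x Z. ?\<phi> z \<in> side z" using \<phi>(2) a(1) by (auto simp: candidates_def)
  ultimately show ?thesis using edges sizes unfolding partial_embedding_def by blast
qed

lemma bounded_degree_embedding:
  obtains \<phi> where "inj_on \<phi> W" "\<And>w. w \<in> W \<Longrightarrow> \<phi> w \<in> side w" "\<And>u v. (u, v) \<in> F \<Longrightarrow> (\<phi> u, \<phi> v) \<in> E"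
proof -
  have "\<exists>\<phi>. partial_embedding E F side \<rho> W \<phi> Z" if "Z \<subseteq> W" "finite Z" for Z
    using that(2,1)
  proof (induction rule: finite_induct)
    case empty
    show ?case by (auto simp: partial_embedding_def candidates_def)
  next
    case (insert x Z)
    thus ?case using partial_embedding_extend[of _ Z x] by auto
  qed
  then obtain \<phi> where "partial_embedding E F side \<rho> W \<phi> W" using simple_graphD(1)[OF F] by blast
  thus thesis using that[of \<phi>] simple_graphD(5)[OF F] unfolding partial_embedding_def by blast
qed

end

section \<open>Hubs\<close>

definition hub :: "'a rel \<Rightarrow> 'a set \<Rightarrow> 'a set \<Rightarrow> nat \<Rightarrow> bool" where
  "hub E U Q f \<longleftrightarrow> (\<forall>a\<in>U. \<forall>b\<in>U. \<forall>F. finite F \<longrightarrow> card F \<le> f \<longrightarrow>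
     (\<exists>C\<subseteq>Q - F. finite C \<and> card C \<le> 3 \<and> connector E a b C))"

lemma hubD:
  assumes "hub E U Q f" "a \<in> U" "b \<in> U" "finite F" "card F \<le> f"
  obtains C where "C \<subseteq> Q - F" "finite C" "card C \<le> 3" "connector E a b C"
proof -
  have "\<exists>C\<subseteq>Q - F. finite C \<and> card C \<le> 3 \<and> connector E a b C" using assms by (simp add: hub_def)
  thus thesis using that by blast
qed

lemma hub_antimono: "hub E U Q f \<Longrightarrow> f' \<le> f \<Longrightarrow> hub E U Q f'"
  unfolding hub_def by (intro ballI allI impI) (simp add: order_trans)

lemma hub_Restr:
  fixes E :: "'a rel"
  assumes "hub E U Q f" "Q \<subseteq> U"
  shows "hub (Restr E U) U Q f"
  unfolding hub_def
proof (intro ballI allI impI)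
  fix a b :: 'a and F :: "'a set" assume ab: "a \<in> U" "b \<in> U" "finite F" "card F \<le> f"
  then obtain C where C: "C \<subseteq> Q - F" "finite C" "card C \<le> 3" "connector E a b C"
    using hubD[OF assms(1)] by blast
  hence "connected_in (Restr E U) C" using assms(2) by (auto simp: connector_def intro: connected_in_mono)
  hence "connector (Restr E U) a b C" using C(1,4) ab assms(2) by (auto simp: connector_def)
  thus "\<exists>C\<subseteq>Q - F. finite C \<and> card C \<le> 3 \<and> connector (Restr E U) a b C" using C by blast
qed

lemma greedy_disjoint_family:
  assumes "finite J"
    and pick: "\<And>j Y. j \<in> J \<Longrightarrow> finite Y \<Longrightarrow> card Y \<le> b * card J \<Longrightarrow> \<exists>T. R j T \<and> finite T \<and> card T \<le> b \<and> T \<inter> (Y0 \<union> Y) = {}"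
  obtains T where "\<And>j. j \<in> J \<Longrightarrow> R j (T j)" "\<And>j. j \<in> J \<Longrightarrow> T j \<inter> Y0 = {}" "disjoint_family_on T J"
proof -
  have "\<exists>T. (\<forall>j\<in>K. R j (T j) \<and> finite (T j) \<and> card (T j) \<le> b \<and> T j \<inter> Y0 = {}) \<and> disjoint_family_on T K"
    if "finite K" "K \<subseteq> J" for K
    using that
  proof (induction rule: finite_subset_induct')
    case empty
    thus ?case by (simp add: disjoint_family_on_def)
  next
    case (insert i K)
    then obtain T where T: "\<forall>j\<in>K. R j (T j) \<and> finite (T j) \<and> card (T j) \<le> b \<and> T j \<inter> Y0 = {}" "disjoint_family_on T K"
      by auto
    let ?Y = "\<Union>j\<in>K. T j"
    have "card ?Y \<le> (\<Sum>j\<in>K. card (T j))" using insert(1) by (rule card_UN_le)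
    also have "\<dots> \<le> (\<Sum>j\<in>K. b)" using T(1) by (intro sum_mono) auto
    also have "\<dots> \<le> b * card J" using card_mono[OF assms(1) insert(3)] by simp
    finally have "card ?Y \<le> b * card J" .
    moreover have "finite ?Y" using insert(1) T(1) by auto
    ultimately obtain S where S: "R i S" "finite S" "card S \<le> b" "S \<inter> (Y0 \<union> ?Y) = {}" using pick[of i ?Y] insert(2) by blast
    let ?T = "T(i := S)"
    have "\<forall>j\<in>insert i K. R j (?T j) \<and> finite (?T j) \<and> card (?T j) \<le> b \<and> ?T j \<inter> Y0 = {}"
      using T(1) S by auto
    moreover have "disjoint_family_on ?T (insert i K)"
      using T(2) S(4) insert(4) by (auto simp: disjoint_family_on_def)
    ultimately show ?case by blast
  qed
  from this[OF assms(1) order.refl] show thesis using that by blast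
qed

lemma hub_connectors:
  fixes Q :: "'j \<Rightarrow> 'a set"
  assumes hub: "\<And>j. j \<in> J \<Longrightarrow> hub E (U j) (Q j) f" "\<And>j. j \<in> J \<Longrightarrow> a j \<in> U j \<and> b j \<in> U j"
    and "finite J" "finite F" "\<And>j. j \<in> J \<Longrightarrow> card (F \<inter> Q j) + 3 * card J \<le> f"
  obtains K where "\<forall>j\<in>J. K j \<subseteq> Q j - F \<and> finite (K j) \<and> card (K j) \<le> 3 \<and> connector E (a j) (b j) (K j)"
    "disjoint_family_on K J"
proof (rule greedy_disjoint_family[OF assms(3), of 3 "\<lambda>j K. K \<subseteq> Q j \<and> finite K \<and> card K \<le> 3 \<and> connector E (a j) (b j) K" F])
  fix j and Y :: "'a set"
  assume j: "j \<in> J" "finite Y" "card Y \<le> 3 * card J"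
  have "(F \<union> Y) \<inter> Q j \<subseteq> F \<inter> Q j \<union> Y" by auto
  hence "card ((F \<union> Y) \<inter> Q j) \<le> card (F \<inter> Q j) + card Y"
    using assms(4) j(2) by (meson card_Un_le card_mono finite_Int finite_UnI order_trans)
  hence "card ((F \<union> Y) \<inter> Q j) \<le> f" using j(3) assms(5)[OF j(1)] by linarith
  then obtain K where "K \<subseteq> Q j - (F \<union> Y) \<inter> Q j" "finite K" "card K \<le> 3" "connector E (a j) (b j) K"
    using hubD[OF hub(1)[OF j(1)], of "a j" "b j" "(F \<union> Y) \<inter> Q j"] hub(2)[OF j(1)] assms(4) j(2) by auto
  thus "\<exists>K. (K \<subseteq> Q j \<and> finite K \<and> card K \<le> 3 \<and> connector E (a j) (b j) K) \<and> finite K \<and> card K \<le> 3 \<and> K \<inter> (F \<union> Y) = {}"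
    by blast
next
  fix K assume "\<And>j. j \<in> J \<Longrightarrow> K j \<subseteq> Q j \<and> finite (K j) \<and> card (K j) \<le> 3 \<and> connector E (a j) (b j) (K j)"
    "\<And>j. j \<in> J \<Longrightarrow> K j \<inter> F = {}" "disjoint_family_on K J"
  thus thesis by (intro that[of K]) blast+
qed

lemma card_Int_Diff_ge:
  assumes "finite F" "card F \<le> f" "m + f \<le> card S"
  shows "m \<le> card (S - F)"
  using diff_card_le_card_Diff[OF assms(1), of S] assms by linarith

lemma lower_regular_connector:
  assumes E: "sym E" "A0 \<subseteq> A" "B0 \<subseteq> B" "lower_regular E m \<rho> A B" "0 < \<rho>" "0 < m"
    and degA: "\<And>a. a \<in> A \<Longrightarrow> m + f \<le> card (E `` {a} \<inter> B0)"
    and degB: "\<And>b. b \<in> B \<Longrightarrow> m + f \<le> card (E `` {b} \<inter> A0)"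
    and ab: "a \<in> A" "b \<in> A \<union> B" and F: "finite F" "card F \<le> f"
  shows "\<exists>C\<subseteq>(A0 \<union> B0) - F. finite C \<and> card C \<le> 3 \<and> connector E a b C"
proof -
  have nbrs: "m \<le> card (E `` {x} \<inter> B0 - F)" if "x \<in> A" for x
    using card_Int_Diff_ge[OF F degA[OF that]] .
  have nbrs': "m \<le> card (E `` {x} \<inter> A0 - F)" if "x \<in> B" for x
    using card_Int_Diff_ge[OF F degB[OF that]] .
  show ?thesis
  proof (cases "b \<in> B")
    case True
    obtain y x where xy: "y \<in> E `` {b} \<inter> A0 - F" "x \<in> E `` {a} \<inter> B0 - F" "(y, x) \<in> E"
      using lower_regular_edge[OF E(4-6) _ _ nbrs'[OF True] nbrs[OF ab(1)]] E(2,3) by blast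
    have "connected_in E {y, x}" by (rule connected_in_edge[OF E(1) xy(3)])
    thus ?thesis using xy by (intro exI[of _ "{y, x}"]) (auto simp: connector_def card_insert_if)
  next
    case False
    hence b: "b \<in> A" using ab(2) by auto
    obtain x where x: "x \<in> E `` {a} \<inter> B0 - F"
      using nbrs[OF ab(1)] E(6) by (metis card.empty ex_in_conv not_le)
    hence "x \<in> B" using E(3) by auto
    then obtain y z where yz: "y \<in> E `` {x} \<inter> A0 - F" "z \<in> E `` {b} \<inter> B0 - F" "(y, z) \<in> E"
      using lower_regular_edge[OF E(4-6) _ _ nbrs' nbrs[OF b]] E(2,3) by blast
    have "connected_in E (insert z {x, y})"
      by (rule connected_in_insert[OF E(1) connected_in_edge[OF E(1)], of x y y]) (use yz in auto)
    thus ?thesis using x yz by (intro exI[of _ "{z, x, y}"]) (auto simp: connector_def card_insert_if)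
  qed
qed

lemma lower_regular_hub:
  fixes E :: "'a rel"
  assumes E: "sym E" "A0 \<subseteq> A" "B0 \<subseteq> B" "lower_regular E m \<rho> A B" "0 < \<rho>" "0 < m"
    and deg: "\<And>a. a \<in> A \<Longrightarrow> m + f \<le> card (E `` {a} \<inter> B0)" "\<And>b. b \<in> B \<Longrightarrow> m + f \<le> card (E `` {b} \<inter> A0)"
  shows "hub E (A \<union> B) (A0 \<union> B0) f"
  unfolding hub_def
proof (intro ballI allI impI)
  fix a b :: 'a and F :: "'a set" assume a: "a \<in> A \<union> B" and b: "b \<in> A \<union> B" and F: "finite F" "card F \<le> f"
  show "\<exists>C\<subseteq>(A0 \<union> B0) - F. finite C \<and> card C \<le> 3 \<and> connector E a b C"
  proof (cases "a \<in> A")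
    case True
    thus ?thesis using lower_regular_connector[OF assms _ b F] by blast
  next
    case False
    hence "a \<in> B" "b \<in> B \<union> A" using a b by auto
    from lower_regular_connector[OF E(1,3,2) lower_regular_commute[OF E(1,4)] E(5,6) deg(2,1) this F]
    show ?thesis by (simp add: Un_commute)
  qed
qed

lemma lower_regular_contains_hub:
  assumes E: "sym E" "finite A" "finite B" "lower_regular E m \<rho> A B" "0 < \<rho>" "0 < m"
    and h: "h \<le> card A" "h \<le> card B" "m \<le> h" "real (2 * m + f) \<le> \<rho> * real h"
  obtains A1 B1 A0 B0 where "A1 \<subseteq> A" "B1 \<subseteq> B" "A0 \<subseteq> A1" "B0 \<subseteq> B1" "card A0 \<le> h" "card B0 \<le> h"
    "h \<le> card A0 + m" "card A \<le> card A1 + m" "card B \<le> card B1 + m" "hub E (A1 \<union> B1) (A0 \<union> B0) f"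
proof -
  obtain A2 where A2: "A2 \<subseteq> A" "card A2 = h" using h(1) by (meson obtain_subset_with_card_n)
  obtain B2 where B2: "B2 \<subseteq> B" "card B2 = h" using h(2) by (meson obtain_subset_with_card_n)
  have f2: "finite A2" "finite B2" using A2 B2 E finite_subset by auto
  define lowA where "lowA = {a \<in> A. real (card (E `` {a} \<inter> B2)) < \<rho> * real (card B2)}"
  define lowB where "lowB = {b \<in> B. real (card (E `` {b} \<inter> A2)) < \<rho> * real (card A2)}"
  have few: "card lowA < m" "card lowB < m" unfolding lowA_def lowB_def
    using lower_regular_few_low_degree[OF E(4,2,3,6) B2(1)]
      lower_regular_few_low_degree[OF lower_regular_commute[OF E(1,4)] E(3,2,6) A2(1)] A2 B2 h(3) by auto
  have fl: "finite lowA" "finite lowB" using E by (auto simp: lowA_def lowB_def)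
  have deg: "m + f \<le> card (N \<inter> (S - D))" if "\<rho> * real h \<le> real (card (N \<inter> S))" "finite D" "card D < m" for N S D :: "'a set"
  proof -
    have "real (2 * m + f) \<le> real (card (N \<inter> S))" using that(1) h(4) by linarith
    hence "2 * m + f \<le> card (N \<inter> S)" by (simp only: of_nat_le_iff)
    hence "m + f \<le> card (N \<inter> S - D)" using card_Int_Diff_ge[OF that(2), of m "m + f" "N \<inter> S"] that(3) by simp
    thus ?thesis by (metis Int_Diff)
  qed
  have "hub E ((A - lowA) \<union> (B - lowB)) ((A2 - lowA) \<union> (B2 - lowB)) f"
  proof (rule lower_regular_hub[OF E(1) _ _ lower_regular_subset[OF E(4)] E(5,6)])
    show "m + f \<le> card (E `` {a} \<inter> (B2 - lowB))" if "a \<in> A - lowA" for a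
      using that B2(2) fl few by (intro deg) (auto simp: lowA_def not_less)
    show "m + f \<le> card (E `` {b} \<inter> (A2 - lowA))" if "b \<in> B - lowB" for b
      using that A2(2) fl few by (intro deg) (auto simp: lowB_def not_less)
  qed (use A2 B2 in auto)
  moreover have "card A \<le> card (A - lowA) + m" "card B \<le> card (B - lowB) + m" "h \<le> card (A2 - lowA) + m"
    using diff_card_le_card_Diff[OF fl(1), of A] diff_card_le_card_Diff[OF fl(2), of B]
      diff_card_le_card_Diff[OF fl(1), of A2] few A2 by linarith+
  moreover have "card (A2 - lowA) \<le> h" "card (B2 - lowB) \<le> h" using A2 B2 f2 by (metis card_mono Diff_subset)+
  ultimately show thesis using A2 B2 by (intro that[of "A - lowA" "B - lowB" "A2 - lowA" "B2 - lowB"]) auto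
qed

section \<open>Menger's theorem\<close>

definition separation :: "'a set \<Rightarrow> 'a rel \<Rightarrow> 'a set \<Rightarrow> 'a set \<Rightarrow> bool" where
  "separation V E P Q \<longleftrightarrow> P \<union> Q = V \<and> E \<inter> (P - Q) \<times> (Q - P) = {}"

lemma separation_swap: "sym E \<Longrightarrow> separation V E P Q \<Longrightarrow> separation V E Q P"
  by (auto simp: separation_def dest: symD)

lemma finite_separation:
  assumes "separation V E P Q" "finite V"
  shows "finite P" "finite Q"
  using assms by (auto simp: separation_def)

lemma separation_extend_right:
  assumes "separation V E A B" "separation A E' P Q" "A \<inter> B \<subseteq> Q" "Restr E A \<subseteq> E' \<union> Q \<times> Q"
  shows "separation V E P (Q \<union> B)" "P \<inter> (Q \<union> B) = P \<inter> Q"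
proof -
  have AB: "A \<union> B = V" "E \<inter> (A - B) \<times> (B - A) = {}" and PQ: "P \<union> Q = A" "E' \<inter> (P - Q) \<times> (Q - P) = {}"
    using assms(1,2) by (auto simp: separation_def)
  show "P \<inter> (Q \<union> B) = P \<inter> Q" using assms(3) PQ(1) by blast
  have "(u, v) \<notin> E" if "u \<in> P - (Q \<union> B)" "v \<in> (Q \<union> B) - P" for u v
  proof
    assume e: "(u, v) \<in> E"
    hence "v \<in> A" using AB(2) PQ(1) that by blast
    hence "(u, v) \<in> E'" using assms(4) PQ(1) that e by blast
    thus False using PQ that \<open>v \<in> A\<close> by blast
  qed
  thus "separation V E P (Q \<union> B)" unfolding separation_def using AB(1) PQ(1) by blast
qed

lemma separation_extend_left:
  assumes "separation V E A B" "separation B E' P Q" "A \<inter> B \<subseteq> P" "Restr E B \<subseteq> E' \<union> P \<times> P"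
  shows "separation V E (A \<union> P) Q" "(A \<union> P) \<inter> Q = P \<inter> Q" "Q - (A \<union> P) = Q - P"
proof -
  have AB: "A \<union> B = V" "E \<inter> (A - B) \<times> (B - A) = {}" and PQ: "P \<union> Q = B" "E' \<inter> (P - Q) \<times> (Q - P) = {}"
    using assms(1,2) by (auto simp: separation_def)
  show "(A \<union> P) \<inter> Q = P \<inter> Q" "Q - (A \<union> P) = Q - P" using assms(3) PQ(1) by blast+
  have "(u, v) \<notin> E" if "u \<in> (A \<union> P) - Q" "v \<in> Q - (A \<union> P)" for u v
  proof
    assume e: "(u, v) \<in> E"
    hence "u \<in> B" using AB(2) PQ(1) that by blast
    hence "(u, v) \<in> E'" using assms(4) PQ(1) that e by blast
    thus False using PQ that \<open>u \<in> B\<close> by blast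
  qed
  thus "separation V E (A \<union> P) Q" unfolding separation_def using AB(1) PQ(1) by blast
qed

text \<open>
  A linkage is a family of disjoint connected sets meeting both sides instead of a family of
  paths; \<open>linkage_trim\<close> recovers the end vertices.
\<close>

definition linkage :: "'a set \<Rightarrow> 'a rel \<Rightarrow> 'a set \<Rightarrow> 'a set \<Rightarrow> nat \<Rightarrow> bool" where
  "linkage V E A B k \<longleftrightarrow> (\<exists>C :: nat \<Rightarrow> 'a set. disjoint_family_on C {..<k} \<and>
     (\<forall>i<k. C i \<subseteq> V \<and> connected_in E (C i) \<and> C i \<inter> A \<noteq> {} \<and> C i \<inter> B \<noteq> {}))"

lemma linkageE:
  assumes "linkage V E A B k"
  obtains C where "disjoint_family_on C {..<k}"
    "\<And>i. i < k \<Longrightarrow> C i \<subseteq> V \<and> connected_in E (C i) \<and> C i \<inter> A \<noteq> {} \<and> C i \<inter> B \<noteq> {}"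
proof -
  obtain C where "disjoint_family_on C {..<k} \<and>
      (\<forall>i<k. C i \<subseteq> V \<and> connected_in E (C i) \<and> C i \<inter> A \<noteq> {} \<and> C i \<inter> B \<noteq> {})"
    using assms unfolding linkage_def ..
  thus thesis by (intro that[of C]) simp_all
qed

lemma linkage_trim:
  assumes "linkage V E A B k" "sym E" "finite V"
  obtains C a b where "\<And>i. i < k \<Longrightarrow> C i \<subseteq> V \<and> connected_in E (C i) \<and> C i \<inter> A = {a i} \<and> C i \<inter> B = {b i}"
    "disjoint_family_on C {..<k}" "inj_on a {..<k}" "inj_on b {..<k}"
proof -
  obtain D where D: "disjoint_family_on D {..<k}"
    "\<And>i. i < k \<Longrightarrow> D i \<subseteq> V \<and> connected_in E (D i) \<and> D i \<inter> A \<noteq> {} \<and> D i \<inter> B \<noteq> {}"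
    by (rule linkageE[OF assms(1)]) blast
  have "\<exists>C a b. C \<subseteq> D i \<and> connected_in E C \<and> C \<inter> A = {a} \<and> C \<inter> B = {b}" if "i < k" for i
    using connected_in_trim[OF assms(2), of "D i" A B] D(2)[OF that] finite_subset[OF _ assms(3)] by blast
  then obtain C a b where C: "\<And>i. i < k \<Longrightarrow> C i \<subseteq> D i \<and> connected_in E (C i) \<and> C i \<inter> A = {a i} \<and> C i \<inter> B = {b i}"
    by metis
  have "C i \<inter> C j = {}" if "i < k" "j < k" "i \<noteq> j" for i j
    using C[OF that(1)] C[OF that(2)] disjoint_family_onD[OF D(1), of i j] that by auto
  hence disj: "disjoint_family_on C {..<k}" by (auto simp: disjoint_family_on_def)
  have "a i \<in> C i" "b i \<in> C i" if "i < k" for i using C[OF that] by blast+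
  hence "inj_on a {..<k}" "inj_on b {..<k}"
    unfolding inj_on_def using disjoint_family_onD[OF disj] by (metis IntI empty_iff lessThan_iff)+
  thus thesis using that[of C a b] C D(2) disj by (metis order_trans)
qed

lemma linkage_of_common_vertices:
  assumes "k \<le> card (A \<inter> B)" "A \<subseteq> V"
  shows "linkage V E A B k"
proof -
  obtain S where S: "S \<subseteq> A \<inter> B" "card S = k" "finite S" using assms(1) by (rule obtain_subset_with_card_n)
  then obtain g where g: "bij_betw g {..<k} S" by (metis atLeast0LessThan ex_bij_betw_nat_finite)
  have "g i \<in> S" if "i < k" for i using g that by (auto simp: bij_betw_def)
  moreover have "disjoint_family_on (\<lambda>i. {g i}) {..<k}"
    using g by (auto simp: disjoint_family_on_def bij_betw_def inj_on_def)
  ultimately show ?thesis unfolding linkage_def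
    using S(1) assms(2) connected_in_singleton[of E] by (intro exI[of _ "\<lambda>i. {g i}"]) auto
qed

lemma linkage_compose:
  assumes sep: "separation V E P Q" and "card (P \<inter> Q) = k" "sym E" "finite V"
    and L1: "linkage P (Restr E' P) A (P \<inter> Q) k" and L2: "linkage Q (Restr E' Q) (P \<inter> Q) B k"
    and E': "sym E'" "E' \<subseteq> E"
  shows "linkage V E A B k"
proof -
  let ?X = "P \<inter> Q"
  have PQ: "P \<union> Q = V" and fin: "finite P" "finite Q" "finite ?X"
    using sep finite_separation[OF sep assms(4)] by (auto simp: separation_def)
  obtain C a b where C: "\<And>i. i < k \<Longrightarrow> C i \<subseteq> P \<and> connected_in (Restr E' P) (C i) \<and> C i \<inter> A = {a i} \<and> C i \<inter> ?X = {b i}"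
    "disjoint_family_on C {..<k}" "inj_on b {..<k}"
    using linkage_trim[OF L1 sym_Restr[OF E'(1)] fin(1)] by metis
  obtain D c e where D: "\<And>i. i < k \<Longrightarrow> D i \<subseteq> Q \<and> connected_in (Restr E' Q) (D i) \<and> D i \<inter> ?X = {c i} \<and> D i \<inter> B = {e i}"
    "disjoint_family_on D {..<k}" "inj_on c {..<k}"
    using linkage_trim[OF L2 sym_Restr[OF E'(1)] fin(2)] by metis
  have "c ` {..<k} = ?X" using D(1,3) assms(2) fin by (intro card_subset_eq) (auto simp: card_image)
  moreover have "b i \<in> ?X" if "i < k" for i using C(1)[OF that] by blast
  ultimately have "\<forall>i. \<exists>j. i < k \<longrightarrow> j < k \<and> c j = b i" by (metis imageE lessThan_iff)
  then obtain \<sigma> where \<sigma>: "\<And>i. i < k \<Longrightarrow> \<sigma> i < k \<and> c (\<sigma> i) = b i" by metis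
  have \<sigma>_inj: "\<sigma> i \<noteq> \<sigma> j" if "i < k" "j < k" "i \<noteq> j" for i j
    using \<sigma>[OF that(1)] \<sigma>[OF that(2)] C(3) that by (metis inj_onD lessThan_iff)
  let ?F = "\<lambda>i. C i \<union> D (\<sigma> i)"
  have "?F i \<subseteq> V \<and> connected_in E (?F i) \<and> ?F i \<inter> A \<noteq> {} \<and> ?F i \<inter> B \<noteq> {}" if i: "i < k" for i
  proof -
    note Ci = C(1)[OF i] and Di = D(1)[OF conjunct1[OF \<sigma>[OF i]]]
    have "connected_in E (C i)" "connected_in E (D (\<sigma> i))"
      using Ci Di E'(2) by (auto intro: connected_in_mono)
    moreover have "b i \<in> C i" "c (\<sigma> i) \<in> D (\<sigma> i)" using Ci Di by blast+
    ultimately have "connected_in E (?F i)" using connected_in_Un_Int[OF assms(3)] \<sigma>[OF i] by auto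
    thus ?thesis using Ci Di PQ by blast
  qed
  moreover have "?F i \<inter> ?F j = {}" if ij: "i < k" "j < k" "i \<noteq> j" for i j
  proof -
    have cross: "C i \<inter> D (\<sigma> j) = {}" if "i < k" "j < k" "i \<noteq> j" for i j
    proof -
      note Ci = C(1)[OF that(1)] and Dj = D(1)[OF conjunct1[OF \<sigma>[OF that(2)]]]
      have "C i \<inter> D (\<sigma> j) \<subseteq> (C i \<inter> ?X) \<inter> (D (\<sigma> j) \<inter> ?X)" using Ci Dj by auto
      also have "\<dots> = {b i} \<inter> {b j}" using Ci Dj \<sigma>[OF that(2)] by simp
      also have "\<dots> = {}" using C(3) that by (auto simp: inj_on_def)
      finally show ?thesis by auto
    qed
    have "D (\<sigma> i) \<inter> D (\<sigma> j) = {}" "C i \<inter> C j = {}"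
      using disjoint_family_onD[OF D(2)] disjoint_family_onD[OF C(2)] \<sigma>[OF ij(1)] \<sigma>[OF ij(2)] \<sigma>_inj[OF ij] ij
      by auto
    thus ?thesis using cross[OF ij] cross[of j i] ij by blast
  qed
  ultimately show ?thesis unfolding linkage_def disjoint_family_on_def by (intro exI[of _ ?F]) auto
qed

definition contract :: "'a \<Rightarrow> 'a \<Rightarrow> 'a \<Rightarrow> 'a" where
  "contract x y z = (if z = y then x else z)"

definition contract_edges :: "'a \<Rightarrow> 'a \<Rightarrow> 'a rel \<Rightarrow> 'a rel" where
  "contract_edges x y E = map_prod (contract x y) (contract x y) ` E - Id"

lemma contract_edges_iff:
  "(l, l') \<in> contract_edges x y E \<longleftrightarrow> l \<noteq> l' \<and> (\<exists>a b. (a, b) \<in> E \<and> contract x y a = l \<and> contract x y b = l')"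
  unfolding contract_edges_def by force

lemma simple_graph_contract:
  assumes "simple_graph V E" "x \<in> V" "x \<noteq> y"
  shows "simple_graph (V - {y}) (contract_edges x y E)"
  unfolding simple_graph_def
proof (intro conjI)
  note V = simple_graphD[OF assms(1)]
  show "sym (contract_edges x y E)" using V(3) unfolding sym_def contract_edges_iff by metis
  show "contract_edges x y E \<subseteq> (V - {y}) \<times> (V - {y})"
    using V(5) assms(2,3) unfolding contract_edges_def contract_def by (auto split: if_splits)
qed (use simple_graphD(1)[OF assms(1)] in \<open>auto simp: irrefl_def contract_edges_def\<close>)

lemma card_contract_edges:
  assumes "finite E" "(x, y) \<in> E"
  shows "card (contract_edges x y E) < card E"
proof -
  have "contract_edges x y E \<subseteq> map_prod (contract x y) (contract x y) ` (E - {(x, y)})"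
    unfolding contract_edges_def contract_def by auto
  hence "card (contract_edges x y E) \<le> card (E - {(x, y)})"
    using assms by (meson card_image_le card_mono finite_Diff finite_imageI order_trans)
  also have "\<dots> < card E" using assms by (meson card_Diff1_less)
  finally show ?thesis .
qed

definition uncontract :: "'a set \<Rightarrow> 'a \<Rightarrow> 'a \<Rightarrow> 'a set \<Rightarrow> 'a set" where
  "uncontract V x y C = {z \<in> V. contract x y z \<in> C}"

lemma mem_uncontract: "z \<in> uncontract V x y C \<longleftrightarrow> z \<in> V \<and> (if z = y then x \<in> C else z \<in> C)"
  by (auto simp: uncontract_def contract_def)

lemma uncontract_Int: "uncontract V x y A \<inter> uncontract V x y B = uncontract V x y (A \<inter> B)"
  by (auto simp: uncontract_def)

lemma uncontract_Diff: "uncontract V x y A - uncontract V x y B = uncontract V x y (A - B)"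
  by (auto simp: uncontract_def)

lemma uncontract_eq:
  assumes "C \<subseteq> V - {y}" "y \<in> V"
  shows "uncontract V x y C = (if x \<in> C then insert y C else C)"
  using assms by (auto simp: mem_uncontract split: if_splits)

lemma connected_in_uncontract:
  assumes "sym E" "(x, y) \<in> E" "x \<in> V" "y \<in> V" "connected_in (contract_edges x y E) C" "C \<subseteq> V - {y}"
  shows "connected_in E (uncontract V x y C)"
proof -
  let ?W = "\<lambda>l. if l = x then {x, y} else {l}"
  have "connected_in E (\<Union>l\<in>C. ?W l)"
  proof (rule connected_in_UN[OF assms(1,5)])
    show "connected_in E (?W l)" for l
      using connected_in_edge[OF assms(1,2)] connected_in_singleton[of E l] by auto
    fix l l' assume "(l, l') \<in> contract_edges x y E"
    then obtain a b where "(a, b) \<in> E" "contract x y a = l" "contract x y b = l'" unfolding contract_edges_iff by auto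
    hence "a \<in> ?W l" "b \<in> ?W l'" "(a, b) \<in> E" by (auto simp: contract_def split: if_splits)
    thus "\<exists>u\<in>?W l. \<exists>v\<in>?W l'. (u, v) \<in> E" by blast
  qed
  moreover have "z \<in> (\<Union>l\<in>C. ?W l) \<longleftrightarrow> z \<in> uncontract V x y C" for z
  proof -
    have "z \<in> (\<Union>l\<in>C. ?W l) \<longleftrightarrow> z \<in> C \<or> z = y \<and> x \<in> C" by (auto split: if_splits)
    thus ?thesis using assms(3,4,6) by (auto simp: mem_uncontract)
  qed
  hence "(\<Union>l\<in>C. ?W l) = uncontract V x y C" by blast
  ultimately show ?thesis by simp
qed

lemma separation_uncontract:
  assumes "separation (V - {y}) (contract_edges x y E) P Q" "x \<in> V" "x \<noteq> y"
  shows "separation V E (uncontract V x y P) (uncontract V x y Q)"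
  unfolding separation_def
proof (intro conjI equals0I)
  have PQ: "P \<union> Q = V - {y}" "contract_edges x y E \<inter> (P - Q) \<times> (Q - P) = {}"
    using assms(1) by (auto simp: separation_def)
  have "contract x y z \<in> P \<union> Q" if "z \<in> V" for z using that PQ(1) assms(2,3) by (simp add: contract_def)
  thus "uncontract V x y P \<union> uncontract V x y Q = V" by (auto simp: uncontract_def)
  fix e assume "e \<in> E \<inter> (uncontract V x y P - uncontract V x y Q) \<times> (uncontract V x y Q - uncontract V x y P)"
  then obtain a b where e: "(a, b) \<in> E" "contract x y a \<in> P - Q" "contract x y b \<in> Q - P"
    by (auto simp: uncontract_def)
  hence "(contract x y a, contract x y b) \<in> contract_edges x y E" unfolding contract_edges_iff by (metis DiffE)
  thus False using PQ(2) e by blast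
qed

lemma linkage_uncontract:
  assumes G: "simple_graph V E" and xy: "(x, y) \<in> E" and AB: "A \<subseteq> V" "B \<subseteq> V"
    and L: "linkage (V - {y}) (contract_edges x y E) (contract x y ` A) (contract x y ` B) k"
  shows "linkage V E A B k"
proof -
  note V = simple_graphD[OF G]
  have xyV: "x \<in> V" "y \<in> V" using V(5) xy by auto
  obtain C where C: "disjoint_family_on C {..<k}"
    "\<And>i. i < k \<Longrightarrow> C i \<subseteq> V - {y} \<and> connected_in (contract_edges x y E) (C i) \<and>
      C i \<inter> contract x y ` A \<noteq> {} \<and> C i \<inter> contract x y ` B \<noteq> {}"
    by (rule linkageE[OF L]) (rule that, simp_all)
  let ?C = "\<lambda>i. uncontract V x y (C i)"
  have "connected_in E (?C i)" if "i < k" for i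
    using connected_in_uncontract[OF V(3) xy xyV] C(2)[OF that] by blast
  moreover have "?C i \<inter> A \<noteq> {}" "?C i \<inter> B \<noteq> {}" if "i < k" for i
    using C(2)[OF that] AB unfolding uncontract_def by blast+
  moreover have "disjoint_family_on ?C {..<k}"
    using C(1) unfolding disjoint_family_on_def uncontract_def by blast
  moreover have "?C i \<subseteq> V" for i by (auto simp: uncontract_def)
  ultimately show ?thesis unfolding linkage_def by (intro exI[of _ ?C]) blast
qed

lemma tight_separation_of_contracted:
  assumes G: "simple_graph V E" and xy: "(x, y) \<in> E" and AB: "A \<subseteq> V" "B \<subseteq> V"
    and sep: "separation (V - {y}) (contract_edges x y E) P' Q'" "contract x y ` A \<subseteq> P'" "contract x y ` B \<subseteq> Q'"
      "card (P' \<inter> Q') < k"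
    and large: "\<And>P Q. separation V E P Q \<Longrightarrow> A \<subseteq> P \<Longrightarrow> B \<subseteq> Q \<Longrightarrow> k \<le> card (P \<inter> Q)"
  obtains P Q where "separation V E P Q" "A \<subseteq> P" "B \<subseteq> Q" "x \<in> P \<inter> Q" "y \<in> P \<inter> Q" "card (P \<inter> Q) = k"
proof -
  note V = simple_graphD[OF G]
  have xyV: "x \<in> V" "y \<in> V" "x \<noteq> y" using V xy by (auto simp: irrefl_def)
  define P where "P = uncontract V x y P'"
  define Q where "Q = uncontract V x y Q'"
  have sepPQ: "separation V E P Q" unfolding P_def Q_def by (rule separation_uncontract[OF sep(1) xyV(1,3)])
  have sub: "A \<subseteq> P" "B \<subseteq> Q" using sep(2,3) AB by (auto simp: P_def Q_def uncontract_def)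
  have fPQ: "finite (P' \<inter> Q')" using finite_separation[OF sep(1)] V(1) by simp
  have k: "k \<le> card (P \<inter> Q)" by (rule large[OF sepPQ sub])
  have x: "x \<in> P' \<inter> Q'"
  proof (rule ccontr)
    assume "x \<notin> P' \<inter> Q'"
    hence "P \<inter> Q \<subseteq> P' \<inter> Q'" by (auto simp: P_def Q_def mem_uncontract split: if_splits)
    hence "card (P \<inter> Q) \<le> card (P' \<inter> Q')" using fPQ by (rule card_mono[rotated])
    thus False using k sep(4) by simp
  qed
  have "P \<inter> Q \<subseteq> insert y (P' \<inter> Q')" by (auto simp: P_def Q_def mem_uncontract split: if_splits)
  hence "card (P \<inter> Q) \<le> card (insert y (P' \<inter> Q'))" using fPQ by (intro card_mono) auto
  hence "card (P \<inter> Q) \<le> Suc (card (P' \<inter> Q'))" using fPQ by (auto simp: card_insert_if split: if_splits)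
  hence "card (P \<inter> Q) = k" using k sep(4) by simp
  moreover have "x \<in> P \<inter> Q" "y \<in> P \<inter> Q" using x xyV by (auto simp: P_def Q_def mem_uncontract)
  ultimately show thesis using that sepPQ sub by blast
qed

theorem menger:
  assumes "simple_graph V E" "A \<subseteq> V" "B \<subseteq> V"
    and "\<And>P Q. separation V E P Q \<Longrightarrow> A \<subseteq> P \<Longrightarrow> B \<subseteq> Q \<Longrightarrow> k \<le> card (P \<inter> Q)"
  shows "linkage V E A B k"
  using assms
proof (induction "card E" arbitrary: V E A B rule: less_induct)
  case less
  note V = simple_graphD[OF less.prems(1)] and AB = less.prems(2,3) and large = less.prems(4)
  show ?case
  proof (cases "E = {}")
    case True
    have "separation V E A (B \<union> (V - A))" unfolding separation_def True using AB by auto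
    moreover have "A \<inter> (B \<union> (V - A)) = A \<inter> B" by auto
    ultimately have "k \<le> card (A \<inter> B)" using large[of A "B \<union> (V - A)"] by auto
    thus ?thesis using AB(1) by (rule linkage_of_common_vertices)
  next
    case False
    then obtain x y where xy: "(x, y) \<in> E" by auto
    have xyV: "x \<in> V" "y \<in> V" "x \<noteq> y" using V xy by (auto simp: irrefl_def)
    let ?V = "V - {y}" and ?E = "contract_edges x y E" and ?A = "contract x y ` A" and ?B = "contract x y ` B"
    have sub: "?A \<subseteq> ?V" "?B \<subseteq> ?V" using AB xyV by (auto simp: contract_def)
    note IH = less.hyps[OF card_contract_edges[OF V(2) xy] simple_graph_contract[OF less.prems(1) xyV(1,3)] sub]
    show ?thesis
    proof (cases "\<forall>P Q. separation ?V ?E P Q \<longrightarrow> ?A \<subseteq> P \<longrightarrow> ?B \<subseteq> Q \<longrightarrow> k \<le> card (P \<inter> Q)")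
      case True
      thus ?thesis using linkage_uncontract[OF less.prems(1) xy AB IH] by blast
    next
      case False
      then obtain P' Q' where "separation ?V ?E P' Q'" "?A \<subseteq> P'" "?B \<subseteq> Q'" "card (P' \<inter> Q') < k"
        by (auto simp: not_le)
      from tight_separation_of_contracted[OF less.prems(1) xy AB this large] obtain P Q
        where sep: "separation V E P Q" and sub: "A \<subseteq> P" "B \<subseteq> Q"
          and X: "x \<in> P \<inter> Q" "y \<in> P \<inter> Q" "card (P \<inter> Q) = k" by blast
      have PQ: "P \<subseteq> V" "Q \<subseteq> V" using sep by (auto simp: separation_def)
      let ?E' = "E - {(x, y), (y, x)}"
      have E': "simple_graph V ?E'" using less.prems(1) by (auto simp: simple_graph_def sym_def irrefl_def)
      have smaller: "card (Restr ?E' S) < card E" for S using xy V(2) by (intro psubset_card_mono) auto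
      have "linkage P (Restr ?E' P) A (P \<inter> Q) k"
      proof (rule less.hyps[OF smaller simple_graph_Restr[OF E' PQ(1)] sub(1)])
        fix P1 P2 assume s: "separation P (Restr ?E' P) P1 P2" "A \<subseteq> P1" "P \<inter> Q \<subseteq> P2"
        have "Restr E P \<subseteq> Restr ?E' P \<union> P2 \<times> P2" using X s(3) by auto
        from separation_extend_right[OF sep s(1,3) this] show "k \<le> card (P1 \<inter> P2)"
          using large[of P1 "P2 \<union> Q"] s(2) sub(2) by auto
      qed auto
      moreover have "linkage Q (Restr ?E' Q) (P \<inter> Q) B k"
      proof (rule less.hyps[OF smaller simple_graph_Restr[OF E' PQ(2)] _ sub(2)])
        fix P1 P2 assume s: "separation Q (Restr ?E' Q) P1 P2" "P \<inter> Q \<subseteq> P1" "B \<subseteq> P2"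
        have "Restr E Q \<subseteq> Restr ?E' Q \<union> P1 \<times> P1" using X s(2) by auto
        from separation_extend_left[OF sep s(1,2) this] show "k \<le> card (P1 \<inter> P2)"
          using large[of "P \<union> P1" P2] s(3) sub(1) by auto
      qed auto
      ultimately show ?thesis
        by (rule linkage_compose[OF sep X(3) V(3,1) _ _ simple_graphD(3)[OF E']]) auto
    qed
  qed
qed

corollary menger_paths:
  assumes G: "simple_graph V E" and "X \<subseteq> V" "B \<subseteq> V"
    and "\<And>P Q. separation V E P Q \<Longrightarrow> X \<subseteq> P \<Longrightarrow> B \<subseteq> Q \<Longrightarrow> card X \<le> card (P \<inter> Q)"
  obtains C g where "\<And>x. x \<in> X \<Longrightarrow> C x \<subseteq> V \<and> connected_in E (C x) \<and> C x \<inter> X = {x} \<and> C x \<inter> B = {g x}"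
    "disjoint_family_on C X"
proof -
  note V = simple_graphD[OF G]
  let ?k = "card X"
  obtain C a b where C: "\<And>i. i < ?k \<Longrightarrow> C i \<subseteq> V \<and> connected_in E (C i) \<and> C i \<inter> X = {a i} \<and> C i \<inter> B = {b i}"
    "disjoint_family_on C {..<?k}" "inj_on a {..<?k}"
    by (rule linkage_trim[OF menger[OF G assms(2,3), of ?k] V(3,1)]) (use assms(4) in auto)
  have "finite X" using V(1) assms(2) finite_subset by auto
  hence "a ` {..<?k} = X" using C(1,3) by (intro card_subset_eq) (auto simp: card_image)
  hence "\<forall>x. \<exists>i. x \<in> X \<longrightarrow> i < ?k \<and> a i = x" by (metis imageE lessThan_iff)
  then obtain \<sigma> where \<sigma>: "\<And>x. x \<in> X \<Longrightarrow> \<sigma> x < ?k \<and> a (\<sigma> x) = x" by metis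
  have "disjoint_family_on (C \<circ> \<sigma>) X"
    using \<sigma> disjoint_family_onD[OF C(2)] by (simp add: disjoint_family_on_def) (metis lessThan_iff)
  thus thesis using that[of "C \<circ> \<sigma>" "b \<circ> \<sigma>"] C(1) \<sigma> by (metis comp_apply)
qed

section \<open>Linked sets\<close>

definition pairing :: "'a rel \<Rightarrow> 'a set \<Rightarrow> bool" where
  "pairing Q X \<longleftrightarrow> Q \<subseteq> X \<times> X \<and> (\<forall>p\<in>Q. fst p \<noteq> snd p) \<and> disjoint_family_on (\<lambda>p. {fst p, snd p}) Q"

lemma pairingD:
  assumes "pairing Q X" "p \<in> Q"
  shows "fst p \<in> X" "snd p \<in> X" "fst p \<noteq> snd p" "q \<in> Q \<Longrightarrow> p \<noteq> q \<Longrightarrow> {fst p, snd p} \<inter> {fst q, snd q} = {}"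
  using assms by (auto simp: pairing_def mem_Times_iff disjoint_family_on_def)

lemma pairing_subset:
  assumes "pairing Q X" "Q' \<subseteq> Q" "fst ` Q' \<union> snd ` Q' \<subseteq> X'"
  shows "pairing Q' X'"
  using assms by (auto simp: pairing_def intro: disjoint_family_on_mono rev_image_eqI)

lemma pairing_image:
  assumes "pairing Q X" "inj_on g X" "g ` X \<subseteq> Z"
  shows "pairing (map_prod g g ` Q) Z"
  unfolding pairing_def disjoint_family_on_def
proof (intro conjI ballI impI)
  show "map_prod g g ` Q \<subseteq> Z \<times> Z" using assms by (auto simp: pairing_def)
  fix p assume "p \<in> map_prod g g ` Q"
  then obtain p' where p': "p' \<in> Q" "p = map_prod g g p'" by auto
  note P = pairingD[OF assms(1) p'(1)]
  show "fst p \<noteq> snd p" using P(1-3) p'(2) inj_onD[OF assms(2)] by auto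
  fix q assume "q \<in> map_prod g g ` Q" and ne: "p \<noteq> q"
  then obtain q' where q': "q' \<in> Q" "q = map_prod g g q'" by auto
  hence "{fst p', snd p'} \<inter> {fst q', snd q'} = {}" using P(4)[of q'] p'(2) ne by auto
  thus "{fst p, snd p} \<inter> {fst q, snd q} = {}"
    using P(1,2) pairingD(1,2)[OF assms(1) q'(1)] p'(2) q'(2) inj_onD[OF assms(2)] by auto
qed

lemma pairing_inj:
  assumes "pairing Q X"
  shows "inj_on fst Q" "inj_on snd Q" "fst ` Q \<inter> snd ` Q = {}"
proof -
  have eq: "p = q" if "p \<in> Q" "q \<in> Q" "{fst p, snd p} \<inter> {fst q, snd q} \<noteq> {}" for p q
    using pairingD(4)[OF assms that(1,2)] that(3) by blast
  show "inj_on fst Q" "inj_on snd Q" by (intro inj_onI eq; auto)+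
  show "fst ` Q \<inter> snd ` Q = {}"
  proof (rule equals0I)
    fix x assume "x \<in> fst ` Q \<inter> snd ` Q"
    then obtain p q where "p \<in> Q" "q \<in> Q" "x = fst p" "x = snd q" by blast
    moreover from this have "p = q" by (intro eq) auto
    ultimately show False using pairingD(3)[OF assms, of p] by simp
  qed
qed

lemma pairing_choice:
  assumes "pairing Q X" "\<And>p. p \<in> Q \<Longrightarrow> \<exists>S T. R p S T"
  obtains P where "\<And>p. p \<in> Q \<Longrightarrow> R p (P (fst p)) (P (snd p))" "\<And>x. x \<notin> fst ` Q \<union> snd ` Q \<Longrightarrow> P x = f x"
proof -
  obtain S T where ST: "\<And>p. p \<in> Q \<Longrightarrow> R p (S p) (T p)" using assms(2) by metis
  define P where "P x = (if x \<in> fst ` Q then S (inv_into Q fst x)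
    else if x \<in> snd ` Q then T (inv_into Q snd x) else f x)" for x
  note inj = pairing_inj[OF assms(1)]
  have "P (fst p) = S p" "P (snd p) = T p" if "p \<in> Q" for p
    using that inj by (auto simp: P_def)
  thus thesis using that[of P] ST by (simp add: P_def)
qed

definition rooted_model :: "'a set \<Rightarrow> 'a rel \<Rightarrow> 'a set \<Rightarrow> 'a rel \<Rightarrow> ('a \<Rightarrow> 'a set) \<Rightarrow> bool" where
  "rooted_model V E X Q C \<longleftrightarrow> (\<forall>x\<in>X. x \<in> C x \<and> C x \<subseteq> V \<and> connected_in E (C x)) \<and>
     disjoint_family_on C X \<and> (\<forall>p\<in>Q. \<exists>u\<in>C (fst p). \<exists>v\<in>C (snd p). (u, v) \<in> E)"

lemma rooted_modelD:
  assumes "rooted_model V E X Q C"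
  shows "x \<in> X \<Longrightarrow> x \<in> C x" "x \<in> X \<Longrightarrow> C x \<subseteq> V" "x \<in> X \<Longrightarrow> connected_in E (C x)"
    "disjoint_family_on C X" "x \<in> X \<Longrightarrow> y \<in> X \<Longrightarrow> x \<noteq> y \<Longrightarrow> C x \<inter> C y = {}"
    "p \<in> Q \<Longrightarrow> \<exists>u\<in>C (fst p). \<exists>v\<in>C (snd p). (u, v) \<in> E"
  using assms unfolding rooted_model_def by (auto dest: disjoint_family_onD)

definition linked :: "'a set \<Rightarrow> 'a rel \<Rightarrow> 'a set \<Rightarrow> bool" where
  "linked V E X \<longleftrightarrow> (\<forall>Q. pairing Q X \<longrightarrow> (\<exists>C. rooted_model V E X Q C))"

lemma linkedD:
  assumes "linked V E X" "pairing Q X"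
  obtains C where "rooted_model V E X Q C"
  using assms unfolding linked_def by blast

lemma linked_mono:
  assumes "linked V E X" "V \<subseteq> V'" "E \<subseteq> E'"
  shows "linked V' E' X"
  unfolding linked_def
proof (intro allI impI)
  fix Q assume "pairing Q X"
  with assms(1) obtain C where C: "rooted_model V E X Q C" by (rule linkedD)
  have "connected_in E' (C x)" if "x \<in> X" for x
    using rooted_modelD(3)[OF C that] connected_in_mono assms(3) by blast
  hence "rooted_model V' E' X Q C" unfolding rooted_model_def
    using rooted_modelD[OF C] assms(2,3) by (meson order_trans subsetD)
  thus "\<exists>C. rooted_model V' E' X Q C" by blast
qed

lemma linked_subset:
  assumes "linked V E X" "Y \<subseteq> X"
  shows "linked V E Y"
  unfolding linked_def
proof (intro allI impI)
  fix Q assume "pairing Q Y"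
  hence "pairing Q X" using assms(2) by (auto simp: pairing_def)
  with assms(1) obtain C where C: "rooted_model V E X Q C" by (rule linkedD)
  have "rooted_model V E Y Q C" unfolding rooted_model_def
    using rooted_modelD[OF C] disjoint_family_on_mono[OF assms(2)] assms(2) by (meson subsetD)
  thus "\<exists>C. rooted_model V E Y Q C" by blast
qed

text \<open>
  The pairs that \<open>P\<close> does not join already are joined inside the linked part, where \<open>P\<close> enters \<open>Z\<close>
  in exactly one vertex.
\<close>

lemma rooted_model_glue:
  assumes E: "sym E" and L: "linked V2 E2 Z" "E2 \<subseteq> E" "V2 \<subseteq> V" and Q: "pairing Q X"
    and P: "\<And>x. x \<in> X \<Longrightarrow> x \<in> P x \<and> P x \<subseteq> V \<and> connected_in E (P x) \<and> P x \<inter> V2 \<subseteq> Z" "disjoint_family_on P X"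
    and joined: "\<And>p. p \<in> Q \<Longrightarrow> (\<exists>u\<in>P (fst p). \<exists>v\<in>P (snd p). (u, v) \<in> E) \<or>
      (\<exists>z z'. P (fst p) \<inter> Z = {z} \<and> P (snd p) \<inter> Z = {z'})"
  shows "\<exists>C. rooted_model V E X Q C"
proof -
  define Q' where "Q' = {p \<in> Q. \<not> (\<exists>u\<in>P (fst p). \<exists>v\<in>P (snd p). (u, v) \<in> E)}"
  define Y where "Y = fst ` Q' \<union> snd ` Q'"
  define entry where "entry x = the_elem (P x \<inter> Z)" for x
  have YX: "Y \<subseteq> X" using pairingD(1,2)[OF Q] by (auto simp: Y_def Q'_def)
  have entry: "P y \<inter> Z = {entry y}" if y: "y \<in> Y" for y
  proof -
    obtain p where "p \<in> Q'" "y = fst p \<or> y = snd p" using y unfolding Y_def by blast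
    then obtain z where "P y \<inter> Z = {z}" using joined[of p] by (auto simp: Q'_def)
    thus ?thesis by (simp add: entry_def)
  qed
  hence entryP: "entry y \<in> P y" "entry y \<in> Z" if "y \<in> Y" for y using that by blast+
  have disj: "P x \<inter> P y = {}" if "x \<in> X" "y \<in> X" "x \<noteq> y" for x y by (rule disjoint_family_onD[OF P(2) that])
  have inj: "inj_on entry Y"
    using disj YX entryP(1) by (intro inj_onI) (metis IntI empty_iff subsetD)
  have "pairing Q' Y" by (rule pairing_subset[OF Q]) (auto simp: Q'_def Y_def)
  hence "pairing (map_prod entry entry ` Q') Z" using inj entryP(2) by (intro pairing_image) auto
  with L(1) obtain C where C: "rooted_model V2 E2 Z (map_prod entry entry ` Q') C" by (rule linkedD)
  define M where "M x = (if x \<in> Y then C (entry x) else {})" for x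
  have M: "M x \<subseteq> V2" for x using rooted_modelD(2)[OF C entryP(2)] by (auto simp: M_def)
  have "P x \<inter> M y = {}" if "x \<in> X" "y \<in> X" "x \<noteq> y" for x y
  proof (rule equals0I)
    fix w assume w: "w \<in> P x \<inter> M y"
    hence y: "y \<in> Y" "w \<in> C (entry y)" by (auto simp: M_def split: if_splits)
    have "w \<in> Z" using w M[of y] P(1)[OF that(1)] by auto
    hence "w = entry y"
      using rooted_modelD(5)[OF C _ entryP(2)[OF y(1)], of w] rooted_modelD(1)[OF C, of w] y(2) by auto
    thus False using entryP(1)[OF y(1)] w disj[OF that] by auto
  qed
  moreover have "M x \<inter> M y = {}" if "x \<noteq> y" for x y
    using rooted_modelD(5)[OF C entryP(2) entryP(2)] inj_onD[OF inj] that by (auto simp: M_def)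
  ultimately have "disjoint_family_on (\<lambda>x. P x \<union> M x) X" using disj unfolding disjoint_family_on_def by blast
  moreover have "connected_in E (P x \<union> M x)" if "x \<in> X" for x
  proof (cases "x \<in> Y")
    case True
    have "connected_in E (C (entry x))"
      using rooted_modelD(3)[OF C entryP(2)[OF True]] L(2) by (auto intro: connected_in_mono)
    thus ?thesis using P(1)[OF that] entryP[OF True] rooted_modelD(1)[OF C entryP(2)[OF True]] True
      by (auto simp: M_def intro!: connected_in_Un_Int[OF E])
  qed (use P(1)[OF that] in \<open>simp add: M_def\<close>)
  moreover have "\<exists>u\<in>P (fst p) \<union> M (fst p). \<exists>v\<in>P (snd p) \<union> M (snd p). (u, v) \<in> E" if "p \<in> Q" for p
  proof (cases "p \<in> Q'")
    case True
    hence "map_prod entry entry p \<in> map_prod entry entry ` Q'" "fst p \<in> Y" "snd p \<in> Y" by (auto simp: Y_def)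
    thus ?thesis using rooted_modelD(6)[OF C, of "map_prod entry entry p"] L(2)
      by (auto simp: M_def fst_map_prod snd_map_prod)
  qed (use that in \<open>auto simp: Q'_def\<close>)
  ultimately have "rooted_model V E X Q (\<lambda>x. P x \<union> M x)"
    unfolding rooted_model_def using P(1) M L(3) by blast
  thus ?thesis by blast
qed

lemma linked_extend:
  assumes "sym E" "linked V2 E2 Z" "E2 \<subseteq> E" "V2 \<subseteq> V" "Z \<subseteq> V2"
    and D: "\<And>x. x \<in> X \<Longrightarrow> x \<in> D x \<and> D x \<subseteq> V \<and> connected_in E (D x) \<and> D x \<inter> V2 = {g x} \<and> g x \<in> Z"
      "disjoint_family_on D X"
  shows "linked V E X"
  unfolding linked_def
proof (intro allI impI)
  fix Q assume Q: "pairing Q X"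
  have "D x \<inter> Z = {g x}" if "x \<in> X" for x using D(1)[OF that] assms(5) by blast
  hence "(\<exists>u\<in>D (fst p). \<exists>v\<in>D (snd p). (u, v) \<in> E) \<or> (\<exists>z z'. D (fst p) \<inter> Z = {z} \<and> D (snd p) \<inter> Z = {z'})"
    if "p \<in> Q" for p using pairingD(1,2)[OF Q that] by blast
  thus "\<exists>C. rooted_model V E X Q C"
    using D by (intro rooted_model_glue[OF assms(1-4) Q]) auto
qed

lemma hub_linked:
  assumes E: "sym E" and hub: "hub E U H f" and sub: "H \<subseteq> V" "U \<subseteq> V" and Z: "finite Z" "Z \<subseteq> U" "4 * card Z \<le> f"
  shows "linked V E Z"
  unfolding linked_def
proof (intro allI impI)
  fix Q assume Q: "pairing Q Z"
  note inj = pairing_inj[OF Q]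
  have fQ: "finite Q" using Q Z(1) by (auto simp: pairing_def intro: finite_subset)
  have "card Q \<le> card Z" using card_inj_on_le[OF inj(1) _ Z(1)] pairingD(1)[OF Q] by blast
  moreover have "card (Z \<inter> H) \<le> card Z" using Z(1) by (intro card_mono) auto
  ultimately have small: "card (Z \<inter> H) + 3 * card Q \<le> f" using Z(3) by simp
  obtain K
    where K: "\<forall>p\<in>Q. K p \<subseteq> H - Z \<and> finite (K p) \<and> card (K p) \<le> 3 \<and> connector E (fst p) (snd p) (K p)"
      "disjoint_family_on K Q"
  proof (rule hub_connectors[of Q E "\<lambda>_. U" "\<lambda>_. H" f fst snd Z])
    show "fst p \<in> U \<and> snd p \<in> U" if "p \<in> Q" for p using pairingD(1,2)[OF Q that] Z(2) by blast
  qed (use hub fQ Z(1) small in auto)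
  obtain P where P: "\<And>p. p \<in> Q \<Longrightarrow> P (fst p) = insert (fst p) (K p) \<and> P (snd p) = {snd p}"
    "\<And>x. x \<notin> fst ` Q \<union> snd ` Q \<Longrightarrow> P x = {x}"
    by (rule pairing_choice[OF Q, where R = "\<lambda>p S T. S = insert (fst p) (K p) \<and> T = {snd p}" and f = "\<lambda>x. {x}"]) auto
  have shape: "P x = {x} \<or> (\<exists>p\<in>Q. x = fst p \<and> P x = insert x (K p))" for x
    using P by (cases "x \<in> fst ` Q \<union> snd ` Q") auto
  have "x \<in> P x \<and> P x \<subseteq> V \<and> connected_in E (P x)" if "x \<in> Z" for x
    using shape[of x]
  proof
    assume "\<exists>p\<in>Q. x = fst p \<and> P x = insert x (K p)"
    then obtain p where p: "p \<in> Q" "x = fst p" "P x = insert x (K p)" by blast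
    then obtain u where "connected_in E (K p)" "u \<in> K p" "(u, x) \<in> E"
      using K(1) symD[OF E] by (blast elim: connectorE)
    from connected_in_insert[OF E this] show ?thesis using p K(1) sub Z(2) that by auto
  qed (use that Z(2) sub(2) connected_in_singleton in auto)
  moreover have "P x \<inter> P y = {}" if "x \<in> Z" "y \<in> Z" "x \<noteq> y" for x y
  proof -
    have "K p \<inter> Z = {}" if "p \<in> Q" for p using K(1) that by auto
    moreover have "K p \<inter> K q = {}" if "p \<in> Q" "q \<in> Q" "p \<noteq> q" for p q using disjoint_family_onD[OF K(2) that] .
    ultimately show ?thesis using shape[of x] shape[of y] that by auto (blast+)?
  qed
  moreover have "\<exists>u\<in>P (fst p). \<exists>v\<in>P (snd p). (u, v) \<in> E" if "p \<in> Q" for p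
    using P(1)[OF that] K(1) that symD[OF E] by (fastforce elim: connectorE)
  ultimately have "rooted_model V E Z Q P" unfolding rooted_model_def disjoint_family_on_def by blast
  thus "\<exists>C. rooted_model V E Z Q C" by blast
qed

lemma connected_in_split_off:
  assumes "sym E" "connected_in E W" "s \<in> W" "t \<in> W" "s \<noteq> t"
  obtains S u where "S \<subseteq> W - {t}" "connected_in E S" "s \<in> S" "u \<in> S" "(u, t) \<in> E"
proof -
  let ?S = "component_in E (W - {t}) s"
  have s: "s \<in> W - {t}" using assms by auto
  have S: "connected_in E ?S" "?S \<subseteq> W - {t}" "s \<in> ?S"
    using connected_in_component_in[OF assms(1) s] component_in_subset[OF s] component_in_self[of s E] by auto
  obtain u v where uv: "u \<in> ?S" "v \<in> W - ?S" "(u, v) \<in> E"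
    using connected_in_leaving_edge[OF assms(2), of ?S] S assms(4) by blast
  have "v = t" using component_in_closed[OF uv(1) s uv(3)] uv(2) by auto
  thus thesis using that[OF S(2,1,3)] uv by blast
qed

lemma connected_in_enter_clique:
  assumes "sym E" "finite D" "connected_in E' D" "E' \<subseteq> E \<union> Z \<times> Z" "x \<in> D" "y \<in> D" "y \<notin> component_in E D x"
  obtains S z where "S \<subseteq> component_in E D x" "connected_in E S" "x \<in> S" "S \<inter> Z = {z}"
proof -
  let ?W = "component_in E D x"
  have W: "connected_in E ?W" "?W \<subseteq> D" "x \<in> ?W"
    using connected_in_component_in[OF assms(1,5)] component_in_subset[OF assms(5)] component_in_self[of x E D] by auto
  obtain u v where uv: "u \<in> ?W" "v \<in> D - ?W" "(u, v) \<in> E'"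
    using connected_in_leaving_edge[OF assms(3) W(2)] W assms(6,7) by auto
  hence "(u, v) \<notin> E" using component_in_closed[OF uv(1) assms(5)] by auto
  hence "?W \<inter> Z \<noteq> {}" using uv assms(4) by auto
  moreover have "finite ?W" using W assms(2) finite_subset by auto
  moreover have "?W \<inter> {x} \<noteq> {}" using W by auto
  ultimately obtain S a z where S: "S \<subseteq> ?W" "connected_in E S" "S \<inter> {x} = {a}" "S \<inter> Z = {z}"
    using connected_in_trim[OF assms(1) _ W(1), of "{x}" Z] by blast
  hence "x \<in> S" by auto
  thus thesis using S that by blast
qed

lemma clique_route:
  assumes "sym E" "finite D" "connected_in E' D" "s \<in> D" "t \<in> D" "s \<noteq> t" "E' \<subseteq> E \<union> Z \<times> Z"
  shows "\<exists>S T. S \<subseteq> D \<and> T \<subseteq> D \<and> s \<in> S \<and> t \<in> T \<and> connected_in E S \<and> connected_in E T \<and> S \<inter> T = {} \<and>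
    ((\<exists>u\<in>S. \<exists>v\<in>T. (u, v) \<in> E) \<or> (\<exists>z z'. S \<inter> Z = {z} \<and> T \<inter> Z = {z'}))"
proof (cases "t \<in> component_in E D s")
  case True
  obtain S u where S: "S \<subseteq> component_in E D s - {t}" "connected_in E S" "s \<in> S" "u \<in> S" "(u, t) \<in> E"
    by (rule connected_in_split_off[OF assms(1) connected_in_component_in[OF assms(1,4)] component_in_self True assms(6)])
  moreover have "S \<subseteq> D" using S(1) component_in_subset[OF assms(4), of E] by blast
  ultimately show ?thesis using assms(5) connected_in_singleton[of E t]
    by (intro exI[of _ S] exI[of _ "{t}"]) auto
next
  case False
  hence False': "s \<notin> component_in E D t" using component_in_sym[OF assms(1)] by blast
  obtain S z where S: "S \<subseteq> component_in E D s" "connected_in E S" "s \<in> S" "S \<inter> Z = {z}"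
    by (rule connected_in_enter_clique[OF assms(1-3,7,4,5) False])
  obtain T z' where T: "T \<subseteq> component_in E D t" "connected_in E T" "t \<in> T" "T \<inter> Z = {z'}"
    by (rule connected_in_enter_clique[OF assms(1-3,7,5,4) False'])
  have "S \<inter> T = {}" "S \<subseteq> D" "T \<subseteq> D"
    using S(1) T(1) component_in_disjoint[OF assms(1) False] component_in_subset[OF assms(4), of E]
      component_in_subset[OF assms(5), of E] by blast+
  thus ?thesis using S(2-4) T(2-4)
    by (intro exI[of _ S] exI[of _ T] conjI disjI2 exI[of _ z] exI[of _ z'])
qed

lemma disjoint_family_on_pairing_blocks:
  assumes Q: "pairing Q X" and C: "disjoint_family_on C X"
    and block: "\<And>x. x \<in> X \<Longrightarrow> \<exists>B\<subseteq>X. P x \<subseteq> \<Union> (C ` B) \<and> (B = {x} \<and> x \<notin> fst ` Q \<union> snd ` Q \<or> (\<exists>p\<in>Q. B = {fst p, snd p} \<and> x \<in> B))"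
    and pair: "\<And>p. p \<in> Q \<Longrightarrow> P (fst p) \<inter> P (snd p) = {}"
  shows "disjoint_family_on P X"
proof -
  have "P x \<inter> P y = {}" if xy: "x \<in> X" "y \<in> X" "x \<noteq> y" for x y
  proof -
    obtain B where B: "B \<subseteq> X" "P x \<subseteq> \<Union> (C ` B)"
      "B = {x} \<and> x \<notin> fst ` Q \<union> snd ` Q \<or> (\<exists>p\<in>Q. B = {fst p, snd p} \<and> x \<in> B)" using block[OF xy(1)] by blast
    obtain D where D: "D \<subseteq> X" "P y \<subseteq> \<Union> (C ` D)"
      "D = {y} \<and> y \<notin> fst ` Q \<union> snd ` Q \<or> (\<exists>p\<in>Q. D = {fst p, snd p} \<and> y \<in> D)" using block[OF xy(2)] by blast
    have "B \<inter> D = {} \<or> (\<exists>p\<in>Q. {x, y} = {fst p, snd p})"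
      using B(3) D(3)
    proof (elim disjE bexE conjE)
      fix p q assume pq: "p \<in> Q" "B = {fst p, snd p}" "x \<in> B" "q \<in> Q" "D = {fst q, snd q}" "y \<in> D"
      show ?thesis
      proof (cases "p = q")
        case True
        hence "{x, y} = {fst p, snd p}" using pq xy(3) by auto
        thus ?thesis using pq(1) by blast
      next
        case False
        thus ?thesis using pairingD(4)[OF Q pq(1,4)] pq(2,5) by simp
      qed
    qed (use xy(3) in auto)
    thus ?thesis
    proof
      assume "B \<inter> D = {}"
      hence "\<Union> (C ` B) \<inter> \<Union> (C ` D) = {}" using disjoint_family_onD[OF C] B(1) D(1) by blast
      thus ?thesis using B(2) D(2) by blast
    next
      assume "\<exists>p\<in>Q. {x, y} = {fst p, snd p}"
      then obtain p where p: "p \<in> Q" "{x, y} = {fst p, snd p}" by blast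
      thus ?thesis using pair[OF p(1)] by (auto simp: doubleton_eq_iff)
    qed
  qed
  thus ?thesis by (simp add: disjoint_family_on_def)
qed

lemma rooted_model_avoiding_clique:
  assumes E: "sym E" "finite A" "sym E'" "E' \<subseteq> E \<union> Z \<times> Z" and Q: "pairing Q X" and C: "rooted_model A E' X Q C"
  obtains P where "\<And>x. x \<in> X \<Longrightarrow> x \<in> P x \<and> P x \<subseteq> A \<and> connected_in E (P x)" "disjoint_family_on P X"
    "\<And>p. p \<in> Q \<Longrightarrow> (\<exists>u\<in>P (fst p). \<exists>v\<in>P (snd p). (u, v) \<in> E) \<or>
      (\<exists>z z'. P (fst p) \<inter> Z = {z} \<and> P (snd p) \<inter> Z = {z'})"
proof -
  note C = rooted_modelD[OF C]
  define R where "R p S T \<longleftrightarrow> S \<subseteq> C (fst p) \<union> C (snd p) \<and> T \<subseteq> C (fst p) \<union> C (snd p) \<and> fst p \<in> S \<and> snd p \<in> T \<and>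
    connected_in E S \<and> connected_in E T \<and> S \<inter> T = {} \<and>
    ((\<exists>u\<in>S. \<exists>v\<in>T. (u, v) \<in> E) \<or> (\<exists>z z'. S \<inter> Z = {z} \<and> T \<inter> Z = {z'}))" for p S T
  have "\<exists>S T. R p S T" if p: "p \<in> Q" for p
  proof -
    note pX = pairingD(1-3)[OF Q p]
    obtain u v where uv: "u \<in> C (fst p)" "v \<in> C (snd p)" "(u, v) \<in> E'" using C(6)[OF p] by auto
    have "connected_in E' (C (fst p) \<union> C (snd p))"
      by (rule connected_in_Un_edge[OF E(3) C(3)[OF pX(1)] C(3)[OF pX(2)] uv])
    moreover have "finite (C (fst p) \<union> C (snd p))" using C(2) pX(1,2) E(2) finite_subset by blast
    ultimately show ?thesis unfolding R_def using C(1) pX E by (intro clique_route) auto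
  qed
  from pairing_choice[OF Q, of R "\<lambda>x. {x}", OF this] obtain P
    where P: "\<And>p. p \<in> Q \<Longrightarrow> R p (P (fst p)) (P (snd p))" "\<And>x. x \<notin> fst ` Q \<union> snd ` Q \<Longrightarrow> P x = {x}" by blast
  have block: "\<exists>B\<subseteq>X. P x \<subseteq> \<Union> (C ` B) \<and> (B = {x} \<and> x \<notin> fst ` Q \<union> snd ` Q \<or> (\<exists>p\<in>Q. B = {fst p, snd p} \<and> x \<in> B))"
    if "x \<in> X" for x
  proof (cases "x \<in> fst ` Q \<union> snd ` Q")
    case True
    then obtain p where p: "p \<in> Q" "x = fst p \<or> x = snd p" by auto
    thus ?thesis using P(1)[OF p(1)] pairingD(1,2)[OF Q p(1)]
      by (intro exI[of _ "{fst p, snd p}"]) (auto simp: R_def)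
  next
    case False
    thus ?thesis using P(2) C(1) that by (intro exI[of _ "{x}"]) auto
  qed
  have disj: "disjoint_family_on P X"
    by (rule disjoint_family_on_pairing_blocks[OF Q C(4) block]) (use P(1) in \<open>simp_all add: R_def\<close>)
  have rooted: "x \<in> P x \<and> P x \<subseteq> A \<and> connected_in E (P x)" if "x \<in> X" for x
  proof -
    have "x \<in> P x \<and> connected_in E (P x)"
      using P connected_in_singleton[of E x] by (cases "x \<in> fst ` Q \<union> snd ` Q") (auto simp: R_def)
    thus ?thesis using block[OF that] C(2) by blast
  qed
  show thesis using that[OF rooted disj] P(1) by (simp add: R_def)
qed

lemma linked_clique:
  assumes E: "sym E" "finite A" "sym E'" and B: "A \<inter> B = Z" "linked B EB Z" "EB \<subseteq> E"
    and A: "linked A E' X" "E' \<subseteq> E \<union> Z \<times> Z"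
  shows "linked (A \<union> B) E X"
  unfolding linked_def
proof (intro allI impI)
  fix Q assume Q: "pairing Q X"
  with A(1) obtain C where C: "rooted_model A E' X Q C" by (rule linkedD)
  obtain P where P: "\<And>x. x \<in> X \<Longrightarrow> x \<in> P x \<and> P x \<subseteq> A \<and> connected_in E (P x)" "disjoint_family_on P X"
    "\<And>p. p \<in> Q \<Longrightarrow> (\<exists>u\<in>P (fst p). \<exists>v\<in>P (snd p). (u, v) \<in> E) \<or>
      (\<exists>z z'. P (fst p) \<inter> Z = {z} \<and> P (snd p) \<inter> Z = {z'})"
    by (rule rooted_model_avoiding_clique[OF E A(2) Q C]) blast
  show "\<exists>C. rooted_model (A \<union> B) E X Q C"
    by (rule rooted_model_glue[OF E(1) B(2,3) _ Q _ P(2,3)]) (use P(1) B(1) in auto)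
qed

lemma linked_via_menger:
  assumes E: "sym E" and A: "simple_graph A (Restr E A)" and AB: "A \<inter> B = T" and Y: "Y \<subseteq> A"
    and L: "\<And>Z. Z \<subseteq> T \<Longrightarrow> card Z \<le> card Y \<Longrightarrow> linked B (Restr E B) Z"
    and sep: "\<And>P Q. separation A (Restr E A) P Q \<Longrightarrow> Y \<subseteq> P \<Longrightarrow> T \<subseteq> Q \<Longrightarrow> card Y \<le> card (P \<inter> Q)"
  shows "linked (A \<union> B) (Restr E (A \<union> B)) Y"
proof -
  have T: "T \<subseteq> A" using AB by auto
  obtain C g where C: "\<And>x. x \<in> Y \<Longrightarrow> C x \<subseteq> A \<and> connected_in (Restr E A) (C x) \<and> C x \<inter> Y = {x} \<and> C x \<inter> T = {g x}"
    "disjoint_family_on C Y"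
    by (rule menger_paths[OF A Y T]) (blast intro: sep, rule that, simp_all)
  have fY: "finite Y" using Y simple_graphD(1)[OF A] finite_subset by auto
  have gT: "g ` Y \<subseteq> T" using C(1) by blast
  have "linked B (Restr E B) (g ` Y)" using L gT card_image_le[OF fY] by blast
  thus ?thesis
  proof (rule linked_extend[OF sym_Restr[OF E], where D = C and g = g])
    fix x assume x: "x \<in> Y"
    have "connected_in (Restr E (A \<union> B)) (C x)" using C(1)[OF x] by (auto intro: connected_in_mono)
    moreover have "C x \<inter> B = C x \<inter> T" using C(1)[OF x] AB by blast
    ultimately show "x \<in> C x \<and> C x \<subseteq> A \<union> B \<and> connected_in (Restr E (A \<union> B)) (C x) \<and> C x \<inter> B = {g x} \<and> g x \<in> g ` Y"
      using C(1)[OF x] x by auto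
  qed (use C(2) gT AB in auto)
qed

definition linked_separation :: "'a set \<Rightarrow> 'a rel \<Rightarrow> 'a set \<Rightarrow> 'a set \<Rightarrow> 'a set \<Rightarrow> bool" where
  "linked_separation V E X A B \<longleftrightarrow> separation V E A B \<and> X \<subseteq> A \<and> card (A \<inter> B) < card X \<and>
     linked B (Restr E B) (A \<inter> B) \<and> B - A \<noteq> {}"

lemma linked_or_linked_separation:
  assumes G: "simple_graph V E" and AB: "separation V E A B" and X: "X \<subseteq> A" "card X \<le> card (A \<inter> B)"
    and L: "\<And>Z. Z \<subseteq> A \<inter> B \<Longrightarrow> card Z \<le> card X \<Longrightarrow> linked B (Restr E B) Z"
  shows "linked V E X \<or> (\<exists>P Q. linked_separation V E X P Q)"
proof -
  let ?T = "A \<inter> B"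
  note G' = simple_graphD[OF G]
  have V: "A \<union> B = V" "Restr E V = E" using AB G'(5) by (auto simp: separation_def)
  have GA: "simple_graph A (Restr E A)" using simple_graph_Restr[OF G] V by auto
  define small where "small = (\<lambda>(P, Q). separation A (Restr E A) P Q \<and> X \<subseteq> P \<and> ?T \<subseteq> Q \<and> card (P \<inter> Q) < card X)"
  show ?thesis
  proof (cases "\<exists>PQ. small PQ")
    case False
    hence "linked (A \<union> B) (Restr E (A \<union> B)) X"
      by (intro linked_via_menger[OF G'(3) GA refl X(1) L]) (auto simp: small_def not_less)
    thus ?thesis using V by simp
  next
    case True
    then obtain P Q where PQ: "small (P, Q)" and min: "\<And>P' Q'. small (P', Q') \<Longrightarrow> card (P \<inter> Q) \<le> card (P' \<inter> Q')"
      using ex_has_least_nat[of small _ "\<lambda>(P, Q). card (P \<inter> Q)"] by fast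
    have P: "P \<union> Q = A" "X \<subseteq> P" "?T \<subseteq> Q" "card (P \<inter> Q) < card X" and sepA: "separation A (Restr E A) P Q"
      using PQ by (auto simp: small_def separation_def)
    let ?Y = "P \<inter> Q" and ?B = "Q \<union> B"
    have GQ: "simple_graph Q (Restr E Q)" using simple_graph_Restr[OF G] P V by auto
    have "linked ?B (Restr E ?B) ?Y"
    proof (rule linked_via_menger[OF G'(3) GQ])
      show "Q \<inter> B = ?T" using P(1,3) by blast
      show "linked B (Restr E B) Z" if "Z \<subseteq> ?T" "card Z \<le> card ?Y" for Z using L that P(4) by simp
      fix P1 Q1 assume s: "separation Q (Restr E Q) P1 Q1" "?Y \<subseteq> P1" "?T \<subseteq> Q1"
      have "Restr (Restr E A) Q \<subseteq> Restr E Q \<union> P1 \<times> P1" by auto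
      note ext = separation_extend_left[OF sepA s(1,2) this]
      show "card ?Y \<le> card (P1 \<inter> Q1)"
      proof (rule ccontr)
        assume less: "\<not> ?thesis"
        hence "small (P \<union> P1, Q1)" using ext s(3) P(2,4) by (auto simp: small_def)
        thus False using min[of "P \<union> P1" Q1] ext(2) less by simp
      qed
    qed auto
    moreover have "separation V E P ?B" "P \<inter> ?B = ?Y" using separation_extend_right[OF AB sepA P(3)] by auto
    moreover have "?B - P \<noteq> {}"
    proof
      assume "?B - P = {}"
      hence "?T \<subseteq> ?Y" using P(3) by auto
      moreover have "finite ?Y" using simple_graphD(1)[OF GQ] by simp
      ultimately have "card ?T \<le> card ?Y" by (rule card_mono[rotated])
      thus False using P(4) X(2) by simp
    qed
    ultimately have "linked_separation V E X P ?B" unfolding linked_separation_def using P(2,4) by simp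
    thus ?thesis by blast
  qed
qed

section \<open>Massed graphs are linked\<close>

definition num_incident :: "'a rel \<Rightarrow> 'a set \<Rightarrow> nat" where
  "num_incident E W = card {e \<in> E. fst e \<in> W \<or> snd e \<in> W}"

lemma num_incident_mono:
  assumes "finite E'" "\<And>a b. (a, b) \<in> E \<Longrightarrow> a \<in> W \<or> b \<in> W \<Longrightarrow> (a, b) \<in> E' \<and> (a \<in> W' \<or> b \<in> W')"
  shows "num_incident E W \<le> num_incident E' W'"
proof -
  have "{e \<in> E. fst e \<in> W \<or> snd e \<in> W} \<subseteq> {e \<in> E'. fst e \<in> W' \<or> snd e \<in> W'}"
    using assms(2)[of "fst e" "snd e" for e] by auto
  thus ?thesis unfolding num_incident_def using assms(1) by (intro card_mono) auto
qed

lemma num_incident_le_add: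
  assumes "{e \<in> E. fst e \<in> W \<or> snd e \<in> W} \<subseteq> {e \<in> E'. fst e \<in> W' \<or> snd e \<in> W'} \<union> R" "finite E'" "finite R"
  shows "num_incident E W \<le> num_incident E' W' + card R"
proof -
  have "num_incident E W \<le> card ({e \<in> E'. fst e \<in> W' \<or> snd e \<in> W'} \<union> R)"
    unfolding num_incident_def using assms by (intro card_mono) auto
  thus ?thesis unfolding num_incident_def using card_Un_le order_trans by blast
qed

lemma num_incident_empty: "num_incident E {} = 0"
  by (simp add: num_incident_def)

lemma sum_degree_le_num_incident:
  assumes "finite E" "finite W"
  shows "(\<Sum>v\<in>W. card (E `` {v})) \<le> num_incident E W"
proof -
  have "(\<Sum>v\<in>W. card (E `` {v})) = card (Sigma W (\<lambda>v. E `` {v}))"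
    using assms by (intro card_SigmaI[symmetric]) (auto intro: finite_Image)
  also have "\<dots> \<le> num_incident E W" unfolding num_incident_def using assms(1) by (intro card_mono) auto
  finally show ?thesis .
qed

definition overfull_separation :: "nat \<Rightarrow> 'a set \<Rightarrow> 'a rel \<Rightarrow> 'a set \<Rightarrow> 'a set \<Rightarrow> 'a set \<Rightarrow> bool" where
  "overfull_separation c V E X A B \<longleftrightarrow> separation V E A B \<and> X \<subseteq> A \<and> card (A \<inter> B) < card X \<and>
     c * card (B - A) < num_incident E (B - A)"

definition massed :: "nat \<Rightarrow> 'a set \<Rightarrow> 'a rel \<Rightarrow> 'a set \<Rightarrow> bool" where
  "massed c V E X \<longleftrightarrow> c * card (V - X) < num_incident E (V - X) \<and> (\<nexists>A B. overfull_separation c V E X A B)"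

lemma massedI:
  assumes "c * card (V - X) < num_incident E (V - X)"
    and "\<And>A B. separation V E A B \<Longrightarrow> X \<subseteq> A \<Longrightarrow> card (A \<inter> B) < card X \<Longrightarrow> num_incident E (B - A) \<le> c * card (B - A)"
  shows "massed c V E X"
  unfolding massed_def overfull_separation_def using assms by (meson not_less)

lemma massedD:
  assumes "massed c V E X"
  shows "c * card (V - X) < num_incident E (V - X)"
    "separation V E A B \<Longrightarrow> X \<subseteq> A \<Longrightarrow> card (A \<inter> B) < card X \<Longrightarrow> num_incident E (B - A) \<le> c * card (B - A)"
  using assms unfolding massed_def overfull_separation_def by (simp, meson not_less)

lemma massed_side:
  assumes G: "simple_graph V E" and AB: "separation V E A B" and X: "X \<subseteq> A"
    and dense: "c * card (B - A) < num_incident E (B - A)"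
    and min: "\<And>A' B'. separation V E A' B' \<Longrightarrow> X \<subseteq> A' \<Longrightarrow> card (A' \<inter> B') < card (A \<inter> B) \<Longrightarrow>
      num_incident E (B' - A') \<le> c * card (B' - A')"
  shows "massed c B (Restr E B) (A \<inter> B)"
proof (rule massedI)
  note V = simple_graphD[OF G]
  have sides: "A \<union> B = V" "E \<inter> (B - A) \<times> (A - B) = {}" "E \<inter> (A - B) \<times> (B - A) = {}"
    using separation_swap[OF V(3) AB] AB by (auto simp: separation_def)
  have BA: "B - A \<inter> B = B - A" by auto
  have "num_incident E (B - A) \<le> num_incident (Restr E B) (B - A)"
    by (rule num_incident_mono) (use V sides in auto)
  thus "c * card (B - A \<inter> B) < num_incident (Restr E B) (B - A \<inter> B)" using dense unfolding BA by simp
  fix P Q assume s: "separation B (Restr E B) P Q" "A \<inter> B \<subseteq> P" "card (P \<inter> Q) < card (A \<inter> B)"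
  have "Restr E B \<subseteq> Restr E B \<union> P \<times> P" by auto
  note ext = separation_extend_left[OF AB s(1,2) this]
  have "num_incident (Restr E B) (Q - P) \<le> num_incident E (Q - P)" by (rule num_incident_mono) (use V in auto)
  moreover have "X \<subseteq> A \<union> P" using X by auto
  ultimately show "num_incident (Restr E B) (Q - P) \<le> c * card (Q - P)"
    using min[OF ext(1)] s(3) ext(2,3) by simp
qed

lemma massed_side_of_overfull:
  assumes G: "simple_graph V E" and "overfull_separation c V E X A0 B0"
  obtains A B where "overfull_separation c V E X A B" "massed c B (Restr E B) (A \<inter> B)"
proof -
  let ?P = "\<lambda>(A, B). overfull_separation c V E X A B"
  obtain A B where AB: "overfull_separation c V E X A B"
    and min: "\<And>A' B'. overfull_separation c V E X A' B' \<Longrightarrow> card (A \<inter> B) \<le> card (A' \<inter> B')"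
    using ex_has_least_nat[of ?P "(A0, B0)" "\<lambda>(A, B). card (A \<inter> B)"] assms(2) by fast
  have "massed c B (Restr E B) (A \<inter> B)"
  proof (rule massed_side[OF G])
    show "num_incident E (B' - A') \<le> c * card (B' - A')"
      if "separation V E A' B'" "X \<subseteq> A'" "card (A' \<inter> B') < card (A \<inter> B)" for A' B'
    proof (rule ccontr)
      assume "\<not> ?thesis"
      hence "overfull_separation c V E X A' B'" using that AB by (auto simp: overfull_separation_def)
      from min[OF this] show False using that(3) by simp
    qed
  qed (use AB in \<open>auto simp: overfull_separation_def\<close>)
  thus thesis using AB that by blast
qed

definition linking_const :: nat where
  "linking_const = 12 * 40 ^ increment_steps 40 (1 / 6) + 24"

lemma linking_const_bound: "linking_const * (\<kappa> + 1) \<le> c \<Longrightarrow> 24 * (\<kappa> + 1) \<le> c"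
  using mult_right_mono[of 24 linking_const "\<kappa> + 1"] by (simp add: linking_const_def)

lemma dense_neighbourhood_contains_hub:
  assumes E: "sym E" "finite J" and c: "linking_const * (\<kappa> + 1) \<le> c" and J: "card J \<le> c + 2" "J \<noteq> {}"
    and deg: "\<And>w. w \<in> J \<Longrightarrow> c \<le> 2 * card (E `` {w} \<inter> J) + 2 * \<kappa> + 4"
  obtains U H where "U \<subseteq> J" "H \<subseteq> U" "hub E U H (4 * \<kappa>)" "\<kappa> < card U"
proof -
  define r where "r = 4 * \<kappa> + 1"
  have c24: "24 * (\<kappa> + 1) \<le> c" by (rule linking_const_bound[OF c])
  have third: "c \<le> 3 * card (E `` {w} \<inter> J)" if "w \<in> J" for w using deg[OF that] c24 by simp
  obtain w0 where "w0 \<in> J" using J by auto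
  hence J3: "c \<le> 3 * card J" using third[of w0] card_mono[OF E(2), of "E `` {w0} \<inter> J"] by auto
  have "3 * (r * 40 ^ increment_steps 40 (1 / 6)) \<le> linking_const * (\<kappa> + 1)"
    unfolding r_def linking_const_def by (simp add: algebra_simps)
  hence rJ: "r * 40 ^ increment_steps 40 (1 / 6) \<le> card J" using c J3 by linarith
  have dense: "1 / 6 * real (card J) * real (card J) \<le> real (edge_count E J J)"
  proof -
    have "real (card J) \<le> 2 * real c" using J(1) c24 by simp
    hence "real (card J) * (real (card J) / 6) \<le> real (card J) * (real c / 3)" by (intro mult_left_mono) auto
    also have "\<dots> = (\<Sum>w\<in>J. real c / 3)" by simp
    also have "\<dots> \<le> (\<Sum>w\<in>J. real (card (E `` {w} \<inter> J)))"
    proof (rule sum_mono)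
      fix w assume "w \<in> J"
      from of_nat_mono[OF third[OF this], where 'a = real] show "real c / 3 \<le> real (card (E `` {w} \<inter> J))" by simp
    qed
    also have "\<dots> = real (edge_count E J J)" using edge_count_eq_sum[OF E(2) E(2), of E] by simp
    finally show ?thesis by simp
  qed
  obtain X Y m where XY: "X \<subseteq> J" "Y \<subseteq> J" "r \<le> m" "card X = 40 * m" "card Y = 40 * m" "lower_regular E m (1 / 6 / 2) X Y"
    by (rule dense_pair_contains_lower_regular[of 40 "1 / 6" r J J E]) (use E(2) rJ dense in \<open>auto simp: r_def\<close>)
  have fin: "finite X" "finite Y" using XY E finite_subset by auto
  have m: "0 < m" "4 * \<kappa> \<le> m" "\<kappa> < m" using XY(3) by (auto simp: r_def)
  hence low: "real (2 * m + 4 * \<kappa>) \<le> 1 / 6 / 2 * real (36 * m)" by simp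
  obtain A1 B1 A0 B0 where H: "A1 \<subseteq> X" "B1 \<subseteq> Y" "A0 \<subseteq> A1" "B0 \<subseteq> B1" "card X \<le> card A1 + m"
    "hub E (A1 \<union> B1) (A0 \<union> B0) (4 * \<kappa>)"
    by (rule lower_regular_contains_hub[OF E(1) fin XY(6) _ m(1) _ _ _ low]) (use XY m in auto)
  have "card A1 \<le> card (A1 \<union> B1)" using H fin by (intro card_mono) (auto intro: finite_subset)
  hence "\<kappa> < card (A1 \<union> B1)" using H(5) XY(4) m by simp
  thus thesis using H XY by (intro that[of "A1 \<union> B1" "A0 \<union> B0"]) auto
qed

text \<open>The separator \<open>Z\<close> becomes a clique, so that no separation of the torso splits it.\<close>

definition torso :: "'a rel \<Rightarrow> 'a set \<Rightarrow> 'a set \<Rightarrow> 'a rel" where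
  "torso E A Z = Restr E A \<union> (Z \<times> Z - Id)"

lemma simple_graph_torso:
  assumes "simple_graph V E" "A \<subseteq> V" "Z \<subseteq> A"
  shows "simple_graph A (torso E A Z)"
proof -
  note A = simple_graphD[OF simple_graph_Restr[OF assms(1,2)]]
  have "sym (Z \<times> Z - Id)" by (auto simp: sym_def)
  hence "sym (torso E A Z)" using A(3) unfolding torso_def by (rule sym_Un[rotated])
  moreover have "irrefl (torso E A Z)" using A(4) by (auto simp: torso_def irrefl_def)
  ultimately show ?thesis using A(1) assms(3) by (auto simp: simple_graph_def torso_def)
qed

lemma separation_torso:
  assumes "separation A (torso E A Z) P Q" "Z \<subseteq> A"
  shows "Z \<subseteq> P \<or> Z \<subseteq> Q"
proof (rule ccontr)
  assume "\<not> ?thesis"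
  then obtain z z' where z: "z \<in> Z" "z \<notin> P" "z' \<in> Z" "z' \<notin> Q" by auto
  hence "z \<in> Q" "z' \<in> P" "(z', z) \<in> torso E A Z" using assms by (auto simp: separation_def torso_def)
  thus False using assms(1) z by (auto simp: separation_def)
qed

lemma linked_torso:
  assumes "simple_graph V E" "A \<union> B = V" "linked B (Restr E B) (A \<inter> B)" "linked A (torso E A (A \<inter> B)) X"
  shows "linked V E X"
proof -
  note V = simple_graphD[OF assms(1)]
  have "simple_graph A (torso E A (A \<inter> B))" using assms(1,2) by (intro simple_graph_torso) auto
  note A = simple_graphD[OF this]
  have "linked (A \<union> B) E X"
    by (rule linked_clique[OF V(3) A(1,3) refl assms(3) _ assms(4)]) (auto simp: torso_def)
  thus ?thesis using assms(2) by simp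
qed

lemma linked_separation_of_torso:
  assumes E: "sym E" "finite A" and AB: "separation V E A B" "linked B (Restr E B) (A \<inter> B)"
    and T: "simple_graph A (torso E A (A \<inter> B))"
    and PQ: "separation A (torso E A (A \<inter> B)) P Q" "X \<subseteq> P" "card (P \<inter> Q) < card X" "A \<inter> B \<subseteq> Q" "Q - P \<noteq> {}"
    and L: "linked Q (Restr (torso E A (A \<inter> B)) Q) (P \<inter> Q)"
  shows "linked_separation V E X P (Q \<union> B)"
proof -
  let ?T = "torso E A (A \<inter> B)" and ?B = "Q \<union> B"
  have QA: "Q \<subseteq> A" using PQ(1) by (auto simp: separation_def)
  hence QB: "Q \<inter> B = A \<inter> B" using PQ(4) by auto
  have "linked ?B (Restr E ?B) (P \<inter> Q)"
  proof (rule linked_clique[OF sym_Restr[OF E(1)] _ _ QB AB(2) _ L])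
    show "finite Q" using QA E(2) finite_subset by auto
    show "sym (Restr ?T Q)" using simple_graphD(3)[OF T] by (rule sym_Restr)
    show "Restr ?T Q \<subseteq> Restr E ?B \<union> (A \<inter> B) \<times> (A \<inter> B)" by (auto simp: torso_def)
  qed auto
  moreover have "Restr E A \<subseteq> ?T \<union> Q \<times> Q" by (auto simp: torso_def)
  note separation_extend_right[OF AB(1) PQ(1,4) this]
  ultimately show ?thesis unfolding linked_separation_def using PQ by auto
qed

lemma num_incident_separation:
  assumes G: "simple_graph V E" and AB: "separation V E A B" "X \<subseteq> A"
  shows "num_incident E (V - X) \<le> num_incident E (B - A) + num_incident (torso E A (A \<inter> B)) (A - X)"
    "card (V - X) = card (A - X) + card (B - A)"
proof -
  note V = simple_graphD[OF G]
  have un: "A \<union> B = V" and fin: "finite A" "finite B"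
    using AB finite_separation[OF AB(1) V(1)] by (auto simp: separation_def)
  have T: "simple_graph A (torso E A (A \<inter> B))" using un by (intro simple_graph_torso[OF G]) auto
  have "num_incident E (V - X) \<le> num_incident (torso E A (A \<inter> B)) (A - X) + card {e \<in> E. fst e \<in> B - A \<or> snd e \<in> B - A}"
    by (rule num_incident_le_add) (use V un simple_graphD(2)[OF T] in \<open>auto simp: torso_def\<close>)
  thus "num_incident E (V - X) \<le> num_incident E (B - A) + num_incident (torso E A (A \<inter> B)) (A - X)"
    by (simp add: num_incident_def)
  have "V - X = (A - X) \<union> (B - A)" "(A - X) \<inter> (B - A) = {}" using un AB(2) by auto
  thus "card (V - X) = card (A - X) + card (B - A)" using fin by (simp add: card_Un_disjoint)
qed

lemma linked_uncontract:
  assumes G: "simple_graph V E" and xy: "(x, y) \<in> E" and L: "linked W (Restr (contract_edges x y E) W) X"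
    and W: "W \<subseteq> V - {y}" "X \<subseteq> W"
  shows "linked (uncontract V x y W) (Restr E (uncontract V x y W)) X"
  unfolding linked_def
proof (intro allI impI)
  let ?W = "uncontract V x y W"
  fix Q assume "pairing Q X"
  with L obtain C where "rooted_model W (Restr (contract_edges x y E) W) X Q C" by (rule linkedD)
  note C = rooted_modelD[OF this]
  note V = simple_graphD[OF G]
  have xyV: "x \<in> V" "y \<in> V" using V(5) xy by auto
  let ?C = "\<lambda>z. uncontract V x y (C z)"
  have "z \<in> ?C z \<and> ?C z \<subseteq> ?W \<and> connected_in (Restr E ?W) (?C z)" if "z \<in> X" for z
  proof -
    have CW: "C z \<subseteq> W" by (rule C(2)[OF that])
    have "connected_in (contract_edges x y E) (C z)" using C(3)[OF that] by (auto intro: connected_in_mono)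
    hence "connected_in E (?C z)" using connected_in_uncontract[OF V(3) xy xyV] CW W(1) by blast
    hence "connected_in (Restr E ?W) (?C z)" by (rule connected_in_mono) (use CW in \<open>auto simp: uncontract_def\<close>)
    thus ?thesis using CW C(1)[OF that] that W by (auto simp: uncontract_def contract_def)
  qed
  moreover have "disjoint_family_on ?C X" using C(4) by (auto simp: disjoint_family_on_def uncontract_def)
  moreover have "\<exists>u\<in>?C (fst p). \<exists>v\<in>?C (snd p). (u, v) \<in> Restr E ?W" if p: "p \<in> Q" for p
  proof -
    obtain u v where uv: "u \<in> C (fst p)" "v \<in> C (snd p)" "(u, v) \<in> contract_edges x y E" "u \<in> W" "v \<in> W"
      using C(6)[OF p] by auto
    then obtain a b where "(a, b) \<in> E" "contract x y a = u" "contract x y b = v" by (auto simp: contract_edges_iff)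
    thus ?thesis using uv V(5) by (intro bexI[of _ a] bexI[of _ b]) (auto simp: uncontract_def)
  qed
  ultimately show "\<exists>C. rooted_model ?W (Restr E ?W) X Q C" unfolding rooted_model_def by (intro exI[of _ ?C]) simp
qed

lemma massed_delete_vertex:
  assumes G: "simple_graph V E" and v: "v \<in> V - X" "2 * card (E `` {v}) \<le> c"
    and dense: "c * card (V - X) < num_incident E (V - X)"
    and tight: "\<And>A B. separation V E A B \<Longrightarrow> X \<subseteq> A \<Longrightarrow> card (A \<inter> B) \<le> card X \<Longrightarrow> B \<noteq> V \<Longrightarrow>
      num_incident E (B - A) \<le> c * card (B - A)"
  shows "massed c (V - {v}) (Restr E (V - {v})) X"
proof (rule massedI)
  note V = simple_graphD[OF G]
  let ?V = "V - {v}" and ?E = "Restr E (V - {v})" and ?R = "{v} \<times> E `` {v} \<union> E `` {v} \<times> {v}"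
  have fN: "finite (E `` {v})" using V(2) by (rule finite_Image)
  have "num_incident E (V - X) \<le> num_incident ?E (?V - X) + card ?R"
    by (rule num_incident_le_add) (use V fN in \<open>auto dest: symD[OF V(3)]\<close>)
  also have "card ?R \<le> card ({v} \<times> E `` {v}) + card (E `` {v} \<times> {v})" by (rule card_Un_le)
  finally have "num_incident E (V - X) \<le> num_incident ?E (?V - X) + c"
    using v(2) by (simp add: card_cartesian_product)
  moreover have eq: "?V - X = V - X - {v}" by auto
  have "card (V - X) = Suc (card (?V - X))" unfolding eq using v(1) V(1) by (intro card.remove) auto
  ultimately show "c * card (?V - X) < num_incident ?E (?V - X)" using dense by simp
  fix A B assume s: "separation ?V ?E A B" "X \<subseteq> A" "card (A \<inter> B) < card X"
  have AB: "A \<union> B = ?V" and fin: "finite A" "finite B"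
    using s(1) finite_separation[OF s(1)] V(1) by (auto simp: separation_def)
  have sep: "separation V E (insert v A) (insert v B)" using s(1) v(1) by (auto simp: separation_def)
  have I: "insert v A \<inter> insert v B = insert v (A \<inter> B)" "insert v B - insert v A = B - A" using AB by auto
  have "card (insert v A \<inter> insert v B) \<le> card X" unfolding I(1) using s(3) fin by (simp add: card_insert_if)
  moreover have "insert v B \<noteq> V"
  proof
    assume "insert v B = V"
    hence "A \<subseteq> B" using AB by auto
    thus False using s(2,3) card_mono[OF fin(1) s(2)] by (simp add: Int_absorb2)
  qed
  ultimately have "num_incident E (B - A) \<le> c * card (B - A)"
    using tight[OF sep] s(2) I(2) by auto
  moreover have "num_incident ?E (B - A) \<le> num_incident E (B - A)" by (rule num_incident_mono) (use V in auto)
  ultimately show "num_incident ?E (B - A) \<le> c * card (B - A)" by simp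
qed

lemma massed_delete_edge:
  assumes G: "simple_graph V E" and xy: "(x, y) \<in> E" "x \<notin> X" "y \<notin> X"
    and dense: "c * card (V - X) + 2 < num_incident E (V - X)"
    and tight: "\<And>A B. separation V E A B \<Longrightarrow> X \<subseteq> A \<Longrightarrow> card (A \<inter> B) \<le> card X \<Longrightarrow> B \<noteq> V \<Longrightarrow>
      num_incident E (B - A) \<le> c * card (B - A)"
  shows "massed c V (E - {(x, y), (y, x)}) X"
proof (rule massedI)
  note V = simple_graphD[OF G]
  let ?E = "E - {(x, y), (y, x)}"
  have "num_incident E (V - X) \<le> num_incident ?E (V - X) + card {(x, y), (y, x)}"
    by (rule num_incident_le_add) (use V(2) in auto)
  also have "card {(x, y), (y, x)} \<le> 2" using card_length[of "[(x, y), (y, x)]"] by simp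
  finally show "c * card (V - X) < num_incident ?E (V - X)" using dense by simp
  fix A B assume s: "separation V ?E A B" "X \<subseteq> A" "card (A \<inter> B) < card X"
  have AB: "A \<union> B = V" "?E \<inter> (A - B) \<times> (B - A) = {}" and fin: "finite A" "finite B"
    using s(1) finite_separation[OF s(1) V(1)] by (auto simp: separation_def)
  have AV: "A \<inter> V = A" and "\<not> A \<subseteq> B"
    using AB(1) s(2,3) card_mono[OF fin(1) s(2)] by (auto simp: Int_absorb2)
  have "num_incident E (B - A) \<le> c * card (B - A)"
  proof (cases "separation V E A B")
    case True
    moreover have "B \<noteq> V" using AV s(3) card_mono[OF fin(1) s(2)] by auto
    ultimately show ?thesis using tight s by simp
  next
    case False
    then obtain a where a: "a \<in> A - B" "a \<in> {x, y}" using AB by (auto simp: separation_def)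
    have "separation V E A (insert a B)" using AB a by (auto simp: separation_def)
    moreover have I: "A \<inter> insert a B = insert a (A \<inter> B)" "insert a B - A = B - A" using a by auto
    moreover have "card (A \<inter> insert a B) \<le> card X" unfolding I(1) using s(3) fin by (simp add: card_insert_if)
    moreover have "insert a B \<noteq> V"
    proof
      assume "insert a B = V"
      hence "A \<inter> insert a B = A" using AB(1) by auto
      hence "card A \<le> card X" using \<open>card (A \<inter> insert a B) \<le> card X\<close> by simp
      hence "A = X" using s(2) fin(1) by (metis card_seteq)
      thus False using a xy by auto
    qed
    ultimately show ?thesis using tight[of A "insert a B"] s(2) by simp
  qed
  moreover have "num_incident ?E (B - A) \<le> num_incident E (B - A)" by (rule num_incident_mono) (use V in auto)
  ultimately show "num_incident ?E (B - A) \<le> c * card (B - A)" by simp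
qed

lemma num_incident_contract:
  assumes G: "simple_graph V E" and xy: "(x, y) \<in> E" "x \<notin> X" "y \<notin> X"
  shows "num_incident E (V - X) \<le>
    num_incident (contract_edges x y E) (V - {y} - X) + 2 + 2 * card (E `` {x} \<inter> E `` {y})"
proof -
  note V = simple_graphD[OF G]
  have xyV: "x \<in> V" "y \<in> V" "x \<noteq> y" using V xy by (auto simp: irrefl_def)
  let ?h = "map_prod (contract x y) (contract x y)" and ?E = "contract_edges x y E" and ?N = "E `` {x} \<inter> E `` {y}"
  let ?I = "{e \<in> E. fst e \<in> V - X \<or> snd e \<in> V - X}" and ?R = "{(x, y), (y, x)} \<union> ({y} \<times> ?N \<union> ?N \<times> {y})"
  have fin: "finite ?I" "finite ?N" "finite ?R" "finite ?E"
    using V(2) simple_graphD(2)[OF simple_graph_contract[OF G xyV(1,3)]] by (auto intro: finite_Image)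
  let ?g = "\<lambda>e. if e \<in> E then e else if fst e = x then (y, snd e) else (fst e, y)"
  have inverse: "?g (?h (a, b)) = (a, b)" if ab: "(a, b) \<in> ?I - ?R" for a b
  proof -
    have "a \<noteq> b" and e: "(a, b) \<in> E" using ab V(4) by (auto simp: irrefl_def)
    consider "a = y" | "b = y" | "a \<noteq> y" "b \<noteq> y" by blast
    thus ?thesis
    proof cases
      case 1
      hence "b \<noteq> x" "b \<noteq> y" "(x, b) \<notin> E" using ab \<open>a \<noteq> b\<close> by auto
      thus ?thesis using 1 xyV(3) by (simp add: contract_def)
    next
      case 2
      hence "a \<noteq> x" "a \<noteq> y" "(y, a) \<in> E" using ab \<open>a \<noteq> b\<close> symD[OF V(3) e] by auto
      moreover from this have "(a, x) \<notin> E" using 2 ab symD[OF V(3), of a x] by auto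
      ultimately show ?thesis using 2 xyV(3) by (simp add: contract_def)
    next
      case 3
      thus ?thesis using e by (simp add: contract_def)
    qed
  qed
  have "inj_on ?h (?I - ?R)"
  proof (rule inj_on_inverseI[where g = ?g])
    show "?g (?h e) = e" if "e \<in> ?I - ?R" for e
      using inverse[of "fst e" "snd e"] that unfolding prod.collapse .
  qed
  moreover have "?h ` (?I - ?R) \<subseteq> {e \<in> ?E. fst e \<in> V - {y} - X \<or> snd e \<in> V - {y} - X}"
  proof (rule subsetI, elim imageE)
    fix e' e assume e: "e' = ?h e" "e \<in> ?I - ?R"
    obtain a b where ab: "e = (a, b)" by (cases e)
    have "contract x y a \<noteq> contract x y b" using e ab V(4) by (auto simp: contract_def irrefl_def)
    hence "?h e \<in> ?E" using e ab by (auto simp: contract_edges_def)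
    thus "e' \<in> {e \<in> ?E. fst e \<in> V - {y} - X \<or> snd e \<in> V - {y} - X}"
      using e ab xyV xy by (auto simp: contract_def)
  qed
  ultimately have "card (?I - ?R) \<le> num_incident ?E (V - {y} - X)"
    unfolding num_incident_def using fin(4) by (intro card_inj_on_le[where f = ?h]) auto
  moreover have "card ?R \<le> 2 + 2 * card ?N"
  proof -
    have "card ({y} \<times> ?N \<union> ?N \<times> {y}) \<le> card ({y} \<times> ?N) + card (?N \<times> {y})" by (rule card_Un_le)
    moreover have "card ?R \<le> card {(x, y), (y, x)} + card ({y} \<times> ?N \<union> ?N \<times> {y})" by (rule card_Un_le)
    moreover have "card {(x, y), (y, x)} \<le> 2" using card_length[of "[(x, y), (y, x)]"] by simp
    ultimately show ?thesis by (simp add: card_cartesian_product)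
  qed
  moreover have "card ?I \<le> card (?I - ?R) + card ?R" using diff_card_le_card_Diff[OF fin(3), of ?I] by simp
  ultimately show ?thesis by (simp add: num_incident_def)
qed

context
  fixes V :: "'a set" and E :: "'a rel" and X :: "'a set" and c \<kappa> :: nat
  assumes G: "simple_graph V E" and XV: "X \<subseteq> V" and X_le: "card X \<le> \<kappa>" and massed: "massed c V E X"
    and IH: "\<And>(V' :: 'a set) E' X'. card V' < card V \<Longrightarrow> simple_graph V' E' \<Longrightarrow> X' \<subseteq> V' \<Longrightarrow> card X' \<le> \<kappa> \<Longrightarrow>
      massed c V' E' X' \<Longrightarrow> linked V' E' X'"
begin

lemma linked_of_linked_separation:
  assumes "linked_separation V E X A0 B0"
  shows "linked V E X"
proof -
  note V = simple_graphD[OF G]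
  let ?P = "\<lambda>(A, B). linked_separation V E X A B"
  obtain A B where AB: "linked_separation V E X A B"
    and min: "\<And>A' B'. linked_separation V E X A' B' \<Longrightarrow> card A \<le> card A'"
    using ex_has_least_nat[of ?P "(A0, B0)" "\<lambda>(A, B). card A"] assms by fast
  define T where "T = torso E A (A \<inter> B)"
  have s: "separation V E A B" "X \<subseteq> A" "card (A \<inter> B) < card X" "linked B (Restr E B) (A \<inter> B)" "B - A \<noteq> {}"
    using AB by (auto simp: linked_separation_def)
  have un: "A \<union> B = V" and fin: "finite A" "finite B"
    using s(1) finite_separation[OF s(1) V(1)] by (auto simp: separation_def)
  have G': "simple_graph A T" unfolding T_def using un by (intro simple_graph_torso[OF G]) auto
  have smaller: "card A < card V" using s(5) un V(1) by (intro psubset_card_mono) auto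
  have "massed c A T X" unfolding massed_def
  proof (intro conjI notI)
    show "c * card (A - X) < num_incident T (A - X)"
      using num_incident_separation[OF G s(1,2)] massedD(1)[OF massed] massedD(2)[OF massed s(1-3)]
      by (simp add: T_def algebra_simps)
    assume "\<exists>P Q. overfull_separation c A T X P Q"
    then obtain P Q where PQ: "overfull_separation c A T X P Q" and mQ: "massed c Q (Restr T Q) (P \<inter> Q)"
      using massed_side_of_overfull[OF G'] by blast
    have sep: "separation A T P Q" "X \<subseteq> P" "card (P \<inter> Q) < card X" "c * card (Q - P) < num_incident T (Q - P)"
      using PQ by (auto simp: overfull_separation_def)
    have PQA: "P \<union> Q = A" using sep(1) by (auto simp: separation_def)
    have ne: "Q - P \<noteq> {}" using sep(4) num_incident_empty[of T] by force
    consider "A \<inter> B \<subseteq> P" | "A \<inter> B \<subseteq> Q" using separation_torso[of A E "A \<inter> B" P Q] sep(1) by (auto simp: T_def)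
    thus False
    proof cases
      case 1
      have "Restr E A \<subseteq> T \<union> P \<times> P" by (auto simp: T_def torso_def)
      note ext = separation_extend_left[OF separation_swap[OF V(3) s(1)] sep(1) _ this]
      have "num_incident E (Q - P) \<le> c * card (Q - P)"
        using massedD(2)[OF massed ext(1)] ext(2,3) 1 sep(2,3) by (auto simp: Int_commute)
      moreover have "num_incident T (Q - P) \<le> num_incident E (Q - P)"
        by (rule num_incident_mono) (use V(2) 1 in \<open>auto simp: T_def torso_def\<close>)
      ultimately show False using sep(4) by simp
    next
      case 2
      have "card Q \<le> card A" using PQA fin(1) by (intro card_mono) auto
      hence "linked Q (Restr T Q) (P \<inter> Q)"
        using smaller sep(3) X_le PQA by (intro IH[OF _ simple_graph_Restr[OF G'] _ _ mQ]) auto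
      hence "linked_separation V E X P (Q \<union> B)"
        using linked_separation_of_torso[OF V(3) fin(1) s(1,4)] G' sep(1-3) 2 ne unfolding T_def by blast
      from min[OF this] have "card A \<le> card P" .
      moreover have "card P < card A" using PQA ne fin by (intro psubset_card_mono) auto
      ultimately show False by simp
    qed
  qed
  hence "linked A T X" using IH[OF smaller G' s(2) X_le] by simp
  thus ?thesis using linked_torso[OF G un s(4)] by (simp add: T_def)
qed

lemma linked_of_tight_separation:
  assumes s: "separation V E A B" "X \<subseteq> A" "card (A \<inter> B) = card X" "B \<noteq> V" "c * card (B - A) < num_incident E (B - A)"
  shows "linked V E X"
proof -
  have mB: "massed c B (Restr E B) (A \<inter> B)"
    by (rule massed_side[OF G s(1,2,5)]) (use massedD(2)[OF massed] s(3) in auto)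
  have BV: "B \<subseteq> V" using s(1) by (auto simp: separation_def)
  hence "card B < card V" using s(4) simple_graphD(1)[OF G] by (intro psubset_card_mono) auto
  hence "linked B (Restr E B) (A \<inter> B)"
    using s(3) X_le by (intro IH[OF _ simple_graph_Restr[OF G BV] _ _ mB]) auto
  hence "linked V E X \<or> (\<exists>P Q. linked_separation V E X P Q)"
    by (intro linked_or_linked_separation[OF G s(1,2)]) (use s(3) in \<open>auto intro: linked_subset[of B _ "A \<inter> B"]\<close>)
  thus ?thesis using linked_of_linked_separation by blast
qed

lemma linked_of_overfull_contraction:
  assumes xy: "(x, y) \<in> E" "x \<notin> X" "y \<notin> X"
    and tight: "\<And>A B. separation V E A B \<Longrightarrow> X \<subseteq> A \<Longrightarrow> card (A \<inter> B) \<le> card X \<Longrightarrow> B \<noteq> V \<Longrightarrow>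
      num_incident E (B - A) \<le> c * card (B - A)"
    and over: "overfull_separation c (V - {y}) (contract_edges x y E) X A0 B0"
  shows "linked V E X"
proof -
  note V = simple_graphD[OF G]
  have xyV: "x \<in> V" "y \<in> V" "x \<noteq> y" using V xy by (auto simp: irrefl_def)
  let ?V = "V - {y}" and ?E = "contract_edges x y E"
  have G': "simple_graph ?V ?E" by (rule simple_graph_contract[OF G xyV(1,3)])
  obtain A B where "overfull_separation c ?V ?E X A B" and mB: "massed c B (Restr ?E B) (A \<inter> B)"
    by (rule massed_side_of_overfull[OF G' over])
  hence s: "separation ?V ?E A B" "X \<subseteq> A" "card (A \<inter> B) < card X" "c * card (B - A) < num_incident ?E (B - A)"
    by (auto simp: overfull_separation_def)
  have sub: "A \<subseteq> ?V" "B \<subseteq> ?V" and fin: "finite A" "finite B"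
    using s(1) finite_separation[OF s(1)] V(1) by (auto simp: separation_def)
  let ?A = "uncontract V x y A" and ?B = "uncontract V x y B"
  have sep: "separation V E ?A ?B" by (rule separation_uncontract[OF s(1) xyV(1,3)])
  have XA: "X \<subseteq> ?A" using s(2) XV xy by (auto simp: mem_uncontract)
  show ?thesis
  proof (cases "x \<in> A \<inter> B")
    case True
    have I: "?A \<inter> ?B = insert y (A \<inter> B)" "?B - ?A = B - A"
      using True sub xyV(2) by (auto simp: uncontract_Int uncontract_Diff uncontract_eq)
    have "?B \<noteq> V"
    proof
      assume "?B = V"
      hence "A \<subseteq> B" using sub True xyV(2) by (auto simp: uncontract_eq)
      thus False using s(2,3) card_mono[OF fin(1) s(2)] by (simp add: Int_absorb2)
    qed
    moreover have "card (?A \<inter> ?B) \<le> card X" unfolding I(1) using s(3) fin by (simp add: card_insert_if)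
    ultimately have "num_incident E (B - A) \<le> c * card (B - A)" using tight[OF sep XA] I(2) by simp
    moreover have "num_incident ?E (B - A) \<le> num_incident E (B - A)"
    proof -
      have "{e \<in> ?E. fst e \<in> B - A \<or> snd e \<in> B - A} \<subseteq>
          map_prod (contract x y) (contract x y) ` {e \<in> E. fst e \<in> B - A \<or> snd e \<in> B - A}"
        using True by (auto simp: contract_edges_def contract_def split: if_splits)
      thus ?thesis unfolding num_incident_def using V(2) by (intro surj_card_le) auto
    qed
    ultimately show ?thesis using s(4) by simp
  next
    case False
    have "card B < card V" using sub(2) xyV V(1) by (intro psubset_card_mono) auto
    hence "linked B (Restr ?E B) (A \<inter> B)"
      using s(3) X_le by (intro IH[OF _ simple_graph_Restr[OF G' sub(2)] _ _ mB]) auto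
    hence "linked ?B (Restr E ?B) (A \<inter> B)" by (rule linked_uncontract[OF G xy(1) _ sub(2)]) (use False in auto)
    moreover have "?A \<inter> ?B = A \<inter> B"
      unfolding uncontract_Int using False sub xyV(2) by (subst uncontract_eq) auto
    moreover have "B - A \<noteq> {}" using s(4) num_incident_empty[of ?E] by force
    hence "?B - ?A \<noteq> {}" using sub xyV(2) by (auto simp: uncontract_Diff uncontract_eq)
    ultimately have "linked_separation V E X ?A ?B" unfolding linked_separation_def using sep XA s(3) by auto
    thus ?thesis by (rule linked_of_linked_separation)
  qed
qed

lemma separation_not_overfull:
  assumes "\<not> linked V E X" "separation V E A B" "X \<subseteq> A" "card (A \<inter> B) \<le> card X" "B \<noteq> V"
  shows "num_incident E (B - A) \<le> c * card (B - A)"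
proof (cases "card (A \<inter> B) < card X")
  case True
  thus ?thesis using massedD(2)[OF massed assms(2,3)] by simp
next
  case False
  thus ?thesis using linked_of_tight_separation[OF assms(2,3) _ assms(5)] assms(1,4)
    by (meson le_neq_implies_less not_le)
qed

lemma degree_lower_bound:
  assumes nl: "\<not> linked V E X" and v: "v \<in> V - X"
  shows "c < 2 * card (E `` {v})"
proof (rule ccontr)
  assume "\<not> ?thesis"
  hence "massed c (V - {v}) (Restr E (V - {v})) X"
    by (intro massed_delete_vertex[OF G v _ massedD(1)[OF massed] separation_not_overfull[OF nl]]) auto
  moreover have "card (V - {v}) < card V" using v simple_graphD(1)[OF G] by (meson DiffD1 card_Diff1_less)
  ultimately have "linked (V - {v}) (Restr E (V - {v})) X"
    using v XV X_le by (intro IH[OF _ simple_graph_Restr[OF G]]) auto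
  thus False using linked_mono[of "V - {v}" "Restr E (V - {v})" X V E] nl by auto
qed

lemma common_neighbours_lower_bound:
  assumes nl: "\<not> linked V E X" and xy: "(x, y) \<in> E" "x \<notin> X" "y \<notin> X"
  shows "c < 2 + 2 * card (E `` {x} \<inter> E `` {y})"
proof (rule ccontr)
  assume few: "\<not> ?thesis"
  note V = simple_graphD[OF G]
  have xyV: "x \<in> V" "y \<in> V" "x \<noteq> y" using V xy by (auto simp: irrefl_def)
  let ?V = "V - {y}" and ?E = "contract_edges x y E"
  have G': "simple_graph ?V ?E" by (rule simple_graph_contract[OF G xyV(1,3)])
  have XV': "X \<subseteq> ?V" using XV xy by auto
  have eq: "?V - X = V - X - {y}" by auto
  have "card (V - X) = Suc (card (?V - X))" unfolding eq using xyV xy V(1) by (intro card.remove) auto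
  hence "c * card (?V - X) < num_incident ?E (?V - X)"
    using num_incident_contract[OF G xy] massedD(1)[OF massed] few by simp
  moreover have "\<not> overfull_separation c ?V ?E X A B" for A B
    using linked_of_overfull_contraction[OF xy separation_not_overfull[OF nl]] nl by blast
  ultimately have "massed c ?V ?E X" unfolding massed_def by blast
  moreover have "card ?V < card V" using xyV V(1) by (meson card_Diff1_less)
  ultimately have L: "linked ?V ?E X" using IH[OF _ G' XV' X_le] by simp
  have "Restr ?E ?V = ?E" using simple_graphD(5)[OF G'] by auto
  hence "linked (uncontract V x y ?V) (Restr E (uncontract V x y ?V)) X"
    using L xy XV' by (intro linked_uncontract[OF G xy(1)]) auto
  hence "linked V E X" by (rule linked_mono) (auto simp: uncontract_def)
  thus False using nl by simp
qed

lemma linked_of_hub: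
  assumes hub: "hub E U H (4 * \<kappa>)" "H \<subseteq> U" "U \<subseteq> V" "\<kappa> < card U"
  shows "linked V E X"
proof -
  note V = simple_graphD[OF G]
  have VU: "V \<inter> U = U" using hub(3) by auto
  have "linked V E X \<or> (\<exists>P Q. linked_separation V E X P Q)"
  proof (rule linked_or_linked_separation[OF G _ XV])
    show "separation V E V U" using hub(3) by (auto simp: separation_def)
    show "card X \<le> card (V \<inter> U)" using hub(4) X_le VU by simp
    fix Z assume Z: "Z \<subseteq> V \<inter> U" "card Z \<le> card X"
    hence "finite Z" using V(1) finite_subset by blast
    thus "linked U (Restr E U) Z" using Z X_le hub(2)
      by (intro hub_linked[OF sym_Restr[OF V(3)] hub_Restr[OF hub(1,2)]]) auto
  qed
  thus ?thesis using linked_of_linked_separation by blast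
qed

lemma low_degree_vertex:
  assumes upper: "num_incident E (V - X) \<le> c * card (V - X) + 2" and ne: "V - X \<noteq> {}"
  shows "\<exists>v\<in>V - X. card (E `` {v}) \<le> c + 2"
proof (rule ccontr)
  note V = simple_graphD[OF G]
  assume "\<not> ?thesis"
  hence "c + 3 \<le> card (E `` {v})" if "v \<in> V - X" for v using that by force
  hence "(\<Sum>v\<in>V - X. c + 3) \<le> (\<Sum>v\<in>V - X. card (E `` {v}))" by (rule sum_mono)
  also have "\<dots> \<le> num_incident E (V - X)" using V by (intro sum_degree_le_num_incident) auto
  finally have "card (V - X) * (c + 3) \<le> c * card (V - X) + 2" using upper by simp
  moreover have "0 < card (V - X)" using ne V(1) by (auto simp: card_gt_0_iff)
  ultimately show False by (simp add: algebra_simps)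
qed

lemma linked_induction_step:
  assumes IH_edges: "\<And>E'. card E' < card E \<Longrightarrow> simple_graph V E' \<Longrightarrow> massed c V E' X \<Longrightarrow> linked V E' X"
    and c: "linking_const * (\<kappa> + 1) \<le> c"
  shows "linked V E X"
proof (rule ccontr)
  assume nl: "\<not> linked V E X"
  note V = simple_graphD[OF G]
  have fN: "finite (E `` {v})" for v using V(2) by (rule finite_Image)
  have fX: "finite X" using XV V(1) finite_subset by auto
  have outside: "\<exists>w. (v, w) \<in> E \<and> w \<notin> X" if "v \<in> V - X" for v
  proof (rule ccontr)
    assume "\<not> ?thesis"
    hence "card (E `` {v}) \<le> card X" using fX by (intro card_mono) auto
    thus False using degree_lower_bound[OF nl that] X_le linking_const_bound[OF c] by simp
  qed
  have ne: "V - X \<noteq> {}" using massedD(1)[OF massed] num_incident_empty[of E] by force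
  then obtain x where x: "x \<in> V - X" by auto
  then obtain y where xy: "(x, y) \<in> E" "x \<notin> X" "y \<notin> X" using outside by blast
  have "num_incident E (V - X) \<le> c * card (V - X) + 2"
  proof (rule ccontr)
    assume "\<not> ?thesis"
    hence "massed c V (E - {(x, y), (y, x)}) X"
      by (intro massed_delete_edge[OF G xy _ separation_not_overfull[OF nl]]) auto
    moreover have "card (E - {(x, y), (y, x)}) < card E" using xy V(2) by (intro psubset_card_mono) auto
    moreover have "simple_graph V (E - {(x, y), (y, x)})" using G by (auto simp: simple_graph_def sym_def irrefl_def)
    ultimately have "linked V (E - {(x, y), (y, x)}) X" by (intro IH_edges)
    hence "linked V E X" by (rule linked_mono) auto
    thus False using nl by simp
  qed
  from low_degree_vertex[OF this ne] obtain v where v: "v \<in> V - X" "card (E `` {v}) \<le> c + 2" by auto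
  define J where "J = E `` {v} - X"
  have J: "finite J" "card J \<le> c + 2" "J \<noteq> {}"
    using fN[of v] v(2) card_mono[of "E `` {v}" J] outside[OF v(1)] by (auto simp: J_def)
  have "c \<le> 2 * card (E `` {w} \<inter> J) + 2 * \<kappa> + 4" if "w \<in> J" for w
  proof -
    have "E `` {v} \<inter> E `` {w} \<subseteq> (E `` {w} \<inter> J) \<union> X" by (auto simp: J_def)
    hence "card (E `` {v} \<inter> E `` {w}) \<le> card ((E `` {w} \<inter> J) \<union> X)" using fN fX by (intro card_mono) auto
    hence "card (E `` {v} \<inter> E `` {w}) \<le> card (E `` {w} \<inter> J) + \<kappa>"
      using card_Un_le[of "E `` {w} \<inter> J" X] X_le by linarith
    thus ?thesis using common_neighbours_lower_bound[OF nl, of v w] that v by (auto simp: J_def)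
  qed
  then obtain U H where "U \<subseteq> J" "H \<subseteq> U" "hub E U H (4 * \<kappa>)" "\<kappa> < card U"
    by (rule dense_neighbourhood_contains_hub[OF V(3) J(1) c J(2,3)])
  thus False using linked_of_hub[of U H] V(5) nl by (auto simp: J_def)
qed

end

theorem massed_linked:
  assumes "simple_graph V E" "X \<subseteq> V" "card X \<le> \<kappa>" "linking_const * (\<kappa> + 1) \<le> c" "massed c V E X"
  shows "linked V E X"
  using assms
proof (induction "card V" arbitrary: V E X rule: less_induct)
  case outer: less
  note c = outer.prems(4)
  from outer.prems show ?case
  proof (induction "card E" arbitrary: E rule: less_induct)
    case inner: less
    show ?case
    proof (rule linked_induction_step[OF inner.prems(1-3,5)])
      show "linked V' E' X'" if "card V' < card V" "simple_graph V' E'" "X' \<subseteq> V'" "card X' \<le> \<kappa>" "massed c V' E' X'"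
        for V' :: "'a set" and E' X'
        using outer.hyps[OF that(1-4) c that(5)] .
      show "linked V E' X" if "card E' < card E" "simple_graph V E'" "massed c V E' X" for E'
        using inner.hyps[OF that(1,2) inner.prems(2,3) c that(3)] .
    qed (rule c)
  qed
qed

section \<open>Highly connected subgraphs\<close>

definition vertex_connected :: "nat \<Rightarrow> 'a set \<Rightarrow> 'a rel \<Rightarrow> bool" where
  "vertex_connected k V E \<longleftrightarrow> (\<forall>A B. separation V E A B \<longrightarrow> card (A \<inter> B) < k \<longrightarrow> A \<subseteq> B \<or> B \<subseteq> A)"

definition mader_dense :: "real \<Rightarrow> nat \<Rightarrow> 'a rel \<Rightarrow> 'a set \<Rightarrow> bool" where
  "mader_dense a k E W \<longleftrightarrow> 2 * k \<le> card W \<and> a * real (card W) < real (edge_count E W W) + a * real k"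

context
  fixes V :: "'a set" and E :: "'a rel" and a :: real and k :: nat and W :: "'a set"
  assumes G: "simple_graph V E" and k: "1 \<le> k" "4 * real k \<le> a" and WV: "W \<subseteq> V" and W: "mader_dense a k E W"
    and min: "\<And>W'. W' \<subseteq> V \<Longrightarrow> mader_dense a k E W' \<Longrightarrow> card W \<le> card W'"
begin

lemma finite_minimal_mader_dense: "finite W"
  using WV simple_graphD(1)[OF G] finite_subset by auto

lemma card_minimal_mader_dense: "2 * k < card W"
proof (rule ccontr)
  assume "\<not> ?thesis"
  hence W2: "card W = 2 * k" using W by (simp add: mader_dense_def)
  have "a * real k < real (edge_count E W W)" using W unfolding mader_dense_def W2 by (simp add: algebra_simps)
  also have "\<dots> \<le> real (2 * k * (2 * k))"
    using edge_count_le[OF finite_minimal_mader_dense finite_minimal_mader_dense, of E] unfolding W2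
    by (simp only: of_nat_le_iff)
  finally have "a * real k < (4 * real k) * real k" by simp
  thus False using mult_right_mono[OF k(2), of "real k"] by simp
qed

lemma degree_minimal_mader_dense:
  assumes v: "v \<in> W"
  shows "a / 2 < real (card (E `` {v} \<inter> W))"
proof (rule ccontr)
  note fin = finite_minimal_mader_dense
  assume small: "\<not> ?thesis"
  have "real (edge_count E W W) \<le> real (edge_count E (W - {v}) (W - {v})) + a"
    using edge_count_remove_vertex[OF simple_graphD(3)[OF G] fin, of v] small by linarith
  moreover have card: "card (W - {v}) = card W - 1" "1 \<le> card W" using v fin card_minimal_mader_dense by auto
  hence "a * real (card (W - {v})) = a * real (card W) - a" by (simp add: of_nat_diff right_diff_distrib)
  ultimately have "mader_dense a k E (W - {v})"
    using card card_minimal_mader_dense W by (simp add: mader_dense_def)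
  hence "card W \<le> card (W - {v})" using WV by (intro min) auto
  thus False using card by simp
qed

lemma sparse_side_minimal_mader_dense:
  assumes "P \<subseteq> W" "v \<in> P" "E `` {v} \<inter> W \<subseteq> P" "P \<noteq> W"
  shows "real (edge_count E P P) + a * real k \<le> a * real (card P)"
proof -
  note fin = finite_minimal_mader_dense
  have "finite P" using assms(1) fin by (rule finite_subset)
  hence "card (E `` {v} \<inter> W) \<le> card P" using assms(3) by (intro card_mono)
  hence "2 * k \<le> card P" using degree_minimal_mader_dense[of v] assms(1,2) k(2) by force
  moreover have "card P < card W" using assms fin by (intro psubset_card_mono) auto
  hence "\<not> mader_dense a k E P" using min[of P] assms(1) WV by auto
  ultimately show ?thesis by (simp add: mader_dense_def not_less)
qed

lemma vertex_connected_minimal_mader_dense: "vertex_connected k W (Restr E W)"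
  unfolding vertex_connected_def
proof (intro allI impI, rule ccontr)
  fix P Q assume s: "separation W (Restr E W) P Q" "card (P \<inter> Q) < k" and nonempty: "\<not> (P \<subseteq> Q \<or> Q \<subseteq> P)"
  note E = simple_graphD[OF G]
  have PQ: "P \<union> Q = W" "Restr E W \<inter> (P - Q) \<times> (Q - P) = {}" "Restr E W \<inter> (Q - P) \<times> (P - Q) = {}"
    using s(1) separation_swap[OF sym_Restr[OF E(3)] s(1)] by (auto simp: separation_def)
  have fin: "finite P" "finite Q" using finite_separation[OF s(1) finite_minimal_mader_dense] by auto
  obtain v w where vw: "v \<in> P - Q" "w \<in> Q - P" using nonempty by auto
  have "E `` {v} \<inter> W \<subseteq> P" "E `` {w} \<inter> W \<subseteq> Q" using vw PQ by blast+
  hence side: "real (edge_count E P P) + a * real k \<le> a * real (card P)"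
    "real (edge_count E Q Q) + a * real k \<le> a * real (card Q)"
    using sparse_side_minimal_mader_dense[of P v] sparse_side_minimal_mader_dense[of Q w] vw PQ(1) by blast+
  have "Restr E W \<subseteq> Restr E P \<union> Restr E Q"
  proof
    fix e assume "e \<in> Restr E W"
    moreover obtain x y where "e = (x, y)" by (cases e)
    ultimately show "e \<in> Restr E P \<union> Restr E Q" using PQ by blast
  qed
  hence "edge_count E W W \<le> card (Restr E P \<union> Restr E Q)"
    unfolding edge_count_def using fin by (intro card_mono) auto
  also have "\<dots> \<le> edge_count E P P + edge_count E Q Q" unfolding edge_count_def by (rule card_Un_le)
  finally have "edge_count E W W \<le> edge_count E P P + edge_count E Q Q" .
  hence "real (edge_count E W W) \<le> a * (real (card P) + real (card Q)) - 2 * (a * real k)"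
    using side by (simp add: distrib_left)
  also have "real (card P) + real (card Q) = real (card W) + real (card (P \<inter> Q))"
    using card_Un_Int[OF fin] PQ(1) by (metis of_nat_add)
  also have "a * (real (card W) + real (card (P \<inter> Q))) \<le> a * (real (card W) + real k)" using s(2) k by simp
  finally show False using W by (simp add: mader_dense_def algebra_simps)
qed

end

theorem mader:
  fixes a :: real and k :: nat
  assumes G: "simple_graph V E" and ne: "V \<noteq> {}" and k: "1 \<le> k" "4 * real k \<le> a" and dens: "a * real (card V) \<le> real (card E)"
  obtains W where "W \<subseteq> V" "W \<noteq> {}" "\<And>v. v \<in> W \<Longrightarrow> a / 2 < real (card (E `` {v} \<inter> W))"
    "vertex_connected k W (Restr E W)"
    "a * real (card W) < real (card (Restr E W)) + a * real k"
proof -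
  note E = simple_graphD[OF G]
  have "real (card V) * a \<le> real (card V) * real (card V)"
    using dens edge_count_le[OF E(1,1), of E] unfolding simple_graph_card_edges(1)[OF G]
    by (metis mult.commute of_nat_le_iff of_nat_mult order_trans)
  moreover have "0 < card V" using ne E(1) by (simp add: card_gt_0_iff)
  ultimately have "a \<le> real (card V)" by simp
  hence "2 * k \<le> card V" using k(2) by linarith
  moreover have "0 < a * real k" using k by simp
  ultimately have "V \<subseteq> V \<and> mader_dense a k E V"
    using dens simple_graph_card_edges(1)[OF G] by (simp add: mader_dense_def)
  from ex_has_least_nat[of "\<lambda>W. W \<subseteq> V \<and> mader_dense a k E W", OF this, of card]
  obtain W where W: "W \<subseteq> V" "mader_dense a k E W" "\<And>W'. W' \<subseteq> V \<Longrightarrow> mader_dense a k E W' \<Longrightarrow> card W \<le> card W'"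
    by auto
  show thesis
  proof (rule that[OF W(1)])
    show "W \<noteq> {}" using card_minimal_mader_dense[OF G k W] by auto
    show "a / 2 < real (card (E `` {v} \<inter> W))" if "v \<in> W" for v
      by (rule degree_minimal_mader_dense[OF G k W that])
    show "vertex_connected k W (Restr E W)" by (rule vertex_connected_minimal_mader_dense[OF G k W])
    show "a * real (card W) < real (card (Restr E W)) + a * real k"
      using W(2) by (simp add: mader_dense_def edge_count_def)
  qed
qed

lemma massed_of_connected:
  assumes G: "simple_graph V E" and X: "X \<subset> V"
    and deg: "\<And>v. v \<in> V \<Longrightarrow> c < card (E `` {v})"
    and con: "vertex_connected (card X) V E"
  shows "massed c V E X"
proof (rule massedI)
  note V = simple_graphD[OF G]
  have "(\<Sum>v\<in>V - X. c) < (\<Sum>v\<in>V - X. card (E `` {v}))"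
    using X V(1) deg by (intro sum_strict_mono) auto
  also have "\<dots> \<le> num_incident E (V - X)" using V by (intro sum_degree_le_num_incident) auto
  finally show "c * card (V - X) < num_incident E (V - X)" by (simp add: mult.commute)
  fix A B assume s: "separation V E A B" "X \<subseteq> A" "card (A \<inter> B) < card X"
  have "\<not> A \<subseteq> B"
  proof
    assume "A \<subseteq> B"
    hence "A \<inter> B = A" by auto
    thus False using s(3) card_mono[OF finite_separation(1)[OF s(1) V(1)] s(2)] by simp
  qed
  hence "B - A = {}" using con s(1,3) unfolding vertex_connected_def by blast
  thus "num_incident E (B - A) \<le> c * card (B - A)" by (metis num_incident_empty zero_le)
qed

lemma highly_connected_linked:
  assumes G: "simple_graph W M" and J: "J \<subseteq> W" "W \<noteq> {}" and X: "X \<subseteq> W - J" "card X \<le> \<kappa>" "card J + card X \<le> k"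
    and deg: "\<And>v. v \<in> W \<Longrightarrow> linking_const * (\<kappa> + 1) + card J < card (M `` {v})"
    and con: "vertex_connected k W M"
  shows "linked (W - J) (Restr M (W - J)) X"
proof -
  note W = simple_graphD[OF G]
  let ?M = "Restr M (W - J)"
  have fJ: "finite J" using J(1) W(1) finite_subset by auto
  have G': "simple_graph (W - J) ?M" by (rule simple_graph_Restr[OF G]) auto
  have deg': "linking_const * (\<kappa> + 1) < card (?M `` {v})" if v: "v \<in> W - J" for v
  proof -
    have "M `` {v} \<subseteq> ?M `` {v} \<union> J" using v W(5) by auto
    hence "card (M `` {v}) \<le> card (?M `` {v} \<union> J)" using W(2) fJ by (intro card_mono) (auto intro: finite_Image)
    thus ?thesis using deg[of v] v card_Un_le[of "?M `` {v}" J] by simp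
  qed
  have "X \<noteq> W - J"
  proof
    assume eq: "X = W - J"
    obtain v where v: "v \<in> W" using J(2) by auto
    have "card (M `` {v}) \<le> card W" using W by (intro card_mono) auto
    also have "\<dots> \<le> card X + card J" unfolding eq using diff_card_le_card_Diff[OF fJ, of W] by simp
    finally have "linking_const * (\<kappa> + 1) < \<kappa>" using deg[OF v] X(2) by simp
    thus False using linking_const_bound[of \<kappa> "linking_const * (\<kappa> + 1)"] by simp
  qed
  hence "massed (linking_const * (\<kappa> + 1)) (W - J) ?M X"
  proof (intro massed_of_connected[OF G' _ deg'])
    show "vertex_connected (card X) (W - J) ?M"
      unfolding vertex_connected_def
    proof (intro allI impI)
      fix P Q assume s: "separation (W - J) ?M P Q" "card (P \<inter> Q) < card X"
      have "separation W M (P \<union> J) (Q \<union> J)" using s(1) J(1) by (auto simp: separation_def)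
      moreover have "(P \<union> J) \<inter> (Q \<union> J) = (P \<inter> Q) \<union> J" by auto
      hence "card ((P \<union> J) \<inter> (Q \<union> J)) < k" using card_Un_le[of "P \<inter> Q" J] s(2) X(3) by simp
      ultimately have "P \<union> J \<subseteq> Q \<union> J \<or> Q \<union> J \<subseteq> P \<union> J" using con unfolding vertex_connected_def by blast
      moreover have "P \<inter> J = {}" "Q \<inter> J = {}" using s(1) by (auto simp: separation_def)
      ultimately show "P \<subseteq> Q \<or> Q \<subseteq> P" by blast
    qed
  qed (use X(1) in auto)
  thus ?thesis by (rule massed_linked[OF G' X(1,2) order.refl])
qed

section \<open>Topological minors\<close>

definition path_via :: "'a rel \<Rightarrow> 'a set \<Rightarrow> 'a \<Rightarrow> 'a \<Rightarrow> bool" where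
  "path_via E I x y \<longleftrightarrow> (x, y) \<in> E \<or> (\<exists>C\<subseteq>I. connector E x y C)"

lemma path_via_mono:
  assumes "path_via E I x y" "E \<subseteq> E'" "I \<subseteq> I'"
  shows "path_via E' I' x y"
proof -
  have "connector E' x y C" if "connector E x y C" for C
    using that assms(2) by (auto simp: connector_def intro: connected_in_mono)
  thus ?thesis using assms unfolding path_via_def by blast
qed

text \<open>
  \<open>I {u, v}\<close> contains the interior of the path that replaces the edge \<open>uv\<close>; the path itself is
  extracted from a connected set only at the end.
\<close>

definition topological_minor :: "'a set \<Rightarrow> 'a rel \<Rightarrow> 'w set \<Rightarrow> 'w rel \<Rightarrow> bool" where
  "topological_minor V E VH EH \<longleftrightarrow> (\<exists>f I. inj_on f VH \<and> f ` VH \<subseteq> V \<and>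
     (\<forall>u v. (u, v) \<in> EH \<longrightarrow> I {u, v} \<subseteq> V - f ` VH \<and> path_via E (I {u, v}) (f u) (f v)) \<and>
     (\<forall>u v x y. (u, v) \<in> EH \<longrightarrow> (x, y) \<in> EH \<longrightarrow> {u, v} \<noteq> {x, y} \<longrightarrow> I {u, v} \<inter> I {x, y} = {}))"

lemma topological_minorE:
  assumes "topological_minor V E VH EH"
  obtains f I where "inj_on f VH" "f ` VH \<subseteq> V" "\<And>u v. (u, v) \<in> EH \<Longrightarrow> I {u, v} \<subseteq> V - f ` VH"
    "\<And>u v. (u, v) \<in> EH \<Longrightarrow> path_via E (I {u, v}) (f u) (f v)"
    "\<And>u v x y. (u, v) \<in> EH \<Longrightarrow> (x, y) \<in> EH \<Longrightarrow> {u, v} \<noteq> {x, y} \<Longrightarrow> I {u, v} \<inter> I {x, y} = {}"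
proof -
  obtain f I where fI: "inj_on f VH" "f ` VH \<subseteq> V"
    "\<forall>u v. (u, v) \<in> EH \<longrightarrow> I {u, v} \<subseteq> V - f ` VH \<and> path_via E (I {u, v}) (f u) (f v)"
    "\<forall>u v x y. (u, v) \<in> EH \<longrightarrow> (x, y) \<in> EH \<longrightarrow> {u, v} \<noteq> {x, y} \<longrightarrow> I {u, v} \<inter> I {x, y} = {}"
    using assms unfolding topological_minor_def by (elim exE conjE) (rule that)
  show thesis by (rule that[OF fI(1,2), of I]) (use fI(3,4) in simp_all)
qed

lemma topological_minor_mono:
  assumes "topological_minor V E VH EH" "V \<subseteq> V'" "E \<subseteq> E'"
  shows "topological_minor V' E' VH EH"
proof -
  obtain f I where fI: "inj_on f VH" "f ` VH \<subseteq> V" "\<And>u v. (u, v) \<in> EH \<Longrightarrow> I {u, v} \<subseteq> V - f ` VH"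
    "\<And>u v. (u, v) \<in> EH \<Longrightarrow> path_via E (I {u, v}) (f u) (f v)"
    "\<And>u v x y. (u, v) \<in> EH \<Longrightarrow> (x, y) \<in> EH \<Longrightarrow> {u, v} \<noteq> {x, y} \<Longrightarrow> I {u, v} \<inter> I {x, y} = {}"
    by (rule topological_minorE[OF assms(1)]) (rule that, simp_all)
  show ?thesis unfolding topological_minor_def
  proof (intro exI[of _ f] exI[of _ I] conjI allI impI)
    show "path_via E' (I {u, v}) (f u) (f v)" if "(u, v) \<in> EH" for u v
      using path_via_mono[OF fI(4)[OF that] assms(3) order.refl] .
    show "I {u, v} \<subseteq> V' - f ` VH" if "(u, v) \<in> EH" for u v using fI(3)[OF that] assms(2) by auto
  qed (use fI assms(2) in auto)
qed

lemma topological_minor_of_arc_sets: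
  assumes f: "inj_on f VH" "f ` VH \<subseteq> V" and EH: "sym EH"
    and P: "disjoint_family_on P EH" "\<And>e. e \<in> EH \<Longrightarrow> P e \<subseteq> V - f ` VH"
    and via: "\<And>u v. (u, v) \<in> EH \<Longrightarrow> path_via E (P (u, v) \<union> P (v, u)) (f u) (f v)"
  shows "topological_minor V E VH EH"
proof -
  define I where "I e = (\<Union>(u, v)\<in>{(u, v) \<in> EH. {u, v} = e}. P (u, v))" for e
  have I: "I {u, v} = P (u, v) \<union> P (v, u)" if "(u, v) \<in> EH" for u v
    using that symD[OF EH] by (fastforce simp: I_def doubleton_eq_iff)
  show ?thesis unfolding topological_minor_def
  proof (intro exI[of _ f] exI[of _ I] conjI allI impI)
    fix u v assume e: "(u, v) \<in> EH"
    show "I {u, v} \<subseteq> V - f ` VH" using P(2) e symD[OF EH e] by (simp add: I)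
    show "path_via E (I {u, v}) (f u) (f v)" using via e by (simp add: I)
    fix x y assume e': "(x, y) \<in> EH" and "{u, v} \<noteq> {x, y}"
    hence "P a \<inter> P b = {}" if "a \<in> {(u, v), (v, u)}" "b \<in> {(x, y), (y, x)}" for a b
      using that e e' symD[OF EH] by (intro disjoint_family_onD[OF P(1)]) auto
    thus "I {u, v} \<inter> I {x, y} = {}" using e e' by (simp add: I Int_Un_distrib Int_Un_distrib2)
  qed (use f in auto)
qed

lemma pairing_of_arcs:
  assumes H: "simple_graph VH EH" and x: "inj_on x EH"
  obtains Q where "pairing Q (x ` EH)" "\<And>h h'. (h, h') \<in> EH \<Longrightarrow> (x (h, h'), x (h', h)) \<in> Q \<or> (x (h', h), x (h, h')) \<in> Q"
proof -
  note H = simple_graphD[OF H]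
  obtain idx :: "'a \<Rightarrow> nat" where idx: "inj_on idx VH" using finite_imp_inj_to_nat_seg[OF H(1)] by auto
  define R where "R = {(e, prod.swap e) | e. e \<in> EH \<and> idx (fst e) < idx (snd e)}"
  have "pairing R EH" unfolding pairing_def disjoint_family_on_def
    using symD[OF H(3)] by (auto simp: R_def)
  hence "pairing (map_prod x x ` R) (x ` EH)" using x by (intro pairing_image) auto
  moreover have "(x (h, h'), x (h', h)) \<in> map_prod x x ` R \<or> (x (h', h), x (h, h')) \<in> map_prod x x ` R"
    if e: "(h, h') \<in> EH" for h h'
  proof -
    have "idx h \<noteq> idx h'" using e idx H(4,5) by (auto simp: inj_on_def irrefl_def)
    hence "((h, h'), (h', h)) \<in> R \<or> ((h', h), (h, h')) \<in> R" using e symD[OF H(3) e] by (auto simp: R_def)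
    thus ?thesis by (force simp: image_iff)
  qed
  ultimately show thesis using that by blast
qed

section \<open>Dense cluster graphs\<close>

text \<open>
  A cluster consists of a connected core and some fringe vertices adjacent to it. The fringe vertices
  have two uses: as branch vertices of a subdivision they leave their own cluster through the cores in
  \<open>reach\<close>, and as ordinary vertices they make clusters adjacent.
\<close>

locale fringed_clusters =
  fixes V :: "'a set" and E :: "'a rel" and L :: "'l set" and core fringe :: "'l \<Rightarrow> 'a set"
    and reach :: "'a \<Rightarrow> 'l set" and q n :: nat
  assumes graph: "simple_graph V E" and finite_L: "finite L"
    and core: "l \<in> L \<Longrightarrow> connected_in E (core l)" "l \<in> L \<Longrightarrow> core l \<subseteq> V" "disjoint_family_on core L"
    and fringe: "l \<in> L \<Longrightarrow> finite (fringe l)" "l \<in> L \<Longrightarrow> card (fringe l) \<le> q" "disjoint_family_on fringe L"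
      "l \<in> L \<Longrightarrow> u \<in> fringe l \<Longrightarrow> u \<in> V \<and> (\<exists>w\<in>core l. (w, u) \<in> E)"
    and fringe_Int_core: "l \<in> L \<Longrightarrow> l' \<in> L \<Longrightarrow> fringe l \<inter> core l' = {}"
    and reach: "l \<in> L \<Longrightarrow> u \<in> fringe l \<Longrightarrow> card (reach u) \<le> n"
      "l \<in> L \<Longrightarrow> u \<in> fringe l \<Longrightarrow> x \<in> reach u \<Longrightarrow> x \<in> L \<and> (\<exists>w\<in>core x. (w, u) \<in> E)"
begin

definition outreach :: "'l \<Rightarrow> 'l set" where
  "outreach l = (\<Union>u\<in>fringe l. reach u) - {l}"

definition cluster_graph :: "'l rel" where
  "cluster_graph = {(l, l'). l \<in> L \<and> l' \<in> L \<and> (l' \<in> outreach l \<or> l \<in> outreach l')}"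

definition cluster :: "'l \<Rightarrow> 'a set" where
  "cluster l = core l \<union> fringe l"

lemma outreach_subset: "l \<in> L \<Longrightarrow> outreach l \<subseteq> L"
  using reach(2) by (auto simp: outreach_def)

lemma finite_outreach: "l \<in> L \<Longrightarrow> finite (outreach l)"
  using outreach_subset finite_L finite_subset by blast

lemma finite_reach: "l \<in> L \<Longrightarrow> u \<in> fringe l \<Longrightarrow> finite (reach u)"
  using reach(2) finite_L by (meson finite_subset subsetI)

lemma card_outreach_le:
  assumes "l \<in> L"
  shows "card (outreach l) \<le> q * n"
proof -
  have "card (outreach l) \<le> card (\<Union>u\<in>fringe l. reach u)"
    using fringe(1) finite_reach assms by (intro card_mono) (auto simp: outreach_def)
  also have "\<dots> \<le> (\<Sum>u\<in>fringe l. card (reach u))" using fringe(1)[OF assms] by (rule card_UN_le)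
  also have "\<dots> \<le> (\<Sum>u\<in>fringe l. n)" using reach(1)[OF assms] by (intro sum_mono)
  also have "\<dots> \<le> q * n" using fringe(2)[OF assms] by simp
  finally show ?thesis .
qed

lemma simple_graph_cluster_graph: "simple_graph L cluster_graph"
  unfolding simple_graph_def cluster_graph_def using finite_L by (auto simp: sym_def irrefl_def outreach_def)

lemma card_cluster_graph_ge: "(\<Sum>l\<in>L. card (outreach l)) \<le> card cluster_graph"
proof -
  have "Sigma L outreach \<subseteq> cluster_graph" using outreach_subset by (auto simp: cluster_graph_def)
  hence "card (Sigma L outreach) \<le> card cluster_graph"
    using simple_graphD(2)[OF simple_graph_cluster_graph] by (intro card_mono)
  thus ?thesis using finite_L finite_outreach by (simp add: card_SigmaI)
qed

lemma card_Restr_cluster_graph_le: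
  assumes "finite W"
  shows "card (Restr cluster_graph W) \<le> 2 * (\<Sum>l\<in>W. card (outreach l \<inter> W))"
proof -
  let ?S = "Sigma W (\<lambda>l. outreach l \<inter> W)"
  have fin: "finite ?S" using assms by auto
  have "Restr cluster_graph W \<subseteq> ?S \<union> prod.swap ` ?S" by (auto simp: cluster_graph_def image_iff)
  hence "card (Restr cluster_graph W) \<le> card (?S \<union> prod.swap ` ?S)" using fin by (intro card_mono) auto
  also have "\<dots> \<le> 2 * card ?S"
    using card_Un_le[of ?S "prod.swap ` ?S"] card_image_le[OF fin, of prod.swap] by linarith
  also have "card ?S = (\<Sum>l\<in>W. card (outreach l \<inter> W))" using assms by (intro card_SigmaI) auto
  finally show ?thesis .
qed

lemma connected_in_cluster: "l \<in> L \<Longrightarrow> connected_in E (cluster l)"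
  unfolding cluster_def using core(1) fringe(4) by (intro connected_in_Un_leaves[OF simple_graphD(3)[OF graph]]) auto

lemma cluster_subset: "l \<in> L \<Longrightarrow> cluster l \<subseteq> V"
  using core(2) fringe(4) by (auto simp: cluster_def)

lemma disjoint_family_on_cluster: "disjoint_family_on cluster L"
  using core(3) fringe(3) fringe_Int_core unfolding disjoint_family_on_def cluster_def by blast

lemma UN_cluster_disjoint:
  assumes "A \<subseteq> L" "B \<subseteq> L" "A \<inter> B = {}"
  shows "(\<Union>l\<in>A. cluster l) \<inter> (\<Union>l\<in>B. cluster l) = {}"
proof -
  have "cluster l \<inter> cluster l' = {}" if "l \<in> A" "l' \<in> B" for l l'
    using that assms by (intro disjoint_family_onD[OF disjoint_family_on_cluster]) auto
  thus ?thesis by blast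
qed

lemma cluster_graph_edge:
  assumes "(l, l') \<in> cluster_graph"
  shows "\<exists>u\<in>cluster l. \<exists>v\<in>cluster l'. (u, v) \<in> E"
proof -
  have "\<exists>u\<in>cluster l. \<exists>v\<in>cluster l'. (u, v) \<in> E \<and> (v, u) \<in> E" if l: "l' \<in> outreach l" "l \<in> L" for l l'
  proof -
    obtain u where u: "u \<in> fringe l" "l' \<in> reach u" using l(1) by (auto simp: outreach_def)
    then obtain w where "w \<in> core l'" "(w, u) \<in> E" using reach(2)[OF l(2)] by auto
    thus ?thesis using u(1) symD[OF simple_graphD(3)[OF graph]] by (auto simp: cluster_def)
  qed
  thus ?thesis using assms unfolding cluster_graph_def by blast
qed

lemma many_clusters_with_large_outreach:
  assumes W: "W \<subseteq> L" and dense: "a * card W < card (Restr cluster_graph W) + a * k" "a < 2 * card W"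
    and num: "4 * k \<le> a" "16 * (q * n) * d \<le> a * a"
  shows "d \<le> card {l \<in> W. a < 8 * card (outreach l \<inter> W)}"
proof (rule ccontr)
  let ?deg = "\<lambda>l. card (outreach l \<inter> W)"
  let ?R = "{l \<in> W. a < 8 * ?deg l}"
  assume few: "\<not> ?thesis"
  have fin: "finite W" using W finite_L finite_subset by auto
  have "card (outreach l \<inter> W) \<le> q * n" if "l \<in> W" for l
    using card_outreach_le[of l] card_mono[OF finite_outreach[of l], of "outreach l \<inter> W"] that W by fastforce
  hence "(\<Sum>l\<in>?R. ?deg l) \<le> (\<Sum>l\<in>?R. q * n)" by (intro sum_mono) auto
  also have "\<dots> \<le> d * (q * n)" using few by simp
  finally have large: "(\<Sum>l\<in>?R. ?deg l) \<le> d * (q * n)" .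
  have "8 * (\<Sum>l\<in>W - ?R. ?deg l) \<le> (\<Sum>l\<in>W - ?R. a)" unfolding sum_distrib_left by (intro sum_mono) auto
  also have "\<dots> \<le> a * card W" using fin by (simp add: card_mono)
  finally have small: "8 * (\<Sum>l\<in>W - ?R. ?deg l) \<le> a * card W" .
  have "(\<Sum>l\<in>W. ?deg l) = (\<Sum>l\<in>?R. ?deg l) + (\<Sum>l\<in>W - ?R. ?deg l)"
    using sum.subset_diff[of ?R W ?deg] fin by simp
  hence "3 * (a * card W) < 8 * (d * (q * n)) + 4 * (a * k)"
    using large small dense(1) card_Restr_cluster_graph_le[OF fin] by linarith
  moreover have "4 * (a * k) \<le> a * a" using num(1) by (metis mult.left_commute mult_le_mono2)
  moreover have "a * a \<le> 2 * (a * card W)" using dense(2) by (metis less_imp_le mult.left_commute mult_le_mono2)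
  moreover have "2 * (8 * (d * (q * n))) \<le> a * a" using num(2) by (simp add: algebra_simps)
  ultimately show False by linarith
qed

lemma fringe_vertex_reaching_many:
  assumes l: "l \<in> L" and fin: "finite W" "finite Y" and many: "card Y + q * \<Delta> < card (outreach l \<inter> W)"
  shows "\<exists>u\<in>fringe l. \<Delta> \<le> card (reach u \<inter> W - Y)"
proof (rule ccontr)
  assume few: "\<not> ?thesis"
  have "card (outreach l \<inter> W - Y) \<le> card (\<Union>u\<in>fringe l. reach u \<inter> W - Y)"
    using fringe(1)[OF l] fin(1) by (intro card_mono) (auto simp: outreach_def)
  also have "\<dots> \<le> (\<Sum>u\<in>fringe l. card (reach u \<inter> W - Y))" using fringe(1)[OF l] by (rule card_UN_le)
  also have "\<dots> \<le> (\<Sum>u\<in>fringe l. \<Delta>)" using few by (intro sum_mono) (meson nat_le_linear)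
  also have "\<dots> \<le> q * \<Delta>" using fringe(2)[OF l] by simp
  finally show False using diff_card_le_card_Diff[OF fin(2), of "outreach l \<inter> W"] many by linarith
qed

lemma choose_terminals:
  assumes H: "simple_graph VH EH" "\<And>h. card (EH `` {h}) \<le> \<Delta>" and W: "W \<subseteq> L" and lh: "\<And>h. h \<in> VH \<Longrightarrow> lh h \<in> L"
    and many: "\<And>h. h \<in> VH \<Longrightarrow> card VH + \<Delta> * card VH + q * \<Delta> < card (outreach (lh h) \<inter> W)"
  obtains u x where "\<And>h. h \<in> VH \<Longrightarrow> u h \<in> fringe (lh h)"
    "\<And>h h'. (h, h') \<in> EH \<Longrightarrow> x (h, h') \<in> reach (u h) \<inter> W - lh ` VH" "inj_on x EH"
proof -
  note H' = simple_graphD[OF H(1)]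
  let ?R = "\<lambda>h T. \<exists>u\<in>fringe (lh h). T \<subseteq> reach u \<inter> W \<and> card T = card (EH `` {h})"
  have fin: "finite W" "finite (lh ` VH)" using W finite_L H'(1) finite_subset by auto
  have pick: "\<exists>T. ?R h T \<and> finite T \<and> card T \<le> \<Delta> \<and> T \<inter> (lh ` VH \<union> Y) = {}"
    if h: "h \<in> VH" and Y: "finite Y" "card Y \<le> \<Delta> * card VH" for h Y
  proof -
    let ?Y = "lh ` VH \<union> Y"
    have "card ?Y \<le> card VH + card Y" using card_Un_le[of "lh ` VH" Y] card_image_le[OF H'(1), of lh] by linarith
    hence "card ?Y + q * \<Delta> < card (outreach (lh h) \<inter> W)" using many[OF h] Y(2) by linarith
    from fringe_vertex_reaching_many[OF lh[OF h] fin(1) _ this] obtain u where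
      u: "u \<in> fringe (lh h)" "card (EH `` {h}) \<le> card (reach u \<inter> W - ?Y)" using H(2)[of h] fin(2) Y(1) by auto
    obtain T where T: "T \<subseteq> reach u \<inter> W - ?Y" "card T = card (EH `` {h})" using u(2) by (meson obtain_subset_with_card_n)
    have "finite T" using T(1) fin(1) finite_subset by blast
    thus ?thesis using T u(1) H(2)[of h] by (intro exI[of _ T]) auto
  qed
  obtain T where T: "\<And>h. h \<in> VH \<Longrightarrow> ?R h (T h)" "\<And>h. h \<in> VH \<Longrightarrow> T h \<inter> lh ` VH = {}" "disjoint_family_on T VH"
    by (rule greedy_disjoint_family[of VH \<Delta> ?R "lh ` VH", OF H'(1)]) (erule (2) pick, rule that, simp_all)
  obtain u where u: "\<And>h. h \<in> VH \<Longrightarrow> u h \<in> fringe (lh h) \<and> T h \<subseteq> reach (u h) \<inter> W \<and> card (T h) = card (EH `` {h})"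
    using T(1) by metis
  have "\<exists>b. bij_betw b (EH `` {h}) (T h)" if "h \<in> VH" for h
    using finite_same_card_bij[of "EH `` {h}" "T h"] u[OF that] fin(1) H'(2) by (metis finite_Image finite_Int finite_subset)
  then obtain b where b: "\<And>h. h \<in> VH \<Longrightarrow> bij_betw (b h) (EH `` {h}) (T h)" by metis
  have bT: "b h h' \<in> T h" if "(h, h') \<in> EH" for h h' using b[of h] that H'(5) by (auto simp: bij_betw_def)
  let ?x = "\<lambda>e. b (fst e) (snd e)"
  have "inj_on ?x EH"
  proof (rule inj_onI, clarify)
    fix h k h' k' assume e: "(h, k) \<in> EH" "(h', k') \<in> EH" and eq: "?x (h, k) = ?x (h', k')"
    have VH: "h \<in> VH" "h' \<in> VH" using e H'(5) by auto
    have "h = h'" using disjoint_family_onD[OF T(3) VH] bT[OF e(1)] bT[OF e(2)] eq by auto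
    moreover have "k = k'" using b[OF VH(1)] e eq calculation by (auto simp: bij_betw_def dest: inj_onD)
    ultimately show "h = h' \<and> k = k'" ..
  qed
  moreover have "?x (h, h') \<in> reach (u h) \<inter> W - lh ` VH" if "(h, h') \<in> EH" for h h'
    using bT[OF that] u[of h] T(2)[of h] that H'(5) by auto
  ultimately show thesis using u that[of u ?x] by blast
qed

lemma topological_minor_of_linked_terminals:
  assumes H: "simple_graph VH EH" and lh: "inj_on lh VH" "lh ` VH \<subseteq> L" and u: "\<And>h. h \<in> VH \<Longrightarrow> u h \<in> fringe (lh h)"
    and x: "inj_on x EH" "\<And>h h'. (h, h') \<in> EH \<Longrightarrow> x (h, h') \<in> reach (u h)"
    and U: "U \<subseteq> L - lh ` VH" "M \<subseteq> cluster_graph" "linked U M (x ` EH)"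
  shows "topological_minor V E VH EH"
proof -
  note H' = simple_graphD[OF H] and E = simple_graphD[OF graph]
  obtain Q where Q: "pairing Q (x ` EH)"
    "\<And>h h'. (h, h') \<in> EH \<Longrightarrow> (x (h, h'), x (h', h)) \<in> Q \<or> (x (h', h), x (h, h')) \<in> Q"
    by (rule pairing_of_arcs[OF H x(1)]) (rule that, simp_all)
  obtain C where "rooted_model U M (x ` EH) Q C" using linkedD[OF U(3) Q(1)] .
  note C = rooted_modelD[OF this]
  define P where "P e = (\<Union>l\<in>C (x e). cluster l)" for e
  have CL: "C (x e) \<subseteq> L" "C (x e) \<inter> lh ` VH = {}" if "e \<in> EH" for e using C(2)[of "x e"] U(1) that by auto
  have u_cluster: "u h \<in> cluster (lh h)" "lh h \<in> L" "u h \<in> V" if "h \<in> VH" for h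
    using u[OF that] lh(2) that fringe(4)[of "lh h" "u h"] by (auto simp: cluster_def)
  have connected: "connected_in E (P e)" if e: "e \<in> EH" for e
    unfolding P_def
  proof (rule connected_in_UN[OF E(3) C(3)])
    show "connected_in E (cluster l)" if "l \<in> C (x e)" for l using CL(1)[OF e] that connected_in_cluster by auto
    show "\<exists>u\<in>cluster l. \<exists>v\<in>cluster l'. (u, v) \<in> E" if "(l, l') \<in> M" for l l'
      using that U(2) by (intro cluster_graph_edge) auto
  qed (use e in auto)
  have attached: "\<exists>w\<in>P (h, h'). (u h, w) \<in> E" if e: "(h, h') \<in> EH" for h h'
  proof -
    have h: "h \<in> VH" using e H'(5) by auto
    then obtain w where "w \<in> core (x (h, h'))" "(w, u h) \<in> E" using reach(2)[OF u_cluster(2) u[OF h] x(2)[OF e]] by auto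
    moreover have "x (h, h') \<in> C (x (h, h'))" using C(1) e by auto
    ultimately show ?thesis using symD[OF E(3)] by (auto simp: P_def cluster_def)
  qed
  have adjacent: "\<exists>a\<in>P (h, h'). \<exists>b\<in>P (h', h). (a, b) \<in> E" if e: "(h, h') \<in> EH" for h h'
  proof -
    have "\<exists>l\<in>C (x (h, h')). \<exists>l'\<in>C (x (h', h)). (l, l') \<in> cluster_graph"
      using Q(2)[OF e] C(6) U(2) symD[OF simple_graphD(3)[OF simple_graph_cluster_graph]] by fastforce
    thus ?thesis using cluster_graph_edge unfolding P_def by blast
  qed
  show ?thesis
  proof (rule topological_minor_of_arc_sets[where f = u and P = P])
    have "lh h = lh h'" if "h \<in> VH" "h' \<in> VH" "u h = u h'" for h h'
    proof (rule ccontr)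
      assume "lh h \<noteq> lh h'"
      from disjoint_family_onD[OF disjoint_family_on_cluster u_cluster(2)[OF that(1)] u_cluster(2)[OF that(2)] this]
      show False using u_cluster(1)[OF that(1)] u_cluster(1)[OF that(2)] unfolding that(3) by blast
    qed
    thus "inj_on u VH" using lh(1) unfolding inj_on_def by blast
    show "disjoint_family_on P EH" unfolding disjoint_family_on_def
    proof (intro ballI impI)
      fix e e' assume e: "e \<in> EH" "e' \<in> EH" "e \<noteq> e'"
      hence "C (x e) \<inter> C (x e') = {}" using x(1) by (intro C(5)) (auto simp: inj_on_def)
      thus "P e \<inter> P e' = {}" unfolding P_def using CL e by (intro UN_cluster_disjoint)
    qed
    fix e assume e: "e \<in> EH"
    have "u h \<notin> P e" if h: "h \<in> VH" for h
      using UN_cluster_disjoint[of "{lh h}" "C (x e)"] CL[OF e] u_cluster[OF h] h by (auto simp: P_def)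
    moreover have "P e \<subseteq> V" using CL(1)[OF e] cluster_subset unfolding P_def by blast
    ultimately show "P e \<subseteq> V - u ` VH" by auto
  next
    fix h h' assume e: "(h, h') \<in> EH"
    note e' = symD[OF H'(3) e]
    obtain a b where "a \<in> P (h, h')" "b \<in> P (h', h)" "(a, b) \<in> E" using adjacent[OF e] by blast
    hence "connected_in E (P (h, h') \<union> P (h', h))"
      by (rule connected_in_Un_edge[OF E(3) connected[OF e] connected[OF e']])
    hence "connector E (u h) (u h') (P (h, h') \<union> P (h', h))"
      using attached[OF e] attached[OF e'] by (auto simp: connector_def)
    thus "path_via E (P (h, h') \<union> P (h', h)) (u h) (u h')" unfolding path_via_def by blast
  qed (use H'(3) u_cluster in auto)
qed

theorem dense_cluster_graph_topological_minor:
  assumes L: "L \<noteq> {}" and dense: "a * card L \<le> (\<Sum>l\<in>L. card (outreach l))"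
    and H: "simple_graph VH EH" "card VH \<le> d" "\<And>h. card (EH `` {h}) \<le> \<Delta>"
    and a: "2 * (linking_const * (\<Delta> * d + 1) + d + 1) \<le> a" "8 * ((\<Delta> + 1) * d + q * \<Delta> + 1) \<le> a" "16 * (q * n) * d \<le> a * a"
  shows "topological_minor V E VH EH"
proof -
  note H' = simple_graphD[OF H(1)]
  define k where "k = (\<Delta> + 1) * d + 1"
  have "1 \<le> k" "4 * k \<le> a" using a(2) by (auto simp: k_def)
  hence k: "1 \<le> k" "4 * real k \<le> real a" "4 * k \<le> a" by simp_all
  have "real (a * card L) \<le> real (card cluster_graph)" using dense card_cluster_graph_ge by (metis of_nat_le_iff order_trans)
  hence dense': "real a * real (card L) \<le> real (card cluster_graph)" by simp
  obtain W where W: "W \<subseteq> L" "W \<noteq> {}" and deg: "\<And>v. v \<in> W \<Longrightarrow> real a / 2 < real (card (cluster_graph `` {v} \<inter> W))"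
    and con: "vertex_connected k W (Restr cluster_graph W)"
    and dW: "real a * real (card W) < real (card (Restr cluster_graph W)) + real a * real k"
    by (rule mader[OF simple_graph_cluster_graph L k(1,2) dense']) blast
  have fW: "finite W" using W(1) finite_L finite_subset by auto
  have deg': "a < 2 * card (cluster_graph `` {v} \<inter> W)" if "v \<in> W" for v using deg[OF that] by linarith
  have "a < 2 * card W"
  proof -
    obtain v where v: "v \<in> W" using W(2) by auto
    have "card (cluster_graph `` {v} \<inter> W) \<le> card W" using fW by (intro card_mono) auto
    thus ?thesis using deg'[OF v] by simp
  qed
  moreover have "a * card W < card (Restr cluster_graph W) + a * k"
    using dW by (simp only: of_nat_mult[symmetric] of_nat_add[symmetric] of_nat_less_iff)
  ultimately have "card VH \<le> card {l \<in> W. a < 8 * card (outreach l \<inter> W)}"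
    using many_clusters_with_large_outreach[OF W(1) _ _ k(3) a(3)] H(2) by (meson order_trans)
  then obtain J where J: "J \<subseteq> {l \<in> W. a < 8 * card (outreach l \<inter> W)}" "card J = card VH" "finite J"
    by (meson obtain_subset_with_card_n)
  obtain lh where lh: "bij_betw lh VH J" using finite_same_card_bij[OF H'(1) J(3)] J(2) by auto
  have lhJ: "lh ` VH = J" "inj_on lh VH" using lh by (auto simp: bij_betw_def)
  have many: "card VH + \<Delta> * card VH + q * \<Delta> < card (outreach (lh h) \<inter> W)" if "h \<in> VH" for h
  proof -
    have "\<Delta> * card VH \<le> \<Delta> * d" using H(2) by simp
    moreover have "8 * d + 8 * (\<Delta> * d) + 8 * (q * \<Delta>) + 8 \<le> a" using a(2) by (simp add: algebra_simps)
    moreover have "a < 8 * card (outreach (lh h) \<inter> W)" using that lhJ(1) J(1) by auto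
    ultimately show ?thesis using H(2) by linarith
  qed
  obtain u x where ux: "\<And>h. h \<in> VH \<Longrightarrow> u h \<in> fringe (lh h)"
    "\<And>h h'. (h, h') \<in> EH \<Longrightarrow> x (h, h') \<in> reach (u h) \<inter> W - lh ` VH" "inj_on x EH"
    by (rule choose_terminals[OF H(1,3) W(1) _ many]) (use lhJ J W(1) in auto)
  have "card EH \<le> \<Delta> * d"
    using sum_mono[of VH "\<lambda>h. card (EH `` {h})" "\<lambda>_. \<Delta>"] H(3) mult_le_mono2[OF H(2), of \<Delta>]
    unfolding simple_graph_card_edges(2)[OF H(1)] by (simp add: mult.commute order_trans)
  hence card_x: "card (x ` EH) \<le> \<Delta> * d" using card_image_le[OF H'(2), of x] by simp
  have "linked (W - J) (Restr (Restr cluster_graph W) (W - J)) (x ` EH)"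
  proof (rule highly_connected_linked[OF simple_graph_Restr[OF simple_graph_cluster_graph W(1)]])
    show "x ` EH \<subseteq> W - J" using ux(2) lhJ(1) by force
    show "card J + card (x ` EH) \<le> k" using J(2) H(2) card_x by (simp add: k_def)
    show "linking_const * (\<Delta> * d + 1) + card J < card (Restr cluster_graph W `` {v})" if v: "v \<in> W" for v
    proof -
      have "Restr cluster_graph W `` {v} = cluster_graph `` {v} \<inter> W" using v by auto
      thus ?thesis using deg'[OF v] a(1) J(2) H(2) by simp
    qed
  qed (use W J(1) card_x con in auto)
  thus ?thesis
    using W(1) lhJ J ux by (intro topological_minor_of_linked_terminals[OF H(1) lhJ(2) _ ux(1,3)]) auto
qed

end

section \<open>Locally sparse graphs\<close>

definition locally_sparse :: "'a rel \<Rightarrow> 'a set \<Rightarrow> nat \<Rightarrow> nat \<Rightarrow> nat \<Rightarrow> bool" where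
  "locally_sparse E V d b t \<longleftrightarrow> (\<forall>X Y. X \<subseteq> V \<longrightarrow> Y \<subseteq> V \<longrightarrow> X \<inter> Y = {} \<longrightarrow> d \<le> b * card X \<longrightarrow> d \<le> b * card Y \<longrightarrow>
     t * edge_count E X Y < card X * card Y)"

lemma locally_sparse_mono:
  assumes "locally_sparse E V d b t" "b' \<le> b" "t' \<le> t" "E' \<subseteq> E" "V' \<subseteq> V" "finite V"
  shows "locally_sparse E' V' d b' t'"
  unfolding locally_sparse_def
proof (intro allI impI)
  fix X Y assume XY: "X \<subseteq> V'" "Y \<subseteq> V'" "X \<inter> Y = {}" "d \<le> b' * card X" "d \<le> b' * card Y"
  have "finite X" "finite Y" using XY(1,2) assms(5,6) by (meson finite_subset order_trans)+
  hence "t' * edge_count E' X Y \<le> t * edge_count E X Y"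
    using assms(3,4) by (intro mult_le_mono edge_count_mono) auto
  moreover have "d \<le> b * card X" "d \<le> b * card Y" using XY(4,5) assms(2) by (meson mult_le_mono1 order_trans)+
  hence "t * edge_count E X Y < card X * card Y" using assms(1,5) XY(1-3) unfolding locally_sparse_def by simp
  ultimately show "t' * edge_count E' X Y < card X * card Y" by (rule le_less_trans)
qed

lemma locally_sparse_low_degree:
  assumes sparse: "locally_sparse E V d b (b * t)" "finite V" and XY: "X \<subseteq> V" "Y \<subseteq> V" "X \<inter> Y = {}" "X \<noteq> {}"
    and card: "d \<le> b * card X" "card Y \<le> t * d"
  shows "\<exists>x\<in>X. b * card (E `` {x} \<inter> Y) < d"
proof (rule ccontr)
  assume "\<not> ?thesis"
  hence deg: "d \<le> b * card (E `` {x} \<inter> Y)" if "x \<in> X" for x using that by auto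
  have fin: "finite X" "finite Y" using XY(1,2) sparse(2) finite_subset by auto
  obtain x where x: "x \<in> X" using XY(4) by auto
  have "card (E `` {x} \<inter> Y) \<le> card Y" using fin by (intro card_mono) auto
  hence "d \<le> b * card Y" using deg[OF x] by (meson mult_le_mono2 order_trans)
  hence "b * t * edge_count E X Y < card X * card Y"
    using sparse(1) XY(1-3) card(1) unfolding locally_sparse_def by simp
  moreover have "card X * d \<le> b * edge_count E X Y"
    using sum_mono[of X "\<lambda>_. d" "\<lambda>x. b * card (E `` {x} \<inter> Y)"] deg
    by (simp add: edge_count_eq_sum[OF fin] sum_distrib_left)
  hence "t * (card X * d) \<le> t * (b * edge_count E X Y)" by (rule mult_le_mono2)
  moreover have "card X * card Y \<le> card X * (t * d)" using card(2) by (rule mult_le_mono2)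
  moreover have "b * t * edge_count E X Y = t * (b * edge_count E X Y)" "card X * (t * d) = t * (card X * d)" by simp_all
  ultimately show False by linarith
qed

lemma card_Int_add_card_Diff: "finite A \<Longrightarrow> card A = card (A \<inter> B) + card (A - B)"
  by (metis Int_Diff_Un Int_Diff_disjoint card_Un_disjoint finite_Diff finite_Int)

lemma card_le_of_disjoint_representatives:
  assumes "disjoint_family_on P T" "finite N" "\<And>y. y \<in> T \<Longrightarrow> P y \<inter> N \<noteq> {}"
  shows "card T \<le> card N"
proof -
  have "\<forall>y\<in>T. \<exists>w. w \<in> P y \<inter> N" using assms(3) by blast
  from bchoice[OF this] obtain w where w: "\<And>y. y \<in> T \<Longrightarrow> w y \<in> P y \<inter> N" by auto
  have "inj_on w T"
  proof (rule inj_onI, rule ccontr)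
    fix x y assume xy: "x \<in> T" "y \<in> T" "w x = w y" "x \<noteq> y"
    thus False using w[of x] w[of y] disjoint_family_onD[OF assms(1) xy(1,2,4)] by auto
  qed
  thus ?thesis using w assms(2) by (intro card_inj_on_le[of w]) auto
qed

lemma edge_count_le_degree:
  assumes "finite X" "finite Y" "\<And>y. y \<in> Y \<Longrightarrow> card (B\<inverse> `` {y} \<inter> X) \<le> n"
  shows "edge_count B X Y \<le> card Y * n"
proof -
  have "edge_count B X Y = (\<Sum>y\<in>Y. card (B\<inverse> `` {y} \<inter> X))"
    using edge_count_eq_sum[OF assms(2,1), of "B\<inverse>"] by (simp add: edge_count_converse)
  also have "\<dots> \<le> (\<Sum>y\<in>Y. n)" using assms(3) by (rule sum_mono)
  finally show ?thesis by simp
qed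

lemma maximal_disjoint_family:
  assumes "finite L"
  obtains L' F where "L' \<subseteq> L" "\<And>l. l \<in> L' \<Longrightarrow> R l (F l)" "disjoint_family_on F L'"
    "\<forall>l\<in>L - L'. \<forall>A. R l A \<longrightarrow> A \<inter> (\<Union>l\<in>L'. F l) \<noteq> {}"
proof -
  let ?ok = "\<lambda>p. fst p \<subseteq> L \<and> (\<forall>l\<in>fst p. R l (snd p l)) \<and> disjoint_family_on (snd p) (fst p)"
  have "?ok ({}, \<lambda>_. {})" by (simp add: disjoint_family_on_def)
  moreover have "\<forall>p. ?ok p \<longrightarrow> card (fst p) < Suc (card L)" using assms by (simp add: card_mono less_Suc_eq_le)
  ultimately have "\<exists>p. ?ok p \<and> (\<forall>p'. ?ok p' \<longrightarrow> card (fst p') \<le> card (fst p))" by (rule ex_has_greatest_nat)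
  then obtain p where pmax: "?ok p \<and> (\<forall>p'. ?ok p' \<longrightarrow> card (fst p') \<le> card (fst p))" by (rule exE)
  note p = conjunct1[OF pmax] and max = conjunct2[OF pmax]
  obtain L' F where LF: "p = (L', F)" by (cases p)
  have "A \<inter> (\<Union>l\<in>L'. F l) \<noteq> {}" if l: "l \<in> L - L'" and A: "R l A" for l A
  proof
    assume "A \<inter> (\<Union>l\<in>L'. F l) = {}"
    hence "disjoint_family_on (F(l := A)) (insert l L')"
      using p LF l by (auto simp: disjoint_family_on_def)
    moreover have "\<forall>x\<in>insert l L'. R x ((F(l := A)) x)" using p LF l A by auto
    ultimately have "card (insert l L') \<le> card L'" using max[rule_format, of "(insert l L', F(l := A))"] p LF l by simp
    moreover have "finite L'" using p LF assms finite_subset by auto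
    ultimately show False using l by simp
  qed
  thus thesis using p LF by (intro that[of L' F]) auto
qed

lemma grow_union:
  assumes fin: "\<And>r. r \<in> A \<Longrightarrow> finite (S r)" and g: "0 < g"
    and step: "\<And>F. F \<subseteq> A \<Longrightarrow> finite F \<Longrightarrow> card F < q \<Longrightarrow> \<not> stop F \<Longrightarrow> \<exists>r\<in>A. g \<le> c * card (S r - (\<Union>r\<in>F. S r))"
  shows "\<exists>F\<subseteq>A. finite F \<and> card F \<le> q \<and> (stop F \<or> card F = q \<and> q * g \<le> c * card (\<Union>r\<in>F. S r))"
proof -
  have "\<exists>F\<subseteq>A. finite F \<and> card F \<le> j \<and> (stop F \<or> card F = j \<and> j * g \<le> c * card (\<Union>r\<in>F. S r))" if "j \<le> q" for j
    using that
  proof (induction j)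
    case 0
    thus ?case by (intro exI[of _ "{}"]) simp
  next
    case (Suc j)
    then obtain F where F: "F \<subseteq> A" "finite F" "card F \<le> j" "stop F \<or> card F = j \<and> j * g \<le> c * card (\<Union>r\<in>F. S r)" by auto
    let ?U = "\<Union>r\<in>F. S r"
    show ?case
    proof (cases "stop F")
      case True
      thus ?thesis using F by (intro exI[of _ F]) auto
    next
      case False
      then obtain r where r: "r \<in> A" "g \<le> c * card (S r - ?U)" using step[OF F(1,2)] F(3) Suc.prems by auto
      have "r \<notin> F"
      proof
        assume "r \<in> F"
        hence "S r - ?U = {}" by auto
        thus False using r(2) g by (metis card.empty mult_0_right not_le)
      qed
      have "(\<Union>r\<in>insert r F. S r) = ?U \<union> (S r - ?U)" by auto
      hence "card (\<Union>r\<in>insert r F. S r) = card ?U + card (S r - ?U)"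
        using F(1,2) fin r(1) by (metis Diff_disjoint card_Un_disjoint finite_Diff finite_UN subsetD)
      thus ?thesis using F r \<open>r \<notin> F\<close> False by (intro exI[of _ "insert r F"]) (auto simp: add_mult_distrib2)
    qed
  qed
  thus ?thesis by blast
qed

lemma disjoint_neighbour_sets:
  fixes B :: "('l \<times> 'r) set"
  assumes fin: "finite L" "finite R" "B \<subseteq> L \<times> R"
    and deg: "\<And>l. l \<in> L \<Longrightarrow> m \<le> c * card (B `` {l})" "\<And>r. r \<in> R \<Longrightarrow> card (B\<inverse> `` {r}) \<le> n"
    and pick: "\<And>l A. l \<in> L \<Longrightarrow> A \<subseteq> B `` {l} \<Longrightarrow> card (B `` {l}) \<le> 2 * card A \<Longrightarrow> \<exists>F\<subseteq>A. card F \<le> q \<and> good F"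
  obtains L' F where "L' \<subseteq> L" "\<forall>l\<in>L'. F l \<subseteq> B `` {l} \<and> card (F l) \<le> q \<and> good (F l)"
    "disjoint_family_on F L'" "card (L - L') * m \<le> 2 * c * (card L' * q * n)"
proof -
  obtain L' F where L': "L' \<subseteq> L" "\<And>l. l \<in> L' \<Longrightarrow> F l \<subseteq> B `` {l} \<and> card (F l) \<le> q \<and> good (F l)" "disjoint_family_on F L'"
    and max: "\<forall>l\<in>L - L'. \<forall>A. A \<subseteq> B `` {l} \<and> card A \<le> q \<and> good A \<longrightarrow> A \<inter> (\<Union>l\<in>L'. F l) \<noteq> {}"
    by (rule maximal_disjoint_family[OF fin(1), of "\<lambda>l A. A \<subseteq> B `` {l} \<and> card A \<le> q \<and> good A"]) blast
  let ?Z = "\<Union>l\<in>L'. F l"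
  have fL': "finite L'" "finite (L - L')" using L'(1) fin(1) finite_subset by auto
  have Z: "?Z \<subseteq> R" using L'(2) fin(3) by blast
  have fZ: "finite ?Z" using Z fin(2) finite_subset by auto
  have fB: "finite (B `` {l})" "finite (B\<inverse> `` {r})" for l r using fin by (auto intro!: finite_Image finite_subset[OF fin(3)])
  have used: "m \<le> 2 * c * card (B `` {l} \<inter> ?Z)" if l: "l \<in> L - L'" for l
  proof (rule ccontr)
    assume "\<not> ?thesis"
    hence "c * (2 * card (B `` {l} \<inter> ?Z)) < m" by (simp add: algebra_simps)
    also have "m \<le> c * card (B `` {l})" using deg(1) l by simp
    finally have "2 * card (B `` {l} \<inter> ?Z) < card (B `` {l})" by (metis mult_less_cancel1)
    hence "card (B `` {l}) \<le> 2 * card (B `` {l} - ?Z)" using card_Int_add_card_Diff[OF fB(1), of l ?Z] by linarith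
    then obtain A where "A \<subseteq> B `` {l} - ?Z" "card A \<le> q" "good A" using pick[of l "B `` {l} - ?Z"] l by auto
    thus False using max l by blast
  qed
  have "card ?Z \<le> (\<Sum>l\<in>L'. card (F l))" using fL'(1) by (rule card_UN_le)
  also have "\<dots> \<le> (\<Sum>l\<in>L'. q)" using L'(2) by (intro sum_mono) auto
  finally have card_Z: "card ?Z \<le> card L' * q" by simp
  have "card (L - L') * m \<le> (\<Sum>l\<in>L - L'. 2 * c * card (B `` {l} \<inter> ?Z))"
    using sum_mono[of "L - L'" "\<lambda>_. m"] used by (simp del: UN_simps)
  also have "\<dots> = 2 * c * edge_count B (L - L') ?Z" using edge_count_eq_sum[OF fL'(2) fZ, of B] by (simp add: sum_distrib_left)
  also have "\<dots> \<le> 2 * c * (card ?Z * n)"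
  proof (intro mult_le_mono2 edge_count_le_degree[OF fL'(2) fZ])
    fix r assume r: "r \<in> ?Z"
    have "card (B\<inverse> `` {r} \<inter> (L - L')) \<le> card (B\<inverse> `` {r})" using fB(2) by (intro card_mono) auto
    also have "\<dots> \<le> n" using r Z by (intro deg(2)) auto
    finally show "card (B\<inverse> `` {r} \<inter> (L - L')) \<le> n" .
  qed
  also have "\<dots> \<le> 2 * c * (card L' * q * n)" using card_Z by simp
  finally show thesis using that[of L' F] L' by blast
qed

definition outreach_factor :: "nat \<Rightarrow> nat \<Rightarrow> nat \<Rightarrow> nat" where
  "outreach_factor \<Delta> b D = 2 * (linking_const * (\<Delta> + 1) + 2) + 8 * (\<Delta> + 2) + 96 * b * D"

definition fringe_size :: "nat \<Rightarrow> nat \<Rightarrow> nat \<Rightarrow> nat" where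
  "fringe_size \<Delta> b D = 2 * (2 * outreach_factor \<Delta> b D + 1) * b"

definition degree_threshold :: "nat \<Rightarrow> nat \<Rightarrow> nat \<Rightarrow> nat" where
  "degree_threshold \<Delta> b D = 2 * outreach_factor \<Delta> b D + 1 + fringe_size \<Delta> b D * \<Delta> + 1"

lemma outreach_factor_bounds:
  assumes "degree_threshold \<Delta> b D \<le> d"
  shows "2 * (linking_const * (\<Delta> * d + 1) + d + 1) \<le> outreach_factor \<Delta> b D * d"
    "8 * ((\<Delta> + 1) * d + fringe_size \<Delta> b D * \<Delta> + 1) \<le> outreach_factor \<Delta> b D * d"
    "16 * (fringe_size \<Delta> b D * (D * d)) * d \<le> outreach_factor \<Delta> b D * d * (outreach_factor \<Delta> b D * d)"
proof -
  let ?a = "outreach_factor \<Delta> b D" and ?q = "fringe_size \<Delta> b D"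
  have d: "1 \<le> d" "?q * \<Delta> + 1 \<le> d" using assms by (auto simp: degree_threshold_def)
  have "2 * (linking_const * (\<Delta> * d + 1) + d + 1) \<le> 2 * (linking_const * ((\<Delta> + 1) * d) + d + d)"
    using d(1) by (intro mult_le_mono2 add_mono) auto
  also have "\<dots> = (2 * (linking_const * (\<Delta> + 1) + 2)) * d" by (simp add: algebra_simps)
  also have "\<dots> \<le> ?a * d" by (intro mult_le_mono1) (simp add: outreach_factor_def)
  finally show "2 * (linking_const * (\<Delta> * d + 1) + d + 1) \<le> ?a * d" .
  have "8 * ((\<Delta> + 1) * d + ?q * \<Delta> + 1) \<le> (8 * (\<Delta> + 2)) * d" using d(2) by (simp add: algebra_simps)
  also have "\<dots> \<le> ?a * d" by (intro mult_le_mono1) (simp add: outreach_factor_def)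
  finally show "8 * ((\<Delta> + 1) * d + ?q * \<Delta> + 1) \<le> ?a * d" .
  have a: "96 * b * D \<le> ?a" "1 \<le> ?a" by (auto simp: outreach_factor_def)
  have "16 * ?q * D = 32 * (b * D) * (2 * ?a + 1)" by (simp add: fringe_size_def algebra_simps)
  also have "\<dots> \<le> 32 * (b * D) * (3 * ?a)" using a(2) by (intro mult_le_mono2) simp
  also have "\<dots> = (96 * b * D) * ?a" by simp
  also have "\<dots> \<le> ?a * ?a" using a(1) by (rule mult_le_mono1)
  finally have "16 * ?q * D * (d * d) \<le> ?a * ?a * (d * d)" by (rule mult_le_mono1)
  thus "16 * (?q * (D * d)) * d \<le> ?a * d * (?a * d)" by (simp add: algebra_simps)
qed

context
  fixes V :: "'a set" and E :: "'a rel" and L :: "'l set" and R :: "'a set" and P :: "'l \<Rightarrow> 'a set"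
    and B :: "('l \<times> 'a) set" and \<Delta> b D d s :: nat
  assumes G: "simple_graph V E" and L: "finite L" "L \<noteq> {}"
    and P: "\<And>l. l \<in> L \<Longrightarrow> connected_in E (P l)" "\<And>l. l \<in> L \<Longrightarrow> P l \<subseteq> V" "\<And>l. l \<in> L \<Longrightarrow> card (P l) \<le> s" "disjoint_family_on P L"
    and R: "R \<subseteq> V" "\<And>l. l \<in> L \<Longrightarrow> P l \<inter> R = {}"
    and B: "B \<subseteq> L \<times> R" "\<And>l r. (l, r) \<in> B \<Longrightarrow> \<exists>w\<in>P l. (w, r) \<in> E"
    and deg_L: "\<And>l. l \<in> L \<Longrightarrow> 4 * fringe_size \<Delta> b D * D * d \<le> card (B `` {l})"
    and deg_R: "\<And>r. r \<in> R \<Longrightarrow> d \<le> b * card (B\<inverse> `` {r})" "\<And>r. r \<in> R \<Longrightarrow> card (B\<inverse> `` {r}) \<le> D * d"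
    and sparse: "locally_sparse E V d (2 * b) (2 * b * (s * degree_threshold \<Delta> b D))"
    and d: "degree_threshold \<Delta> b D \<le> d" and b: "1 \<le> b" "1 \<le> D"
begin

lemma finite_cluster_relation: "finite R" "finite B" "finite (B `` {l})" "finite (B\<inverse> `` {r})"
proof -
  show "finite R" using R(1) simple_graphD(1)[OF G] finite_subset by auto
  thus "finite B" using B(1) L(1) finite_subset by blast
  thus "finite (B `` {l})" "finite (B\<inverse> `` {r})" by (auto intro: finite_Image)
qed

lemma fringe_size_pos: "0 < fringe_size \<Delta> b D"
  using b by (simp add: fringe_size_def)

lemma few_saturated_neighbours:
  assumes l: "l \<in> L" and Z: "Z \<subseteq> L" "card Z < (2 * outreach_factor \<Delta> b D + 1) * d"
  shows "2 * card {r \<in> B `` {l}. card (B\<inverse> `` {r}) \<le> 2 * card (B\<inverse> `` {r} \<inter> Z)} < card (B `` {l})"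
proof (rule ccontr)
  let ?X = "{r \<in> B `` {l}. card (B\<inverse> `` {r}) \<le> 2 * card (B\<inverse> `` {r} \<inter> Z)}" and ?U = "\<Union>y\<in>Z. P y"
  assume many: "\<not> ?thesis"
  have V: "?X \<subseteq> R" "?U \<subseteq> V" using B(1) P(2) Z(1) by auto
  have fin: "finite Z" "finite ?U"
    using finite_subset[OF Z(1) L(1)] finite_subset[OF V(2) simple_graphD(1)[OF G]] by auto
  have "card ?U \<le> (\<Sum>y\<in>Z. card (P y))" using fin(1) by (rule card_UN_le)
  also have "\<dots> \<le> (\<Sum>y\<in>Z. s)" using P(3) Z(1) by (intro sum_mono) auto
  also have "card Z \<le> degree_threshold \<Delta> b D * d" using Z(2) by (simp add: degree_threshold_def add_mult_distrib)
  hence "(\<Sum>y\<in>Z. s) \<le> (degree_threshold \<Delta> b D * d) * s" by simp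
  finally have card_U: "card ?U \<le> s * degree_threshold \<Delta> b D * d" by (simp add: algebra_simps)
  have "1 * d \<le> (2 * (fringe_size \<Delta> b D * D)) * d" using fringe_size_pos b(2) by (intro mult_le_mono1) simp
  moreover have "(4 * (fringe_size \<Delta> b D * D)) * d \<le> card (B `` {l})" using deg_L[OF l] by (simp add: mult.assoc)
  ultimately have card_X: "d \<le> card ?X" using many by linarith
  have "1 * card ?X \<le> 2 * b * card ?X" using b(1) by (intro mult_le_mono1) simp
  hence X: "d \<le> 2 * b * card ?X" using card_X by linarith
  have "0 < card ?X" using card_X d by (simp add: degree_threshold_def)
  hence X': "?X \<noteq> {}" by (metis card.empty less_irrefl)
  obtain r where r: "r \<in> ?X" "2 * b * card (E `` {r} \<inter> ?U) < d"
    using locally_sparse_low_degree[OF sparse simple_graphD(1)[OF G] _ V(2) _ X' X card_U] V(1) R Z(1) by blast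
  have "P y \<inter> (E `` {r} \<inter> ?U) \<noteq> {}" if "y \<in> B\<inverse> `` {r} \<inter> Z" for y
    using B(2)[of y r] that symD[OF simple_graphD(3)[OF G]] by blast
  hence "card (B\<inverse> `` {r} \<inter> Z) \<le> card (E `` {r} \<inter> ?U)"
    using fin(2) Z(1) by (intro card_le_of_disjoint_representatives[OF disjoint_family_on_mono[OF _ P(4)]]) auto
  hence "b * card (B\<inverse> `` {r}) \<le> b * (2 * card (E `` {r} \<inter> ?U))" using r(1) by (intro mult_le_mono2) auto
  also have "\<dots> = 2 * b * card (E `` {r} \<inter> ?U)" by simp
  finally have "b * card (B\<inverse> `` {r}) \<le> 2 * b * card (E `` {r} \<inter> ?U)" .
  moreover have "d \<le> b * card (B\<inverse> `` {r})" using deg_R(1) r(1) V(1) by blast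
  ultimately show False using r(2) by linarith
qed

lemma far_reaching_neighbours:
  assumes l: "l \<in> L" and A: "A \<subseteq> B `` {l}" "card (B `` {l}) \<le> 2 * card A"
  shows "\<exists>F\<subseteq>A. card F \<le> fringe_size \<Delta> b D \<and> (2 * outreach_factor \<Delta> b D + 1) * d \<le> card (\<Union>r\<in>F. B\<inverse> `` {r})"
proof -
  let ?y = "(2 * outreach_factor \<Delta> b D + 1) * d" and ?q = "fringe_size \<Delta> b D"
  have "\<exists>F\<subseteq>A. finite F \<and> card F \<le> ?q \<and> (?y \<le> card (\<Union>r\<in>F. B\<inverse> `` {r}) \<or> card F = ?q \<and> ?q * d \<le> 2 * b * card (\<Union>r\<in>F. B\<inverse> `` {r}))"
  proof (rule grow_union)
    fix F assume F: "\<not> ?y \<le> card (\<Union>r\<in>F. B\<inverse> `` {r})"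
    let ?Z = "\<Union>r\<in>F. B\<inverse> `` {r}" and ?bad = "\<lambda>Z. {r \<in> B `` {l}. card (B\<inverse> `` {r}) \<le> 2 * card (B\<inverse> `` {r} \<inter> Z)}"
    have "card (?bad ?Z) < card A" using few_saturated_neighbours[OF l, of ?Z] F A(2) B(1) by fastforce
    moreover have "finite (?bad ?Z)" using finite_cluster_relation(3) by (rule finite_subset[rotated]) auto
    ultimately have "\<not> A \<subseteq> ?bad ?Z" by (meson card_mono not_le)
    hence "\<exists>r\<in>A. 2 * card (B\<inverse> `` {r} \<inter> ?Z) < card (B\<inverse> `` {r})" using A(1) by (auto simp: not_le)
    then obtain r where r: "r \<in> A" "2 * card (B\<inverse> `` {r} \<inter> ?Z) < card (B\<inverse> `` {r})" by blast
    hence "card (B\<inverse> `` {r}) \<le> 2 * card (B\<inverse> `` {r} - ?Z)"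
      using card_Int_add_card_Diff[OF finite_cluster_relation(4), of r ?Z] by linarith
    hence "b * card (B\<inverse> `` {r}) \<le> 2 * b * card (B\<inverse> `` {r} - ?Z)" by simp
    moreover have "r \<in> R" using r(1) A(1) B(1) by auto
    ultimately show "\<exists>r\<in>A. d \<le> 2 * b * card (B\<inverse> `` {r} - ?Z)" using r(1) deg_R(1) by (meson order_trans)
  qed (use d finite_cluster_relation in \<open>auto simp: degree_threshold_def\<close>)
  then obtain F where F: "F \<subseteq> A" "card F \<le> ?q" "?y \<le> card (\<Union>r\<in>F. B\<inverse> `` {r}) \<or> ?q * d \<le> 2 * b * card (\<Union>r\<in>F. B\<inverse> `` {r})" by blast
  have "?q * d = 2 * b * ?y" by (simp add: fringe_size_def algebra_simps)
  hence "?y \<le> card (\<Union>r\<in>F. B\<inverse> `` {r})" using F(3) b(1) by simp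
  thus ?thesis using F(1,2) by blast
qed

lemma topological_minor_of_small_clusters:
  assumes H: "simple_graph VH EH" "card VH \<le> d" "\<And>h. card (EH `` {h}) \<le> \<Delta>"
  shows "topological_minor V E VH EH"
proof -
  let ?q = "fringe_size \<Delta> b D" and ?a = "outreach_factor \<Delta> b D" and ?S = "\<lambda>r. B\<inverse> `` {r}"
  note fin = finite_cluster_relation
  obtain L' F where L': "L' \<subseteq> L"
    "\<forall>l\<in>L'. F l \<subseteq> B `` {l} \<and> card (F l) \<le> ?q \<and> (2 * ?a + 1) * d \<le> card (\<Union>r\<in>F l. ?S r)" "disjoint_family_on F L'"
    and rest: "card (L - L') * (4 * ?q * D * d) \<le> 2 * 1 * (card L' * ?q * (D * d))"
  proof (rule disjoint_neighbour_sets[of L R B "4 * ?q * D * d" 1 "D * d" ?q "\<lambda>F. (2 * ?a + 1) * d \<le> card (\<Union>r\<in>F. ?S r)"])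
    show "4 * ?q * D * d \<le> 1 * card (B `` {l})" if "l \<in> L" for l using deg_L[OF that] by simp
    show "\<exists>F\<subseteq>A. card F \<le> ?q \<and> (2 * ?a + 1) * d \<le> card (\<Union>r\<in>F. ?S r)"
      if "l \<in> L" "A \<subseteq> B `` {l}" "card (B `` {l}) \<le> 2 * card A" for l A by (rule far_reaching_neighbours[OF that])
  qed (use L(1) fin(1) B(1) deg_R(2) in auto)
  have pos: "0 < ?q * D * d" using fringe_size_pos b(2) d by (simp add: degree_threshold_def)
  have "card (L - L') * (4 * ?q * D * d) = 2 * (2 * card (L - L') * (?q * D * d))"
    "2 * 1 * (card L' * ?q * (D * d)) = 2 * (card L' * (?q * D * d))" by simp_all
  hence "2 * card (L - L') * (?q * D * d) \<le> card L' * (?q * D * d)" using rest by linarith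
  hence "2 * card (L - L') \<le> card L'" using pos by (metis mult_le_cancel2)
  moreover have "card (L - L') = card L - card L'" using L'(1) L(1) by (simp add: card_Diff_subset finite_subset)
  ultimately have half: "card L \<le> 2 * card L'" by linarith
  let ?F = "\<lambda>l. if l \<in> L' then F l else {}"
  have F: "u \<in> R" "\<exists>w\<in>P l. (w, u) \<in> E" if "u \<in> ?F l" for l u
  proof -
    have "(l, u) \<in> B" using that L'(2) by (auto split: if_splits)
    thus "u \<in> R" "\<exists>w\<in>P l. (w, u) \<in> E" using B by auto
  qed
  interpret fringed_clusters V E L P ?F ?S ?q "D * d"
  proof unfold_locales
    show "finite (?F l)" "card (?F l) \<le> ?q" for l using L'(2) fin(3)[of l] by (auto intro: finite_subset)
    show "disjoint_family_on ?F L" using L'(3) by (auto simp: disjoint_family_on_def)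
    show "?F l \<inter> P l' = {}" if "l' \<in> L" for l l' using F(1)[of _ l] R(2)[OF that] by blast
    show "card (?S u) \<le> D * d" if "u \<in> ?F l" for l u using deg_R(2) F(1)[OF that] by simp
    show "u \<in> V \<and> (\<exists>w\<in>P l. (w, u) \<in> E)" if "u \<in> ?F l" for l u using F[OF that] R(1) by auto
    show "x \<in> L \<and> (\<exists>w\<in>P x. (w, u) \<in> E)" if "x \<in> ?S u" for x u using that B by auto
  qed (use G L P in auto)
  have "2 * ?a * d \<le> card (outreach l)" if l: "l \<in> L'" for l
  proof -
    have "(2 * ?a + 1) * d \<le> card (\<Union>u\<in>F l. ?S u)" using L'(2) l by blast
    moreover have "card (\<Union>u\<in>F l. ?S u) - card {l} \<le> card (outreach l)"
      using diff_card_le_card_Diff[of "{l}" "\<Union>u\<in>F l. ?S u"] l by (simp add: outreach_def)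
    moreover have "1 \<le> d" using d by (simp add: degree_threshold_def)
    ultimately show ?thesis by (simp add: add_mult_distrib)
  qed
  hence "card L' * (2 * ?a * d) \<le> (\<Sum>l\<in>L'. card (outreach l))" using sum_mono[of L' "\<lambda>_. 2 * ?a * d"] by simp
  also have "\<dots> \<le> (\<Sum>l\<in>L. card (outreach l))" using L'(1) L(1) by (intro sum_mono2) auto
  finally have "card L' * (2 * ?a * d) \<le> (\<Sum>l\<in>L. card (outreach l))" .
  moreover have "?a * d * card L \<le> ?a * d * (2 * card L')" using half by (rule mult_le_mono2)
  moreover have "?a * d * (2 * card L') = card L' * (2 * ?a * d)" by simp
  ultimately have "?a * d * card L \<le> (\<Sum>l\<in>L. card (outreach l))" by linarith
  thus ?thesis by (rule dense_cluster_graph_topological_minor[OF L(2) _ H outreach_factor_bounds[OF d]])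
qed

end

definition subpair_weight :: "('l \<times> 'r) set \<Rightarrow> 'l set \<Rightarrow> 'r set \<Rightarrow> 'l set \<Rightarrow> 'r set \<Rightarrow> int" where
  "subpair_weight B L R L' R' = int (edge_count B L' R') * (4 * int (card L) * int (card R)) -
     int (card B) * (int (card R) * int (card L') + int (card L) * int (card R'))"

lemma subpair_weight_converse: "subpair_weight (B\<inverse>) R L R' L' = subpair_weight B L R L' R'"
  by (simp add: subpair_weight_def edge_count_converse algebra_simps)

lemma degree_of_maximal_subpair:
  assumes fin: "finite L" "finite R" "R \<noteq> {}" and L': "L' \<subseteq> L" "R' \<subseteq> R" "l \<in> L'"
    and max: "subpair_weight B L R (L' - {l}) R' \<le> subpair_weight B L R L' R'"
  shows "card B \<le> 4 * card L * card (B `` {l} \<inter> R')"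
proof -
  have fin': "finite L'" "finite R'" using fin L' finite_subset by auto
  have "edge_count B L' R' = card (B `` {l} \<inter> R') + edge_count B (L' - {l}) R'"
    using sum.remove[OF fin'(1) L'(3), of "\<lambda>x. card (B `` {x} \<inter> R')"] fin' by (simp add: edge_count_eq_sum)
  moreover have "int (card (L' - {l})) = int (card L') - 1" using card_Suc_Diff1[OF fin'(1) L'(3)] by linarith
  ultimately have "int (card B) * int (card R) \<le> int (4 * card L * card (B `` {l} \<inter> R')) * int (card R)"
    using max unfolding subpair_weight_def by (simp only:) (simp add: algebra_simps)
  moreover have "0 < card R" using fin(2,3) by (simp add: card_gt_0_iff)
  ultimately have "int (card B) \<le> int (4 * card L * card (B `` {l} \<inter> R'))" by (metis mult_le_cancel_right_pos of_nat_0_less_iff)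
  thus ?thesis by (simp only: of_nat_le_iff)
qed

lemma min_degree_subpair:
  fixes B :: "('l \<times> 'r) set"
  assumes fin: "finite L" "finite R" "B \<subseteq> L \<times> R" "B \<noteq> {}"
  obtains L' R' where "L' \<subseteq> L" "R' \<subseteq> R" "L' \<noteq> {}" "R' \<noteq> {}"
    "\<And>l. l \<in> L' \<Longrightarrow> card B \<le> 4 * card L * card (B `` {l} \<inter> R')"
    "\<And>r. r \<in> R' \<Longrightarrow> card B \<le> 4 * card R * card (B\<inverse> `` {r} \<inter> L')"
proof -
  let ?w = "\<lambda>p. subpair_weight B L R (fst p) (snd p)"
  have ne: "L \<noteq> {}" "R \<noteq> {}" using fin by auto
  have "finite B" using fin finite_subset by blast
  hence pos: "0 < int (card L) * int (card R) * int (card B)" using fin ne by (simp add: card_gt_0_iff)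
  let ?S = "?w ` (Pow L \<times> Pow R)"
  have S: "finite ?S" "?S \<noteq> {}" using fin by auto
  obtain L' R' where LR: "L' \<subseteq> L" "R' \<subseteq> R" and eq: "Max ?S = subpair_weight B L R L' R'" using Max_in[OF S] by auto
  have max: "subpair_weight B L R L2 R2 \<le> subpair_weight B L R L' R'" if "L2 \<subseteq> L" "R2 \<subseteq> R" for L2 R2
    using Max_ge[OF S(1) imageI[of "(L2, R2)"]] that by (simp add: eq)
  have "edge_count B L R = card B" using fin(3) by (simp add: edge_count_def Int_absorb2)
  hence "0 < subpair_weight B L R L R" using pos by (simp add: subpair_weight_def algebra_simps)
  hence "0 < subpair_weight B L R L' R'" using max[of L R] by simp
  hence "L' \<noteq> {}" "R' \<noteq> {}" by (auto simp: subpair_weight_def edge_count_def mult_less_0_iff zero_less_mult_iff)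
  moreover have "card B \<le> 4 * card L * card (B `` {l} \<inter> R')" if "l \<in> L'" for l
    using LR max[of "L' - {l}" R'] by (intro degree_of_maximal_subpair[OF fin(1,2) ne(2) LR that]) auto
  moreover have "card (B\<inverse>) \<le> 4 * card R * card (B\<inverse> `` {r} \<inter> L')" if "r \<in> R'" for r
    using LR max[of L' "R' - {r}"]
    by (intro degree_of_maximal_subpair[OF fin(2,1) ne(1) LR(2,1) that]) (auto simp: subpair_weight_converse)
  ultimately show thesis using that[of L' R'] LR by simp
qed

lemma large_cut:
  assumes "finite R" "sym E" "irrefl E"
  shows "\<exists>A\<subseteq>R. edge_count E R R \<le> 4 * edge_count E A (R - A)"
  using assms(1)
proof (induction R rule: finite_induct)
  case empty
  thus ?case by (simp add: edge_count_def)
next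
  case (insert v R)
  then obtain A where A: "A \<subseteq> R" "edge_count E R R \<le> 4 * edge_count E A (R - A)" by auto
  let ?N = "\<lambda>X. card (E `` {v} \<inter> X)"
  have fA: "finite A" "finite (R - A)" using A insert finite_subset by auto
  have "edge_count E (insert v R) (insert v R) \<le> edge_count E R R + 2 * card (E `` {v} \<inter> insert v R)"
    using edge_count_remove_vertex[OF assms(2), of "insert v R" v] insert by simp
  moreover have "E `` {v} \<inter> insert v R = (E `` {v} \<inter> A) \<union> (E `` {v} \<inter> (R - A))"
    using A(1) assms(3) by (auto simp: irrefl_def)
  hence "card (E `` {v} \<inter> insert v R) \<le> ?N A + ?N (R - A)" by (metis card_Un_le)
  ultimately have total: "edge_count E (insert v R) (insert v R) \<le> edge_count E R R + 2 * ?N A + 2 * ?N (R - A)" by linarith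
  have single: "edge_count E {v} X = ?N X" if "finite X" for X using edge_count_eq_sum[OF _ that, of "{v}" E] by simp
  show ?case
  proof (cases "?N A \<le> ?N (R - A)")
    case True
    have "insert v R - insert v A = R - A" using insert(2) by auto
    moreover have "edge_count E (insert v A) (R - A) = ?N (R - A) + edge_count E A (R - A)"
      using edge_count_Un_left[of "{v}" A "R - A" E] fA insert A single by auto
    ultimately show ?thesis using True total A by (intro exI[of _ "insert v A"]) auto
  next
    case False
    have "insert v R - A = insert v (R - A)" using A(1) insert(2) by auto
    moreover have "edge_count E A (insert v (R - A)) = ?N A + edge_count E A (R - A)"
      using edge_count_Un_right[of A "{v}" "R - A" E] edge_count_commute[OF assms(2), of A "{v}"] fA insert single by auto
    ultimately show ?thesis using False total A by (intro exI[of _ A]) auto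
  qed
qed

definition star_factor :: "nat \<Rightarrow> nat \<Rightarrow> nat" where
  "star_factor b D = 16 * b * (1 + 2 * b * D)"

definition star_size :: "nat \<Rightarrow> nat \<Rightarrow> nat \<Rightarrow> nat" where
  "star_size \<Delta> b D = 16 * b * (4 * fringe_size \<Delta> (star_factor b D) D * D) + 4 * b * D"

definition sparsity :: "nat \<Rightarrow> nat \<Rightarrow> nat \<Rightarrow> nat" where
  "sparsity \<Delta> b D = 2 * star_factor b D * ((star_size \<Delta> b D + 1) * degree_threshold \<Delta> (star_factor b D) D)"

text \<open>
  Stars with centres in \<open>V2\<close> and disjoint sets of leaves in \<open>V1\<close> serve as clusters that see many of
  the remaining vertices of \<open>V2\<close>.
\<close>

context
  fixes V1 V2 :: "'a set" and E :: "'a rel" and \<Delta> b D d :: nat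
  assumes b: "1 \<le> b" "1 \<le> D"
    and G: "simple_graph (V1 \<union> V2) E" and V: "V1 \<inter> V2 = {}" "V2 \<noteq> {}" "E \<subseteq> V1 \<times> V2 \<union> V2 \<times> V1"
    and deg: "\<And>x. x \<in> V1 \<union> V2 \<Longrightarrow> d \<le> b * card (E `` {x})" "\<And>x. x \<in> V1 \<union> V2 \<Longrightarrow> card (E `` {x}) \<le> D * d"
    and sparse: "locally_sparse E (V1 \<union> V2) d (2 * star_factor b D) (sparsity \<Delta> b D)"
    and d: "degree_threshold \<Delta> (star_factor b D) D \<le> d"
begin

lemma bipartite_neighbourhoods: "finite V1" "finite V2" "sym E" "finite (E `` {x})" "x \<in> V1 \<Longrightarrow> E `` {x} \<subseteq> V2" "x \<in> V2 \<Longrightarrow> E `` {x} \<subseteq> V1"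
  using simple_graphD[OF G] V by auto

lemma star_parameters_pos: "0 < d" "b \<le> star_factor b D" "1 \<le> star_factor b D" "0 < star_size \<Delta> b D"
  using d b by (auto simp: degree_threshold_def star_factor_def star_size_def)

lemma expanding_neighbours:
  assumes x: "x \<in> V2" and A: "A \<subseteq> E `` {x}" "card (E `` {x}) \<le> 2 * card A"
  shows "\<exists>F\<subseteq>A. card F \<le> star_size \<Delta> b D \<and> star_size \<Delta> b D * d \<le> 2 * b * card (\<Union>y\<in>F. E `` {y})"
proof -
  let ?q = "star_size \<Delta> b D"
  have AV: "A \<subseteq> V1" using A(1) bipartite_neighbourhoods(6)[OF x] by auto
  have "D \<le> degree_threshold \<Delta> (star_factor b D) D"
  proof -
    have "1 * D \<le> star_factor b D * D" using star_parameters_pos(3) by (rule mult_le_mono1)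
    also have "\<dots> \<le> degree_threshold \<Delta> (star_factor b D) D" by (simp add: degree_threshold_def outreach_factor_def)
    finally show ?thesis by simp
  qed
  hence sparse': "locally_sparse E (V1 \<union> V2) d (2 * b) (2 * b * (?q * D))"
    using star_parameters_pos(2) simple_graphD(1)[OF G] unfolding sparsity_def
    by (intro locally_sparse_mono[OF sparse[unfolded sparsity_def]] mult_le_mono) auto
  have "\<exists>F\<subseteq>A. finite F \<and> card F \<le> ?q \<and> (False \<or> card F = ?q \<and> ?q * d \<le> 2 * b * card (\<Union>y\<in>F. E `` {y}))"
  proof (rule grow_union)
    fix F assume F: "F \<subseteq> A" "finite F" "card F < ?q"
    let ?U = "\<Union>y\<in>F. E `` {y}"
    have "card ?U \<le> (\<Sum>y\<in>F. card (E `` {y}))" using F(2) by (rule card_UN_le)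
    also have "\<dots> \<le> (\<Sum>y\<in>F. D * d)" using F(1) AV deg(2) by (intro sum_mono) auto
    also have "\<dots> \<le> ?q * D * d" using F(3) by (simp add: mult.assoc)
    finally have card_U: "card ?U \<le> ?q * D * d" .
    have UV: "?U \<subseteq> V2" using F(1) AV bipartite_neighbourhoods(5) by blast
    have "d \<le> b * card (E `` {x})" using deg(1) x by simp
    also have "\<dots> \<le> b * (2 * card A)" using A(2) by (rule mult_le_mono2)
    also have "\<dots> = 2 * b * card A" by simp
    finally have "d \<le> 2 * b * card A" .
    moreover from this have "A \<noteq> {}" using star_parameters_pos(1) by auto
    moreover have "A \<subseteq> V1 \<union> V2" "?U \<subseteq> V1 \<union> V2" "A \<inter> ?U = {}" using AV UV V(1) by auto
    ultimately obtain z where z: "z \<in> A" "2 * b * card (E `` {z} \<inter> ?U) < d"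
      using locally_sparse_low_degree[OF sparse' _ _ _ _ _ _ card_U] simple_graphD(1)[OF G] by blast
    have "d \<le> b * card (E `` {z} \<inter> ?U) + b * card (E `` {z} - ?U)"
      using deg(1)[of z] z(1) AV card_Int_add_card_Diff[OF bipartite_neighbourhoods(4), of z ?U]
      by (auto simp flip: add_mult_distrib2)
    hence "d \<le> 2 * b * card (E `` {z} - ?U)" using z(2) by simp
    thus "\<exists>z\<in>A. d \<le> 2 * b * card (E `` {z} - ?U)" using z(1) by blast
  qed (use bipartite_neighbourhoods(4) star_parameters_pos(1) in auto)
  thus ?thesis by auto
qed

lemma disjoint_stars:
  obtains X F where "X \<subseteq> V2" "X \<noteq> {}" "disjoint_family_on F X"
    "\<forall>x\<in>X. F x \<subseteq> E `` {x} \<and> card (F x) \<le> star_size \<Delta> b D \<and> star_size \<Delta> b D * d \<le> 2 * b * card (\<Union>y\<in>F x. E `` {y})"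
    "card (V2 - X) \<le> card X * (2 * b * star_size \<Delta> b D * D)"
proof -
  let ?B = "E \<inter> V2 \<times> V1" and ?q = "star_size \<Delta> b D"
  note fin = bipartite_neighbourhoods
  have B: "?B `` {x} = E `` {x}" if "x \<in> V2" for x using fin(6)[OF that] that by auto
  have B': "?B\<inverse> `` {y} = E `` {y}" if "y \<in> V1" for y using fin(5)[OF that] that symD[OF fin(3)] by auto
  obtain X F where X: "X \<subseteq> V2" "\<forall>x\<in>X. F x \<subseteq> ?B `` {x} \<and> card (F x) \<le> ?q \<and> ?q * d \<le> 2 * b * card (\<Union>y\<in>F x. E `` {y})"
    "disjoint_family_on F X" and rest: "card (V2 - X) * d \<le> 2 * b * (card X * ?q * (D * d))"
  proof (rule disjoint_neighbour_sets[of V2 V1 ?B d b "D * d" ?q "\<lambda>F. ?q * d \<le> 2 * b * card (\<Union>y\<in>F. E `` {y})"])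
    show "\<exists>F\<subseteq>A. card F \<le> ?q \<and> ?q * d \<le> 2 * b * card (\<Union>y\<in>F. E `` {y})"
      if "x \<in> V2" "A \<subseteq> ?B `` {x}" "card (?B `` {x}) \<le> 2 * card A" for x A
      using that B[of x] by (intro expanding_neighbours[of x]) auto
  qed (use fin(1,2) B B' deg in auto)
  have "card (V2 - X) * d \<le> (card X * (2 * b * ?q * D)) * d" using rest by (simp add: algebra_simps)
  hence few: "card (V2 - X) \<le> card X * (2 * b * ?q * D)" using star_parameters_pos(1) by simp
  moreover have "X \<noteq> {}" using few V(2) fin(2) by (metis Diff_empty card.empty card_gt_0_iff mult_0 not_le)
  ultimately show thesis using X B by (intro that[of X F]) auto
qed

context
  fixes X :: "'a set" and F :: "'a \<Rightarrow> 'a set"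
  assumes X: "X \<subseteq> V2" "X \<noteq> {}" "disjoint_family_on F X" "card (V2 - X) \<le> card X * (2 * b * star_size \<Delta> b D * D)"
    and F: "\<forall>x\<in>X. F x \<subseteq> E `` {x} \<and> card (F x) \<le> star_size \<Delta> b D \<and>
      star_size \<Delta> b D * d \<le> 2 * b * card (\<Union>y\<in>F x. E `` {y})"
begin

definition leaf_adjacency :: "'a rel" where
  "leaf_adjacency = {(x, r). x \<in> X \<and> r \<in> V2 \<and> (\<exists>y\<in>F x. (y, r) \<in> E)}"

lemma finite_star_graph: "finite X" "finite leaf_adjacency" "X \<times> V2 \<inter> leaf_adjacency = leaf_adjacency"
proof -
  show "finite X" using X(1) bipartite_neighbourhoods(2) finite_subset by auto
  thus "finite leaf_adjacency" using bipartite_neighbourhoods(2)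
    by (intro finite_subset[of leaf_adjacency "X \<times> V2"]) (auto simp: leaf_adjacency_def)
qed (auto simp: leaf_adjacency_def)

lemma card_centres_seeing: "r \<in> V2 \<Longrightarrow> card (leaf_adjacency\<inverse> `` {r}) \<le> D * d"
proof -
  assume r: "r \<in> V2"
  have "F x \<inter> E `` {r} \<noteq> {}" if "x \<in> leaf_adjacency\<inverse> `` {r}" for x
    using that symD[OF bipartite_neighbourhoods(3)] by (auto simp: leaf_adjacency_def)
  hence "card (leaf_adjacency\<inverse> `` {r}) \<le> card (E `` {r})"
    using bipartite_neighbourhoods(4) by (intro card_le_of_disjoint_representatives[OF disjoint_family_on_mono[OF _ X(3)]])
      (auto simp: leaf_adjacency_def)
  thus ?thesis using deg(2)[of r] r by simp
qed

lemma edge_count_stars_to_rest: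
  "card X * (star_size \<Delta> b D * d) \<le> 4 * b * edge_count leaf_adjacency X (V2 - X)"
proof -
  let ?q = "star_size \<Delta> b D" and ?e = "edge_count leaf_adjacency X"
  note fin = finite_star_graph(1) bipartite_neighbourhoods(2)
  have row: "leaf_adjacency `` {x} \<inter> V2 = (\<Union>y\<in>F x. E `` {y})" if "x \<in> X" for x
    using that X(1) F bipartite_neighbourhoods(5,6) unfolding leaf_adjacency_def by blast
  have "card X * (?q * d) \<le> (\<Sum>x\<in>X. 2 * b * card (leaf_adjacency `` {x} \<inter> V2))"
    using sum_mono[of X "\<lambda>_. ?q * d"] F by (simp add: row)
  also have "\<dots> = 2 * b * ?e V2" by (simp add: edge_count_eq_sum[OF fin] sum_distrib_left)
  also have "?e V2 = ?e X + ?e (V2 - X)"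
    using edge_count_Un_right[of X X "V2 - X" leaf_adjacency] fin X(1) by (simp add: Un_absorb1)
  also have "?e X \<le> card X * (D * d)"
  proof (rule edge_count_le_degree[OF fin(1) fin(1)])
    fix r assume r: "r \<in> X"
    have "leaf_adjacency\<inverse> `` {r} \<inter> X = leaf_adjacency\<inverse> `` {r}" by (auto simp: leaf_adjacency_def)
    thus "card (leaf_adjacency\<inverse> `` {r} \<inter> X) \<le> D * d" using card_centres_seeing r X(1) by auto
  qed
  finally have "card X * (?q * d) \<le> 2 * b * (card X * (D * d)) + 2 * b * ?e (V2 - X)" by (simp add: add_mult_distrib2)
  moreover have "(4 * b * D) * (card X * d) \<le> ?q * (card X * d)" by (intro mult_le_mono1) (simp add: star_size_def)
  hence "2 * (2 * b * (card X * (D * d))) \<le> card X * (?q * d)" by (simp add: algebra_simps)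
  ultimately show ?thesis by linarith
qed

lemma topological_minor_of_stars:
  assumes H: "simple_graph VH EH" "card VH \<le> d" "\<And>h. card (EH `` {h}) \<le> \<Delta>"
  shows "topological_minor (V1 \<union> V2) E VH EH"
proof -
  let ?q = "star_size \<Delta> b D" and ?c = "star_factor b D"
  define B where "B = leaf_adjacency \<inter> X \<times> (V2 - X)"
  note fin = finite_star_graph(1) bipartite_neighbourhoods
  have card_X: "0 < card X" using X(2) fin(1) by (simp add: card_gt_0_iff)
  have card_B: "card X * (?q * d) \<le> 4 * b * card B" using edge_count_stars_to_rest by (simp add: edge_count_def B_def)
  have "0 < card X * (?q * d)" using card_X star_parameters_pos by simp
  hence "B \<noteq> {}" using card_B by (metis card.empty mult_0_right not_le)
  then obtain L R where LR: "L \<subseteq> X" "R \<subseteq> V2 - X" "L \<noteq> {}" "R \<noteq> {}"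
    "\<And>l. l \<in> L \<Longrightarrow> card B \<le> 4 * card X * card (B `` {l} \<inter> R)"
    "\<And>r. r \<in> R \<Longrightarrow> card B \<le> 4 * card (V2 - X) * card (B\<inverse> `` {r} \<inter> L)"
    using min_degree_subpair[of X "V2 - X" B] fin(1,3) unfolding B_def by (metis Int_lower2 finite_Diff)
  have FV: "F l \<subseteq> V1" if "l \<in> X" for l using X(1) F that fin(7) by blast

  show ?thesis
  proof (rule topological_minor_of_small_clusters[where P = "\<lambda>l. insert l (F l)" and R = R and L = L and B = "B \<inter> L \<times> R"
        and b = ?c and D = D and s = "?q + 1" and d = d and \<Delta> = \<Delta>])
    show "connected_in E (insert l (F l))" if "l \<in> L" for l
      using connected_in_Un_leaves[OF fin(4) connected_in_singleton[of E l], of "F l"] that LR(1) F by auto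
    show "insert l (F l) \<subseteq> V1 \<union> V2" if "l \<in> L" for l using FV[of l] that LR(1) X(1) by auto
    show "card (insert l (F l)) \<le> ?q + 1" if "l \<in> L" for l
      using F that LR(1) card_insert_le_m1[of "?q + 1" "F l" l] by auto
    show "disjoint_family_on (\<lambda>l. insert l (F l)) L"
    proof (unfold disjoint_family_on_def, intro ballI impI)
      fix l l' assume l: "l \<in> L" "l' \<in> L" "l \<noteq> l'"
      hence "F l \<inter> F l' = {}" using LR(1) by (intro disjoint_family_onD[OF X(3)]) auto
      moreover have "F l \<subseteq> V1" "F l' \<subseteq> V1" "l \<in> V2" "l' \<in> V2" using FV l LR(1) X(1) by auto
      ultimately show "insert l (F l) \<inter> insert l' (F l') = {}" using V(1) l(3) by blast
    qed
    show "insert l (F l) \<inter> R = {}" if "l \<in> L" for l using FV[of l] that LR(1,2) V(1) by auto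
    show "\<exists>w\<in>insert l (F l). (w, r) \<in> E" if "(l, r) \<in> B \<inter> L \<times> R" for l r
      using that by (auto simp: B_def leaf_adjacency_def)
    show "4 * fringe_size \<Delta> ?c D * D * d \<le> card ((B \<inter> L \<times> R) `` {l})" if l: "l \<in> L" for l
    proof -
      have "card X * (?q * d) \<le> 4 * b * (4 * card X * card (B `` {l} \<inter> R))"
        using card_B LR(5)[OF l] by (meson mult_le_mono2 order_trans)
      hence "card X * (?q * d) \<le> card X * (16 * b * card (B `` {l} \<inter> R))" by (simp add: algebra_simps)
      hence "?q * d \<le> 16 * b * card (B `` {l} \<inter> R)" using card_X by simp
      moreover have "16 * b * (4 * fringe_size \<Delta> ?c D * D * d) \<le> ?q * d"
        unfolding star_size_def by (simp add: add_mult_distrib algebra_simps)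
      ultimately have "16 * b * (4 * fringe_size \<Delta> ?c D * D * d) \<le> 16 * b * card (B `` {l} \<inter> R)" by linarith
      hence "4 * fringe_size \<Delta> ?c D * D * d \<le> card (B `` {l} \<inter> R)" using b unfolding mult_le_cancel1 by simp
      moreover have "(B \<inter> L \<times> R) `` {l} = B `` {l} \<inter> R" using l by auto
      ultimately show ?thesis by simp
    qed
    fix r assume r: "r \<in> R"
    let ?n = "card (B\<inverse> `` {r} \<inter> L)"
    have B_r: "(B \<inter> L \<times> R)\<inverse> `` {r} = B\<inverse> `` {r} \<inter> L" using r by auto
    have "card (V2 - X) \<le> card X * (?q * (1 + 2 * b * D))" using X(4) by (simp add: algebra_simps)
    hence "4 * b * (4 * card (V2 - X) * ?n) \<le> 4 * b * (4 * (card X * (?q * (1 + 2 * b * D))) * ?n)" by simp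
    moreover have "card X * (?q * d) \<le> 4 * b * (4 * card (V2 - X) * ?n)"
      using card_B LR(6)[OF r] by (meson mult_le_mono2 order_trans)
    ultimately have "card X * (?q * d) \<le> card X * (?q * (?c * ?n))" by (simp add: star_factor_def algebra_simps)
    thus "d \<le> ?c * card ((B \<inter> L \<times> R)\<inverse> `` {r})" using card_X star_parameters_pos(4) by (simp add: B_r)
    have "?n \<le> card (leaf_adjacency\<inverse> `` {r})"
      using finite_star_graph(2) by (intro card_mono) (auto simp: B_def intro: finite_Image)
    thus "card ((B \<inter> L \<times> R)\<inverse> `` {r}) \<le> D * d" using card_centres_seeing[of r] r LR(2) by (auto simp: B_r)
  next
    show "locally_sparse E (V1 \<union> V2) d (2 * ?c) (2 * ?c * ((?q + 1) * degree_threshold \<Delta> ?c D))"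
      using sparse unfolding sparsity_def .
  qed (use G LR fin(1,2,3) d b star_parameters_pos(3) H in \<open>auto intro: finite_subset\<close>)
qed

end

lemma topological_minor_of_bounded_degrees:
  assumes "simple_graph VH EH" "card VH \<le> d" "\<And>h. card (EH `` {h}) \<le> \<Delta>"
  shows "topological_minor (V1 \<union> V2) E VH EH"
  by (rule disjoint_stars) (rule topological_minor_of_stars[OF _ _ _ _ _ assms])

end

lemma degree_threshold_mono:
  assumes "b \<le> b'"
  shows "degree_threshold \<Delta> b D \<le> degree_threshold \<Delta> b' D"
proof -
  have a: "outreach_factor \<Delta> b D \<le> outreach_factor \<Delta> b' D" using assms by (simp add: outreach_factor_def)
  hence "fringe_size \<Delta> b D \<le> fringe_size \<Delta> b' D" using assms unfolding fringe_size_def by (intro mult_le_mono) auto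
  thus ?thesis unfolding degree_threshold_def using a by (intro add_mono mult_le_mono) auto
qed

lemma topological_minor_of_degree_gap:
  assumes G: "simple_graph W E" and LR: "L \<subseteq> W" "R \<subseteq> W" "L \<inter> R = {}"
    and dense: "0 < m" "d * card W \<le> c * m" "m \<le> 8 * edge_count E L R"
    and L: "card L * (32 * (4 * fringe_size \<Delta> (32 * c) k * k) * d) \<le> m"
    and R: "\<And>r. r \<in> R \<Longrightarrow> card (E `` {r}) \<le> k * d"
    and ck: "1 \<le> c" "1 \<le> k"
    and sparse: "locally_sparse E W d (2 * (32 * c)) (2 * (32 * c) * (1 * degree_threshold \<Delta> (32 * c) k))"
    and d: "degree_threshold \<Delta> (32 * c) k \<le> d"
    and H: "simple_graph VH EH" "card VH \<le> d" "\<And>h. card (EH `` {h}) \<le> \<Delta>"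
  shows "topological_minor W E VH EH"
proof -
  note E = simple_graphD[OF G]
  define B where "B = E \<inter> L \<times> R"
  have fin: "finite L" "finite R" "finite (E `` {x})" for x using LR E(1,2) finite_subset by auto
  have m: "m \<le> 8 * card B" using dense(3) by (simp add: B_def edge_count_def)
  hence "B \<noteq> {}" using dense(1) by auto
  then obtain L' R' where L': "L' \<subseteq> L" "R' \<subseteq> R" "L' \<noteq> {}" "R' \<noteq> {}"
    "\<And>l. l \<in> L' \<Longrightarrow> card B \<le> 4 * card L * card (B `` {l} \<inter> R')"
    "\<And>r. r \<in> R' \<Longrightarrow> card B \<le> 4 * card R * card (B\<inverse> `` {r} \<inter> L')"
    using min_degree_subpair[of L R B] fin(1,2) unfolding B_def by (metis Int_lower2)
  have pos: "0 < card W" "0 < card L" using L'(1,3) LR(1) E(1) fin(1) by (auto simp: card_gt_0_iff)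
  show ?thesis
  proof (rule topological_minor_of_small_clusters[OF G, where L = L' and P = "\<lambda>l. {l}" and R = R' and s = 1 and d = d
        and b = "32 * c" and D = k and \<Delta> = \<Delta> and B = "B \<inter> L' \<times> R'"])
    show "4 * fringe_size \<Delta> (32 * c) k * k * d \<le> card ((B \<inter> L' \<times> R') `` {l})" if l: "l \<in> L'" for l
    proof -
      have "card L * (32 * (4 * fringe_size \<Delta> (32 * c) k * k) * d) \<le> 8 * (4 * card L * card (B `` {l} \<inter> R'))"
        using L m L'(5)[OF l] by linarith
      also have "\<dots> = card L * (32 * card (B `` {l} \<inter> R'))" by simp
      finally have "32 * (4 * fringe_size \<Delta> (32 * c) k * k) * d \<le> 32 * card (B `` {l} \<inter> R')"
        using pos(2) unfolding mult_le_cancel1 by simp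
      moreover have "32 * (4 * fringe_size \<Delta> (32 * c) k * k) * d = 32 * (4 * fringe_size \<Delta> (32 * c) k * k * d)" by simp
      moreover have B_l: "(B \<inter> L' \<times> R') `` {l} = B `` {l} \<inter> R'" using l by auto
      ultimately show ?thesis unfolding B_l by linarith
    qed
    show "finite L'" using L'(1) fin(1) by (rule finite_subset)
    show "disjoint_family_on (\<lambda>l. {l}) L'" by (simp add: disjoint_family_on_def)
    show "R' \<subseteq> W" using L'(2) LR(2) by auto
    show "{l} \<subseteq> W" "{l} \<inter> R' = {}" if "l \<in> L'" for l using that L'(1,2) LR by auto
    fix r assume r: "r \<in> R'"
    let ?n = "card (B\<inverse> `` {r} \<inter> L')"
    have B_r: "(B \<inter> L' \<times> R')\<inverse> `` {r} = B\<inverse> `` {r} \<inter> L'" using r by auto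
    have "card R \<le> card W" using LR(2) E(1) by (rule card_mono[rotated])
    hence "8 * (4 * card R * ?n) \<le> 8 * (4 * card W * ?n)" by simp
    hence "m \<le> 8 * (4 * card W * ?n)" using m L'(6)[OF r] by linarith
    hence "d * card W \<le> c * (8 * (4 * card W * ?n))" using dense(2) by (meson mult_le_mono2 order_trans)
    also have "\<dots> = 32 * c * ?n * card W" by simp
    finally show "d \<le> 32 * c * card ((B \<inter> L' \<times> R')\<inverse> `` {r})" using pos(1) by (simp add: B_r)
    have "?n \<le> card (E `` {r})" using fin(3) by (intro card_mono) (auto simp: B_def dest: symD[OF E(3)])
    thus "card ((B \<inter> L' \<times> R')\<inverse> `` {r}) \<le> k * d" unfolding B_r using R[of r] r L'(2) by auto
  next
    show "connected_in E {l}" for l by (rule connected_in_singleton)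
    show "\<exists>w\<in>{l}. (w, r) \<in> E" if "(l, r) \<in> B \<inter> L' \<times> R'" for l r using that by (simp add: B_def)
  qed (use sparse d ck H L'(3) in auto)
qed

lemma topological_minor_of_bounded_part:
  assumes G: "simple_graph W E" and RW: "R \<subseteq> W"
    and dense: "0 < m" "d * card W \<le> c * m" "m \<le> 4 * edge_count E R R"
    and R: "\<And>r. r \<in> R \<Longrightarrow> card (E `` {r}) \<le> k * d"
    and ck: "1 \<le> c" "1 \<le> k"
    and sparse: "locally_sparse E W d (2 * star_factor (64 * c) k) (sparsity \<Delta> (64 * c) k)"
    and d: "degree_threshold \<Delta> (star_factor (64 * c) k) k \<le> d"
    and H: "simple_graph VH EH" "card VH \<le> d" "\<And>h. card (EH `` {h}) \<le> \<Delta>"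
  shows "topological_minor W E VH EH"
proof -
  note E = simple_graphD[OF G]
  have finR: "finite R" using RW E(1) finite_subset by auto
  obtain A where A: "A \<subseteq> R" "edge_count E R R \<le> 4 * edge_count E A (R - A)" using large_cut[OF finR E(3,4)] by auto
  define B where "B = E \<inter> A \<times> (R - A)"
  have fin: "finite A" "finite (R - A)" using A(1) finR finite_subset by auto
  have m: "m \<le> 16 * card B" using dense(3) A(2) by (simp add: B_def edge_count_def)
  hence "B \<noteq> {}" using dense(1) by auto
  then obtain V1 V2 where V: "V1 \<subseteq> A" "V2 \<subseteq> R - A" "V1 \<noteq> {}" "V2 \<noteq> {}"
    "\<And>l. l \<in> V1 \<Longrightarrow> card B \<le> 4 * card A * card (B `` {l} \<inter> V2)"
    "\<And>r. r \<in> V2 \<Longrightarrow> card B \<le> 4 * card (R - A) * card (B\<inverse> `` {r} \<inter> V1)"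
    using min_degree_subpair[of A "R - A" B] fin unfolding B_def by (metis Int_lower2)
  have V12: "V1 \<inter> V2 = {}" "V1 \<union> V2 \<subseteq> R" using V(1,2) A(1) by auto
  define E2 where "E2 = E \<inter> (V1 \<times> V2 \<union> V2 \<times> V1)"
  have nbrs: "E2 `` {x} = B `` {x} \<inter> V2" if "x \<in> V1" for x using that V12(1) V(1,2) by (auto simp: E2_def B_def)
  have nbrs': "E2 `` {x} = B\<inverse> `` {x} \<inter> V1" if "x \<in> V2" for x
    using that V12(1) V(1,2) by (auto simp: E2_def B_def dest: symD[OF E(3)])
  have lower: "d \<le> 64 * c * n" if "card B \<le> 4 * card X * n" "X \<subseteq> R" for X n
  proof -
    have "card X \<le> card W" using that(2) RW E(1) by (intro card_mono) auto
    hence "16 * (4 * card X * n) \<le> 16 * (4 * card W * n)" by simp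
    hence "m \<le> 16 * (4 * card W * n)" using m that(1) by linarith
    hence "d * card W \<le> c * (16 * (4 * card W * n))" using dense(2) by (meson mult_le_mono2 order_trans)
    also have "\<dots> = 64 * c * n * card W" by simp
    finally show ?thesis using V(3) V12(2) RW E(1) by (auto simp: card_gt_0_iff)
  qed
  have "topological_minor (V1 \<union> V2) E2 VH EH"
  proof (rule topological_minor_of_bounded_degrees[of "64 * c" k])
    have "finite (V1 \<union> V2)" using V12(2) finR by (rule finite_subset)
    thus "simple_graph (V1 \<union> V2) E2" unfolding simple_graph_def
      using E(4) by (auto simp: E2_def irrefl_def sym_def dest: symD[OF E(3)])
    show "d \<le> 64 * c * card (E2 `` {x})" if "x \<in> V1 \<union> V2" for x
      using that
    proof
      assume x: "x \<in> V1"
      show ?thesis unfolding nbrs[OF x] by (rule lower[OF V(5)[OF x] A(1)])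
    next
      assume x: "x \<in> V2"
      show ?thesis unfolding nbrs'[OF x] by (rule lower[OF V(6)[OF x]]) auto
    qed
    show "card (E2 `` {x}) \<le> k * d" if "x \<in> V1 \<union> V2" for x
    proof -
      have "card (E2 `` {x}) \<le> card (E `` {x})"
        using E(2) by (intro card_mono) (auto simp: E2_def intro: finite_Image)
      thus ?thesis using R[of x] that V12(2) by auto
    qed
    show "locally_sparse E2 (V1 \<union> V2) d (2 * star_factor (64 * c) k) (sparsity \<Delta> (64 * c) k)"
      by (rule locally_sparse_mono[OF sparse]) (use V12(2) RW E(1) in \<open>auto simp: E2_def\<close>)
    show "E2 \<subseteq> V1 \<times> V2 \<union> V2 \<times> V1" by (auto simp: E2_def)
  qed (use ck d V(4) V12(1) H in auto)
  thus ?thesis by (rule topological_minor_mono) (use V12(2) RW in \<open>auto simp: E2_def\<close>)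
qed

lemma minimal_dense_subgraph:
  assumes "V \<noteq> {}" "d * card V \<le> c * edge_count E V V"
  obtains W where "W \<subseteq> V" "W \<noteq> {}" "d * card W \<le> c * edge_count E W W"
    "\<forall>X\<subseteq>V. X \<noteq> {} \<longrightarrow> d * card X \<le> c * edge_count E X X \<longrightarrow> card W \<le> card X"
proof -
  let ?P = "\<lambda>W. W \<subseteq> V \<and> W \<noteq> {} \<and> d * card W \<le> c * edge_count E W W"
  have "?P V" using assms by simp
  hence "\<exists>W. ?P W \<and> (\<forall>X. ?P X \<longrightarrow> card W \<le> card X)" by (rule ex_has_least_nat)
  thus thesis using that by blast
qed

lemma edge_count_minimal_dense_less:
  assumes E: "sym E" and W: "finite W" "W \<noteq> {}" and dense: "d * card W \<le> c * edge_count E W W"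
    and min: "\<And>X. X \<subseteq> W \<Longrightarrow> X \<noteq> {} \<Longrightarrow> X \<noteq> W \<Longrightarrow> c * edge_count E X X < d * card X"
    and d: "1 \<le> c" "4 * c \<le> d"
  shows "edge_count E W W < 2 * d * card W"
proof -
  let ?m = "edge_count E W W" and ?deg = "\<lambda>v. card (E `` {v} \<inter> W)"
  note dense
  also have "c * ?m \<le> c * (card W * card W)" using edge_count_le[OF W(1,1)] by (rule mult_le_mono2)
  also have "\<dots> = c * card W * card W" by simp
  finally have "d \<le> c * card W" using W by (simp add: card_gt_0_iff)
  hence "c * 4 \<le> c * card W" using d(2) by linarith
  hence card_W: "4 \<le> card W" using d(1) by simp
  have m: "?m = (\<Sum>v\<in>W. ?deg v)" by (rule edge_count_eq_sum[OF W(1,1)])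
  have "\<exists>v\<in>W. card W * ?deg v \<le> ?m"
  proof (rule ccontr)
    assume "\<not> ?thesis"
    hence "(\<Sum>v\<in>W. ?m) < (\<Sum>v\<in>W. card W * ?deg v)" using W by (intro sum_strict_mono) auto
    thus False by (simp add: m sum_distrib_left)
  qed
  then obtain v where v: "v \<in> W" "card W * ?deg v \<le> ?m" by auto
  have "4 * ?deg v \<le> card W * ?deg v" using card_W by (rule mult_le_mono1)
  hence half: "?m \<le> 2 * edge_count E (W - {v}) (W - {v})"
    using edge_count_remove_vertex[OF E W(1), of v] v(2) by linarith
  have card_Wv: "card (W - {v}) = card W - 1" using v(1) W(1) by simp
  hence "0 < card (W - {v})" using card_W by simp
  hence "W - {v} \<noteq> {}" by (metis card.empty less_irrefl)
  hence "c * edge_count E (W - {v}) (W - {v}) < d * card (W - {v})" using v(1) by (intro min) auto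
  also have "\<dots> \<le> d * card W" using card_Wv by simp
  finally have "c * edge_count E (W - {v}) (W - {v}) < d * card W" .
  moreover have "1 * edge_count E (W - {v}) (W - {v}) \<le> c * edge_count E (W - {v}) (W - {v})" using d(1) by (rule mult_le_mono1)
  moreover have "2 * d * card W = 2 * (d * card W)" by simp
  ultimately show ?thesis using half by linarith
qed

lemma light_level:
  fixes k :: "nat \<Rightarrow> nat" and f :: "'a \<Rightarrow> nat"
  assumes W: "finite W" and k: "mono k" and N: "0 < N"
  shows "\<exists>i<N. N * (\<Sum>v\<in>{v \<in> W. k i \<le> f v \<and> f v < k (Suc i)}. f v) \<le> (\<Sum>v\<in>W. f v)"
proof (rule ccontr)
  let ?L = "\<lambda>i. {v \<in> W. k i \<le> f v \<and> f v < k (Suc i)}"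
  assume "\<not> ?thesis"
  hence "(\<Sum>i<N. \<Sum>v\<in>W. f v) < (\<Sum>i<N. N * (\<Sum>v\<in>?L i. f v))"
    using N by (intro sum_strict_mono) (auto simp: lessThan_empty_iff)
  also have "\<dots> = N * (\<Sum>i<N. \<Sum>v\<in>?L i. f v)" by (rule sum_distrib_left[symmetric])
  also have "(\<Sum>i<N. \<Sum>v\<in>?L i. f v) = (\<Sum>v\<in>(\<Union>i<N. ?L i). f v)"
  proof (rule sum.UNION_disjoint[symmetric])
    have False if "i < j" "v \<in> ?L i" "v \<in> ?L j" for i j v
    proof -
      have "k (Suc i) \<le> k j" using that(1) by (intro monoD[OF k]) simp
      thus False using that by simp
    qed
    thus "\<forall>i\<in>{..<N}. \<forall>j\<in>{..<N}. i \<noteq> j \<longrightarrow> ?L i \<inter> ?L j = {}" by (metis (lifting) disjoint_iff nat_neq_iff)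
  qed (use W in auto)
  also have "\<dots> \<le> (\<Sum>v\<in>W. f v)" using W by (intro sum_mono2) auto
  finally show False using N by simp
qed

lemma edge_count_degree_split:
  assumes E: "sym E" and fin: "finite L" "finite M" "finite R"
    and sparse: "16 * edge_count E L L \<le> m" "8 * edge_count E M (L \<union> R \<union> M) \<le> m"
    and m: "m = edge_count E (L \<union> R \<union> M) (L \<union> R \<union> M)"
  shows "m \<le> 8 * edge_count E L R \<or> m \<le> 4 * edge_count E R R"
proof -
  let ?e = "edge_count E" and ?W = "L \<union> R \<union> M"
  have mono: "?e X Y \<le> ?e X' Y'" if "X \<subseteq> X'" "Y \<subseteq> Y'" "X' \<subseteq> ?W" "Y' \<subseteq> ?W" for X Y X' Y'
    using that fin by (intro edge_count_mono) (auto intro: finite_subset)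
  have "m \<le> ?e (L \<union> R) ?W + ?e M ?W" unfolding m by (rule edge_count_Un_left_le)
  also have "?e (L \<union> R) ?W = ?e ?W (L \<union> R)" by (rule edge_count_commute[OF E])
  also have "\<dots> \<le> ?e (L \<union> R) (L \<union> R) + ?e M (L \<union> R)" by (rule edge_count_Un_left_le)
  also have "?e M (L \<union> R) \<le> ?e M ?W" by (intro mono) auto
  also have "?e (L \<union> R) (L \<union> R) \<le> ?e L (L \<union> R) + ?e R (L \<union> R)" by (rule edge_count_Un_left_le)
  also have "?e L (L \<union> R) = ?e (L \<union> R) L" by (rule edge_count_commute[OF E])
  also have "\<dots> \<le> ?e L L + ?e R L" by (rule edge_count_Un_left_le)
  also have "?e R (L \<union> R) = ?e (L \<union> R) R" by (rule edge_count_commute[OF E])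
  also have "\<dots> \<le> ?e L R + ?e R R" by (rule edge_count_Un_left_le)
  also have "?e R L = ?e L R" by (rule edge_count_commute[OF E])
  finally show ?thesis using sparse by linarith
qed

text \<open>
  The degree thresholds grow so fast that, unless one of eight consecutive levels carries few edges,
  there are too many edges; deleting that level leaves a large gap between low and high degrees.
\<close>

fun degree_level :: "nat \<Rightarrow> nat \<Rightarrow> nat \<Rightarrow> nat" where
  "degree_level \<Delta> c 0 = 16"
| "degree_level \<Delta> c (Suc i) =
    32 * (4 * fringe_size \<Delta> (32 * c) (degree_level \<Delta> c i) * degree_level \<Delta> c i) + degree_level \<Delta> c i"

lemma degree_level_ge: "16 \<le> degree_level \<Delta> c i"
  by (induction i) auto

lemma mono_degree_level: "mono (degree_level \<Delta> c)"
  by (intro incseq_SucI) simp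

declare degree_level.simps(2) [simp del]

lemma minimal_dense_topological_minor:
  assumes G: "simple_graph W E" "W \<noteq> {}" and dense: "d * card W \<le> c * card E"
    and min: "\<And>X. X \<subseteq> W \<Longrightarrow> X \<noteq> {} \<Longrightarrow> X \<noteq> W \<Longrightarrow> c * edge_count E X X < d * card X"
    and d: "1 \<le> c" "4 * c \<le> d"
      "\<And>i. i < 8 \<Longrightarrow> degree_threshold \<Delta> (star_factor (64 * c) (degree_level \<Delta> c i)) (degree_level \<Delta> c i) \<le> d"
    and sparse: "\<And>i. i < 8 \<Longrightarrow> locally_sparse E W d (2 * star_factor (64 * c) (degree_level \<Delta> c i)) (sparsity \<Delta> (64 * c) (degree_level \<Delta> c i))"
    and H: "simple_graph VH EH" "card VH \<le> d" "\<And>h. card (EH `` {h}) \<le> \<Delta>"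
  shows "topological_minor W E VH EH"
proof -
  note E = simple_graphD[OF G(1)] and edges = simple_graph_card_edges[OF G(1)]
  let ?m = "card E" and ?deg = "\<lambda>v. card (E `` {v})" and ?k = "degree_level \<Delta> c"
  have m: "0 < ?m" "?m < 2 * d * card W"
  proof -
    show "?m < 2 * d * card W"
      using edge_count_minimal_dense_less[OF E(3,1) G(2) _ min d(1,2)] dense unfolding edges(1) by simp
    have "0 < d * card W" using d(1,2) G(2) E(1) by (simp add: card_gt_0_iff)
    thus "0 < ?m" using dense by (metis gr0I mult_0_right not_le)
  qed
  have "mono (\<lambda>i. ?k i * d)" using mono_degree_level by (intro monoI mult_le_mono1) (rule monoD)
  from light_level[OF E(1) this, of 8 ?deg] obtain i where i: "i < 8"
    "8 * (\<Sum>v\<in>{v \<in> W. ?k i * d \<le> ?deg v \<and> ?deg v < ?k (Suc i) * d}. ?deg v) \<le> ?m" unfolding edges(2) by auto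
  define L where "L = {v \<in> W. ?k (Suc i) * d \<le> ?deg v}"
  define M where "M = {v \<in> W. ?k i * d \<le> ?deg v \<and> ?deg v < ?k (Suc i) * d}"
  define R where "R = {v \<in> W. ?deg v < ?k i * d}"
  have fin: "finite L" "finite M" "finite R" using E(1) by (auto simp: L_def M_def R_def)
  have mono: "?k i * d \<le> ?k (Suc i) * d" by (intro mult_le_mono1 monoD[OF mono_degree_level]) simp
  have W: "W = L \<union> R \<union> M" by (auto simp: L_def M_def R_def)
  have "v \<notin> R" if "v \<in> L" for v using that mono unfolding L_def R_def mem_Collect_eq by linarith
  hence LR: "L \<inter> R = {}" by auto
  have "card L * (?k (Suc i) * d) \<le> (\<Sum>v\<in>L. ?deg v)" using sum_mono[of L "\<lambda>_. ?k (Suc i) * d" ?deg] by (simp add: L_def)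
  also have "\<dots> \<le> ?m" unfolding edges(2) using E(1) by (intro sum_mono2) (auto simp: L_def)
  finally have card_L: "card L * (?k (Suc i) * d) \<le> ?m" .
  have "16 * (d * card L) = card L * (16 * d)" by simp
  also have "\<dots> \<le> card L * (?k (Suc i) * d)" using degree_level_ge by (intro mult_le_mono2 mult_le_mono1)
  also note card_L
  finally have card_L': "16 * (d * card L) \<le> ?m" .
  have sparse_L: "16 * edge_count E L L \<le> ?m"
  proof (cases "L = {}")
    case False
    have "L \<noteq> W" using card_L' m by auto
    hence "c * edge_count E L L < d * card L" using min[of L] False by (auto simp: L_def)
    moreover have "1 * edge_count E L L \<le> c * edge_count E L L" using d(1) by (rule mult_le_mono1)
    ultimately show ?thesis using card_L' by linarith
  qed (simp add: edge_count_def)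
  have "E `` {v} \<inter> W = E `` {v}" for v using E(5) by auto
  hence sparse_M: "8 * edge_count E M W \<le> ?m" using edge_count_eq_sum[OF fin(2) E(1), of E] i(2) by (simp add: M_def)
  have "?m \<le> 8 * edge_count E L R \<or> ?m \<le> 4 * edge_count E R R"
    by (rule edge_count_degree_split[OF E(3) fin sparse_L]) (unfold W[symmetric] edges(1), rule sparse_M, rule refl)
  thus ?thesis
  proof
    assume across: "?m \<le> 8 * edge_count E L R"
    have star: "32 * c \<le> star_factor (64 * c) (?k i)" by (simp add: star_factor_def)
    note threshold = degree_threshold_mono[OF star, of \<Delta> "?k i"]
    have "locally_sparse E W d (2 * (32 * c)) (2 * (32 * c) * (1 * degree_threshold \<Delta> (32 * c) (?k i)))"
    proof (rule locally_sparse_mono[OF sparse[OF i(1)]])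
      show "2 * (32 * c) * (1 * degree_threshold \<Delta> (32 * c) (?k i)) \<le> sparsity \<Delta> (64 * c) (?k i)"
        unfolding sparsity_def using star threshold by (intro mult_le_mono) auto
    qed (use star E(1) in auto)
    moreover have "card L * (32 * (4 * fringe_size \<Delta> (32 * c) (?k i) * ?k i) * d) \<le> ?m"
      using card_L by (simp add: degree_level.simps(2) add_mult_distrib add_mult_distrib2)
    moreover have "degree_threshold \<Delta> (32 * c) (?k i) \<le> d" using threshold d(3)[OF i(1)] by simp
    ultimately show ?thesis
      using across degree_level_ge[of \<Delta> c i]
      by (intro topological_minor_of_degree_gap[OF G(1) _ _ LR m(1) dense _ _ _ d(1) _ _ _ H]) (auto simp: L_def R_def)
  next
    assume inside: "?m \<le> 4 * edge_count E R R"
    show ?thesis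
      using degree_level_ge[of \<Delta> c i]
      by (intro topological_minor_of_bounded_part[OF G(1) _ m(1) dense inside _ d(1) _ sparse[OF i(1)] d(3)[OF i(1)] H])
        (auto simp: R_def)
  qed
qed

theorem locally_sparse_topological_minor:
  fixes \<Delta> c :: nat
  assumes c: "1 \<le> c"
  obtains b t d0 :: nat where
    "\<And>d V (E :: 'a rel) (VH :: 'w set) EH. simple_graph V E \<Longrightarrow> V \<noteq> {} \<Longrightarrow> d * card V \<le> c * card E \<Longrightarrow>
      locally_sparse E V d b t \<Longrightarrow> simple_graph VH EH \<Longrightarrow> card VH \<le> d \<Longrightarrow> (\<And>h. card (EH `` {h}) \<le> \<Delta>) \<Longrightarrow> d0 \<le> d \<Longrightarrow>
      topological_minor V E VH EH"
proof -
  let ?k = "degree_level \<Delta> c"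
  let ?b = "\<lambda>i. 2 * star_factor (64 * c) (?k i)" and ?t = "\<lambda>i. sparsity \<Delta> (64 * c) (?k i)"
    and ?d = "\<lambda>i. degree_threshold \<Delta> (star_factor (64 * c) (?k i)) (?k i)"
  have le_sum: "f i \<le> sum f {..<8}" if "i < 8" for f :: "nat \<Rightarrow> nat" and i using that by (intro member_le_sum) auto
  show thesis
  proof (rule that[of "\<Sum>i<8. ?b i" "\<Sum>i<8. ?t i" "4 * c + (\<Sum>i<8. ?d i)"])
    fix d V and E :: "'a rel" and VH :: "'w set" and EH
    assume G: "simple_graph V E" "V \<noteq> {}" "d * card V \<le> c * card E" and sparse: "locally_sparse E V d (\<Sum>i<8. ?b i) (\<Sum>i<8. ?t i)"
      and H: "simple_graph VH EH" "card VH \<le> d" "\<And>h. card (EH `` {h}) \<le> \<Delta>" and d: "4 * c + (\<Sum>i<8. ?d i) \<le> d"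
    note E = simple_graphD[OF G(1)]
    have "d * card V \<le> c * edge_count E V V" using G(3) simple_graph_card_edges(1)[OF G(1)] by simp
    then obtain W where W: "W \<subseteq> V" "W \<noteq> {}" "d * card W \<le> c * edge_count E W W"
      "\<forall>X\<subseteq>V. X \<noteq> {} \<longrightarrow> d * card X \<le> c * edge_count E X X \<longrightarrow> card W \<le> card X"
      by (rule minimal_dense_subgraph[OF G(2)])
    have finW: "finite W" using W(1) E(1) finite_subset by auto
    have "topological_minor W (Restr E W) VH EH"
    proof (rule minimal_dense_topological_minor[OF simple_graph_Restr[OF G(1) W(1)] W(2)])
      show "d * card W \<le> c * card (Restr E W)" using W(3) by (simp add: edge_count_def)
      fix X assume X: "X \<subseteq> W" "X \<noteq> {}" "X \<noteq> W"
      have "Restr (Restr E W) X = Restr E X" using X(1) by auto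
      moreover have "card X < card W" using X finW by (intro psubset_card_mono) auto
      hence "\<not> d * card X \<le> c * edge_count E X X" using W(1,4) X by (meson not_le order_trans)
      ultimately show "c * edge_count (Restr E W) X X < d * card X" unfolding edge_count_def by simp
    next
      fix i :: nat assume i: "i < 8"
      show "?d i \<le> d" using le_sum[OF i, of ?d] d by simp
      show "locally_sparse (Restr E W) W d (?b i) (?t i)"
        using W(1) E(1) le_sum[OF i] by (intro locally_sparse_mono[OF sparse]) auto
    qed (use c d H in auto)
    thus "topological_minor V E VH EH" by (rule topological_minor_mono) (use W(1) in auto)
  qed
qed

section \<open>Tilings by regular pairs\<close>

datatype 'a tile = Tile (left: "'a set") (right: "'a set") (scale: nat)

definition tile_verts :: "'a tile \<Rightarrow> 'a set" where
  "tile_verts t = left t \<union> right t"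

definition is_tile :: "'a rel \<Rightarrow> 'a set \<Rightarrow> real \<Rightarrow> nat \<Rightarrow> real \<Rightarrow> 'a tile \<Rightarrow> bool" where
  "is_tile E V \<rho> q g t \<longleftrightarrow> left t \<subseteq> V \<and> right t \<subseteq> V \<and> left t \<inter> right t = {} \<and> card (left t) = card (right t) \<and>
     q * scale t \<le> card (left t) \<and> 1 \<le> scale t \<and> g \<le> real (scale t) \<and> lower_regular E (scale t) \<rho> (left t) (right t)"

definition tile_family :: "'a rel \<Rightarrow> 'a set \<Rightarrow> real \<Rightarrow> nat \<Rightarrow> real \<Rightarrow> 'a tile set \<Rightarrow> bool" where
  "tile_family E V \<rho> q g T \<longleftrightarrow> finite T \<and> (\<forall>t\<in>T. is_tile E V \<rho> q g t) \<and> disjoint_family_on tile_verts T"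

definition covered :: "'a tile set \<Rightarrow> 'a set" where
  "covered T = (\<Union>t\<in>T. tile_verts t)"

definition coverage :: "'a tile set \<Rightarrow> nat" where
  "coverage T = (\<Sum>t\<in>T. card (left t))"

lemma is_tileD:
  assumes "is_tile E V \<rho> q g t"
  shows "left t \<subseteq> V" "right t \<subseteq> V" "left t \<inter> right t = {}" "card (left t) = card (right t)"
    "q * scale t \<le> card (left t)" "1 \<le> scale t" "g \<le> real (scale t)"
    "lower_regular E (scale t) \<rho> (left t) (right t)" "tile_verts t \<subseteq> V"
  using assms by (auto simp: is_tile_def tile_verts_def)

lemma tile_familyD:
  assumes "tile_family E V \<rho> q g T"
  shows "finite T" "t \<in> T \<Longrightarrow> is_tile E V \<rho> q g t" "disjoint_family_on tile_verts T"
    "t \<in> T \<Longrightarrow> t' \<in> T \<Longrightarrow> t \<noteq> t' \<Longrightarrow> tile_verts t \<inter> tile_verts t' = {}" "covered T \<subseteq> V"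
  using assms is_tileD(9) unfolding tile_family_def covered_def by (auto dest: disjoint_family_onD) blast+

lemma is_tile_mono: "is_tile E V \<rho> q g t \<Longrightarrow> q' \<le> q \<Longrightarrow> g' \<le> g \<Longrightarrow> is_tile E V \<rho> q' g' t"
  unfolding is_tile_def by (auto intro: order_trans[OF mult_le_mono1])

lemma tile_family_mono: "tile_family E V \<rho> q g T \<Longrightarrow> q' \<le> q \<Longrightarrow> g' \<le> g \<Longrightarrow> tile_family E V \<rho> q' g' T"
  unfolding tile_family_def using is_tile_mono by blast

lemma card_left_pos:
  assumes "is_tile E V \<rho> q g t" "1 \<le> q"
  shows "0 < card (left t)" "tile_verts t \<noteq> {}"
proof -
  have "1 * 1 \<le> q * scale t" using is_tileD(6)[OF assms(1)] assms(2) by (intro mult_le_mono)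
  thus "0 < card (left t)" using is_tileD(5)[OF assms(1)] by linarith
  thus "tile_verts t \<noteq> {}" by (auto simp: tile_verts_def)
qed

lemma card_covered:
  assumes T: "tile_family E V \<rho> q g T" and V: "finite V"
  shows "card (covered T) = 2 * coverage T"
proof -
  have fin: "finite (tile_verts t)" if "t \<in> T" for t
    using is_tileD(9)[OF tile_familyD(2)[OF T that]] V by (rule finite_subset)
  hence "card (tile_verts t) = 2 * card (left t)" if "t \<in> T" for t
    using is_tileD(3,4)[OF tile_familyD(2)[OF T that]] that by (simp add: tile_verts_def card_Un_disjoint)
  moreover have "card (covered T) = (\<Sum>t\<in>T. card (tile_verts t))"
    unfolding covered_def by (rule card_UN_disjoint) (use tile_familyD[OF T] fin in auto)
  ultimately show ?thesis by (simp add: coverage_def sum_distrib_left)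
qed

lemma tile_family_image:
  assumes T: "tile_family E V \<rho> q g T" "1 \<le> q"
    and f: "\<And>t. t \<in> T \<Longrightarrow> is_tile E V \<rho> q' g' (f t)" "\<And>t. t \<in> T \<Longrightarrow> tile_verts (f t) \<subseteq> tile_verts t" "1 \<le> q'"
  shows "tile_family E V \<rho> q' g' (f ` T)" "coverage (f ` T) = (\<Sum>t\<in>T. card (left (f t)))"
proof -
  have disjoint: "tile_verts (f t) \<inter> tile_verts (f t') = {}" if "t \<in> T" "t' \<in> T" "t \<noteq> t'" for t t'
    using tile_familyD(4)[OF T(1) that] f(2) that by blast
  hence "inj_on f T" using card_left_pos(2)[OF f(1,3)] by (metis Int_absorb inj_onI)
  thus "coverage (f ` T) = (\<Sum>t\<in>T. card (left (f t)))" by (simp add: coverage_def sum.reindex)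
  show "tile_family E V \<rho> q' g' (f ` T)"
    using tile_familyD(1)[OF T(1)] f(1) disjoint unfolding tile_family_def disjoint_family_on_def by blast
qed

lemma tile_family_Un:
  assumes "tile_family E V \<rho> q g S" "tile_family E V \<rho> q g T" "1 \<le> q" "covered S \<inter> covered T = {}"
  shows "tile_family E V \<rho> q g (S \<union> T)" "coverage (S \<union> T) = coverage S + coverage T"
proof -
  have cross: "tile_verts s \<inter> tile_verts t = {}" if "s \<in> S" "t \<in> T" for s t
    using assms(4) that by (auto simp: covered_def)
  have "s \<notin> T" if "s \<in> S" for s
    using cross[OF that, of s] card_left_pos(2)[OF tile_familyD(2)[OF assms(1) that] assms(3)] by auto
  thus "coverage (S \<union> T) = coverage S + coverage T"
    unfolding coverage_def using tile_familyD(1)[OF assms(1)] tile_familyD(1)[OF assms(2)] by (intro sum.union_disjoint) auto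
  show "tile_family E V \<rho> q g (S \<union> T)"
    using assms(1,2) cross unfolding tile_family_def disjoint_family_on_def by blast
qed

lemma sum_card_Int_le:
  assumes "finite T" "disjoint_family_on f T" "finite A"
  shows "(\<Sum>t\<in>T. card (f t \<inter> A)) \<le> card A"
proof -
  have "(\<Sum>t\<in>T. card (f t \<inter> A)) = card (\<Union>t\<in>T. f t \<inter> A)"
    using assms by (intro card_UN_disjoint[symmetric]) (auto simp: disjoint_family_on_def)
  also have "\<dots> \<le> card A" using assms(3) by (intro card_mono) auto
  finally show ?thesis .
qed

definition has_dense_pair :: "'a rel \<Rightarrow> 'a set \<Rightarrow> real \<Rightarrow> real \<Rightarrow> bool" where
  "has_dense_pair E U s \<eta> \<longleftrightarrow> (\<exists>X\<subseteq>U. \<exists>Y\<subseteq>U. X \<inter> Y = {} \<and> s \<le> real (card X) \<and> s \<le> real (card Y) \<and>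
     \<eta> * real (card X) * real (card Y) \<le> real (edge_count E X Y))"

definition tiling_host :: "'a set \<Rightarrow> 'a rel \<Rightarrow> real \<Rightarrow> real \<Rightarrow> real \<Rightarrow> real \<Rightarrow> bool" where
  "tiling_host V E e d s \<eta> \<longleftrightarrow> simple_graph V E \<and> V \<noteq> {} \<and> (1 - e / 8) * d * real (card V) \<le> real (card E) \<and>
     (\<forall>U\<subseteq>V. U \<noteq> {} \<longrightarrow> e / 8 * d * real (card U) \<le> real (edge_count E U U) \<longrightarrow> has_dense_pair E U s \<eta>)"

text \<open>
  One round of enlarging a tile family \<open>F\<close>: new tiles \<open>N\<close> are found among the uncovered vertices or
  between them and one side of an old tile, and the old tiles are trimmed where \<open>N\<close> meets them. As
  long as the two sides of an old tile lose nearly the same number of vertices, about one vertex of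
  \<open>F\<close> is lost for two that are gained.
\<close>

context
  fixes V :: "'a set" and E :: "'a rel" and e \<theta> s \<eta> g d :: real and q r M :: nat and F :: "'a tile set"
  assumes e: "0 < e" "e < 1" and \<theta>: "0 < \<theta>" "\<theta> \<le> e / 32" "\<theta> \<le> \<eta>" and q: "2 \<le> q" and r: "0 < r" and d: "0 < d"
    and host: "tiling_host V E e d s \<eta>"
    and F: "tile_family E V (\<theta> / 2) (2 * q) g F" "2 * real (coverage F) < (1 - e) * d"
    and M: "real M \<le> s" "real M \<le> e / 64 * d" "0 < g" "real M \<le> e / 32 * g" "real M \<le> e\<^sup>2 / 256 * g"
    and M_eq: "M = r * q ^ increment_steps q \<theta>"
begin

lemma host_graph: "simple_graph V E" "finite V" "sym E"
proof -
  show G: "simple_graph V E" using host by (simp add: tiling_host_def)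
  show "finite V" "sym E" using simple_graphD[OF G] by auto
qed

lemma old_tile:
  assumes "t \<in> F"
  shows "finite (left t)" "finite (right t)" "2 * (q * scale t) \<le> card (left t)" "g \<le> real (card (left t))"
    "32 * real M \<le> e * real (card (left t))"
proof -
  note t = is_tileD[OF tile_familyD(2)[OF F(1) assms]]
  show "finite (left t)" "finite (right t)" using t(1,2) host_graph(2) by (auto intro: finite_subset)
  show size: "2 * (q * scale t) \<le> card (left t)" using t(5) by (simp add: mult.assoc)
  have "1 * scale t \<le> 2 * q * scale t" using q by (intro mult_le_mono1) simp
  also have "\<dots> = 2 * (q * scale t)" by simp
  also note size
  finally have "real (scale t) \<le> real (card (left t))" by simp
  thus g: "g \<le> real (card (left t))" using t(7) by linarith
  have "e * g \<le> e * real (card (left t))" using g e by (intro mult_left_mono) auto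
  thus "32 * real M \<le> e * real (card (left t))" using M(4) by simp
qed

definition balanced :: "'a set \<Rightarrow> 'a set \<Rightarrow> 'a tile set \<Rightarrow> bool" where
  "balanced X Y N \<longleftrightarrow>
     8 * real (card (X \<inter> covered N)) \<le> e * real (card X) \<and> 8 * real (card (Y \<inter> covered N)) \<le> e * real (card Y) \<and>
     card (X \<inter> covered N) \<le> card (Y \<inter> covered N) + M \<and> card (Y \<inter> covered N) \<le> card (X \<inter> covered N) + M"

definition admissible :: "'a tile set \<Rightarrow> bool" where
  "admissible N \<longleftrightarrow> tile_family E V (\<theta> / 2) q (real r) N \<and> (\<forall>t\<in>F. balanced (left t) (right t) N) \<and>
     (\<Sum>t\<in>F. card (tile_verts t \<inter> covered N)) \<le> coverage N"

definition uncovered :: "'a tile set \<Rightarrow> 'a set" where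
  "uncovered N = V - covered F - covered N"

lemma uncovered: "finite (uncovered N)" "uncovered N \<subseteq> V" "uncovered N \<inter> covered F = {}" "uncovered N \<inter> covered N = {}"
  unfolding uncovered_def using host_graph(2) by auto

lemma balanced_sym: "balanced X Y N \<longleftrightarrow> balanced Y X N"
  by (auto simp: balanced_def)

lemma admissible_empty: "admissible {}"
  using e by (simp add: admissible_def tile_family_def disjoint_family_on_def balanced_def covered_def coverage_def)

lemma admissible_insert:
  assumes N: "admissible N" and n: "is_tile E V (\<theta> / 2) q (real r) n" "tile_verts n \<inter> covered N = {}" "right n \<inter> covered F = {}"
    and balanced: "\<And>t. t \<in> F \<Longrightarrow> balanced (left t) (right t) (insert n N)"
  shows "admissible (insert n N)" "coverage N < coverage (insert n N)"
proof -
  have q1: "1 \<le> q" using q by simp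
  have fam: "tile_family E V (\<theta> / 2) q (real r) N" using N by (simp add: admissible_def)
  have "tile_family E V (\<theta> / 2) q (real r) {n}" using n(1) by (simp add: tile_family_def disjoint_family_on_def)
  note Un = tile_family_Un[OF this fam q1]
  have cov: "coverage (insert n N) = card (left n) + coverage N" using Un(2) n(2) by (simp add: covered_def coverage_def)
  thus "coverage N < coverage (insert n N)" using card_left_pos(1)[OF n(1) q1] by simp
  have left: "finite (left n)" using is_tileD(1)[OF n(1)] host_graph(2) by (rule finite_subset)
  have "card (tile_verts t \<inter> covered (insert n N)) \<le> card (tile_verts t \<inter> left n) + card (tile_verts t \<inter> covered N)"
    if "t \<in> F" for t
  proof -
    have "tile_verts t \<inter> covered (insert n N) = (tile_verts t \<inter> left n) \<union> (tile_verts t \<inter> covered N)"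
      using n(3) that by (auto simp: covered_def tile_verts_def)
    thus ?thesis by (metis card_Un_le)
  qed
  hence "(\<Sum>t\<in>F. card (tile_verts t \<inter> covered (insert n N)))
      \<le> (\<Sum>t\<in>F. card (tile_verts t \<inter> left n)) + (\<Sum>t\<in>F. card (tile_verts t \<inter> covered N))"
    by (simp flip: sum.distrib add: sum_mono)
  also have "\<dots> \<le> card (left n) + coverage N"
    using sum_card_Int_le[OF tile_familyD(1,3)[OF F(1)] left] N by (intro add_mono) (auto simp: admissible_def)
  finally show "admissible (insert n N)"
    using Un(1) n(2) balanced cov unfolding admissible_def by (simp add: covered_def)
qed

lemma new_tile:
  assumes XY: "X \<subseteq> V" "Y \<subseteq> V" "X \<inter> Y = {}" and dense: "M \<le> card X" "M \<le> card Y" "\<theta> * real (card X) * real (card Y) \<le> real (edge_count E X Y)"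
  obtains n where "is_tile E V (\<theta> / 2) q (real r) n" "left n \<subseteq> X" "right n \<subseteq> Y" "card (left n) \<le> M"
proof -
  have fin: "finite X" "finite Y" using XY(1,2) host_graph(2) finite_subset by auto
  obtain X' Y' m where X': "X' \<subseteq> X" "Y' \<subseteq> Y" "r \<le> m" "card X' = q * m" "card Y' = q * m" "q * m \<le> M" "lower_regular E m (\<theta> / 2) X' Y'"
    using dense_pair_contains_lower_regular[OF q \<theta>(1) r fin dense[unfolded M_eq]] unfolding M_eq[symmetric] .
  hence "is_tile E V (\<theta> / 2) q (real r) (Tile X' Y' m)" using XY r by (auto simp: is_tile_def)
  thus thesis using that X' by simp
qed

lemma augment_in_uncovered:
  assumes N: "admissible N" and dense: "uncovered N \<noteq> {}" "e / 8 * d * real (card (uncovered N)) \<le> real (edge_count E (uncovered N) (uncovered N))"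
  shows "\<exists>N'. admissible N' \<and> coverage N < coverage N'"
proof -
  note L = uncovered[of N]
  have "has_dense_pair E (uncovered N) s \<eta>" using host L(2) dense by (simp add: tiling_host_def)
  then obtain X Y where XY: "X \<subseteq> uncovered N" "Y \<subseteq> uncovered N" "X \<inter> Y = {}" "s \<le> real (card X)" "s \<le> real (card Y)"
    "\<eta> * real (card X) * real (card Y) \<le> real (edge_count E X Y)" unfolding has_dense_pair_def by (elim exE conjE) (rule that)
  have "\<theta> * (real (card X) * real (card Y)) \<le> \<eta> * (real (card X) * real (card Y))" using \<theta>(3) by (intro mult_right_mono) auto
  hence "\<theta> * real (card X) * real (card Y) \<le> real (edge_count E X Y)" using XY(6) by (simp add: mult.assoc)
  moreover have "M \<le> card X" "M \<le> card Y" using M(1) XY(4,5) by linarith+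
  moreover have "X \<subseteq> V" "Y \<subseteq> V" using XY(1,2) L(2) by auto
  ultimately obtain n where n: "is_tile E V (\<theta> / 2) q (real r) n" "left n \<subseteq> X" "right n \<subseteq> Y"
    using new_tile[OF _ _ XY(3)] by metis
  have sub: "tile_verts n \<subseteq> uncovered N" using n(2,3) XY(1,2) by (auto simp: tile_verts_def)
  have same: "X \<inter> covered (insert n N) = X \<inter> covered N" if "X \<subseteq> covered F" for X
    using sub L(3) that by (auto simp: covered_def)
  have "balanced (left t) (right t) (insert n N)" if t: "t \<in> F" for t
  proof -
    have "left t \<subseteq> covered F" "right t \<subseteq> covered F" using t by (auto simp: covered_def tile_verts_def)
    thus ?thesis using N t by (simp add: admissible_def balanced_def same)
  qed
  moreover have "tile_verts n \<inter> covered N = {}" "right n \<inter> covered F = {}" using sub L(3,4) by (auto simp: tile_verts_def)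
  ultimately show ?thesis using admissible_insert[OF N n(1)] by blast
qed

lemma augment_at_tile:
  assumes N: "admissible N" and t: "t \<in> F" and XY: "X = left t \<and> Y = right t \<or> X = right t \<and> Y = left t"
    and lost: "card (X \<inter> covered N) \<le> card (Y \<inter> covered N)" "8 * (real (card (X \<inter> covered N)) + real M) \<le> e * real (card X)"
    and dense: "M \<le> card (uncovered N)" "\<theta> * real (card (X - covered N)) * real (card (uncovered N)) \<le> real (edge_count E (X - covered N) (uncovered N))"
  shows "\<exists>N'. admissible N' \<and> coverage N < coverage N'"
proof -
  note L = uncovered[of N] and tile = is_tileD[OF tile_familyD(2)[OF F(1) t]] and old = old_tile[OF t]
  have X: "X \<subseteq> tile_verts t" "Y \<subseteq> tile_verts t" "X \<inter> Y = {}" "X \<subseteq> V" "finite X" "card X = card (left t)"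
    using XY tile old by (auto simp: tile_verts_def)
  have XF: "tile_verts t \<subseteq> covered F" using t by (auto simp: covered_def)
  have "e * real (card X) \<le> 1 * real (card X)" using e by (intro mult_right_mono) auto
  hence "real (card (X \<inter> covered N) + M) \<le> real (card X)" using lost(2) by simp
  hence "card (X \<inter> covered N) + M \<le> card X" by (simp only: of_nat_le_iff)
  hence "M \<le> card (X - covered N)" using card_Int_add_card_Diff[OF X(5), of "covered N"] by linarith
  moreover have "X - covered N \<subseteq> V" "(X - covered N) \<inter> uncovered N = {}" using X(1,4) XF L(3) by auto
  ultimately obtain n where n: "is_tile E V (\<theta> / 2) q (real r) n" "left n \<subseteq> X - covered N" "right n \<subseteq> uncovered N" "card (left n) \<le> M"
    using new_tile[OF _ L(2) _ _ dense] by metis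
  have "balanced (left t') (right t') (insert n N)" if t': "t' \<in> F" for t'
  proof (cases "t' = t")
    case False
    hence "tile_verts t' \<inter> tile_verts t = {}" using tile_familyD(4)[OF F(1) t' t] by simp
    moreover have "tile_verts t' \<inter> uncovered N = {}" using L(3) t' by (auto simp: covered_def)
    ultimately have "tile_verts t' \<inter> tile_verts n = {}" using n(2,3) X(1) by (auto simp: tile_verts_def)
    hence "left t' \<inter> covered (insert n N) = left t' \<inter> covered N" "right t' \<inter> covered (insert n N) = right t' \<inter> covered N"
      by (auto simp: covered_def tile_verts_def)
    thus ?thesis using N t' by (simp add: admissible_def balanced_def)
  next
    case True
    have "balanced (left t) (right t) N" using N t by (simp add: admissible_def)
    hence b: "balanced X Y N" using XY balanced_sym by auto
    have "X \<inter> right n = {}" using n(3) X(1) XF L(3) by blast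
    hence "X \<inter> covered (insert n N) = (X \<inter> covered N) \<union> left n" using n(2) by (auto simp: covered_def tile_verts_def)
    hence "card (X \<inter> covered (insert n N)) \<le> card (X \<inter> covered N) + M" using n(4) card_Un_le[of "X \<inter> covered N" "left n"] by simp
    moreover have "card (X \<inter> covered N) \<le> card (X \<inter> covered (insert n N))" using X(5) by (intro card_mono) (auto simp: covered_def)
    moreover have "Y \<inter> tile_verts n = {}" using n(2,3) X(2,3) XF L(3) unfolding tile_verts_def by blast
    hence "Y \<inter> covered (insert n N) = Y \<inter> covered N" by (auto simp: covered_def)
    ultimately have "balanced X Y (insert n N)" using b lost by (auto simp: balanced_def)
    thus ?thesis using XY True balanced_sym by auto
  qed
  moreover have "tile_verts n \<inter> covered N = {}" "right n \<inter> covered F = {}" using n(2,3) L(3,4) by (auto simp: tile_verts_def)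
  ultimately show ?thesis using admissible_insert[OF N n(1)] by blast
qed

lemma uncovered_size:
  assumes N: "admissible N" "real (coverage N) < e\<^sup>2 / 128 * d"
  shows "real (card (covered F \<union> covered N)) \<le> (1 - e / 8) * d" "e / 64 * d \<le> real (card (uncovered N))"
    "card V = card (uncovered N) + card (covered F \<union> covered N)"
proof -
  have fam: "tile_family E V (\<theta> / 2) q (real r) N" using N(1) by (simp add: admissible_def)
  have sub: "covered F \<union> covered N \<subseteq> V" using tile_familyD(5)[OF F(1)] tile_familyD(5)[OF fam] by auto
  show V: "card V = card (uncovered N) + card (covered F \<union> covered N)"
    using card_Int_add_card_Diff[OF host_graph(2), of "covered F \<union> covered N"] sub
    by (simp add: uncovered_def Int_absorb1 Diff_Un Int_Diff Diff_Int_distrib set_diff_eq conj_ac)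
  have "card (covered F \<union> covered N) \<le> 2 * coverage F + 2 * coverage N"
    using card_Un_le[of "covered F" "covered N"] card_covered[OF F(1) host_graph(2)] card_covered[OF fam host_graph(2)] by simp
  hence "real (card (covered F \<union> covered N)) \<le> 2 * real (coverage F) + 2 * real (coverage N)" by linarith
  moreover have "e\<^sup>2 / 64 * d \<le> e / 64 * d" using e d by (intro mult_right_mono divide_right_mono) (auto simp: power2_eq_square)
  ultimately have covered: "real (card (covered F \<union> covered N)) \<le> (1 - e) * d + e / 64 * d" using F(2) N(2) by linarith
  have "real (card E) \<le> real (card V * card V)"
    using edge_count_le[OF host_graph(2,2), of E] simple_graph_card_edges(1)[OF host_graph(1)] by (simp only: of_nat_le_iff)
  hence "((1 - e / 8) * d) * real (card V) \<le> real (card V) * real (card V)" using host by (simp add: tiling_host_def)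
  moreover have "0 < real (card V)" using host host_graph(2) by (simp add: tiling_host_def card_gt_0_iff)
  ultimately have large: "(1 - e / 8) * d \<le> real (card V)" by simp
  have "0 < e * d" using e d by simp
  thus "real (card (covered F \<union> covered N)) \<le> (1 - e / 8) * d" "e / 64 * d \<le> real (card (uncovered N))"
    using covered large V by (simp_all add: algebra_simps)
qed

definition saturated :: "'a tile set \<Rightarrow> 'a tile set" where
  "saturated N = {t \<in> F. e * real (card (left t)) < 8 * (real (min (card (left t \<inter> covered N)) (card (right t \<inter> covered N))) + real M)}"

lemma card_tile_verts_Int: "t \<in> F \<Longrightarrow> card (tile_verts t \<inter> A) = card (left t \<inter> A) + card (right t \<inter> A)"
proof -
  assume t: "t \<in> F"
  have "tile_verts t \<inter> A = (left t \<inter> A) \<union> (right t \<inter> A)" by (auto simp: tile_verts_def)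
  thus ?thesis
    using old_tile(1,2)[OF t] is_tileD(3)[OF tile_familyD(2)[OF F(1) t]] by (simp add: card_Un_disjoint disjoint_iff)
qed

lemma saturated_small:
  assumes N: "admissible N" "real (coverage N) < e\<^sup>2 / 128 * d"
  shows "(\<Sum>t\<in>saturated N. real (card (left t))) \<le> e / 24 * d"
proof -
  let ?lost = "\<lambda>t. real (card (tile_verts t \<inter> covered N))"
  have "3 * e * (\<Sum>t\<in>saturated N. real (card (left t))) \<le> (\<Sum>t\<in>saturated N. 16 * ?lost t)"
    unfolding sum_distrib_left
  proof (rule sum_mono)
    fix t assume "t \<in> saturated N"
    hence t: "t \<in> F" "e * real (card (left t)) < 8 * (real (min (card (left t \<inter> covered N)) (card (right t \<inter> covered N))) + real M)"
      by (auto simp: saturated_def)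
    have "2 * real (min (card (left t \<inter> covered N)) (card (right t \<inter> covered N))) \<le> ?lost t"
      by (simp add: card_tile_verts_Int[OF t(1)] min_def)
    thus "3 * e * real (card (left t)) \<le> 16 * ?lost t" using t(2) old_tile(5)[OF t(1)] by (simp add: mult.assoc)
  qed
  also have "\<dots> \<le> 16 * (\<Sum>t\<in>F. ?lost t)" unfolding sum_distrib_left[symmetric]
    using tile_familyD(1)[OF F(1)] by (intro mult_left_mono sum_mono2) (auto simp: saturated_def)
  also have "\<dots> \<le> 16 * real (coverage N)" using N(1) by (simp add: admissible_def flip: of_nat_sum)
  also have "\<dots> < e * (e / 8 * d)" using N(2) by (simp add: power2_eq_square)
  finally have "e * (3 * (\<Sum>t\<in>saturated N. real (card (left t)))) < e * (e / 8 * d)" by simp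
  hence "3 * (\<Sum>t\<in>saturated N. real (card (left t))) < e / 8 * d" using e(1) by (rule mult_less_cancel_left_pos[THEN iffD1, rotated])
  thus ?thesis by simp
qed

context
  fixes N :: "'a tile set"
  assumes N: "admissible N" "real (coverage N) < e\<^sup>2 / 128 * d" and max: "\<And>N'. admissible N' \<Longrightarrow> coverage N' \<le> coverage N"
begin

lemma edge_count_tile_uncovered:
  assumes t: "t \<in> F"
  shows "real (edge_count E (tile_verts t - covered N) (uncovered N)) \<le>
    real (card (uncovered N)) * ((1 + \<theta>) * real (card (left t)) + (if t \<in> saturated N then real (card (left t)) else 0))"
proof -
  let ?L = "uncovered N" and ?e = "\<lambda>X. real (edge_count E (X - covered N) (uncovered N))" and ?c = "real (card (left t))"
  note fin = old_tile(1,2)[OF t] uncovered(1)[of N]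
  have "tile_verts t - covered N = (left t - covered N) \<union> (right t - covered N)" by (auto simp: tile_verts_def)
  hence split: "?e (tile_verts t) \<le> ?e (left t) + ?e (right t)"
    using edge_count_Un_left_le[of E "left t - covered N" "right t - covered N" ?L] by simp
  have side: "card X = card (left t)" "finite X" "real (card (X - covered N)) \<le> ?c" if "X = left t \<or> X = right t" for X
  proof -
    show X: "card X = card (left t)" "finite X" using that is_tileD(4)[OF tile_familyD(2)[OF F(1) t]] fin by auto
    thus "real (card (X - covered N)) \<le> ?c" using card_mono[of X "X - covered N"] by auto
  qed
  have trivial: "?e X \<le> real (card ?L) * ?c" if X: "X = left t \<or> X = right t" for X
  proof -
    have "?e X \<le> real (card (X - covered N) * card ?L)"
      using edge_count_le[OF finite_Diff[OF side(2)[OF X]] fin(3), of E] by (simp only: of_nat_le_iff)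
    also have "\<dots> \<le> ?c * real (card ?L)" using side(3)[OF X] by (simp add: mult_right_mono)
    finally show ?thesis by (simp add: mult.commute)
  qed
  have pos: "0 \<le> \<theta> * (real (card ?L) * ?c)" using \<theta>(1) by simp
  show ?thesis
  proof (cases "t \<in> saturated N")
    case True
    thus ?thesis using split trivial[of "left t"] trivial[of "right t"] pos by (simp add: algebra_simps)
  next
    case False
    have sparse: "?e X \<le> \<theta> * (real (card ?L) * ?c)"
      if XY: "X = left t \<and> Y = right t \<or> X = right t \<and> Y = left t" and less: "card (X \<inter> covered N) \<le> card (Y \<inter> covered N)" for X Y
    proof -
      have X: "X = left t \<or> X = right t" using XY by auto
      have "min (card (left t \<inter> covered N)) (card (right t \<inter> covered N)) = card (X \<inter> covered N)" using XY less by auto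
      hence "8 * (real (card (X \<inter> covered N)) + real M) \<le> e * real (card X)"
        using False t side(1)[OF X] by (auto simp: saturated_def)
      moreover have "M \<le> card ?L" using uncovered_size(2)[OF N] M(2) by linarith
      ultimately have "?e X \<le> \<theta> * real (card (X - covered N)) * real (card ?L)"
        using augment_at_tile[OF N(1) t XY less] max by (meson leD linear)
      also have "\<dots> \<le> \<theta> * ?c * real (card ?L)" using side(3)[OF X] \<theta>(1) by (intro mult_right_mono mult_left_mono) auto
      finally show ?thesis by (simp add: mult_ac)
    qed
    consider "card (left t \<inter> covered N) \<le> card (right t \<inter> covered N)" | "card (right t \<inter> covered N) \<le> card (left t \<inter> covered N)" by linarith
    hence "?e (left t) + ?e (right t) \<le> real (card ?L) * ?c + \<theta> * (real (card ?L) * ?c)"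
    proof cases
      case 1
      have "?e (left t) \<le> \<theta> * (real (card ?L) * ?c)" by (rule sparse[of _ "right t"]) (use 1 in auto)
      moreover have "?e (right t) \<le> real (card ?L) * ?c" by (rule trivial) simp
      ultimately show ?thesis by linarith
    next
      case 2
      have "?e (right t) \<le> \<theta> * (real (card ?L) * ?c)" by (rule sparse[of _ "left t"]) (use 2 in auto)
      moreover have "?e (left t) \<le> real (card ?L) * ?c" by (rule trivial) simp
      ultimately show ?thesis by linarith
    qed
    thus ?thesis using split False by (simp add: algebra_simps)
  qed
qed

lemma edge_count_covered_uncovered:
  "2 * real (edge_count E (covered F \<union> covered N) (uncovered N)) \<le> real (card (uncovered N)) * ((1 - e) * d + e / 6 * d)"
proof -
  let ?L = "uncovered N" and ?e = "\<lambda>X. real (edge_count E X (uncovered N))"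
  note finF = tile_familyD(1)[OF F(1)]
  have fam: "tile_family E V (\<theta> / 2) q (real r) N" using N(1) by (simp add: admissible_def)
  have "covered F \<union> covered N = (\<Union>t\<in>F. tile_verts t - covered N) \<union> covered N" by (auto simp: covered_def)
  hence "edge_count E (covered F \<union> covered N) ?L \<le> (\<Sum>t\<in>F. edge_count E (tile_verts t - covered N) ?L) + edge_count E (covered N) ?L"
    using edge_count_Un_left_le[of E "\<Union>t\<in>F. tile_verts t - covered N" "covered N" ?L]
      edge_count_UN_left_le[OF finF, of E "\<lambda>t. tile_verts t - covered N" ?L] by simp
  hence "?e (covered F \<union> covered N) \<le> (\<Sum>t\<in>F. ?e (tile_verts t - covered N)) + ?e (covered N)"
    by (metis of_nat_add of_nat_le_iff of_nat_sum)
  also have "(\<Sum>t\<in>F. ?e (tile_verts t - covered N)) \<le>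
      (\<Sum>t\<in>F. real (card ?L) * ((1 + \<theta>) * real (card (left t)) + (if t \<in> saturated N then real (card (left t)) else 0)))"
    by (rule sum_mono) (rule edge_count_tile_uncovered)
  also have "\<dots> = real (card ?L) * ((1 + \<theta>) * real (coverage F) + (\<Sum>t\<in>saturated N. real (card (left t))))"
  proof -
    have "F \<inter> {t. t \<in> saturated N} = saturated N" by (auto simp: saturated_def)
    thus ?thesis using finF by (simp add: sum_distrib_left[symmetric] sum.distrib sum.If_cases coverage_def)
  qed
  also have "?e (covered N) \<le> real (card ?L) * (2 * real (coverage N))"
  proof -
    have "finite (covered N)" using tile_familyD(5)[OF fam] host_graph(2) by (rule finite_subset)
    hence "?e (covered N) \<le> real (card (covered N) * card ?L)"
      using edge_count_le[of "covered N" ?L E] uncovered(1)[of N] by (simp only: of_nat_le_iff)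
    thus ?thesis using card_covered[OF fam host_graph(2)] by (simp add: mult_ac)
  qed
  finally have bound: "2 * ?e (covered F \<union> covered N) \<le> real (card ?L) *
      (2 * ((1 + \<theta>) * real (coverage F)) + 2 * (\<Sum>t\<in>saturated N. real (card (left t))) + 4 * real (coverage N))"
    by (simp add: algebra_simps)
  have "(1 + \<theta>) * (2 * real (coverage F)) \<le> (1 + e / 32) * ((1 - e) * d)"
    by (rule mult_mono) (use F(2) \<theta>(1,2) e in auto)
  also have "\<dots> \<le> (1 - e) * d + e / 32 * d" using e d by (simp add: algebra_simps)
  finally have "2 * ((1 + \<theta>) * real (coverage F)) \<le> (1 - e) * d + e / 32 * d" by (simp add: mult.left_commute)
  moreover have "e\<^sup>2 / 32 * d \<le> e / 32 * d" using e d by (intro mult_right_mono divide_right_mono) (auto simp: power2_eq_square)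
  moreover have "0 \<le> e * d" using e d by simp
  ultimately have "2 * ((1 + \<theta>) * real (coverage F)) + 2 * (\<Sum>t\<in>saturated N. real (card (left t))) + 4 * real (coverage N)
      \<le> (1 - e) * d + e / 6 * d"
    using saturated_small[OF N] N(2) by linarith
  thus ?thesis using bound by (meson mult_left_mono of_nat_0_le_iff order_trans)
qed

lemma not_maximal: False
proof -
  let ?L = "uncovered N" and ?T = "covered F \<union> covered N"
  note V = host_graph and L = uncovered[of N] and size = uncovered_size[OF N]
  have fam: "tile_family E V (\<theta> / 2) q (real r) N" using N(1) by (simp add: admissible_def)
  have T: "?T \<subseteq> V" "finite ?T" "?L \<inter> ?T = {}" "V = ?L \<union> ?T"
    using tile_familyD(5)[OF F(1)] tile_familyD(5)[OF fam] V(2) by (auto simp: uncovered_def intro: finite_subset)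
  have pos: "0 < real (card ?L)" using size(2) e d by (smt (verit) divide_pos_pos mult_pos_pos)
  hence "?L \<noteq> {}" by auto
  hence inner: "real (edge_count E ?L ?L) < e / 8 * d * real (card ?L)"
    using augment_in_uncovered[OF N(1)] max by (meson leD linear not_le)
  have "card E = edge_count E (?L \<union> ?T) (?L \<union> ?T)" using simple_graph_card_edges(1)[OF V(1)] T(4) by simp
  also have "\<dots> = edge_count E ?L ?L + edge_count E ?L ?T + (edge_count E ?T ?L + edge_count E ?T ?T)"
    using edge_count_Un_left[OF L(1) T(2) _ T(3), of "?L \<union> ?T" E] edge_count_Un_right[OF L(1) L(1) T(2,3), of E]
      edge_count_Un_right[OF T(2) L(1) T(2,3), of E] L(1) T(2) by simp
  also have "edge_count E ?L ?T = edge_count E ?T ?L" by (rule edge_count_commute[OF V(3)])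
  finally have "real (card E) = real (edge_count E ?L ?L) + 2 * real (edge_count E ?T ?L) + real (edge_count E ?T ?T)" by simp
  moreover have "real (edge_count E ?T ?T) \<le> (1 - e / 8) * d * real (card ?T)"
  proof -
    have "real (edge_count E ?T ?T) \<le> real (card ?T * card ?T)" using edge_count_le[OF T(2,2)] by (simp only: of_nat_le_iff)
    also have "\<dots> \<le> (1 - e / 8) * d * real (card ?T)" using size(1) by (simp add: mult_right_mono)
    finally show ?thesis .
  qed
  moreover have "(1 - e / 8) * d * (real (card ?L) + real (card ?T)) \<le> real (card E)"
    using host size(3) by (simp add: tiling_host_def)
  ultimately have "(1 - e / 8) * d * real (card ?L) < e / 8 * d * real (card ?L) + real (card ?L) * ((1 - e) * d + e / 6 * d)"
    using inner edge_count_covered_uncovered by (simp only: distrib_left)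
  hence "((1 - e / 8) * d) * real (card ?L) < (e / 8 * d + ((1 - e) * d + e / 6 * d)) * real (card ?L)" by (simp add: algebra_simps)
  hence "(1 - e / 8) * d < e / 8 * d + ((1 - e) * d + e / 6 * d)" using pos by (simp only: mult_less_cancel_right_pos)
  moreover have "0 < e * d" using e d by simp
  ultimately show False by (simp add: algebra_simps)
qed

end

lemma exists_large_admissible: "\<exists>N. admissible N \<and> e\<^sup>2 / 128 * d \<le> real (coverage N)"
proof (rule ccontr)
  assume "\<not> ?thesis"
  hence small: "real (coverage N) < e\<^sup>2 / 128 * d" if "admissible N" for N using that by (meson not_le)
  hence "\<forall>N. admissible N \<longrightarrow> coverage N < nat \<lceil>e\<^sup>2 / 128 * d\<rceil>" by (metis less_ceiling_iff of_int_of_nat_eq zless_nat_conj zless_nat_eq_int_zless)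
  with admissible_empty have "\<exists>N. admissible N \<and> (\<forall>N'. admissible N' \<longrightarrow> coverage N' \<le> coverage N)" by (rule ex_has_greatest_nat)
  thus False using not_maximal small by blast
qed

definition trim :: "'a tile set \<Rightarrow> 'a tile \<Rightarrow> 'a tile" where
  "trim N t = (let k = card (left t) - max (card (left t \<inter> covered N)) (card (right t \<inter> covered N)) in
     Tile (SOME A. A \<subseteq> left t - covered N \<and> card A = k) (SOME B. B \<subseteq> right t - covered N \<and> card B = k) (scale t))"

lemma trim:
  assumes N: "admissible N" and t: "t \<in> F"
  shows "is_tile E V (\<theta> / 2) q g (trim N t)" "tile_verts (trim N t) \<subseteq> tile_verts t - covered N"
    "2 * card (left t) \<le> 2 * card (left (trim N t)) + card (tile_verts t \<inter> covered N) + M"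
proof -
  note tile = is_tileD[OF tile_familyD(2)[OF F(1) t]] and old = old_tile[OF t]
  define k where "k = card (left t) - max (card (left t \<inter> covered N)) (card (right t \<inter> covered N))"
  have balanced: "balanced (left t) (right t) N" using N t by (simp add: admissible_def)
  have "k \<le> card (left t - covered N)" "k \<le> card (right t - covered N)"
    using card_Int_add_card_Diff[OF old(1), of "covered N"] card_Int_add_card_Diff[OF old(2), of "covered N"] tile(4)
    by (auto simp: k_def)
  hence "\<exists>A. A \<subseteq> left t - covered N \<and> card A = k" "\<exists>B. B \<subseteq> right t - covered N \<and> card B = k"
    by (meson obtain_subset_with_card_n)+
  from this[THEN someI_ex] have AB: "left (trim N t) \<subseteq> left t - covered N" "card (left (trim N t)) = k"
    "right (trim N t) \<subseteq> right t - covered N" "card (right (trim N t)) = k" "scale (trim N t) = scale t"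
    by (simp_all add: trim_def Let_def k_def)
  show "tile_verts (trim N t) \<subseteq> tile_verts t - covered N" using AB(1,3) by (auto simp: tile_verts_def)
  have "e * real (card (left t)) \<le> 1 * real (card (left t))" using e by (intro mult_right_mono) auto
  hence "real (8 * card (left t \<inter> covered N)) \<le> real (card (left t))" "real (8 * card (right t \<inter> covered N)) \<le> real (card (left t))"
    using balanced tile(4) by (auto simp: balanced_def)
  hence half: "card (left t) \<le> 2 * k" "card (left t) = k + max (card (left t \<inter> covered N)) (card (right t \<inter> covered N))"
    by (auto simp: k_def)
  thus "2 * card (left t) \<le> 2 * card (left (trim N t)) + card (tile_verts t \<inter> covered N) + M"
    using balanced AB(2) by (auto simp: balanced_def card_tile_verts_Int[OF t])
  have sub: "left (trim N t) \<subseteq> left t" "right (trim N t) \<subseteq> right t" using AB(1,3) by auto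
  show "is_tile E V (\<theta> / 2) q g (trim N t)"
    unfolding is_tile_def AB(2,4,5) using tile sub half(1) old(3) lower_regular_subset[OF tile(8) sub] by auto
qed

lemma sum_scale_error: "real (card F) * real M \<le> e\<^sup>2 / 256 * d"
proof -
  have "real (card F) * g \<le> (\<Sum>t\<in>F. real (card (left t)))" using sum_mono[of F "\<lambda>_. g" "\<lambda>t. real (card (left t))"] old_tile(4) by simp
  also have "\<dots> = real (coverage F)" by (simp add: coverage_def)
  also have "\<dots> \<le> d"
  proof -
    have "(1 - e) * d \<le> 1 * d" using e d by (intro mult_right_mono) auto
    thus ?thesis using F(2) by linarith
  qed
  finally have "e\<^sup>2 / 256 * (real (card F) * g) \<le> e\<^sup>2 / 256 * d" by (intro mult_left_mono) auto
  moreover have "real (card F) * real M \<le> real (card F) * (e\<^sup>2 / 256 * g)" using M(5) by (intro mult_left_mono) auto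
  ultimately show ?thesis by (simp add: mult_ac)
qed

lemma enlarge_tile_family:
  "\<exists>F'. tile_family E V (\<theta> / 2) q (min g (real r)) F' \<and> real (coverage F) + e\<^sup>2 / 512 * d \<le> real (coverage F')"
proof -
  obtain N where N: "admissible N" "e\<^sup>2 / 128 * d \<le> real (coverage N)" using exists_large_admissible by auto
  have q1: "1 \<le> q" "1 \<le> 2 * q" using q by auto
  have trimmed: "tile_family E V (\<theta> / 2) q g (trim N ` F)" "coverage (trim N ` F) = (\<Sum>t\<in>F. card (left (trim N t)))"
    using tile_family_image[OF F(1) q1(2), of q g "trim N"] trim[OF N(1)] q1(1) by blast+
  have disjoint: "covered (trim N ` F) \<inter> covered N = {}" using trim(2)[OF N(1)] by (auto simp: covered_def)
  have "tile_family E V (\<theta> / 2) q (real r) N" using N(1) by (simp add: admissible_def)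
  hence new: "tile_family E V (\<theta> / 2) q (min g (real r)) N" by (rule tile_family_mono) auto
  have "tile_family E V (\<theta> / 2) q (min g (real r)) (trim N ` F)" by (rule tile_family_mono[OF trimmed(1)]) auto
  note union = tile_family_Un[OF this new q1(1) disjoint]
  have "2 * coverage F = (\<Sum>t\<in>F. 2 * card (left t))" by (simp add: coverage_def sum_distrib_left)
  also have "\<dots> \<le> (\<Sum>t\<in>F. 2 * card (left (trim N t)) + card (tile_verts t \<inter> covered N) + M)"
    using trim(3)[OF N(1)] by (rule sum_mono)
  also have "\<dots> = 2 * coverage (trim N ` F) + (\<Sum>t\<in>F. card (tile_verts t \<inter> covered N)) + card F * M"
    by (simp add: trimmed(2) sum.distrib sum_distrib_left)
  also have "\<dots> \<le> 2 * coverage (trim N ` F) + coverage N + card F * M" using N(1) by (simp add: admissible_def)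
  finally have "2 * coverage F \<le> 2 * coverage (trim N ` F) + coverage N + card F * M" .
  hence "2 * real (coverage F) \<le> 2 * real (coverage (trim N ` F)) + real (coverage N) + real (card F) * real M"
    by (metis (mono_tags) of_nat_add of_nat_le_iff of_nat_mult of_nat_numeral)
  moreover have "e\<^sup>2 / 512 * d = e\<^sup>2 / 256 * d / 2" "e\<^sup>2 / 128 * d = 2 * (e\<^sup>2 / 256 * d)" by simp_all
  ultimately have "real (coverage F) + e\<^sup>2 / 512 * d \<le> real (coverage (trim N ` F)) + real (coverage N)"
    using N(2) sum_scale_error by linarith
  thus ?thesis using union by (intro exI[of _ "trim N ` F \<union> N"]) simp
qed

end

lemma tile_family_of_coverage:
  fixes e \<eta> a :: real
  assumes e: "0 < e" "e < 1" and \<eta>: "0 < \<eta>" and a: "0 < a" and q: "2 \<le> q"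
  shows "\<exists>\<gamma>>0. \<exists>d0. \<forall>V (E :: 'a rel) d. tiling_host V E e d (a * d) \<eta> \<longrightarrow> d0 \<le> d \<longrightarrow>
    (\<exists>F. tile_family E V (min (e / 32) \<eta> / 2) q (\<gamma> * d) F \<and> min ((1 - e) * d) (real j * (e\<^sup>2 / 256) * d) \<le> 2 * real (coverage F))"
  using q
proof (induction j arbitrary: q)
  case 0
  show ?case
    by (intro exI[of _ 1] conjI exI[of _ 0] allI impI exI[of _ "{}"]) (auto simp: tile_family_def coverage_def disjoint_family_on_def)
next
  case (Suc j)
  note q = Suc.prems
  define \<theta> where "\<theta> = min (e / 32) \<eta>"
  have \<theta>: "0 < \<theta>" "\<theta> \<le> e / 32" "\<theta> \<le> \<eta>" using e \<eta> by (auto simp: \<theta>_def)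
  have "2 \<le> 2 * q" using q by simp
  from Suc.IH[OF this] obtain \<gamma>0 d0 where IH: "0 < \<gamma>0" "\<forall>V (E :: 'a rel) d. tiling_host V E e d (a * d) \<eta> \<longrightarrow> d0 \<le> d \<longrightarrow>
    (\<exists>F. tile_family E V (\<theta> / 2) (2 * q) (\<gamma>0 * d) F \<and> min ((1 - e) * d) (real j * (e\<^sup>2 / 256) * d) \<le> 2 * real (coverage F))"
    unfolding \<theta>_def[symmetric] by (elim exE conjE) (rule that)
  define c0 where "c0 = min (min a (e / 64)) (min (e / 32 * \<gamma>0) (e\<^sup>2 / 256 * \<gamma>0))"
  define p where "p = q ^ increment_steps q \<theta>"
  define c where "c = c0 / real p"
  have p: "0 < real p" using q by (simp add: p_def)
  have c: "0 < c" using a e IH(1) p by (simp add: c_def c0_def)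
  have enlarge: "\<exists>F. tile_family E V (\<theta> / 2) q (min \<gamma>0 (c / 2) * d) F \<and> min ((1 - e) * d) (real (Suc j) * (e\<^sup>2 / 256) * d) \<le> 2 * real (coverage F)"
    if host: "tiling_host V E e d (a * d) \<eta>" and large: "max (max d0 1) (2 / c) \<le> d" for V and E :: "'a rel" and d
  proof -
    have d: "d0 \<le> d" "0 < d" "2 \<le> c * d" using large c by (auto simp: divide_le_eq mult.commute)
    have \<gamma>: "min \<gamma>0 (c / 2) * d \<le> \<gamma>0 * d" "min \<gamma>0 (c / 2) * d \<le> c / 2 * d" using d(2) by auto
    obtain F where F: "tile_family E V (\<theta> / 2) (2 * q) (\<gamma>0 * d) F" "min ((1 - e) * d) (real j * (e\<^sup>2 / 256) * d) \<le> 2 * real (coverage F)"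
      using IH(2) host d(1) by blast
    show ?thesis
    proof (cases "2 * real (coverage F) < (1 - e) * d")
      case False
      thus ?thesis using tile_family_mono[OF F(1) _ \<gamma>(1), of q] by (intro exI[of _ F]) auto
    next
      case True
      define r where "r = nat \<lfloor>c * d\<rfloor>"
      have r: "real r \<le> c * d" "c * d < real r + 1" using d(3) by (auto simp: r_def)
      have "real (r * p) \<le> c * d * real p" using r(1) by (simp add: mult_right_mono)
      also have "c * d * real p = c0 * d" using p by (simp add: c_def)
      finally have scale: "real (r * p) \<le> y * d" if "c0 \<le> y" for y using mult_right_mono[OF that, of d] d(2) by linarith
      have "real (r * p) \<le> e / 32 * \<gamma>0 * d" "real (r * p) \<le> e\<^sup>2 / 256 * \<gamma>0 * d"
        by (rule scale; simp add: c0_def)+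
      then obtain F' where F': "tile_family E V (\<theta> / 2) q (min (\<gamma>0 * d) (real r)) F'" "real (coverage F) + e\<^sup>2 / 512 * d \<le> real (coverage F')"
        using enlarge_tile_family[OF e \<theta> q _ d(2) host F(1) True _ _ _ _ _ refl, of r] scale[of a] scale[of "e / 64"] r d IH(1)
        by (auto simp: p_def c0_def mult.assoc)
      have "min \<gamma>0 (c / 2) * d \<le> min (\<gamma>0 * d) (real r)" using \<gamma> r(2) d(3) by auto
      hence "tile_family E V (\<theta> / 2) q (min \<gamma>0 (c / 2) * d) F'" using tile_family_mono[OF F'(1)] by simp
      moreover have "real j * (e\<^sup>2 / 256) * d \<le> 2 * real (coverage F)" using F(2) True by (simp add: min_le_iff_disj)
      hence "min ((1 - e) * d) (real (Suc j) * (e\<^sup>2 / 256) * d) \<le> 2 * real (coverage F')"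
        using F'(2) by (simp add: min_le_iff_disj algebra_simps)
      ultimately show ?thesis by blast
    qed
  qed
  show ?case unfolding \<theta>_def[symmetric]
    by (intro exI[of _ "min \<gamma>0 (c / 2)"] conjI exI[of _ "max (max d0 1) (2 / c)"] allI impI enlarge) (use IH(1) c in auto)
qed

theorem tile_family_exists:
  fixes e \<eta> a :: real
  assumes e: "0 < e" "e < 1" and "0 < \<eta>" "0 < a" "2 \<le> q"
  obtains \<gamma> d0 where "0 < \<gamma>" "\<forall>V (E :: 'a rel) d. tiling_host V E e d (a * d) \<eta> \<longrightarrow> d0 \<le> d \<longrightarrow>
    (\<exists>F. tile_family E V (min (e / 32) \<eta> / 2) q (\<gamma> * d) F \<and> (1 - e) * d \<le> 2 * real (coverage F))"
proof -
  define j where "j = nat \<lceil>256 / e\<^sup>2\<rceil>"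
  have "256 / e\<^sup>2 \<le> real j" unfolding j_def by linarith
  hence j: "1 \<le> real j * (e\<^sup>2 / 256)" using e by (simp add: field_simps)
  obtain \<gamma> d0 where T: "0 < \<gamma>" "\<forall>V (E :: 'a rel) d. tiling_host V E e d (a * d) \<eta> \<longrightarrow> d0 \<le> d \<longrightarrow>
    (\<exists>F. tile_family E V (min (e / 32) \<eta> / 2) q (\<gamma> * d) F \<and> min ((1 - e) * d) (real j * (e\<^sup>2 / 256) * d) \<le> 2 * real (coverage F))"
    using tile_family_of_coverage[OF assms, of j] by (elim exE conjE) (rule that)
  show thesis
  proof (rule that[OF T(1)], intro allI impI)
    fix V and E :: "'a rel" and d assume "tiling_host V E e d (a * d) \<eta>" "max d0 0 \<le> d"
    hence "\<exists>F. tile_family E V (min (e / 32) \<eta> / 2) q (\<gamma> * d) F \<and>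
        min ((1 - e) * d) (real j * (e\<^sup>2 / 256) * d) \<le> 2 * real (coverage F)" using T(2) by simp
    then obtain F where F: "tile_family E V (min (e / 32) \<eta> / 2) q (\<gamma> * d) F"
      "min ((1 - e) * d) (real j * (e\<^sup>2 / 256) * d) \<le> 2 * real (coverage F)" by (elim exE conjE) (rule that)
    have "(1 - e) * d \<le> real j * (e\<^sup>2 / 256) * d" using j e \<open>max d0 0 \<le> d\<close> by (intro mult_right_mono) auto
    thus "\<exists>F. tile_family E V (min (e / 32) \<eta> / 2) q (\<gamma> * d) F \<and> (1 - e) * d \<le> 2 * real (coverage F)"
      using F by (intro exI[of _ F]) simp
  qed
qed

section \<open>Embedding small components into tiles\<close>

lemma component_in_eq:
  assumes "sym E" "y \<in> component_in E S x"
  shows "component_in E S y = component_in E S x"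
  using component_in_sym[OF assms] assms(2) unfolding component_in_def by (auto intro: rtrancl_trans)

lemma balanced_bipartition:
  fixes a b s :: nat
  assumes "card X + card Y \<le> s" "a \<le> b + s" "b \<le> a + s"
  obtains A B where "A = X \<and> B = Y \<or> A = Y \<and> B = X" "a + card A \<le> b + card B + s" "b + card B \<le> a + card A + s"
proof (cases "(a \<le> b) = (card Y \<le> card X)")
  case True
  thus thesis using assms by (intro that[of X Y]) auto
next
  case False
  thus thesis using assms by (intro that[of Y X]) auto
qed

context
  fixes E :: "'a rel" and T :: "'t set" and t0 :: 't and A B :: "'t \<Rightarrow> 'a set" and m L n :: "'t \<Rightarrow> nat" and \<rho> :: real
    and VH X1 X2 S :: "'w set" and EH :: "'w rel" and \<Delta> s :: nat
  assumes E: "sym E" and \<rho>: "0 < \<rho>" "\<rho> \<le> 1" and T: "finite T" "t0 \<in> T"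
    and AB: "\<And>t. t \<in> T \<Longrightarrow> finite (A t) \<and> finite (B t) \<and> A t \<inter> B t = {}" "\<And>t. t \<in> T \<Longrightarrow> lower_regular E (m t) \<rho> (A t) (B t)"
      "disjoint_family_on (\<lambda>t. A t \<union> B t) T"
    and H: "simple_graph VH EH" "VH \<subseteq> X1 \<union> X2" "X1 \<inter> X2 = {}" "EH \<subseteq> X1 \<times> X2 \<union> X2 \<times> X1" "\<And>h. card (EH `` {h}) \<le> \<Delta>"
    and S: "S \<subseteq> VH" "card S \<le> s" "\<And>x. x \<in> VH - S \<Longrightarrow> card (component_in EH (VH - S) x) \<le> s"
    and scale: "\<And>t. t \<in> T \<Longrightarrow> s \<le> m t" "\<And>t. t \<in> T \<Longrightarrow> real ((\<Delta> + 2) * m t) \<le> \<rho> ^ \<Delta> * real (L t)"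
      "\<And>t. t \<in> T \<Longrightarrow> n t \<le> card (A t) \<and> n t \<le> card (B t)"
    and room: "s \<le> n t0" "card VH + (\<Sum>t\<in>T. 2 * L t + s) < (\<Sum>t\<in>T. 2 * n t)"
begin

definition balanced_embedding :: "'w set \<Rightarrow> ('w \<Rightarrow> 'a) \<Rightarrow> bool" where
  "balanced_embedding P f \<longleftrightarrow> inj_on f P \<and> f ` P \<subseteq> (\<Union>t\<in>T. A t \<union> B t) \<and> f ` S \<subseteq> A t0 \<and>
     (\<forall>u\<in>P - S. \<forall>v\<in>P - S. (u, v) \<in> EH \<longrightarrow> (f u, f v) \<in> E) \<and>
     (\<forall>t\<in>T. card (f ` P \<inter> A t) \<le> card (f ` P \<inter> B t) + s \<and> card (f ` P \<inter> B t) \<le> card (f ` P \<inter> A t) + s)"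

lemma exists_unused_tile:
  assumes f: "balanced_embedding P f" and P: "P \<subseteq> VH"
  shows "\<exists>t\<in>T. L t \<le> card (A t - f ` P) \<and> L t \<le> card (B t - f ` P)"
proof (rule ccontr)
  assume no: "\<not> ?thesis"
  have finP: "finite P" using P simple_graphD(1)[OF H(1)] by (rule finite_subset)
  have "(\<Sum>t\<in>T. 2 * n t) \<le> (\<Sum>t\<in>T. card ((A t \<union> B t) \<inter> f ` P) + (2 * L t + s))"
  proof (rule sum_mono)
    fix t assume t: "t \<in> T"
    have fin: "finite (A t)" "finite (B t)" "A t \<inter> B t = {}" using AB(1)[OF t] by auto
    have "card ((A t \<union> B t) \<inter> f ` P) = card (A t \<inter> f ` P) + card (B t \<inter> f ` P)"
      unfolding Int_Un_distrib2 using fin by (intro card_Un_disjoint) auto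
    moreover have "card (A t - f ` P) < L t \<or> card (B t - f ` P) < L t" using no t by (meson not_less)
    moreover have "card (A t \<inter> f ` P) \<le> card (B t \<inter> f ` P) + s \<and> card (B t \<inter> f ` P) \<le> card (A t \<inter> f ` P) + s"
      using f t by (simp add: balanced_embedding_def Int_commute)
    ultimately show "2 * n t \<le> card ((A t \<union> B t) \<inter> f ` P) + (2 * L t + s)"
      using card_Int_add_card_Diff[OF fin(1), of "f ` P"] card_Int_add_card_Diff[OF fin(2), of "f ` P"] scale(3)[OF t] by linarith
  qed
  also have "\<dots> = (\<Sum>t\<in>T. card ((A t \<union> B t) \<inter> f ` P)) + (\<Sum>t\<in>T. 2 * L t + s)" by (simp add: sum.distrib)
  also have "(\<Sum>t\<in>T. card ((A t \<union> B t) \<inter> f ` P)) \<le> card (f ` P)" using finP by (intro sum_card_Int_le[OF T(1) AB(3)]) simp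
  also have "card (f ` P) \<le> card VH" using card_image_le[OF finP, of f] card_mono[OF simple_graphD(1)[OF H(1)] P] by linarith
  finally show False using room(2) by simp
qed

lemma embed_component:
  assumes t: "t \<in> T" and U: "L t \<le> card (A t - U)" "L t \<le> card (B t - U)"
    and c: "c \<subseteq> VH" "card c \<le> s" and W: "Wa \<union> Wb = c" "Wa \<inter> Wb = {}" "Restr EH c \<subseteq> Wa \<times> Wb \<union> Wb \<times> Wa"
  obtains \<phi> where "inj_on \<phi> c" "\<phi> ` Wa \<subseteq> A t - U" "\<phi> ` Wb \<subseteq> B t - U" "\<forall>(u, v)\<in>Restr EH c. (\<phi> u, \<phi> v) \<in> E"
proof -
  let ?side = "\<lambda>w. if w \<in> Wa then A t - U else B t - U"
  note reg = lower_regular_subset[OF AB(2)[OF t], of "A t - U" "B t - U"]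
  have large: "real ((\<Delta> + 2) * m t) \<le> \<rho> ^ \<Delta> * real y" if "L t \<le> y" for y
  proof -
    have "\<rho> ^ \<Delta> * real (L t) \<le> \<rho> ^ \<Delta> * real y" using that \<rho> by (intro mult_left_mono) auto
    thus ?thesis using scale(2)[OF t] by linarith
  qed
  show thesis
  proof (rule bounded_degree_embedding[OF E \<rho> simple_graph_Restr[OF H(1) c(1)], of "m t" \<Delta> ?side])
    show "card (Restr EH c `` {w}) \<le> \<Delta>" for w
    proof -
      have "card (Restr EH c `` {w}) \<le> card (EH `` {w})"
        using simple_graphD(2)[OF H(1)] by (intro card_mono) (auto intro: finite_Image)
      thus ?thesis using H(5)[of w] by simp
    qed
    show "lower_regular E (m t) \<rho> (?side x) (?side y)" if "(x, y) \<in> Restr EH c" for x y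
    proof -
      have "x \<in> Wa \<and> y \<in> Wb \<or> x \<in> Wb \<and> y \<in> Wa" using that W(3) by blast
      thus ?thesis using W(2) reg lower_regular_commute[OF E reg] by auto
    qed
    show "card c \<le> m t" using c(2) scale(1)[OF t] by simp
    show "real ((\<Delta> + 2) * m t) \<le> \<rho> ^ \<Delta> * real (card (?side w))" for w using large U by simp
  next
    fix \<phi> assume \<phi>: "inj_on \<phi> c" "\<And>w. w \<in> c \<Longrightarrow> \<phi> w \<in> ?side w" "\<And>u v. (u, v) \<in> Restr EH c \<Longrightarrow> (\<phi> u, \<phi> v) \<in> E"
    have "\<phi> ` Wa \<subseteq> A t - U" using \<phi>(2) W(1) by force
    moreover have "\<phi> ` Wb \<subseteq> B t - U"
    proof
      fix x assume "x \<in> \<phi> ` Wb"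
      then obtain w where "w \<in> Wb" "x = \<phi> w" by auto
      thus "x \<in> B t - U" using \<phi>(2)[of w] W(1,2) by (auto split: if_splits)
    qed
    ultimately show thesis using that \<phi>(1,3) by blast
  qed (use AB(1)[OF t] in auto)
qed

lemma extend_balanced_embedding:
  assumes f: "balanced_embedding P f" and P: "S \<subseteq> P" "P \<subseteq> VH" and c: "c \<subseteq> VH - P" "card c \<le> s"
    and closed: "\<And>u v. (u, v) \<in> EH \<Longrightarrow> u \<in> c \<Longrightarrow> v \<notin> S \<Longrightarrow> v \<in> c"
  shows "\<exists>f'. balanced_embedding (P \<union> c) f'"
proof -
  note H' = simple_graphD[OF H(1)]
  have fin: "finite P" "finite c" using finite_subset[OF P(2) H'(1)] finite_subset[OF _ H'(1), of c] c(1) by auto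
  have f': "inj_on f P" "f ` P \<subseteq> (\<Union>t\<in>T. A t \<union> B t)" "f ` S \<subseteq> A t0" "\<forall>u\<in>P - S. \<forall>v\<in>P - S. (u, v) \<in> EH \<longrightarrow> (f u, f v) \<in> E"
    "\<forall>t\<in>T. card (f ` P \<inter> A t) \<le> card (f ` P \<inter> B t) + s \<and> card (f ` P \<inter> B t) \<le> card (f ` P \<inter> A t) + s"
    using f by (simp_all add: balanced_embedding_def)
  obtain t where t: "t \<in> T" "L t \<le> card (A t - f ` P)" "L t \<le> card (B t - f ` P)" using exists_unused_tile[OF f P(2)] by auto
  have cX: "(c \<inter> X1) \<union> (c \<inter> X2) = c" "(c \<inter> X1) \<inter> (c \<inter> X2) = {}" using c(1) H(2,3) by auto
  have "card (c \<inter> X1) + card (c \<inter> X2) \<le> s" using card_Un_disjoint[OF _ _ cX(2)] cX(1) c(2) fin(2) by simp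
  then obtain Wa Wb where Wab: "Wa = c \<inter> X1 \<and> Wb = c \<inter> X2 \<or> Wa = c \<inter> X2 \<and> Wb = c \<inter> X1"
    and bal: "card (f ` P \<inter> A t) + card Wa \<le> card (f ` P \<inter> B t) + card Wb + s" "card (f ` P \<inter> B t) + card Wb \<le> card (f ` P \<inter> A t) + card Wa + s"
    by (rule balanced_bipartition[where a = "card (f ` P \<inter> A t)" and b = "card (f ` P \<inter> B t)"]) (use f'(5) t(1) in auto)
  have W: "Wa \<union> Wb = c" "Wa \<inter> Wb = {}" "Restr EH c \<subseteq> Wa \<times> Wb \<union> Wb \<times> Wa" using Wab cX H(4) by auto
  obtain \<phi> where \<phi>: "inj_on \<phi> c" "\<phi> ` Wa \<subseteq> A t - f ` P" "\<phi> ` Wb \<subseteq> B t - f ` P" "\<forall>(u, v)\<in>Restr EH c. (\<phi> u, \<phi> v) \<in> E"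
    by (rule embed_component[OF t _ c(2) W]) (use c(1) in blast, rule that)
  define f2 where "f2 v = (if v \<in> c then \<phi> v else f v)" for v
  have eq: "f2 v = f v" if "v \<in> P" for v using that c(1) by (auto simp: f2_def)
  have im: "f2 ` P = f ` P" "f2 ` c = \<phi> ` c" "\<phi> ` c = \<phi> ` Wa \<union> \<phi> ` Wb" using eq W(1) by (auto simp: f2_def image_iff)
  have "balanced_embedding (P \<union> c) f2" unfolding balanced_embedding_def
  proof (intro conjI ballI impI)
    have "inj_on f2 P" using f'(1) inj_on_cong[of P f2 f] eq by simp
    moreover have "inj_on f2 c" using \<phi>(1) by (simp add: f2_def inj_on_def)
    moreover have "f2 ` P \<inter> f2 ` c = {}" using im \<phi>(2,3) by auto
    ultimately show "inj_on f2 (P \<union> c)" unfolding inj_on_Un by auto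
    have "\<phi> ` c \<subseteq> A t \<union> B t" unfolding im(3) using \<phi>(2,3) by auto
    thus "f2 ` (P \<union> c) \<subseteq> (\<Union>t\<in>T. A t \<union> B t)" unfolding image_Un im(1,2) using f'(2) t(1) by auto
    show "f2 ` S \<subseteq> A t0" using f'(3) eq P(1) by (auto simp: subset_iff)
    fix u v assume uv: "u \<in> P \<union> c - S" "v \<in> P \<union> c - S" "(u, v) \<in> EH"
    have "u \<in> c \<longleftrightarrow> v \<in> c" using closed[OF uv(3)] closed[OF symD[OF H'(3) uv(3)]] uv(1,2) by auto
    thus "(f2 u, f2 v) \<in> E" using uv f'(4) \<phi>(4) by (auto simp: f2_def)
  next
    fix t' assume t': "t' \<in> T"
    have "card (f2 ` (P \<union> c) \<inter> A t') \<le> card (f2 ` (P \<union> c) \<inter> B t') + s \<and> card (f2 ` (P \<union> c) \<inter> B t') \<le> card (f2 ` (P \<union> c) \<inter> A t') + s"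
    proof (cases "t' = t")
      case False
      have "(A t \<union> B t) \<inter> (A t' \<union> B t') = {}" using disjoint_family_onD[OF AB(3) t(1) t'] False by auto
      hence "f2 ` (P \<union> c) \<inter> A t' = f ` P \<inter> A t'" "f2 ` (P \<union> c) \<inter> B t' = f ` P \<inter> B t'"
        unfolding image_Un im using \<phi>(2,3) by auto
      thus ?thesis using f'(5) t' by simp
    next
      case True
      have "f2 ` (P \<union> c) \<inter> A t = (f ` P \<inter> A t) \<union> \<phi> ` Wa" "f2 ` (P \<union> c) \<inter> B t = (f ` P \<inter> B t) \<union> \<phi> ` Wb"
        unfolding image_Un im using \<phi>(2,3) AB(1)[OF t(1)] by auto
      moreover have "card (\<phi> ` Wa) = card Wa" "card (\<phi> ` Wb) = card Wb"
        using \<phi>(1) W(1) by (auto intro!: card_image inj_on_subset[of \<phi> c])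
      moreover have "card ((f ` P \<inter> A t) \<union> \<phi> ` Wa) = card (f ` P \<inter> A t) + card (\<phi> ` Wa)"
        "card ((f ` P \<inter> B t) \<union> \<phi> ` Wb) = card (f ` P \<inter> B t) + card (\<phi> ` Wb)"
        using \<phi>(2,3) fin W(1) by (auto intro!: card_Un_disjoint)
      ultimately show ?thesis using True bal by simp
    qed
    thus "card (f2 ` (P \<union> c) \<inter> A t') \<le> card (f2 ` (P \<union> c) \<inter> B t') + s"
      "card (f2 ` (P \<union> c) \<inter> B t') \<le> card (f2 ` (P \<union> c) \<inter> A t') + s" by auto
  qed
  thus ?thesis by blast
qed

lemma exists_balanced_embedding: "\<exists>f. balanced_embedding VH f"
proof -
  note H' = simple_graphD[OF H(1)]
  let ?C = "component_in EH (VH - S)"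
  have "\<exists>f. balanced_embedding (S \<union> (\<Union>x\<in>R. ?C x)) f" if "finite R" "R \<subseteq> VH - S" for R
    using that
  proof (induction rule: finite_subset_induct')
    case empty
    have fin: "finite S" "finite (A t0)" using S(1) H'(1) AB(1)[OF T(2)] finite_subset by auto
    have "card S \<le> card (A t0)" using S(2) room(1) scale(3)[OF T(2)] by linarith
    then obtain f where f: "inj_on f S" "f ` S \<subseteq> A t0" using inj_on_iff_card_le[OF fin] by auto
    have "card (f ` S \<inter> X) \<le> s" for X
      using card_mono[of "f ` S" "f ` S \<inter> X"] card_image_le[OF fin(1), of f] fin(1) S(2) by simp
    hence "balanced_embedding S f" unfolding balanced_embedding_def using f T(2) by (auto intro: trans_le_add2)
    thus ?case by auto
  next
    case (insert x R)
    let ?P = "S \<union> (\<Union>x\<in>R. ?C x)"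
    have x: "x \<in> VH - S" using insert(2) .
    have sub: "?C y \<subseteq> VH - S" if "y \<in> VH - S" for y by (rule component_in_subset[OF that])
    show ?case
    proof (cases "\<exists>y\<in>R. y \<in> ?C x")
      case True
      then obtain y where "y \<in> R" "?C y = ?C x" using component_in_eq[OF H'(3)] by blast
      hence "S \<union> (\<Union>x\<in>insert x R. ?C x) = ?P" by auto
      thus ?thesis using insert.IH by simp
    next
      case False
      hence "?C x \<inter> ?C y = {}" if "y \<in> R" for y using that component_in_disjoint[OF H'(3)] by blast
      hence "?C x \<subseteq> VH - ?P" using sub[OF x] by blast
      moreover have "?P \<subseteq> VH" using S(1) sub insert(3) by blast
      moreover have "v \<in> ?C x" if "(u, v) \<in> EH" "u \<in> ?C x" "v \<notin> S" for u v
        using component_in_closed[OF that(2) x that(1)] that H'(5) by auto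
      moreover obtain f where "balanced_embedding ?P f" using insert.IH by blast
      ultimately have "\<exists>f. balanced_embedding (?P \<union> ?C x) f" using S(3)[OF x] by (intro extend_balanced_embedding) auto
      thus ?thesis by (simp add: Un_ac)
    qed
  qed
  from this[of "VH - S"] have "\<exists>f. balanced_embedding (S \<union> (\<Union>x\<in>VH - S. ?C x)) f" using H'(1) by simp
  moreover have "S \<union> (\<Union>x\<in>VH - S. ?C x) = VH"
  proof
    show "S \<union> (\<Union>x\<in>VH - S. ?C x) \<subseteq> VH" using S(1) component_in_subset[of _ "VH - S" EH] by blast
    show "VH \<subseteq> S \<union> (\<Union>x\<in>VH - S. ?C x)" using component_in_self[of _ EH "VH - S"] by auto
  qed
  ultimately show ?thesis by simp
qed

lemma exists_tile_embedding:
  obtains f where "inj_on f VH" "f ` VH \<subseteq> (\<Union>t\<in>T. A t \<union> B t)" "f ` S \<subseteq> A t0"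
    "\<And>u v. (u, v) \<in> EH \<Longrightarrow> u \<notin> S \<Longrightarrow> v \<notin> S \<Longrightarrow> (f u, f v) \<in> E"
proof -
  obtain f where "balanced_embedding VH f" using exists_balanced_embedding ..
  thus thesis using simple_graphD(5)[OF H(1)] by (intro that[of f]) (auto simp: balanced_embedding_def)
qed

end

section \<open>Connections through the reserves of the tiles\<close>

definition anchored_family :: "'a rel \<Rightarrow> 'a set \<Rightarrow> ('j \<Rightarrow> 'a) \<Rightarrow> 'a set \<Rightarrow> 'j set \<Rightarrow> ('j \<Rightarrow> 'a set) \<Rightarrow> bool" where
  "anchored_family E V z Y J D \<longleftrightarrow>
     (\<forall>j\<in>J. connected_in E (D j) \<and> D j \<subseteq> V \<and> z j \<in> D j \<and> D j \<inter> Y \<noteq> {}) \<and> disjoint_family_on D J"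

lemma connected_in_shortcut:
  assumes E: "sym E" and D: "finite D" "connected_in E D" "z \<in> D" "D \<inter> Y \<noteq> {}" "D \<inter> U \<noteq> {}"
  obtains B a b where "B \<subseteq> D" "z \<in> B" "B \<inter> Y \<noteq> {}" "B \<inter> U = {a, b}" "\<And>K. connector E a b K \<Longrightarrow> connected_in E (B \<union> K)"
proof -
  obtain D1 x a where D1: "D1 \<subseteq> D" "connected_in E D1" "D1 \<inter> {z} = {x}" "D1 \<inter> U = {a}"
    using connected_in_trim[OF E D(1,2) _ D(5), of "{z}"] D(3) by auto
  obtain D2 y b where D2: "D2 \<subseteq> D" "connected_in E D2" "D2 \<inter> Y = {y}" "D2 \<inter> U = {b}"
    using connected_in_trim[OF E D(1,2,4,5)] by auto
  show thesis
  proof (rule that[of "D1 \<union> D2" a b])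
    fix K assume "connector E a b K"
    hence "connected_in E (D1 \<union> K \<union> D2)" using D1(2,4) D2(2,4) by (intro connected_in_Un_connector[OF E]) auto
    thus "connected_in E (D1 \<union> D2 \<union> K)" by (simp add: Un_ac)
  qed (use D1 D2 in auto)
qed

lemma sum_card_replace_less:
  assumes J: "finite J" and D: "\<And>j. j \<in> J \<Longrightarrow> finite (D j)" and many: "b * card J < card ((\<Union>j\<in>J. D j) \<inter> U)"
    and D': "\<And>j. j \<in> J \<Longrightarrow> \<exists>X. D' j \<subseteq> (D j - U) \<union> X \<and> finite X \<and> card X \<le> b"
  shows "(\<Sum>j\<in>J. card (D' j)) < (\<Sum>j\<in>J. card (D j))"
proof -
  have "card (D' j) \<le> card (D j - U) + b" if j: "j \<in> J" for j
  proof -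
    obtain X where X: "D' j \<subseteq> (D j - U) \<union> X" "finite X" "card X \<le> b" using D'[OF j] by auto
    have "card (D' j) \<le> card ((D j - U) \<union> X)" using X D[OF j] by (intro card_mono) auto
    thus ?thesis using card_Un_le[of "D j - U" X] X(3) by linarith
  qed
  hence "(\<Sum>j\<in>J. card (D' j)) \<le> (\<Sum>j\<in>J. card (D j - U) + b)" by (rule sum_mono)
  hence "(\<Sum>j\<in>J. card (D' j)) \<le> (\<Sum>j\<in>J. card (D j - U)) + b * card J" by (simp add: sum.distrib mult.commute)
  also have "\<dots> < (\<Sum>j\<in>J. card (D j - U)) + (\<Sum>j\<in>J. card (D j \<inter> U))"
  proof -
    have "(\<Union>j\<in>J. D j) \<inter> U = (\<Union>j\<in>J. D j \<inter> U)" by auto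
    thus ?thesis using many card_UN_le[OF J, of "\<lambda>j. D j \<inter> U"] by simp
  qed
  also have "\<dots> = (\<Sum>j\<in>J. card (D j))" unfolding sum.distrib[symmetric]
    by (rule sum.cong[OF refl]) (use card_Int_add_card_Diff[OF D, of _ U] in simp)
  finally show ?thesis .
qed

lemma reroute_through_hub:
  assumes E: "sym E" and V: "finite V" and J: "finite J" and hub: "hub E U Q f" "Q \<subseteq> U" "U \<subseteq> V" and f: "5 * card J \<le> f"
    and D: "anchored_family E V z Y J D" and many: "5 * card J < card ((\<Union>j\<in>J. D j) \<inter> U)"
  shows "\<exists>D'. anchored_family E V z Y J D' \<and> (\<Sum>j\<in>J. card (D' j)) < (\<Sum>j\<in>J. card (D j))"
proof -
  have Dj: "connected_in E (D j)" "D j \<subseteq> V" "z j \<in> D j" "D j \<inter> Y \<noteq> {}" "finite (D j)" if "j \<in> J" for j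
    using D that V by (auto simp: anchored_family_def intro: finite_subset)
  have disj: "D i \<inter> D j = {}" if "i \<in> J" "j \<in> J" "i \<noteq> j" for i j
    using D that by (auto simp: anchored_family_def dest: disjoint_family_onD)
  define J' where "J' = {j \<in> J. D j \<inter> U \<noteq> {}}"
  have J': "finite J'" "J' \<subseteq> J" "card J' \<le> card J" using J by (auto simp: J'_def intro: card_mono)
  have "\<forall>j\<in>J'. \<exists>B a b. B \<subseteq> D j \<and> z j \<in> B \<and> B \<inter> Y \<noteq> {} \<and> B \<inter> U = {a, b} \<and> (\<forall>K. connector E a b K \<longrightarrow> connected_in E (B \<union> K))"
  proof
    fix j assume "j \<in> J'"
    hence "j \<in> J" "D j \<inter> U \<noteq> {}" by (auto simp: J'_def)
    from connected_in_shortcut[OF E Dj(5,1,3,4)[OF this(1)] this(2)]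
    show "\<exists>B a b. B \<subseteq> D j \<and> z j \<in> B \<and> B \<inter> Y \<noteq> {} \<and> B \<inter> U = {a, b} \<and> (\<forall>K. connector E a b K \<longrightarrow> connected_in E (B \<union> K))" by metis
  qed
  then obtain B a b where B: "\<And>j. j \<in> J' \<Longrightarrow> B j \<subseteq> D j \<and> z j \<in> B j \<and> B j \<inter> Y \<noteq> {} \<and> B j \<inter> U = {a j, b j} \<and>
    (\<forall>K. connector E (a j) (b j) K \<longrightarrow> connected_in E (B j \<union> K))" by metis
  define F where "F = a ` J' \<union> b ` J'"
  have "card F \<le> 2 * card J'"
    using card_Un_le[of "a ` J'" "b ` J'"] card_image_le[OF J'(1), of a] card_image_le[OF J'(1), of b] by (simp add: F_def)
  moreover have finF: "finite F" using J'(1) by (simp add: F_def)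
  hence "card (F \<inter> Q) \<le> card F" by (intro card_mono) auto
  ultimately have small: "card (F \<inter> Q) + 3 * card J' \<le> f" using J'(3) f by linarith
  obtain K where K: "\<forall>j\<in>J'. K j \<subseteq> Q - F \<and> finite (K j) \<and> card (K j) \<le> 3 \<and> connector E (a j) (b j) (K j)" "disjoint_family_on K J'"
  proof (rule hub_connectors[of J' E "\<lambda>_. U" "\<lambda>_. Q" f a b F])
    show "a j \<in> U \<and> b j \<in> U" if "j \<in> J'" for j using B[OF that] by blast
  qed (use hub(1) J'(1) finF small in auto)
  define D' where "D' j = (if j \<in> J' then B j \<union> K j else D j)" for j
  have avoid: "B i \<inter> K j = {}" if "i \<in> J'" "j \<in> J'" for i j
  proof -
    have "B i \<inter> U \<subseteq> F" using B[OF that(1)] that(1) by (auto simp: F_def)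
    moreover have "K j \<subseteq> U - F" using bspec[OF K(1) that(2)] hub(2) by auto
    ultimately show ?thesis by auto
  qed
  have outside: "D i \<inter> K j = {}" if "i \<in> J - J'" "j \<in> J'" for i j using that K(1) hub(2) by (auto simp: J'_def)
  have anchored: "anchored_family E V z Y J D'" unfolding anchored_family_def disjoint_family_on_def
  proof (intro conjI ballI impI)
    fix j assume j: "j \<in> J"
    have "connected_in E (D' j) \<and> D' j \<subseteq> V \<and> z j \<in> D' j \<and> D' j \<inter> Y \<noteq> {}"
    proof (cases "j \<in> J'")
      case True
      have "K j \<subseteq> V" "connector E (a j) (b j) (K j)" using bspec[OF K(1) True] hub(2,3) by auto
      thus ?thesis using B[OF True] Dj(2)[OF j] True by (auto simp: D'_def)
    next
      case False
      thus ?thesis using Dj[OF j] by (simp add: D'_def)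
    qed
    thus "connected_in E (D' j)" "D' j \<subseteq> V" "z j \<in> D' j" "D' j \<inter> Y \<noteq> {}" by simp_all
  next
    fix i j assume ij: "i \<in> J" "j \<in> J" "i \<noteq> j"
    have "K i \<inter> K j = {}" if "i \<in> J'" "j \<in> J'" using disjoint_family_onD[OF K(2) that ij(3)] .
    moreover have "i \<in> J' \<longrightarrow> B i \<subseteq> D i" "j \<in> J' \<longrightarrow> B j \<subseteq> D j" using B by simp_all
    ultimately show "D' i \<inter> D' j = {}"
      using disj[OF ij] avoid[of i j] avoid[of j i] outside[of i j] outside[of j i] ij(1,2) unfolding D'_def disjoint_iff subset_iff by auto
  qed
  have replaced: "\<exists>X. D' j \<subseteq> (D j - U) \<union> X \<and> finite X \<and> card X \<le> 5" if j: "j \<in> J" for j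
  proof (cases "j \<in> J'")
    case True
    have "card ({a j, b j} \<union> K j) \<le> card {a j, b j} + card (K j)" by (rule card_Un_le)
    moreover have "card {a j, b j} \<le> 2" by (simp add: card_insert_if)
    moreover have "D' j \<subseteq> (D j - U) \<union> ({a j, b j} \<union> K j)" using B[OF True] True by (auto simp: D'_def)
    moreover have "finite (K j)" "card (K j) \<le> 3" using K(1) True by auto
    ultimately show ?thesis by (intro exI[of _ "{a j, b j} \<union> K j"]) auto
  next
    case False
    hence "D' j \<subseteq> (D j - U) \<union> {}" using j by (auto simp: D'_def J'_def)
    thus ?thesis by (intro exI[of _ "{}"]) simp
  qed
  have "(\<Sum>j\<in>J. card (D' j)) < (\<Sum>j\<in>J. card (D j))" by (rule sum_card_replace_less[OF J Dj(5) many replaced])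
  with anchored show ?thesis by blast
qed

lemma lean_anchored_family:
  assumes "sym E" "finite V" "finite J" and hub: "\<And>t. t \<in> T \<Longrightarrow> hub E (U t) (Q t) f \<and> Q t \<subseteq> U t \<and> U t \<subseteq> V"
    and "5 * card J \<le> f" and D: "anchored_family E V z Y J D"
  obtains D' where "anchored_family E V z Y J D'" "\<forall>t\<in>T. card ((\<Union>j\<in>J. D' j) \<inter> U t) \<le> 5 * card J"
proof -
  have "\<exists>D'. anchored_family E V z Y J D' \<and> (\<forall>D''. anchored_family E V z Y J D'' \<longrightarrow> (\<Sum>j\<in>J. card (D' j)) \<le> (\<Sum>j\<in>J. card (D'' j)))"
    by (rule ex_has_least_nat) (rule D)
  then obtain D' where D': "anchored_family E V z Y J D' \<and> (\<forall>D''. anchored_family E V z Y J D'' \<longrightarrow> (\<Sum>j\<in>J. card (D' j)) \<le> (\<Sum>j\<in>J. card (D'' j)))"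
    by (rule exE)
  have "card ((\<Union>j\<in>J. D' j) \<inter> U t) \<le> 5 * card J" if t: "t \<in> T" for t
  proof (rule ccontr)
    assume "\<not> ?thesis"
    hence many: "5 * card J < card ((\<Union>j\<in>J. D' j) \<inter> U t)" by simp
    show False using reroute_through_hub[OF assms(1-3) _ _ _ assms(5) conjunct1[OF D'] many] hub[OF t] D' by (meson not_le)
  qed
  thus thesis using that D' by blast
qed

lemma connector_compose:
  assumes E: "sym E" and "connector E x y K" "connected_in E D" "y \<in> D" "z \<in> D" "connector E x' z K'"
  shows "connector E x x' (K \<union> D \<union> K')"
proof -
  obtain u v where K: "connected_in E K" "u \<in> K" "(x, u) \<in> E" "v \<in> K" "(y, v) \<in> E" using assms(2) by (rule connectorE)
  obtain u' v' where K': "connected_in E K'" "u' \<in> K'" "(x', u') \<in> E" "v' \<in> K'" "(z, v') \<in> E" using assms(6) by (rule connectorE)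
  have "connected_in E (K \<union> D)" by (rule connected_in_Un_edge[OF E K(1) assms(3) K(4) assms(4) symD[OF E K(5)]])
  hence "connected_in E (K \<union> D \<union> K')" by (rule connected_in_Un_edge[OF E _ K'(1) _ K'(4,5)]) (use assms(5) in simp)
  thus ?thesis using K(2,3) K'(2,3) by (auto simp: connector_def)
qed

section \<open>Topological minors in tiled graphs\<close>

definition tile_hub :: "'a rel \<Rightarrow> nat \<Rightarrow> 'a tile \<Rightarrow> 'a set \<Rightarrow> 'a set \<Rightarrow> 'a set \<Rightarrow> 'a set \<Rightarrow> bool" where
  "tile_hub E h t A1 B1 A0 B0 \<longleftrightarrow> A1 \<subseteq> left t \<and> B1 \<subseteq> right t \<and> A0 \<subseteq> A1 \<and> B0 \<subseteq> B1 \<and>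
     card A0 \<le> h * scale t \<and> card B0 \<le> h * scale t \<and> h * scale t \<le> card A0 + scale t \<and>
     card (left t) \<le> card A1 + scale t \<and> card (right t) \<le> card B1 + scale t \<and> hub E (A1 \<union> B1) (A0 \<union> B0) (scale t)"

lemma tile_contains_hub:
  assumes "sym E" "finite V" and t: "is_tile E V \<rho> q g t" and \<rho>: "0 < \<rho>" and h: "3 \<le> \<rho> * real h" "1 \<le> h" "h \<le> q"
  shows "\<exists>A1 B1 A0 B0. tile_hub E h t A1 B1 A0 B0"
proof -
  note t' = is_tileD[OF t]
  have fin: "finite (left t)" "finite (right t)" using t'(1,2) assms(2) finite_subset by auto
  have "h * scale t \<le> q * scale t" using h(3) by (rule mult_le_mono1)
  hence fits: "h * scale t \<le> card (left t)" "h * scale t \<le> card (right t)" using t'(4,5) by linarith+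
  have "0 < scale t" "scale t \<le> h * scale t" using t'(6) mult_le_mono1[OF h(2), of "scale t"] by simp_all
  moreover have "real (2 * scale t + scale t) \<le> \<rho> * real (h * scale t)"
    using mult_right_mono[OF h(1), of "real (scale t)"] by (simp add: mult.assoc)
  ultimately show ?thesis unfolding tile_hub_def
    by (rule lower_regular_contains_hub[OF assms(1) fin t'(8) \<rho> _ fits]) (intro exI conjI)
qed

context
  fixes V :: "'a set" and E :: "'a rel" and T :: "'a tile set"
    and \<rho> g :: real and q h l k s \<Delta> :: nat and VH X1 X2 S :: "'w set" and EH :: "'w rel"
  assumes G: "simple_graph V E" "vertex_connected k V E" and \<rho>: "0 < \<rho>" "\<rho> \<le> 1" and T: "tile_family E V \<rho> q g T"
    and H: "simple_graph VH EH" "VH \<subseteq> X1 \<union> X2" "X1 \<inter> X2 = {}" "EH \<subseteq> X1 \<times> X2 \<union> X2 \<times> X1" "\<And>h. card (EH `` {h}) \<le> \<Delta>"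
    and S: "S \<subseteq> VH" "card S \<le> s" "\<And>x. x \<in> VH - S \<Longrightarrow> card (component_in EH (VH - S) x) \<le> s"
    and params: "3 \<le> \<rho> * real h" "h + 3 \<le> q" "real (\<Delta> + 2) \<le> \<rho> ^ \<Delta> * real l"
    and size: "\<Delta> * s * card T \<le> k" "real (20 * (\<Delta> * s * card T)) \<le> g" "real s \<le> g"
    and room: "q * card VH + (2 * l + 2 * h + 5) * coverage T < 2 * q * coverage T"
begin

lemma hub_factor_ge: "3 \<le> h"
proof -
  have "\<rho> * real h \<le> 1 * real h" using \<rho> by (intro mult_right_mono) auto
  thus ?thesis using params(1) by linarith
qed

context
  fixes t0 :: "'a tile" and A1 B1 A0 B0 :: "'a tile \<Rightarrow> 'a set"
  assumes t0: "t0 \<in> T" and hubs: "\<And>t. t \<in> T \<Longrightarrow> tile_hub E h t (A1 t) (B1 t) (A0 t) (B0 t)"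
begin

definition boundary :: "'w rel" where
  "boundary = {j \<in> EH. fst j \<in> S}"

definition num_links :: nat where
  "num_links = card (boundary \<times> T)"

definition territory :: "'a tile \<Rightarrow> 'a set" where
  "territory t = A1 t \<union> B1 t"

definition reserve :: "'a tile \<Rightarrow> 'a set" where
  "reserve t = A0 t \<union> B0 t"

lemma boundary: "finite boundary" "card boundary \<le> num_links" "num_links \<le> \<Delta> * s * card T"
proof -
  note H' = simple_graphD[OF H(1)]
  have fin: "finite S" "\<And>v. finite (EH `` {v})" using S(1) H'(1,2) finite_subset finite_Image by blast+
  have "card boundary \<le> card (Sigma S (\<lambda>v. EH `` {v}))" using fin by (intro card_mono) (auto simp: boundary_def)
  also have "\<dots> = (\<Sum>v\<in>S. card (EH `` {v}))" using fin by simp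
  also have "\<dots> \<le> card S * \<Delta>" using sum_bounded_above[of S "\<lambda>v. card (EH `` {v})" \<Delta>] H(5) by simp
  also have "\<dots> \<le> \<Delta> * s" using S(2) by (simp add: mult.commute)
  finally show "num_links \<le> \<Delta> * s * card T" unfolding num_links_def card_cartesian_product by (rule mult_le_mono1)
  show "finite boundary" using H'(2) by (simp add: boundary_def)
  have "0 < card T" using t0 tile_familyD(1)[OF T] by (auto simp: card_gt_0_iff)
  thus "card boundary \<le> num_links" by (simp add: num_links_def card_cartesian_product)
qed

lemma scale_bounds:
  assumes "t \<in> T"
  shows "20 * num_links \<le> scale t" "s \<le> scale t" "(h + 3) * scale t \<le> card (left t)"
proof -
  note t = is_tileD[OF tile_familyD(2)[OF T assms]]
  have "real (20 * num_links) \<le> real (20 * (\<Delta> * s * card T))" using boundary(3) by (simp only: of_nat_le_iff mult_le_mono2)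
  hence "real (20 * num_links) \<le> real (scale t)" using size(2) t(7) by linarith
  thus "20 * num_links \<le> scale t" by (simp only: of_nat_le_iff)
  have "real s \<le> real (scale t)" using size(3) t(7) by linarith
  thus "s \<le> scale t" by simp
  show "(h + 3) * scale t \<le> card (left t)" using mult_le_mono1[OF params(2), of "scale t"] t(5) by linarith
qed

lemma territory:
  assumes "t \<in> T"
  shows "reserve t \<subseteq> territory t" "territory t \<subseteq> V" "finite (territory t)" "hub E (territory t) (reserve t) (20 * num_links)"
    "num_links \<le> card (reserve t)" "A1 t \<inter> B1 t = {}"
proof -
  note hub = hubs[OF assms, unfolded tile_hub_def] and t = is_tileD[OF tile_familyD(2)[OF T assms]]
  show res: "reserve t \<subseteq> territory t" and V: "territory t \<subseteq> V" using hub t(1,2) by (auto simp: reserve_def territory_def)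
  show fin: "finite (territory t)" using V simple_graphD(1)[OF G(1)] by (rule finite_subset)
  show "hub E (territory t) (reserve t) (20 * num_links)"
    unfolding territory_def reserve_def by (rule hub_antimono[OF _ scale_bounds(1)[OF assms]]) (use hub in simp)
  have "card (A0 t) \<le> card (reserve t)" using fin res by (intro card_mono) (auto simp: reserve_def intro: finite_subset)
  moreover have "3 * scale t \<le> h * scale t" using hub_factor_ge by (rule mult_le_mono1)
  ultimately show "num_links \<le> card (reserve t)" using hub scale_bounds(1)[OF assms] by linarith
  show "A1 t \<inter> B1 t = {}" using hub t(3) by auto
qed

lemma territories_disjoint: "disjoint_family_on territory T"
proof -
  have "territory t \<subseteq> tile_verts t" if "t \<in> T" for t
    using hubs[OF that] by (auto simp: tile_hub_def territory_def tile_verts_def)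
  thus ?thesis using tile_familyD(4)[OF T] unfolding disjoint_family_on_def by blast
qed

lemma exists_terminals:
  obtains z where "inj_on z (boundary \<times> T)" "\<forall>p\<in>boundary \<times> T. z p \<in> reserve (snd p)"
proof -
  have "\<exists>z. inj_on z boundary \<and> z ` boundary \<subseteq> reserve t" if t: "t \<in> T" for t
  proof -
    have "finite (reserve t)" "card boundary \<le> card (reserve t)"
      using finite_subset[OF territory(1,3)[OF t]] boundary(2) territory(5)[OF t] by auto
    thus ?thesis using inj_on_iff_card_le[OF boundary(1)] by blast
  qed
  then obtain \<zeta> where \<zeta>: "\<And>t. t \<in> T \<Longrightarrow> inj_on (\<zeta> t) boundary \<and> \<zeta> t ` boundary \<subseteq> reserve t" by metis
  let ?z = "\<lambda>p. \<zeta> (snd p) (fst p)"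
  have mem: "?z p \<in> reserve (snd p)" if "p \<in> boundary \<times> T" for p
  proof -
    have "fst p \<in> boundary" "snd p \<in> T" using that by auto
    thus ?thesis using \<zeta>[of "snd p"] by blast
  qed
  have "inj_on ?z (boundary \<times> T)"
  proof (rule inj_onI)
    fix p p' assume p: "p \<in> boundary \<times> T" "p' \<in> boundary \<times> T" "?z p = ?z p'"
    have t: "snd p \<in> T" "snd p' \<in> T" using p by auto
    have "?z p \<in> territory (snd p) \<inter> territory (snd p')"
      using mem[OF p(1)] mem[OF p(2)] p(3) territory(1)[OF t(1)] territory(1)[OF t(2)] by auto
    hence "snd p = snd p'" using disjoint_family_onD[OF territories_disjoint t] by blast
    thus "p = p'" using \<zeta>[OF t(1)] p by (auto simp: prod_eq_iff dest: inj_onD)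
  qed
  thus thesis using that[of ?z] mem by blast
qed

lemma exists_lean_linkage:
  obtains z D where "anchored_family E V z (reserve t0) (boundary \<times> T) D" "\<forall>p\<in>boundary \<times> T. z p \<in> reserve (snd p)"
    "\<forall>t\<in>T. card ((\<Union>p\<in>boundary \<times> T. D p) \<inter> territory t) \<le> 5 * num_links"
proof -
  note V = simple_graphD[OF G(1)]
  obtain z where z: "inj_on z (boundary \<times> T)" "\<forall>p\<in>boundary \<times> T. z p \<in> reserve (snd p)" by (rule exists_terminals)
  let ?X = "z ` (boundary \<times> T)"
  have X: "card ?X = num_links" unfolding num_links_def by (rule card_image[OF z(1)])
  have sub: "reserve t \<subseteq> V" if "t \<in> T" for t using territory(1,2)[OF that] by blast
  have XV: "?X \<subseteq> V"
  proof (rule image_subsetI)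
    fix p assume p: "p \<in> boundary \<times> T"
    hence "snd p \<in> T" by auto
    thus "z p \<in> V" using bspec[OF z(2) p] sub by blast
  qed
  obtain C y where C: "\<And>x. x \<in> ?X \<Longrightarrow> C x \<subseteq> V \<and> connected_in E (C x) \<and> C x \<inter> ?X = {x} \<and> C x \<inter> reserve t0 = {y x}"
    "disjoint_family_on C ?X"
  proof (rule menger_paths[OF G(1) XV sub[OF t0]])
    fix P Q assume PQ: "separation V E P Q" "?X \<subseteq> P" "reserve t0 \<subseteq> Q"
    have fin: "finite (P \<inter> Q)" using finite_separation[OF PQ(1) V(1)] by simp
    show "card ?X \<le> card (P \<inter> Q)"
    proof (rule ccontr)
      assume small: "\<not> ?thesis"
      hence "card (P \<inter> Q) < k" using X boundary(3) size(1) by linarith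
      hence "P \<subseteq> Q \<or> Q \<subseteq> P" using G(2) PQ(1) unfolding vertex_connected_def by blast
      hence "?X \<subseteq> P \<inter> Q \<or> reserve t0 \<subseteq> P \<inter> Q" using PQ(2,3) by blast
      hence "card ?X \<le> card (P \<inter> Q) \<or> card (reserve t0) \<le> card (P \<inter> Q)" using card_mono[OF fin] by blast
      thus False using small X territory(5)[OF t0] by linarith
    qed
  qed (rule that)
  have paths: "anchored_family E V z (reserve t0) (boundary \<times> T) (C \<circ> z)" unfolding anchored_family_def
  proof (intro conjI ballI)
    fix p assume "p \<in> boundary \<times> T"
    hence "z p \<in> ?X" by (rule imageI)
    from C(1)[OF this] show "connected_in E ((C \<circ> z) p)" "(C \<circ> z) p \<subseteq> V" "z p \<in> (C \<circ> z) p" "(C \<circ> z) p \<inter> reserve t0 \<noteq> {}" by auto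
  next
    have "C (z p) \<inter> C (z p') = {}" if p: "p \<in> boundary \<times> T" "p' \<in> boundary \<times> T" "p \<noteq> p'" for p p'
      using disjoint_family_onD[OF C(2) imageI[OF p(1)] imageI[OF p(2)]] inj_onD[OF z(1) _ p(1,2)] p(3) by blast
    thus "disjoint_family_on (C \<circ> z) (boundary \<times> T)" unfolding disjoint_family_on_def comp_apply by blast
  qed
  obtain D where "anchored_family E V z (reserve t0) (boundary \<times> T) D"
    "\<forall>t\<in>T. card ((\<Union>p\<in>boundary \<times> T. D p) \<inter> territory t) \<le> 5 * card (boundary \<times> T)"
  proof (rule lean_anchored_family[OF V(3,1) _ _ _ paths])
    show "finite (boundary \<times> T)" using boundary(1) tile_familyD(1)[OF T] by simp
    show "hub E (territory t) (reserve t) (20 * num_links) \<and> reserve t \<subseteq> territory t \<and> territory t \<subseteq> V" if "t \<in> T" for t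
      using territory(1,2,4)[OF that] by simp
    show "5 * card (boundary \<times> T) \<le> 20 * num_links" by (simp add: num_links_def)
  qed (rule that)
  thus thesis using that[OF _ z(2)] by (simp add: num_links_def)
qed

lemma room_for_embedding:
  "card VH + (\<Sum>t\<in>T. 2 * (l * scale t) + s) < (\<Sum>t\<in>T. 2 * (card (left t) - (h + 2) * scale t))"
proof -
  let ?c = "2 * l + 2 * h + 5" and ?M = "\<Sum>t\<in>T. scale t"
  have "q * ?M \<le> coverage T"
    unfolding coverage_def sum_distrib_left by (rule sum_mono) (rule is_tileD(5)[OF tile_familyD(2)[OF T]])
  hence "?c * (q * ?M) \<le> ?c * coverage T" by (rule mult_le_mono2)
  hence "q * (card VH + ?c * ?M) < q * (2 * coverage T)"
    using room by (simp only: distrib_left mult.left_commute[of q] mult.assoc)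
  hence "card VH + ?c * ?M < 2 * coverage T" by simp
  moreover have "?c * ?M = (2 * l + 1) * ?M + (2 * h + 4) * ?M" by (simp add: algebra_simps)
  moreover have "(\<Sum>t\<in>T. 2 * (l * scale t) + s) \<le> (2 * l + 1) * ?M"
    unfolding sum_distrib_left by (rule sum_mono) (use scale_bounds(2) in \<open>simp add: algebra_simps\<close>)
  moreover have "2 * coverage T \<le> (\<Sum>t\<in>T. 2 * (card (left t) - (h + 2) * scale t)) + (2 * h + 4) * ?M"
    unfolding coverage_def sum_distrib_left sum.distrib[symmetric] by (rule sum_mono) (simp add: algebra_simps)
  ultimately show ?thesis by linarith
qed

lemma exists_embedding_avoiding:
  assumes W: "finite W" "\<And>t. t \<in> T \<Longrightarrow> card (W \<inter> territory t) \<le> 5 * num_links"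
  obtains f where "inj_on f VH" "f ` VH \<subseteq> (\<Union>t\<in>T. territory t - reserve t) - W" "f ` S \<subseteq> territory t0"
    "\<And>u v. (u, v) \<in> EH \<Longrightarrow> u \<notin> S \<Longrightarrow> v \<notin> S \<Longrightarrow> (f u, f v) \<in> E"
proof -
  let ?A = "\<lambda>t. A1 t - A0 t - W" and ?B = "\<lambda>t. B1 t - B0 t - W"
  have remaining: "c - (h + 2) * scale t \<le> card (X1 - X0 - W)"
    if "t \<in> T" "c \<le> card X1 + scale t" "card X0 \<le> h * scale t" "X1 \<subseteq> territory t" "X0 \<subseteq> X1" for t c X1 X0
  proof -
    have fin: "finite X1" "finite X0" using finite_subset[OF that(4) territory(3)[OF that(1)]] finite_subset[OF that(5)] by auto
    have "card X1 \<le> card ((X1 - X0 - W) \<union> (X0 \<union> W \<inter> territory t))" using that(4) fin W(1) by (intro card_mono) auto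
    also have "\<dots> \<le> card (X1 - X0 - W) + (card X0 + card (W \<inter> territory t))"
      using card_Un_le[of "X1 - X0 - W" "X0 \<union> W \<inter> territory t"] card_Un_le[of X0 "W \<inter> territory t"] by linarith
    finally have "c \<le> card (X1 - X0 - W) + h * scale t + 5 * num_links + scale t" using that(2,3) W(2)[OF that(1)] by linarith
    thus ?thesis using scale_bounds(1)[OF that(1)] by (simp add: algebra_simps)
  qed
  have inside: "?A t \<union> ?B t \<subseteq> territory t - reserve t - W" if "t \<in> T" for t
    using hubs[OF that] territory(6)[OF that] by (auto simp: tile_hub_def territory_def reserve_def)
  show thesis
  proof (rule exists_tile_embedding[OF simple_graphD(3)[OF G(1)] \<rho> tile_familyD(1)[OF T] t0 _ _ _ H S,
      where A = ?A and B = ?B and m = scale and L = "\<lambda>t. l * scale t" and n = "\<lambda>t. card (left t) - (h + 2) * scale t"])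
    fix t assume t: "t \<in> T"
    note hub = hubs[OF t, unfolded tile_hub_def] and tile = is_tileD[OF tile_familyD(2)[OF T t]]
    show "finite (?A t) \<and> finite (?B t) \<and> ?A t \<inter> ?B t = {}" using territory(3,6)[OF t] by (auto simp: territory_def)
    show "lower_regular E (scale t) \<rho> (?A t) (?B t)" by (rule lower_regular_subset[OF tile(8)]) (use hub in auto)
    show "s \<le> scale t" by (rule scale_bounds(2)[OF t])
    show "real ((\<Delta> + 2) * scale t) \<le> \<rho> ^ \<Delta> * real (l * scale t)"
      using mult_right_mono[OF params(3), of "real (scale t)"] by (simp only: of_nat_mult mult.assoc of_nat_0_le_iff)
    show "card (left t) - (h + 2) * scale t \<le> card (?A t) \<and> card (left t) - (h + 2) * scale t \<le> card (?B t)"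
      using remaining[OF t, of _ "A1 t" "A0 t"] remaining[OF t, of _ "B1 t" "B0 t"] hub tile(4) by (auto simp: territory_def)
  next
    show "disjoint_family_on (\<lambda>t. ?A t \<union> ?B t) T"
      using territories_disjoint inside unfolding disjoint_family_on_def by blast
    show "s \<le> card (left t0) - (h + 2) * scale t0"
      using scale_bounds(2,3)[OF t0] by (simp add: algebra_simps)
    show "card VH + (\<Sum>t\<in>T. 2 * (l * scale t) + s) < (\<Sum>t\<in>T. 2 * (card (left t) - (h + 2) * scale t))"
      by (rule room_for_embedding)
  next
    fix f assume f: "inj_on f VH" "f ` VH \<subseteq> (\<Union>t\<in>T. ?A t \<union> ?B t)" "f ` S \<subseteq> ?A t0"
      "\<And>u v. (u, v) \<in> EH \<Longrightarrow> u \<notin> S \<Longrightarrow> v \<notin> S \<Longrightarrow> (f u, f v) \<in> E"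
    have "f ` S \<subseteq> territory t0" using f(3) by (auto simp: territory_def)
    moreover have "f ` VH \<subseteq> (\<Union>t\<in>T. territory t - reserve t) - W" using f(2) inside by blast
    ultimately show thesis using that f(1,4) by blast
  qed
qed

lemma connect_boundary:
  assumes D: "anchored_family E V z (reserve t0) (boundary \<times> T) D" "\<forall>p\<in>boundary \<times> T. z p \<in> reserve (snd p)"
    and W: "W = (\<Union>p\<in>boundary \<times> T. D p)" "\<forall>t\<in>T. card (W \<inter> territory t) \<le> 5 * num_links"
    and f: "f ` VH \<subseteq> (\<Union>t\<in>T. territory t - reserve t) - W" "f ` S \<subseteq> territory t0"
  obtains P where "\<forall>j\<in>boundary. P j \<subseteq> V - f ` VH \<and> connector E (f (fst j)) (f (snd j)) (P j)" "disjoint_family_on P boundary"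
proof -
  note V = simple_graphD[OF G(1)]
  have D': "connected_in E (D p)" "D p \<subseteq> V" "z p \<in> D p" "D p \<inter> reserve t0 \<noteq> {}" "z p \<in> reserve (snd p)" "D p \<subseteq> W"
    if "p \<in> boundary \<times> T" for p using D that unfolding anchored_family_def W(1) by blast+
  have disj: "disjoint_family_on D (boundary \<times> T)" using D(1) by (simp add: anchored_family_def)
  have "\<forall>p\<in>boundary \<times> T. \<exists>y. y \<in> D p \<inter> reserve t0" using D'(4) by blast
  then obtain y where y: "\<And>p. p \<in> boundary \<times> T \<Longrightarrow> y p \<in> D p \<inter> reserve t0" by metis
  have finW: "finite W" using boundary(1) tile_familyD(1)[OF T] D'(2) V(1) unfolding W(1) by (blast intro: finite_subset)
  have "\<forall>v\<in>VH. \<exists>t\<in>T. f v \<in> territory t" using f(1) by blast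
  then obtain \<tau> where \<tau>: "\<And>v. v \<in> VH \<Longrightarrow> \<tau> v \<in> T \<and> f v \<in> territory (\<tau> v)" by metis
  have image: "f ` VH \<inter> reserve t = {}" if "t \<in> T" for t
  proof -
    have "territory t' \<inter> territory t = {}" if "t' \<in> T" "t' \<noteq> t" for t'
      using disjoint_family_onD[OF territories_disjoint] that \<open>t \<in> T\<close> by blast
    thus ?thesis using f(1) territory(1)[OF that] by blast
  qed
  define p where "p j = (j, \<tau> (snd j))" for j :: "'w \<times> 'w"
  have p: "p j \<in> boundary \<times> T" if "j \<in> boundary" for j
    using that \<tau>[of "snd j"] simple_graphD(5)[OF H(1)] by (auto simp: p_def boundary_def)
  define t where "t i = (if snd i then t0 else \<tau> (snd (fst i)))" for i :: "('w \<times> 'w) \<times> bool"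
  define a where "a i = f (if snd i then fst (fst i) else snd (fst i))" for i :: "('w \<times> 'w) \<times> bool"
  define b where "b i = (if snd i then y else z) (p (fst i))" for i :: "('w \<times> 'w) \<times> bool"
  have t: "t (j, c) \<in> T" if "j \<in> boundary" for j c using p[OF that] t0 by (auto simp: t_def p_def)
  have small: "card (W \<inter> reserve (t i)) + 3 * card (boundary \<times> (UNIV :: bool set)) \<le> 20 * num_links" if "i \<in> boundary \<times> UNIV" for i
  proof -
    have ti: "t i \<in> T" using that t by (cases i) auto
    have "card (W \<inter> reserve (t i)) \<le> card (W \<inter> territory (t i))" using territory(1)[OF ti] finW by (intro card_mono) auto
    thus ?thesis using W(2) ti boundary(2) by (fastforce simp: card_cartesian_product)
  qed
  obtain K where K: "\<forall>i\<in>boundary \<times> UNIV. K i \<subseteq> reserve (t i) - W \<and> finite (K i) \<and> card (K i) \<le> 3 \<and> connector E (a i) (b i) (K i)"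
    "disjoint_family_on K (boundary \<times> UNIV)"
  proof (rule hub_connectors[of "boundary \<times> UNIV" E "\<lambda>i. territory (t i)" "\<lambda>i. reserve (t i)" "20 * num_links" a b W])
    fix i assume i: "i \<in> boundary \<times> (UNIV :: bool set)"
    obtain j c where j: "i = (j, c)" "j \<in> boundary" using i by auto
    show "hub E (territory (t i)) (reserve (t i)) (20 * num_links)" using territory(4)[OF t[OF j(2)]] j(1) by simp
    have "fst j \<in> S" "snd j \<in> VH" using j(2) simple_graphD(5)[OF H(1)] by (auto simp: boundary_def)
    moreover have "y (p j) \<in> territory t0" "z (p j) \<in> territory (\<tau> (snd j))"
      using y[OF p[OF j(2)]] D'(5)[OF p[OF j(2)]] territory(1) t0 p[OF j(2)] by (auto simp: p_def)
    ultimately show "a i \<in> territory (t i) \<and> b i \<in> territory (t i)"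
      using f(2) \<tau>[of "snd j"] by (auto simp: j(1) a_def b_def t_def)
  qed (use boundary(1) finW small in auto)
  have Kj: "K (j, c) \<subseteq> V - f ` VH" "K (j, c) \<inter> W = {}" "connector E (a (j, c)) (b (j, c)) (K (j, c))" if "j \<in> boundary" for j c
    using K(1) that image[OF t[OF that, of c]] territory(1,2)[OF t[OF that, of c]] by blast+
  define P where "P j = K (j, True) \<union> D (p j) \<union> K (j, False)" for j
  show thesis
  proof (rule that, intro ballI conjI)
    fix j assume j: "j \<in> boundary"
    have "f ` VH \<inter> W = {}" using f(1) by blast
    thus "P j \<subseteq> V - f ` VH" using Kj(1)[OF j] D'(2,6)[OF p[OF j]] by (auto simp: P_def)
    show "connector E (f (fst j)) (f (snd j)) (P j)" unfolding P_def
      using Kj(3)[OF j, of True] Kj(3)[OF j, of False] D'(1,3)[OF p[OF j]] y[OF p[OF j]]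
      by (intro connector_compose[OF V(3), of _ "y (p j)" _ _ "z (p j)"]) (auto simp: a_def b_def)
  next
    have "P i \<inter> P j = {}" if ij: "i \<in> boundary" "j \<in> boundary" "i \<noteq> j" for i j
    proof -
      have "K (i, c) \<inter> K (j, c') = {}" for c c' using disjoint_family_onD[OF K(2)] ij by simp
      moreover have "D (p i) \<inter> D (p j) = {}" using disjoint_family_onD[OF disj p[OF ij(1)] p[OF ij(2)]] ij(3) by (simp add: p_def)
      ultimately show ?thesis using Kj(2)[OF ij(1)] Kj(2)[OF ij(2)] D'(6)[OF p[OF ij(1)]] D'(6)[OF p[OF ij(2)]]
        unfolding P_def by blast
    qed
    thus "disjoint_family_on P boundary" by (simp add: disjoint_family_on_def)
  qed
qed

lemma tiling_with_hubs_topological_minor: "topological_minor V E VH EH"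
proof -
  note V = simple_graphD[OF G(1)] and H' = simple_graphD[OF H(1)]
  obtain z D where D: "anchored_family E V z (reserve t0) (boundary \<times> T) D" "\<forall>p\<in>boundary \<times> T. z p \<in> reserve (snd p)"
    "\<forall>t\<in>T. card ((\<Union>p\<in>boundary \<times> T. D p) \<inter> territory t) \<le> 5 * num_links" by (rule exists_lean_linkage)
  let ?W = "\<Union>p\<in>boundary \<times> T. D p"
  have "?W \<subseteq> V" using D(1) by (auto simp: anchored_family_def)
  hence "finite ?W" using V(1) by (rule finite_subset)
  then obtain f where f: "inj_on f VH" "f ` VH \<subseteq> (\<Union>t\<in>T. territory t - reserve t) - ?W" "f ` S \<subseteq> territory t0"
    "\<And>u v. (u, v) \<in> EH \<Longrightarrow> u \<notin> S \<Longrightarrow> v \<notin> S \<Longrightarrow> (f u, f v) \<in> E"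
    by (rule exists_embedding_avoiding) (use D(3) in auto)
  obtain P where P: "\<forall>j\<in>boundary. P j \<subseteq> V - f ` VH \<and> connector E (f (fst j)) (f (snd j)) (P j)" "disjoint_family_on P boundary"
    by (rule connect_boundary[OF D(1,2) refl D(3) f(2,3)])
  let ?P = "\<lambda>j. if j \<in> boundary then P j else {}"
  show ?thesis
  proof (rule topological_minor_of_arc_sets[OF f(1) _ H'(3)])
    show "f ` VH \<subseteq> V" using f(2) territory(2) by blast
    show "disjoint_family_on ?P EH" using P(2) by (auto simp: disjoint_family_on_def)
    show "?P e \<subseteq> V - f ` VH" for e using P(1) by simp
    fix u v assume e: "(u, v) \<in> EH"
    consider "u \<in> S" | "v \<in> S" | "u \<notin> S" "v \<notin> S" by blast
    thus "path_via E (?P (u, v) \<union> ?P (v, u)) (f u) (f v)"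
    proof cases
      case 1
      hence "(u, v) \<in> boundary" using e by (simp add: boundary_def)
      thus ?thesis using P(1) unfolding path_via_def by fastforce
    next
      case 2
      hence "(v, u) \<in> boundary" using symD[OF H'(3) e] by (simp add: boundary_def)
      hence "connector E (f u) (f v) (P (v, u))" using P(1) connector_sym by fastforce
      thus ?thesis using \<open>(v, u) \<in> boundary\<close> unfolding path_via_def by auto
    next
      case 3
      thus ?thesis using f(4)[OF e] by (simp add: path_via_def)
    qed
  qed
qed

end

theorem tiling_topological_minor: "topological_minor V E VH EH"
proof -
  obtain t0 where t0: "t0 \<in> T" using room by (cases "T = {}") (auto simp: coverage_def)
  have "\<exists>A1 B1 A0 B0. tile_hub E h t A1 B1 A0 B0" if "t \<in> T" for t
    using tile_contains_hub[OF simple_graphD(3,1)[OF G(1)] tile_familyD(2)[OF T that] \<rho>(1) params(1)] hub_factor_ge params(2) by simp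
  then obtain A1 B1 A0 B0 where "\<And>t. t \<in> T \<Longrightarrow> tile_hub E h t (A1 t) (B1 t) (A0 t) (B0 t)" by metis
  from tiling_with_hubs_topological_minor[OF t0 this] show ?thesis .
qed

end

section \<open>Separable bipartite graphs in dense graphs\<close>

lemma thin_tile_family:
  fixes c g :: real
  assumes F: "tile_family E V \<rho> q g F" "c \<le> 2 * real (coverage F)" and "0 < g" "1 \<le> q" "0 \<le> c"
  obtains F' where "tile_family E V \<rho> q g F'" "c \<le> 2 * real (coverage F')" "2 * (real (card F') - 1) * g \<le> c"
proof -
  have "\<exists>F'. (F' \<subseteq> F \<and> c \<le> 2 * real (coverage F')) \<and> (\<forall>F''. F'' \<subseteq> F \<and> c \<le> 2 * real (coverage F'') \<longrightarrow> card F' \<le> card F'')"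
    using F(2) by (intro ex_has_least_nat[of _ F]) auto
  then obtain F' where F': "F' \<subseteq> F" "c \<le> 2 * real (coverage F')" "\<forall>F''. F'' \<subseteq> F \<and> c \<le> 2 * real (coverage F'') \<longrightarrow> card F' \<le> card F''"
    by (elim exE conjE) (rule that)
  have T: "tile_family E V \<rho> q g F'" using F(1) F'(1) unfolding tile_family_def disjoint_family_on_def by (meson finite_subset subsetD)
  have "2 * (real (card F') - 1) * g \<le> c"
  proof (cases "F' = {}")
    case True
    thus ?thesis using assms(3,5) by simp
  next
    case False
    then obtain t where t: "t \<in> F'" by auto
    have card: "card (F' - {t}) = card F' - 1" "0 < card F'" using t tile_familyD(1)[OF T] by (auto simp: card_gt_0_iff)
    hence "\<not> card F' \<le> card (F' - {t})" by simp
    hence "2 * real (coverage (F' - {t})) < c" using F'(1,3) by (metis Diff_subset not_le order_trans)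
    moreover have "(\<Sum>t\<in>F' - {t}. g) \<le> (\<Sum>t\<in>F' - {t}. real (card (left t)))"
    proof (rule sum_mono)
      fix u assume "u \<in> F' - {t}"
      hence u: "is_tile E V \<rho> q g u" using tile_familyD(2)[OF T] by simp
      have "scale u \<le> card (left u)" using is_tileD(5)[OF u] mult_le_mono1[OF assms(4), of "scale u"] by linarith
      thus "g \<le> real (card (left u))" using is_tileD(7)[OF u] by linarith
    qed
    hence "real (card (F' - {t})) * g \<le> real (coverage (F' - {t}))" by (simp add: coverage_def)
    moreover have "real (card (F' - {t})) = real (card F') - 1" using card by simp
    ultimately have "2 * ((real (card F') - 1) * g) \<le> c" by simp
    thus ?thesis by (simp only: mult.assoc)
  qed
  thus thesis using that T F'(2) by blast
qed

lemma locally_sparse_of_no_dense_pair: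
  assumes sparse: "\<not> has_dense_pair E U (d / (2 * (real b + 1))) (1 / (real t + 1))" and n: "d \<le> 2 * real n" "0 < n"
  shows "locally_sparse E U n b t"
  unfolding locally_sparse_def
proof (intro allI impI)
  fix X Y assume XY: "X \<subseteq> U" "Y \<subseteq> U" "X \<inter> Y = {}" "n \<le> b * card X" "n \<le> b * card Y"
  have large: "d / (2 * (real b + 1)) \<le> real (card Z) \<and> 0 < card Z" if "n \<le> b * card Z" for Z :: "'a set"
  proof -
    have "real n \<le> real (b * card Z)" using that by (simp only: of_nat_le_iff)
    hence "d \<le> real (card Z) * (2 * (real b + 1))" using n(1) by (simp add: algebra_simps)
    moreover have "0 < card Z" using that n(2) by (cases "card Z") auto
    ultimately show ?thesis by (simp add: pos_divide_le_eq)
  qed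
  have "real (edge_count E X Y) < 1 / (real t + 1) * real (card X) * real (card Y)"
    using sparse XY(1-3) large[OF XY(4)] large[OF XY(5)] unfolding has_dense_pair_def by (meson not_le)
  hence "real ((t + 1) * edge_count E X Y) < real (card X * card Y)" by (simp add: field_simps)
  hence "(t + 1) * edge_count E X Y < card X * card Y" by (simp only: of_nat_less_iff)
  thus "t * edge_count E X Y < card X * card Y" by simp
qed

lemma no_dense_pair_topological_minor:
  fixes c :: real and \<Delta> :: nat
  assumes c: "0 < c"
  obtains a \<eta> d0 :: real where "0 < a" "0 < \<eta>"
    "\<And>d V (E :: 'a rel) (VH :: 'w set) EH. simple_graph V E \<Longrightarrow> V \<noteq> {} \<Longrightarrow> c * d * real (card V) \<le> real (card E) \<Longrightarrow>
      \<not> has_dense_pair E V (a * d) \<eta> \<Longrightarrow> simple_graph VH EH \<Longrightarrow> real (card VH) \<le> d \<Longrightarrow> (\<And>h. card (EH `` {h}) \<le> \<Delta>) \<Longrightarrow> d0 \<le> d \<Longrightarrow>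
      topological_minor V E VH EH"
proof -
  define m where "m = nat \<lceil>1 / c\<rceil> + 1"
  have m: "1 \<le> m" "1 / c \<le> real m" unfolding m_def by linarith+
  obtain b t d0 :: nat where sparse: "\<And>d V (E :: 'a rel) (VH :: 'w set) EH. simple_graph V E \<Longrightarrow> V \<noteq> {} \<Longrightarrow> d * card V \<le> m * card E \<Longrightarrow>
      locally_sparse E V d b t \<Longrightarrow> simple_graph VH EH \<Longrightarrow> card VH \<le> d \<Longrightarrow> (\<And>h. card (EH `` {h}) \<le> \<Delta>) \<Longrightarrow> d0 \<le> d \<Longrightarrow>
      topological_minor V E VH EH"
    using locally_sparse_topological_minor[OF m(1), where 'a = 'a and 'w = 'w and \<Delta> = \<Delta>] by metis
  show thesis
  proof (rule that[of "1 / (2 * (real b + 1))" "1 / (real t + 1)" "real d0 + 2"])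
    fix d V and E :: "'a rel" and VH :: "'w set" and EH
    assume G: "simple_graph V E" "V \<noteq> {}" "c * d * real (card V) \<le> real (card E)"
      "\<not> has_dense_pair E V (1 / (2 * (real b + 1)) * d) (1 / (real t + 1))"
      and H: "simple_graph VH EH" "real (card VH) \<le> d" "\<And>h. card (EH `` {h}) \<le> \<Delta>" and d: "real d0 + 2 \<le> d"
    define n where "n = nat \<lfloor>d\<rfloor>"
    have n: "real n \<le> d" "d < real n + 1" using d unfolding n_def by linarith+
    have large: "d \<le> 2 * real n" "0 < n" "d0 \<le> n" "card VH \<le> n" using n d H(2) by linarith+
    have "real n * real (card V) \<le> d * real (card V)" using n(1) by (intro mult_right_mono) auto
    also have "\<dots> = 1 / c * (c * d * real (card V))" using c by simp
    also have "\<dots> \<le> real m * real (card E)" using G(3) m(2) c d by (intro mult_mono) auto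
    finally have "real (n * card V) \<le> real (m * card E)" by simp
    hence "n * card V \<le> m * card E" by (simp only: of_nat_le_iff)
    moreover have "locally_sparse E V n b t" by (rule locally_sparse_of_no_dense_pair[OF _ large(1,2)]) (use G(4) in simp)
    ultimately show "topological_minor V E VH EH" using sparse[OF G(1,2) _ _ H(1) large(4) H(3) large(3)] by blast
  qed auto
qed

lemma dense_connected_subgraph:
  fixes d e :: real
  assumes G: "simple_graph V E" "V \<noteq> {}" "d * real (card V) \<le> real (card E)" and e: "0 < e" "e < 1" "32 \<le> e * d"
  obtains W k where "W \<subseteq> V" "W \<noteq> {}" "vertex_connected k W (Restr E W)" "e / 32 * d \<le> real k"
    "(1 - e / 8) * d * real (card W) \<le> real (card (Restr E W))"
proof -
  define k where "k = nat \<lfloor>e / 16 * d\<rfloor>"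
  have k: "real k \<le> e / 16 * d" "e / 16 * d < real k + 1" using e(3) unfolding k_def by linarith+
  have "0 < e * d" using e(3) by linarith
  hence d: "0 < d" using e(1) by (simp add: zero_less_mult_iff)
  have "e * d \<le> 1 * d" using e d by (intro mult_right_mono) auto
  hence small: "1 \<le> k" "4 * real k \<le> d" "e / 32 * d \<le> real k" using k e(3) by linarith+
  obtain W where W: "W \<subseteq> V" "W \<noteq> {}" "\<And>v. v \<in> W \<Longrightarrow> d / 2 < real (card (E `` {v} \<inter> W))"
    "vertex_connected k W (Restr E W)" "d * real (card W) < real (card (Restr E W)) + d * real k"
    using mader[OF G(1,2) small(1,2) G(3)] by metis
  have fin: "finite W" using W(1) simple_graphD(1)[OF G(1)] by (rule finite_subset)
  obtain v where v: "v \<in> W" using W(2) by auto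
  have "card (E `` {v} \<inter> W) \<le> card W" using fin by (intro card_mono) auto
  hence "d / 2 \<le> real (card W)" using W(3)[OF v] by linarith
  hence "e / 8 * (d / 2) \<le> e / 8 * real (card W)" using e by (intro mult_left_mono) auto
  moreover have "e / 8 * (d / 2) = e / 16 * d" by simp
  ultimately have "real k \<le> e / 8 * real (card W)" using k(1) by linarith
  hence "d * real k \<le> d * (e / 8 * real (card W))" using d by (intro mult_left_mono) auto
  hence "(1 - e / 8) * d * real (card W) \<le> real (card (Restr E W))" using W(5) by (simp add: algebra_simps)
  thus thesis using that W(1,2,4) small(3) by blast
qed

definition separable_pattern :: "real \<Rightarrow> nat \<Rightarrow> 'w set \<Rightarrow> 'w rel \<Rightarrow> bool" where
  "separable_pattern \<alpha> \<Delta> VH EH \<longleftrightarrow> simple_graph VH EH \<and> (\<forall>h. card (EH `` {h}) \<le> \<Delta>) \<and>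
     (\<exists>X1 X2. VH = X1 \<union> X2 \<and> X1 \<inter> X2 = {} \<and> EH \<subseteq> X1 \<times> X2 \<union> X2 \<times> X1) \<and>
     (\<exists>S\<subseteq>VH. real (card S) \<le> \<alpha> * real (card VH) \<and>
       (\<forall>x\<in>VH - S. real (card (component_in EH (VH - S) x)) \<le> \<alpha> * real (card VH)))"

lemma few_tiles:
  fixes d e \<gamma> :: real
  assumes "2 * (real n - 1) * (\<gamma> * d) \<le> (1 - e) * d" "0 < \<gamma>" "0 < d" "0 < e"
  shows "real n \<le> 1 / \<gamma> + 1"
proof -
  have "(2 * (real n - 1) * \<gamma>) * d \<le> (1 - e) * d" using assms(1) by (simp add: mult.assoc)
  hence "2 * (real n - 1) * \<gamma> \<le> 1 - e" using assms(3) by (rule mult_right_le_imp_le)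
  moreover have "0 < e * d" "0 < 1 / \<gamma>" using assms(2-4) by simp_all
  ultimately have "2 * (real n - 1) \<le> 2 * (1 / \<gamma>)" using assms(2,4) by (simp add: field_simps)
  thus ?thesis by simp
qed

lemma coverage_leaves_room:
  fixes d e :: real
  assumes "real c \<le> 2 * e * real q" "0 < q" "0 < e" "e < 1" "0 < d"
    and x: "(1 - e) * d \<le> 2 * real x" and n: "real n \<le> (1 - 2 * e) * d"
  shows "q * n + c * x < 2 * q * x"
proof -
  have "real q * real n \<le> real q * ((1 - 2 * e) * d)" using n by (intro mult_left_mono) auto
  also have "\<dots> < real q * ((1 - e) * ((1 - e) * d))"
    using assms(2,3,5) by (intro mult_strict_left_mono) (simp_all add: algebra_simps)
  also have "\<dots> \<le> real q * ((1 - e) * (2 * real x))" using x assms(4) by (intro mult_left_mono) auto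
  also have "\<dots> = 2 * real q * real x - 2 * e * real q * real x" by (simp add: algebra_simps)
  also have "\<dots> \<le> 2 * real q * real x - real c * real x" using mult_right_mono[OF assms(1), of "real x"] by simp
  finally have "real (q * n + c * x) < real (2 * q * x)" by simp
  thus ?thesis by (simp only: of_nat_less_iff)
qed

lemma covering_tile_family_topological_minor:
  fixes \<alpha> \<gamma> d e :: real
  assumes G: "simple_graph V E" "vertex_connected k V E" "e / 32 * d \<le> real k" and \<rho>: "0 < \<rho>" "\<rho> \<le> 1"
    and F: "tile_family E V \<rho> q (\<gamma> * d) F" "(1 - e) * d \<le> 2 * real (coverage F)"
    and H: "separable_pattern \<alpha> \<Delta> VH EH" "real (card VH) \<le> (1 - 2 * e) * d"
    and params: "3 \<le> \<rho> * real h" "h + 3 \<le> q" "real (\<Delta> + 2) \<le> \<rho> ^ \<Delta> * real l" "real (2 * l + 2 * h + 5) \<le> 2 * e * real q"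
    and pos: "0 < e" "e < 1" "0 < \<gamma>" "0 < d" and \<alpha>: "0 < \<alpha>" "\<alpha> * (real (\<Delta> + 1) * (1 / \<gamma> + 1)) \<le> min (e / 32) (\<gamma> / 20)"
  shows "topological_minor V E VH EH"
proof -
  obtain F' where F': "tile_family E V \<rho> q (\<gamma> * d) F'" "(1 - e) * d \<le> 2 * real (coverage F')"
      "2 * (real (card F') - 1) * (\<gamma> * d) \<le> (1 - e) * d"
    by (rule thin_tile_family[OF F]) (use params(2) pos in auto)
  define s where "s = nat \<lfloor>\<alpha> * d\<rfloor>"
  have s: "real s \<le> \<alpha> * d" using \<alpha>(1) pos(4) by (simp add: s_def)
  have "0 \<le> e * d" using pos by simp
  hence "real (card VH) \<le> d" using H(2) by (simp add: algebra_simps)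
  hence "\<alpha> * real (card VH) \<le> \<alpha> * d" using \<alpha>(1) by (intro mult_left_mono) auto
  hence le_s: "n \<le> s" if "real n \<le> \<alpha> * real (card VH)" for n
    using that unfolding s_def by (intro le_nat_floor) simp
  have scaled: "x * d \<le> min (e / 32) (\<gamma> / 20) * d" if "x \<le> \<alpha> * (real (\<Delta> + 1) * (1 / \<gamma> + 1))" for x
    using pos(4) by (intro mult_right_mono order_trans[OF that \<alpha>(2)]) simp
  have "real \<Delta> * real (card F') \<le> real (\<Delta> + 1) * (1 / \<gamma> + 1)"
    using few_tiles[OF F'(3) pos(3,4,1)] by (intro mult_mono) auto
  hence "real s * (real \<Delta> * real (card F')) \<le> (\<alpha> * d) * (real (\<Delta> + 1) * (1 / \<gamma> + 1))"
    by (rule mult_mono[OF s]) (use \<alpha>(1) pos(4) in auto)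
  hence links: "real (\<Delta> * s * card F') \<le> min (e / 32) (\<gamma> / 20) * d" using scaled[OF order.refl] by (simp add: mult_ac)
  have "min (e / 32) (\<gamma> / 20) * d \<le> e / 32 * d" "min (e / 32) (\<gamma> / 20) * d \<le> \<gamma> / 20 * d"
    using pos(4) by (intro mult_right_mono; simp)+
  note links = order_trans[OF links this(1)] order_trans[OF links this(2)] and bound = this(2)
  have "1 * 1 \<le> real (\<Delta> + 1) * (1 / \<gamma> + 1)" using pos(3) by (intro mult_mono) auto
  hence "\<alpha> * 1 \<le> \<alpha> * (real (\<Delta> + 1) * (1 / \<gamma> + 1))" using \<alpha>(1) by (intro mult_left_mono) auto
  hence "real s \<le> \<gamma> / 20 * d" using scaled[of \<alpha>] s bound by linarith
  moreover have "0 < \<gamma> * d" using pos by simp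
  ultimately have "real s \<le> \<gamma> * d" by linarith
  obtain X1 X2 S where H': "simple_graph VH EH" "\<And>h. card (EH `` {h}) \<le> \<Delta>" "VH = X1 \<union> X2" "X1 \<inter> X2 = {}" "EH \<subseteq> X1 \<times> X2 \<union> X2 \<times> X1"
    "S \<subseteq> VH" "card S \<le> s" "\<And>x. x \<in> VH - S \<Longrightarrow> card (component_in EH (VH - S) x) \<le> s"
    using H(1) le_s unfolding separable_pattern_def by metis
  show ?thesis
  proof (rule tiling_topological_minor[OF G(1,2) \<rho> F'(1) H'(1) _ H'(4,5,2,6,7,8) params(1-3)])
    show "\<Delta> * s * card F' \<le> k" using links(1) G(3) by (simp only: of_nat_le_iff[where 'a = real, symmetric])
    show "real (20 * (\<Delta> * s * card F')) \<le> \<gamma> * d" using links(2) by simp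
    show "q * card VH + (2 * l + 2 * h + 5) * coverage F' < 2 * q * coverage F'"
      by (rule coverage_leaves_room[OF params(4) _ pos(1,2,4) F'(2) H(2)]) (use params(2) in simp)
  qed (use H'(3) \<open>real s \<le> \<gamma> * d\<close> in auto)
qed

lemma tiling_parameters:
  fixes e \<rho> :: real
  assumes "0 < e" "0 < \<rho>"
  obtains h l q where "3 \<le> \<rho> * real h" "h + 3 \<le> q" "real (\<Delta> + 2) \<le> \<rho> ^ \<Delta> * real l" "real (2 * l + 2 * h + 5) \<le> 2 * e * real q"
proof -
  define h where "h = nat \<lceil>3 / \<rho>\<rceil>"
  define l where "l = nat \<lceil>real (\<Delta> + 2) / \<rho> ^ \<Delta>\<rceil>"
  define q where "q = nat \<lceil>real (2 * l + 2 * h + 5) / (2 * e)\<rceil> + (h + 3)"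
  have "real (2 * l + 2 * h + 5) / (2 * e) \<le> real q"
    unfolding q_def of_nat_add[of _ "h + 3"] by (rule order_trans[OF real_nat_ceiling_ge]) simp
  moreover have "3 / \<rho> \<le> real h" "real (\<Delta> + 2) / \<rho> ^ \<Delta> \<le> real l" unfolding h_def l_def by (rule real_nat_ceiling_ge)+
  ultimately show thesis using assms by (intro that[of h q l]) (simp_all add: pos_divide_le_eq mult.commute q_def del: of_nat_add of_nat_mult)
qed

theorem separable_pattern_topological_minor:
  fixes \<epsilon> :: real and \<Delta> :: nat
  assumes \<epsilon>: "0 < \<epsilon>" "\<epsilon> < 1"
  obtains \<alpha>0 d0 :: real where "0 < \<alpha>0" "0 < d0"
    "\<And>\<alpha> d V (E :: 'a rel) (VH :: 'w set) EH. 0 < \<alpha> \<Longrightarrow> \<alpha> < \<alpha>0 \<Longrightarrow> d0 \<le> d \<Longrightarrow>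
      simple_graph V E \<Longrightarrow> V \<noteq> {} \<Longrightarrow> d * real (card V) \<le> real (card E) \<Longrightarrow>
      separable_pattern \<alpha> \<Delta> VH EH \<Longrightarrow> real (card VH) \<le> (1 - \<epsilon>) * d \<Longrightarrow> topological_minor V E VH EH"
proof -
  define e where "e = \<epsilon> / 2"
  have e: "0 < e" "e < 1" "\<epsilon> = 2 * e" using \<epsilon> by (auto simp: e_def)
  hence "0 < e / 8" by simp
  then obtain a \<eta> d1 :: real where sparse: "0 < a" "0 < \<eta>"
    "\<And>d V (E :: 'a rel) (VH :: 'w set) EH. simple_graph V E \<Longrightarrow> V \<noteq> {} \<Longrightarrow> e / 8 * d * real (card V) \<le> real (card E) \<Longrightarrow>
      \<not> has_dense_pair E V (a * d) \<eta> \<Longrightarrow> simple_graph VH EH \<Longrightarrow> real (card VH) \<le> d \<Longrightarrow> (\<And>h. card (EH `` {h}) \<le> \<Delta>) \<Longrightarrow> d1 \<le> d \<Longrightarrow>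
      topological_minor V E VH EH"
    by (rule no_dense_pair_topological_minor[where \<Delta> = \<Delta>]) blast
  define \<rho> where "\<rho> = min (e / 32) \<eta> / 2"
  have \<rho>: "0 < \<rho>" "\<rho> \<le> 1" using e sparse(2) by (auto simp: \<rho>_def)
  obtain h l q where params: "3 \<le> \<rho> * real h" "h + 3 \<le> q" "real (\<Delta> + 2) \<le> \<rho> ^ \<Delta> * real l" "real (2 * l + 2 * h + 5) \<le> 2 * e * real q"
    by (rule tiling_parameters[OF e(1) \<rho>(1)])
  hence "2 \<le> q" by simp
  then obtain \<gamma> d2 where tiles: "0 < \<gamma>" "\<forall>V (E :: 'a rel) d. tiling_host V E e d (a * d) \<eta> \<longrightarrow> d2 \<le> d \<longrightarrow>
      (\<exists>F. tile_family E V \<rho> q (\<gamma> * d) F \<and> (1 - e) * d \<le> 2 * real (coverage F))"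
    unfolding \<rho>_def by (rule tile_family_exists[OF e(1,2) sparse(2,1)])
  define M where "M = real (\<Delta> + 1) * (1 / \<gamma> + 1)"
  have M: "0 < M" using tiles(1) by (simp add: M_def add_pos_pos)
  show thesis
  proof (rule that[of "min (e / 32) (\<gamma> / 20) / M" "max (32 / e) (max d1 d2)"])
    show "0 < min (e / 32) (\<gamma> / 20) / M" using e tiles(1) M by simp
    show "0 < max (32 / e) (max d1 d2)" using e(1) by (simp add: less_max_iff_disj)
  next
    fix \<alpha> d V and E :: "'a rel" and VH :: "'w set" and EH
    assume \<alpha>: "0 < \<alpha>" "\<alpha> < min (e / 32) (\<gamma> / 20) / M" and d0: "max (32 / e) (max d1 d2) \<le> d"
      and G: "simple_graph V E" "V \<noteq> {}" "d * real (card V) \<le> real (card E)"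
      and H: "separable_pattern \<alpha> \<Delta> VH EH" "real (card VH) \<le> (1 - \<epsilon>) * d"
    have d: "32 \<le> e * d" "d1 \<le> d" "d2 \<le> d" "0 < d" using d0 e(1) by (auto simp: field_simps less_le_trans[OF divide_pos_pos[of 32 e]])
    obtain W k where W: "W \<subseteq> V" "W \<noteq> {}" "vertex_connected k W (Restr E W)" "e / 32 * d \<le> real k"
      "(1 - e / 8) * d * real (card W) \<le> real (card (Restr E W))"
      by (rule dense_connected_subgraph[OF G e(1,2) d(1)])
    note W' = simple_graph_Restr[OF G(1) W(1)]
    show "topological_minor V E VH EH"
    proof (cases "tiling_host W (Restr E W) e d (a * d) \<eta>")
      case True
      then obtain F where F: "tile_family (Restr E W) W \<rho> q (\<gamma> * d) F" "(1 - e) * d \<le> 2 * real (coverage F)"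
        using tiles(2) d(3) by blast
      have "\<alpha> * (real (\<Delta> + 1) * (1 / \<gamma> + 1)) \<le> min (e / 32) (\<gamma> / 20)"
        using less_imp_le[OF \<alpha>(2)] M unfolding M_def[symmetric] by (simp only: pos_le_divide_eq)
      hence "topological_minor W (Restr E W) VH EH"
        using H(2) e by (intro covering_tile_family_topological_minor[OF W' W(3,4) \<rho> F H(1) _ params e(1,2) tiles(1) d(4) \<alpha>(1)]) simp_all
      thus ?thesis by (rule topological_minor_mono[OF _ W(1)]) auto
    next
      case False
      then obtain U where U: "U \<subseteq> W" "U \<noteq> {}" "e / 8 * d * real (card U) \<le> real (edge_count (Restr E W) U U)"
        "\<not> has_dense_pair (Restr E W) U (a * d) \<eta>" using W' W(2,5) by (auto simp: tiling_host_def)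
      have "0 \<le> \<epsilon> * d" using \<epsilon> d(4) by simp
      hence "real (card VH) \<le> d" using H(2) by (simp add: algebra_simps)
      have same: "edge_count (Restr E W) X Y = edge_count (Restr E U) X Y" if "X \<subseteq> U" "Y \<subseteq> U" for X Y
        unfolding edge_count_def by (rule arg_cong[where f = card]) (use that U(1) in blast)
      have "e / 8 * d * real (card U) \<le> real (card (Restr E U))" using U(3) same[of U U] by (simp add: edge_count_def Int_assoc)
      moreover have "\<not> has_dense_pair (Restr E U) U (a * d) \<eta>" using U(4) same unfolding has_dense_pair_def by metis
      moreover have "simple_graph U (Restr E U)" using U(1) W(1) by (intro simple_graph_Restr[OF G(1)]) simp
      ultimately have "topological_minor U (Restr E U) VH EH"
        using sparse(3)[OF _ U(2) _ _ _ \<open>real (card VH) \<le> d\<close> _ d(2)] H(1) unfolding separable_pattern_def by blast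
      thus ?thesis by (rule topological_minor_mono) (use U(1) W(1) in auto)
    qed
  qed
qed

section \<open>Subdivisions from topological minors\<close>

lemma simple_graph_of_pair_graph:
  assumes "pair_graph G"
  shows "simple_graph (pverts G) (parcs G)"
proof -
  interpret pair_graph G by fact
  have "sym (parcs G)" using pair_sym_arcs by (simp add: symmetric_def)
  thus ?thesis unfolding simple_graph_def using pair_finite_verts pair_no_loops wellformed' by (fastforce simp: irrefl_def)
qed

lemma pair_graph_of_simple_graph:
  assumes "simple_graph V E"
  shows "pair_graph \<lparr>pverts = V, parcs = E\<rparr>"
proof -
  note E = simple_graphD[OF assms]
  have "fst e \<in> V \<and> snd e \<in> V \<and> fst e \<noteq> snd e" if "e \<in> E" for e using that E(4,5) by (cases e) (auto simp: irrefl_def)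
  thus ?thesis by unfold_locales (use E(1-3) in \<open>simp_all add: symmetric_def\<close>)
qed

lemma reachable_of_rtrancl:
  assumes "pair_wf_digraph K" "(u, v) \<in> (parcs K)\<^sup>*" "u \<in> pverts K"
  shows "reachable (with_proj K) u v"
proof -
  interpret pair_wf_digraph K by fact
  show ?thesis using assms(2)
    by (induction rule: rtrancl_induct) (use assms(3) in \<open>auto intro: reachable_adj_trans\<close>)
qed

lemma apath_of_path_via:
  assumes G: "pair_graph G" and xy: "x \<in> pverts G" "y \<in> pverts G" and I: "I \<subseteq> pverts G" and via: "path_via (parcs G) I x y"
  shows "\<exists>p. pre_digraph.apath (with_proj G) x p y \<and> set (pre_digraph.inner_verts (with_proj G) p) \<subseteq> I"
proof -
  interpret G: pair_graph G by fact
  note G' = simple_graph_of_pair_graph[OF G]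
  define X where "X = insert x (insert y I)"
  have XV: "X \<subseteq> pverts G" using xy I by (auto simp: X_def)
  define K where "K = \<lparr>pverts = X, parcs = Restr (parcs G) X\<rparr>"
  interpret K: pair_graph K unfolding K_def by (rule pair_graph_of_simple_graph[OF simple_graph_Restr[OF G' XV]])
  have "(x, y) \<in> (parcs K)\<^sup>*"
  proof (cases "(x, y) \<in> parcs G")
    case True
    hence "(x, y) \<in> parcs K" by (simp add: K_def X_def)
    thus ?thesis ..
  next
    case False
    then obtain C where C: "C \<subseteq> I" "connector (parcs G) x y C" using via unfolding path_via_def by auto
    from C(2) obtain u v where uv: "connected_in (parcs G) C" "u \<in> C" "(x, u) \<in> parcs G" "v \<in> C" "(y, v) \<in> parcs G" by (rule connectorE)
    have "Restr (parcs G) C \<subseteq> parcs K" using C(1) by (auto simp: K_def X_def)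
    hence "(u, v) \<in> (parcs K)\<^sup>*" using rtrancl_mono uv(1,2,4) unfolding connected_in_def by blast
    moreover have "(x, u) \<in> parcs K" "(v, y) \<in> parcs K"
      using uv C(1) symD[OF simple_graphD(3)[OF G'] uv(5)] by (auto simp: K_def X_def)
    ultimately show ?thesis by (meson converse_rtrancl_into_rtrancl rtrancl.rtrancl_into_rtrancl)
  qed
  hence "reachable (with_proj K) x y" by (intro reachable_of_rtrancl[OF K.pair_wf_digraph_axioms]) (simp_all add: K_def X_def)
  then obtain p where p: "K.apath x p y" unfolding K.reachable_apath by auto
  have p': "set p \<subseteq> parcs K" "pcas x p y" "distinct (pawalk_verts x p)" using p by (auto simp: K.apath_def K.awalk_def)
  hence arcs: "set p \<subseteq> Restr (parcs G) X" by (simp add: K_def)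
  hence path: "G.apath x p y" using p'(2,3) xy by (auto simp: G.apath_def G.awalk_def)
  have "set (pawalk_verts x p) \<subseteq> insert x (fst ` set p \<union> snd ` set p)" by (induction p arbitrary: x) fastforce+
  also have "\<dots> \<subseteq> X" using arcs by (auto simp: X_def)
  finally have "set (G.inner_verts p) \<subseteq> I" unfolding G.set_inner_verts[OF path] by (auto simp: X_def)
  thus ?thesis using path by auto
qed

lemma symmetric_choice:
  assumes E: "sym E" "irrefl E" and P: "\<And>u v. (u, v) \<in> E \<Longrightarrow> \<exists>p. R u v p" "\<And>u v p. R u v p \<Longrightarrow> R v u (r p)" and r: "\<And>p. r (r p) = p"
  obtains P where "\<And>u v. (u, v) \<in> E \<Longrightarrow> R u v (P (u, v)) \<and> P (v, u) = r (P (u, v))"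
proof -
  have "\<forall>a\<in>E. \<exists>p. R (fst a) (snd a) p" using P(1) by auto
  then obtain p where p: "\<And>u v. (u, v) \<in> E \<Longrightarrow> R u v (p (u, v))" by (metis fst_conv snd_conv)
  define arc where "arc e = (SOME a. a \<in> E \<and> {fst a, snd a} = e)" for e
  define P where "P a = (if arc {fst a, snd a} = a then p a else r (p (snd a, fst a)))" for a
  have arc: "arc {u, v} = (u, v) \<or> arc {u, v} = (v, u)" if "(u, v) \<in> E" for u v
  proof -
    have "arc {u, v} \<in> E \<and> {fst (arc {u, v}), snd (arc {u, v})} = {u, v}"
      unfolding arc_def by (rule someI[of _ "(u, v)"]) (use that in simp)
    thus ?thesis by (metis doubleton_eq_iff prod.collapse)
  qed
  have "R u v (P (u, v)) \<and> P (v, u) = r (P (u, v))" if e: "(u, v) \<in> E" for u v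
  proof -
    have "u \<noteq> v" using e E(2) by (auto simp: irrefl_def)
    hence "P (v, u) = r (P (u, v))" using arc[OF e] r by (auto simp: P_def insert_commute)
    moreover have "R u v (P (u, v))" using p[OF e] P(2)[OF p[OF symD[OF E(1) e]]] by (simp add: P_def)
    ultimately show ?thesis by simp
  qed
  thus thesis by (rule that)
qed

definition interior :: "('b \<times> 'b) list \<Rightarrow> 'b set" where
  "interior p = set (tl (map fst p))"

lemma set_inner_verts_eq_interior: "set (pre_digraph.inner_verts (with_proj K) p) = interior p"
  by (simp only: inner_verts_with_proj_def interior_def)

context
  fixes G :: "'b pair_pre_digraph" and H :: "'a pair_pre_digraph" and f :: "'a \<Rightarrow> 'b" and P :: "'a \<times> 'a \<Rightarrow> ('b \<times> 'b) list"
  assumes G: "pair_graph G" and H: "pair_graph H" and f: "inj_on f (pverts H)" "f ` pverts H \<subseteq> pverts G"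
    and P: "\<And>u v. (u, v) \<in> parcs H \<Longrightarrow> pre_digraph.apath (with_proj G) (f u) (P (u, v)) (f v)"
      "\<And>u v. (u, v) \<in> parcs H \<Longrightarrow> P (v, u) = rev_path (P (u, v))"
      "\<And>u v. (u, v) \<in> parcs H \<Longrightarrow> interior (P (u, v)) \<subseteq> pverts G - f ` pverts H"
      "\<And>u v x y. (u, v) \<in> parcs H \<Longrightarrow> (x, y) \<in> parcs H \<Longrightarrow> {u, v} \<noteq> {x, y} \<Longrightarrow> interior (P (u, v)) \<inter> interior (P (x, y)) = {}"
begin

definition path_union :: "'b pair_pre_digraph" where
  "path_union = \<lparr>pverts = f ` pverts H \<union> (\<Union>e\<in>parcs H. interior (P e)), parcs = (\<Union>e\<in>parcs H. set (P e))\<rparr>"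

lemma path_arcs:
  assumes e: "(u, v) \<in> parcs H"
  shows "set (P (u, v)) \<subseteq> parcs G" "pcas (f u) (P (u, v)) (f v)" "distinct (pawalk_verts (f u) (P (u, v)))"
    "set (P (u, v)) \<subseteq> pverts path_union \<times> pverts path_union"
proof -
  interpret G: pair_graph G by (rule G)
  note path = P(1)[OF e]
  show "set (P (u, v)) \<subseteq> parcs G" "pcas (f u) (P (u, v)) (f v)" "distinct (pawalk_verts (f u) (P (u, v)))"
    using path by (auto simp: G.apath_def G.awalk_def)
  have "interior (P (u, v)) = set (G.awalk_verts (f u) (P (u, v))) - {f u, f v}"
    using G.set_inner_verts[OF path] by (simp only: set_inner_verts_eq_interior)
  moreover have "{f u, f v} \<subseteq> pverts path_union" "interior (P (u, v)) \<subseteq> pverts path_union"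
    using e simple_graphD(5)[OF simple_graph_of_pair_graph[OF H]] by (auto simp: path_union_def)
  ultimately have verts: "set (G.awalk_verts (f u) (P (u, v))) \<subseteq> pverts path_union" by blast
  show "set (P (u, v)) \<subseteq> pverts path_union \<times> pverts path_union"
  proof
    fix a assume a: "a \<in> set (P (u, v))"
    have "fst a \<in> set (G.awalk_verts (f u) (P (u, v)))" "snd a \<in> set (G.awalk_verts (f u) (P (u, v)))"
      using G.awalk_verts_arc1[OF a, of "f u"] G.awalk_verts_arc2[OF G.awalkI_apath[OF path] a] by simp_all
    thus "a \<in> pverts path_union \<times> pverts path_union" using verts by (auto simp: mem_Times_iff)
  qed
qed

lemma path_union_subgraph: "pair_graph path_union" "subgraph (with_proj path_union) (with_proj G)"
proof -
  interpret G: pair_graph G by (rule G)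
  note G' = simple_graphD[OF simple_graph_of_pair_graph[OF G]] and H' = simple_graphD[OF simple_graph_of_pair_graph[OF H]]
  have "set (P e) \<subseteq> parcs G \<and> set (P e) \<subseteq> pverts path_union \<times> pverts path_union" if "e \<in> parcs H" for e
    using path_arcs(1,4)[of "fst e" "snd e"] that by simp
  moreover have "parcs path_union = (\<Union>e\<in>parcs H. set (P e))" by (simp add: path_union_def)
  ultimately have arcs: "parcs path_union \<subseteq> parcs G" "parcs path_union \<subseteq> pverts path_union \<times> pverts path_union" by blast+
  have "simple_graph (pverts path_union) (parcs path_union)" unfolding simple_graph_def
  proof (intro conjI)
    show "finite (pverts path_union)" using H'(1,2) by (simp add: path_union_def interior_def)
    show "irrefl (parcs path_union)" using G'(4) arcs(1) by (auto simp: irrefl_def)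
    show "sym (parcs path_union)"
    proof (rule symI)
      have rev: "set (rev_path p) = (\<lambda>e. (snd e, fst e)) ` set p" for p :: "('b \<times> 'b) list" by (induction p) auto
      fix x y assume "(x, y) \<in> parcs path_union"
      then obtain u v where uv: "(u, v) \<in> parcs H" "(x, y) \<in> set (P (u, v))" by (auto simp: path_union_def)
      hence "(y, x) \<in> set (P (v, u))" unfolding P(2)[OF uv(1)] rev by force
      thus "(y, x) \<in> parcs path_union" using symD[OF H'(3) uv(1)] by (auto simp: path_union_def)
    qed
  qed (rule arcs(2))
  thus graph: "pair_graph path_union" using pair_graph_of_simple_graph unfolding path_union_def by fastforce
  interpret K: pair_graph path_union by (rule graph)
  have "pverts path_union \<subseteq> pverts G" using f(2) P(3) by (fastforce simp: path_union_def)
  thus "subgraph (with_proj path_union) (with_proj G)"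
    using arcs(1) G.wf_digraph_axioms K.wf_digraph_axioms by (simp add: subgraph_def compatible_def)
qed

lemma path_union_is_subdivision: "is_subdivision_of path_union H"
  unfolding is_subdivision_of_def set_inner_verts_eq_interior
proof (intro conjI exI[of _ f] exI[of _ P])
  interpret K: pair_graph path_union by (rule path_union_subgraph(1))
  show "\<forall>(u, v)\<in>parcs H. K.apath (f u) (P (u, v)) (f v) \<and> P (v, u) = rev_path (P (u, v)) \<and> interior (P (u, v)) \<inter> f ` pverts H = {}"
  proof clarify
    fix u v assume e: "(u, v) \<in> parcs H"
    have "f u \<in> pverts path_union" using e simple_graphD(5)[OF simple_graph_of_pair_graph[OF H]] by (auto simp: path_union_def)
    moreover have "set (P (u, v)) \<subseteq> parcs path_union" using e by (auto simp: path_union_def)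
    ultimately have "K.apath (f u) (P (u, v)) (f v)" using path_arcs(2,3)[OF e] by (simp add: K.apath_def K.awalk_def)
    thus "K.apath (f u) (P (u, v)) (f v) \<and> P (v, u) = rev_path (P (u, v)) \<and> interior (P (u, v)) \<inter> f ` pverts H = {}"
      using P(2,3)[OF e] by auto
  qed
  show "\<forall>(u, v)\<in>parcs H. \<forall>(x, y)\<in>parcs H. {u, v} \<noteq> {x, y} \<longrightarrow> interior (P (u, v)) \<inter> interior (P (x, y)) = {}"
    using P(4) by fastforce
qed (use path_union_subgraph(1) f(1) in \<open>simp_all add: path_union_def\<close>)

end

theorem topological_minor_contains_subdivision:
  assumes G: "pair_graph G" and H: "pair_graph H" and minor: "topological_minor (pverts G) (parcs G) (pverts H) (parcs H)"
  shows "contains_subdivision G H"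
proof -
  interpret G: pair_graph G by (rule G)
  note H' = simple_graphD[OF simple_graph_of_pair_graph[OF H]]
  obtain f I where f: "inj_on f (pverts H)" "f ` pverts H \<subseteq> pverts G" "\<And>u v. (u, v) \<in> parcs H \<Longrightarrow> I {u, v} \<subseteq> pverts G - f ` pverts H"
    and via: "\<And>u v. (u, v) \<in> parcs H \<Longrightarrow> path_via (parcs G) (I {u, v}) (f u) (f v)"
    and disjoint: "\<And>u v x y. (u, v) \<in> parcs H \<Longrightarrow> (x, y) \<in> parcs H \<Longrightarrow> {u, v} \<noteq> {x, y} \<Longrightarrow> I {u, v} \<inter> I {x, y} = {}"
    by (rule topological_minorE[OF minor]) (rule that, simp_all)
  let ?R = "\<lambda>u v p. G.apath (f u) p (f v) \<and> interior p \<subseteq> I {u, v}"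
  obtain P where P: "\<And>u v. (u, v) \<in> parcs H \<Longrightarrow> ?R u v (P (u, v)) \<and> P (v, u) = rev_path (P (u, v))"
  proof (rule symmetric_choice[OF H'(3,4), of ?R rev_path])
    show "\<exists>p. ?R u v p" if e: "(u, v) \<in> parcs H" for u v
    proof -
      have "f u \<in> pverts G" "f v \<in> pverts G" "I {u, v} \<subseteq> pverts G" using e H'(5) f(2) f(3)[OF e] by auto
      from apath_of_path_via[OF G this via[OF e]] show ?thesis unfolding set_inner_verts_eq_interior .
    qed
    show "?R v u (rev_path p)" if p: "?R u v p" for u v p
    proof -
      have "set (G.inner_verts (rev_path p)) = set (G.inner_verts p)"
        using G.inner_verts_rev_path[OF G.awalkI_apath[OF conjunct1[OF p]]] by simp
      thus ?thesis using p unfolding set_inner_verts_eq_interior by (simp add: insert_commute)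
    qed
  qed (simp, rule that)
  have path: "G.apath (f u) (P (u, v)) (f v)" "P (v, u) = rev_path (P (u, v))" "interior (P (u, v)) \<subseteq> I {u, v}"
    if "(u, v) \<in> parcs H" for u v using P[OF that] by simp_all
  have avoid: "interior (P (u, v)) \<subseteq> pverts G - f ` pverts H" if "(u, v) \<in> parcs H" for u v
    using path(3)[OF that] f(3)[OF that] by blast
  have "interior (P (u, v)) \<inter> interior (P (x, y)) = {}" if "(u, v) \<in> parcs H" "(x, y) \<in> parcs H" "{u, v} \<noteq> {x, y}" for u v x y
    using path(3)[OF that(1)] path(3)[OF that(2)] disjoint[OF that] by blast
  note paths = G H f(1,2) path(1,2) avoid this
  show ?thesis unfolding contains_subdivision_def using path_union_subgraph(2)[OF paths] path_union_is_subdivision[OF paths] by blast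
qed

lemma card_edges_le:
  assumes "pair_graph G"
  shows "2 * card (edges G) \<le> card (parcs G)"
proof -
  note E = simple_graphD[OF simple_graph_of_pair_graph[OF assms]]
  let ?h = "\<lambda>(u, v). {u, v}"
  have "(\<Sum>e\<in>?h ` parcs G. 2) \<le> (\<Sum>e\<in>?h ` parcs G. card {x \<in> parcs G. ?h x = e})"
  proof (rule sum_mono)
    fix e assume "e \<in> ?h ` parcs G"
    then obtain u v where e: "e = {u, v}" "(u, v) \<in> parcs G" by auto
    have "card {(u, v), (v, u)} \<le> card {x \<in> parcs G. ?h x = e}"
      using e E(2) symD[OF E(3) e(2)] by (intro card_mono) auto
    moreover have "u \<noteq> v" using e(2) E(4) by (auto simp: irrefl_def)
    ultimately show "2 \<le> card {x \<in> parcs G. ?h x = e}" by simp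
  qed
  moreover have "card (parcs G) = (\<Sum>e\<in>?h ` parcs G. card {x \<in> parcs G. ?h x = e})"
    using sum.image_gen[OF E(2), of "\<lambda>_. 1 :: nat" ?h] by simp
  ultimately show ?thesis by (simp add: edges_def)
qed

lemma average_degree_le:
  assumes G: "pair_graph G" and d: "0 < d" "d \<le> average_degree G"
  shows "pverts G \<noteq> {}" "d * real (card (pverts G)) \<le> real (card (parcs G))"
proof -
  show ne: "pverts G \<noteq> {}" using d by (auto simp: average_degree_def)
  have "0 < card (pverts G)" using ne simple_graphD(1)[OF simple_graph_of_pair_graph[OF G]] by (simp add: card_gt_0_iff)
  hence "d * real (card (pverts G)) \<le> real (2 * card (edges G))" using d(2) by (simp add: average_degree_def pos_le_divide_eq)
  also have "\<dots> \<le> real (card (parcs G))" using card_edges_le[OF G] by (simp only: of_nat_le_iff)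
  finally show "d * real (card (pverts G)) \<le> real (card (parcs G))" .
qed

lemma card_Image_le_max_degree:
  assumes "pair_graph H"
  shows "card (parcs H `` {h}) \<le> max_degree H"
proof (cases "h \<in> pverts H")
  case True
  note E = simple_graphD[OF simple_graph_of_pair_graph[OF assms]]
  have "parcs H `` {h} = snd ` out_arcs (with_proj H) h" by (force simp: out_arcs_def)
  hence "card (parcs H `` {h}) \<le> out_degree (with_proj H) h"
    using E(2) by (simp add: card_image_le out_arcs_def out_degree_def)
  also have "\<dots> \<le> max_degree H" unfolding max_degree_def using E(1) True by (intro Max_ge) auto
  finally show ?thesis .
next
  case False
  hence "parcs H `` {h} = {}" using simple_graphD(5)[OF simple_graph_of_pair_graph[OF assms]] by auto
  thus ?thesis by simp
qed

lemma component_in_le_scc: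
  assumes H: "pair_graph H" and x: "x \<in> pverts H - S"
  shows "\<exists>C\<in>pre_digraph.sccs (with_proj H \<restriction> (pverts H - S)). card (component_in (parcs H) (pverts H - S) x) \<le> card (verts C)"
proof -
  define K where "K = \<lparr>pverts = pverts H - S, parcs = Restr (parcs H) (pverts H - S)\<rparr>"
  have eq: "with_proj H \<restriction> (pverts H - S) = with_proj K" by (auto simp: K_def induce_subgraph_def with_proj_def)
  interpret K: pair_graph K
    unfolding K_def by (rule pair_graph_of_simple_graph[OF simple_graph_Restr[OF simple_graph_of_pair_graph[OF H]]]) auto
  have xK: "x \<in> pverts K" using x by (simp add: K_def)
  have "component_in (parcs H) (pverts H - S) x \<subseteq> K.scc_of x"
  proof
    fix y assume "y \<in> component_in (parcs H) (pverts H - S) x"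
    hence "(x, y) \<in> (parcs K)\<^sup>*" by (simp add: component_in_def K_def)
    thus "y \<in> K.scc_of x" using reachable_of_rtrancl[OF K.pair_wf_digraph_axioms _ xK] by (intro K.scc_ofI_reachable') simp
  qed
  moreover have scc: "K.scc_of x \<in> K.sccs_verts" by (rule K.scc_of_in_sccs_verts[OF xK])
  hence "finite (K.scc_of x)" using K.sccs_verts_subsets[OF scc] K.pair_finite_verts by (auto intro: finite_subset)
  ultimately have "card (component_in (parcs H) (pverts H - S) x) \<le> card (K.scc_of x)" by (intro card_mono)
  moreover obtain C where "C \<in> K.sccs" "verts C = K.scc_of x" using scc unfolding K.sccs_verts_conv by auto
  ultimately show ?thesis unfolding eq by (intro bexI[of _ C]) simp_all
qed

lemma separable_pattern_of_pair_graph: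
  assumes H: "pair_graph H" "separable \<alpha> H" "bipartite H" "max_degree H \<le> \<Delta>"
  shows "separable_pattern \<alpha> \<Delta> (pverts H) (parcs H)"
proof -
  obtain S where S: "S \<subseteq> pverts H" "real (card S) \<le> \<alpha> * real (card (pverts H))"
    "\<forall>C\<in>pre_digraph.sccs (with_proj H \<restriction> (pverts H - S)). real (card (verts C)) \<le> \<alpha> * real (card (pverts H))"
    using H(2) unfolding separable_def by blast
  have "real (card (component_in (parcs H) (pverts H - S) x)) \<le> \<alpha> * real (card (pverts H))" if "x \<in> pverts H - S" for x
    using component_in_le_scc[OF H(1) that] S(3) by (meson of_nat_le_iff order_trans)
  thus ?thesis unfolding separable_pattern_def
    using simple_graph_of_pair_graph[OF H(1)] order_trans[OF card_Image_le_max_degree[OF H(1)] H(4)] H(3) S(1,2)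
    by (auto simp: bipartite_def)
qed

theorem theorem1p1:
  shows "\<forall>\<epsilon>::real. \<epsilon> > 0 \<longrightarrow> (\<forall>\<Delta>::nat. \<exists>\<alpha>\<^sub>0::real. \<alpha>\<^sub>0 > 0 \<and> (\<exists>d\<^sub>0::real.
    \<forall>\<alpha> d::real. 0 < \<alpha> \<and> \<alpha> < \<alpha>\<^sub>0 \<and> d \<ge> d\<^sub>0 \<longrightarrow>
      (\<forall>(H :: 'a pair_pre_digraph) (G :: 'b pair_pre_digraph).
        pair_graph H \<and> separable \<alpha> H \<and> bipartite H \<and>
        real (card (pverts H)) \<le> (1 - \<epsilon>) * d \<and> max_degree H \<le> \<Delta> \<and>
        pair_graph G \<and> average_degree G \<ge> d \<longrightarrow>
        contains_subdivision G H)))"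
proof (intro allI impI, goal_cases)
  case (1 \<epsilon> \<Delta>)
  hence "0 < min \<epsilon> (1 / 2)" "min \<epsilon> (1 / 2) < 1" by auto
  then obtain \<alpha>\<^sub>0 d\<^sub>0 where "0 < \<alpha>\<^sub>0" "0 < d\<^sub>0" and minor: "\<And>\<alpha> d V (E :: 'b rel) (VH :: 'a set) EH.
    0 < \<alpha> \<Longrightarrow> \<alpha> < \<alpha>\<^sub>0 \<Longrightarrow> d\<^sub>0 \<le> d \<Longrightarrow> simple_graph V E \<Longrightarrow> V \<noteq> {} \<Longrightarrow> d * real (card V) \<le> real (card E) \<Longrightarrow>
    separable_pattern \<alpha> \<Delta> VH EH \<Longrightarrow> real (card VH) \<le> (1 - min \<epsilon> (1 / 2)) * d \<Longrightarrow> topological_minor V E VH EH"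
    by (rule separable_pattern_topological_minor[where \<Delta> = \<Delta>]) blast
  have "contains_subdivision G H"
    if "0 < \<alpha>" "\<alpha> < \<alpha>\<^sub>0" "d\<^sub>0 \<le> d" and H: "pair_graph H" "separable \<alpha> H" "bipartite H" "real (card (pverts H)) \<le> (1 - \<epsilon>) * d" "max_degree H \<le> \<Delta>"
      and G: "pair_graph G" "d \<le> average_degree G" for \<alpha> d and H :: "'a pair_pre_digraph" and G :: "'b pair_pre_digraph"
  proof (rule topological_minor_contains_subdivision[OF G(1) H(1)])
    have "0 < d" using \<open>d\<^sub>0 \<le> d\<close> \<open>0 < d\<^sub>0\<close> by linarith
    hence "(1 - \<epsilon>) * d \<le> (1 - min \<epsilon> (1 / 2)) * d" by (intro mult_right_mono) auto
    hence "real (card (pverts H)) \<le> (1 - min \<epsilon> (1 / 2)) * d" using H(4) by linarith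
    thus "topological_minor (pverts G) (parcs G) (pverts H) (parcs H)"
      using minor[OF that(1-3) simple_graph_of_pair_graph[OF G(1)]] average_degree_le[OF G(1) \<open>0 < d\<close> G(2)]
        separable_pattern_of_pair_graph[OF H(1-3,5)] by blast
  qed
  thus ?case using \<open>0 < \<alpha>\<^sub>0\<close> by blast
qed

end
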